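(* Let $(\xi_k)_{k\ge1}$ and $(\rho_k)_{k\ge1}$ be two independent i.i.d. sequences with $\rho_k>0$ a.s., $\xi_1$ and $\ln\rho_1$ square-integrable with $\sigma_\xi^2=\mathrm{Var}(\xi_1)>0$, $\sigma_\rho^2=\mathrm{Var}(\ln\rho_1)>0$; let $\mu_\xi=\mathbf{E}\xi_1$, $\mu_\rho=\mathbf{E}\ln\rho_1$. Fix $y\ge0$ and let $\gamma^{(n)}_1$, $\theta^{(n)}$, $Y$, $\tau^n(y)$, $\tau(y)$ be as in the context. (i) If $\mu_\rho\le0$, then $\lim_{n\to\infty}\mathbf{P}(\tau^n(y)<\infty)=1$. (ii) If $\mu_\rho>0$ and there exist $C<1$ and $n_0\in\mathbb{N}^*$ such that $$\sup_{n\ge n_0}\left(\mathbf{E}\left(e^{-2\gamma^{(n)}_1}\right)\right)^n\le C,$$ then $$\lim_{n\to\infty}\mathbf{P}(\tau^n(y)<\infty)=\mathbf{P}(\tau(y)<\infty)=\frac{H(-y)}{H(0)},$$ where for $x\le0$, $$H(x)=\int_{-\infty}^x(\sigma_\xi^2+\sigma_\rho^2z^2)^{-(1/2+\mu_\rho/\sigma_\rho^2)}\exp\left(\frac{2\mu_\xi}{\sigma_\xi\sigma_\rho}\arctan\left(\frac{\sigma_\rho}{\sigma_\xi}z\right)\right)dz.$$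
   Context: Define $\xi^{(n)}_k=\mu_\xi/n+(\xi_k-\mu_\xi)/\sqrt n$, $\gamma^{(n)}_k=\mu_\rho/n+(\ln\rho_k-\mu_\rho)/\sqrt n$, $\rho^{(n)}_k=e^{\gamma^{(n)}_k}$, $\theta^{(n)}(0)=y$, $\theta^{(n)}(k/n)=\xi^{(n)}_k+\theta^{(n)}((k-1)/n)\rho^{(n)}_k$ for $k\ge1$, and $\theta^{(n)}_t=\theta^{(n)}([nt]/n)$ ($[\cdot]$ = floor). $Y_t=e^{R_t}(y+\int_{0+}^te^{-R_{s-}}dX_s)$ with $R_t=\mu_\rho t+\sigma_\rho W_t$, $X_t=\mu_\xi t+\sigma_\xi\tilde W_t$, $W,\tilde W$ independent standard Brownian motions. $\tau^n(y)=\inf\{t>0:\theta^{(n)}_t<0\}$, $\tau(y)=\inf\{t>0:Y_t<0\}$, $\inf\emptyset=+\infty$. *)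

theory Defs
  imports "HOL-Probability.Probability"
begin

text \<open>First time in (0,oo) at which a path is negative; Inf of the empty set is +oo in ereal.\<close>
definition first_neg_time :: "(real \<Rightarrow> real) \<Rightarrow> ereal" where
  "first_neg_time f = Inf (ereal ` {t. t > 0 \<and> f t < 0})"

text \<open>Scaled sequences (indices k >= 1).\<close>
definition xi_n :: "real \<Rightarrow> (nat \<Rightarrow> 'a \<Rightarrow> real) \<Rightarrow> nat \<Rightarrow> nat \<Rightarrow> 'a \<Rightarrow> real" where
  "xi_n mu_xi xi n k \<omega> = mu_xi / real n + (xi k \<omega> - mu_xi) / sqrt (real n)"

definition gamma_n :: "real \<Rightarrow> (nat \<Rightarrow> 'a \<Rightarrow> real) \<Rightarrow> nat \<Rightarrow> nat \<Rightarrow> 'a \<Rightarrow> real" where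
  "gamma_n mu_rho rho n k \<omega> = mu_rho / real n + (ln (rho k \<omega>) - mu_rho) / sqrt (real n)"

text \<open>theta_disc ... n k = theta^(n)(k/n).\<close>
fun theta_disc :: "real \<Rightarrow> real \<Rightarrow> real \<Rightarrow> (nat \<Rightarrow> 'a \<Rightarrow> real) \<Rightarrow> (nat \<Rightarrow> 'a \<Rightarrow> real)
                    \<Rightarrow> nat \<Rightarrow> 'a \<Rightarrow> nat \<Rightarrow> real" where
  "theta_disc y mu_xi mu_rho xi rho n \<omega> 0 = y"
| "theta_disc y mu_xi mu_rho xi rho n \<omega> (Suc k) =
     xi_n mu_xi xi n (Suc k) \<omega> + theta_disc y mu_xi mu_rho xi rho n \<omega> k * exp (gamma_n mu_rho rho n (Suc k) \<omega>)"

definition theta_proc :: "real \<Rightarrow> real \<Rightarrow> real \<Rightarrow> (nat \<Rightarrow> 'a \<Rightarrow> real) \<Rightarrow> (nat \<Rightarrow> 'a \<Rightarrow> real)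
                    \<Rightarrow> nat \<Rightarrow> 'a \<Rightarrow> real \<Rightarrow> real" where
  "theta_proc y mu_xi mu_rho xi rho n \<omega> t =
     theta_disc y mu_xi mu_rho xi rho n \<omega> (nat \<lfloor>real n * t\<rfloor>)"

definition std_BM :: "'b measure \<Rightarrow> (real \<Rightarrow> 'b \<Rightarrow> real) \<Rightarrow> bool" where
  "std_BM N B \<longleftrightarrow> prob_space N \<and>
     (\<forall>t. B t \<in> borel_measurable N) \<and>
     (\<forall>\<omega>\<in>space N. B 0 \<omega> = 0 \<and> continuous_on {0..} (\<lambda>t. B t \<omega>)) \<and>
     (\<forall>s t. 0 \<le> s \<and> s < t \<longrightarrow>
        distributed N lborel (\<lambda>\<omega>. B t \<omega> - B s \<omega>) (\<lambda>x. ennreal (normal_density 0 (sqrt (t - s)) x))) \<and>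
     (\<forall>(ts :: nat \<Rightarrow> real) k. 0 \<le> ts 0 \<and> (\<forall>i<k. ts i < ts (Suc i)) \<longrightarrow>
        prob_space.indep_vars N (\<lambda>_. borel) (\<lambda>i \<omega>. B (ts (Suc i)) \<omega> - B (ts i) \<omega>) {..<k})"

definition riemann_sum :: "(real \<Rightarrow> 'b \<Rightarrow> real) \<Rightarrow> (real \<Rightarrow> 'b \<Rightarrow> real) \<Rightarrow> real \<Rightarrow> nat \<Rightarrow> 'b \<Rightarrow> real" where
  "riemann_sum H Z t m \<omega> =
     (\<Sum>i<2^m. H (real i * t / 2^m) \<omega> * (Z (real (Suc i) * t / 2^m) \<omega> - Z (real i * t / 2^m) \<omega>))"

text \<open>I is (a continuous version of) the stochastic integral t |-> int_{0+}^t H_{s-} dZ_s,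
  characterised as the limit in probability of left-point Riemann sums.\<close>
definition is_stoch_integral :: "'b measure \<Rightarrow> (real \<Rightarrow> 'b \<Rightarrow> real) \<Rightarrow> (real \<Rightarrow> 'b \<Rightarrow> real)
                                 \<Rightarrow> (real \<Rightarrow> 'b \<Rightarrow> real) \<Rightarrow> bool" where
  "is_stoch_integral N H Z I \<longleftrightarrow>
     (\<forall>t. I t \<in> borel_measurable N) \<and>
     (\<forall>\<omega>\<in>space N. continuous_on {0..} (\<lambda>t. I t \<omega>)) \<and>
     (\<forall>t\<ge>0. \<forall>e>0. (\<lambda>m. measure N {\<omega>\<in>space N. \<bar>riemann_sum H Z t m \<omega> - I t \<omega>\<bar> > e}) \<longlonglongrightarrow> 0)"

definition H_fun :: "real \<Rightarrow> real \<Rightarrow> real \<Rightarrow> real \<Rightarrow> real \<Rightarrow> real" where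
  "H_fun mu_xi mu_rho sig_xi sig_rho x =
     (LBINT z:{..x}. (sig_xi^2 + sig_rho^2 * z^2) powr (-(1/2 + mu_rho / sig_rho^2)) *
        exp (2 * mu_xi / (sig_xi * sig_rho) * arctan (sig_rho / sig_xi * z)))"

end

theory Submission
  imports Defs
begin

text \<open>Neither a functional limit theorem nor Ito's formula is used. Both the discrete model and the
  diffusion sampled on a grid of mesh \<open>h\<close> are Markov chains \<open>x \<mapsto> a + x e\<^sup>b\<close> with independent
  coefficients whose first two moments are those of the diffusion up to \<open>o(h)\<close>, together with a
  Lindeberg condition. A Taylor expansion therefore shows that on bounded intervals such a step acts
  on smooth functions as \<open>1 + h L + o(h)\<close>, where \<open>L\<close> is the generator of \<open>Y\<close>. The scale function
  is \<open>L\<close>-harmonic; adding a small multiple of \<open>exp (l x)\<close> makes it strictly sub- or superharmonic,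
  which absorbs the error, so the ruin probability of every such chain is squeezed between explicit
  bounds that converge to the ratio of the scale functions as \<open>h \<rightarrow> 0\<close>.

  The lower bound stops the chain at a high level \<open>B\<close>. For the upper bound, the chain must not be ruined
  from far away: if \<open>E e\<^sup>-\<^sup>2\<^sup>b \<le> 1 - c h\<close>, the discounted sum is contracting in \<open>L\<^sup>2\<close>, and a
  rational function of \<open>x\<close> is a global supersolution that vanishes at infinity. The hypothesis of (ii)
  yields this contraction, and by expansion it forces \<open>\<mu>\<^sub>\<rho> > \<sigma>\<^sub>\<rho>\<^sup>2\<close>, so that the
  diffusion satisfies it too.

  For the diffusion, the integral in the exact skeleton is replaced by Riemann sums on a finer grid, which
  are conditionally Gaussian given \<open>W\<close>; the error bounds are uniform in the finer grid. Ruin in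
  continuous time is the increasing union over dyadic grids, by continuity of the paths.\<close>

section \<open>One-step generator estimate\<close>

text \<open>The obstacle is the infinite horizon: closeness of the laws on bounded time intervals
  says nothing about ruin after a time that grows with \<open>n\<close>. Hence the estimates are
  one-step inequalities with an error \<open>e * h\<close>, inserted into optional stopping, and no
  bound deteriorates with the number of steps. A strict drift also bounds the time that a chain can
  spend in a bounded interval, so that the chain leaves it.

  The two supersolutions of the upper bound are glued by a minimum. The perturbed scale function is
  good on \<open>[0, B]\<close> only; it is raised by the value that the far field can still have
  beyond \<open>B\<close>, so that there the minimum is the far field, which is good everywhere. The
  raise vanishes as \<open>B\<close> grows.

  The lower bound speaks of passage below some \<open>L < 0\<close>, not below 0. The test function
  may then be normalised slightly outside \<open>[L, B]\<close>, and the slack survives when Riemann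
  sums are replaced by their limit in probability.

  The threshold \<open>sr^2\<close> for the drift is that of
  \<open>E e^(-2b) = exp (-2 (mr - sr^2) h)\<close> in the skeleton.\<close>

lemma uniform_at_base:
  fixes G :: "real \<times> real \<times> real \<Rightarrow> real"
  assumes "continuous_on UNIV G" "e > 0"
  obtains d where "d > 0" "d \<le> 1"
    "\<And>x u v. x \<in> {L..B} \<Longrightarrow> \<bar>u\<bar> \<le> d \<Longrightarrow> \<bar>v\<bar> \<le> d \<Longrightarrow> \<bar>G (x,u,v) - G (x,0,0)\<bar> \<le> e"
proof -
  let ?K = "{L..B} \<times> {-1..1::real} \<times> {-1..1::real}"
  have "uniformly_continuous_on ?K G"
    by (intro compact_uniformly_continuous continuous_on_subset[OF assms(1)] compact_Times) auto
  then obtain d where d: "d > 0"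
    "\<And>z z'. z \<in> ?K \<Longrightarrow> z' \<in> ?K \<Longrightarrow> dist z' z < d \<Longrightarrow> dist (G z') (G z) < e"
    using assms(2) unfolding uniformly_continuous_on_def by meson
  show ?thesis
  \<comment> \<open>With \<open>u\<close> and \<open>v\<close> at most \<open>d / 3\<close> the
    distance to the base point stays below \<open>d\<close>; the cap 1 keeps the point in the
    compact box.\<close>
  proof (rule that[of "min 1 (d/3)"])
    fix x u v :: real assume x: "x \<in> {L..B}" and u: "\<bar>u\<bar> \<le> min 1 (d/3)" and v: "\<bar>v\<bar> \<le> min 1 (d/3)"
    have "dist (x,u,v) (x,0,0) \<le> \<bar>u\<bar> + \<bar>v\<bar>"
      by (simp add: dist_prod_def sqrt_sum_squares_le_sum_abs)
    also have "\<dots> < d" using u v d(1) by auto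
    finally have "dist (G (x,u,v)) (G (x,0,0)) < e"
      using x u v by (intro d(2)) auto
    then show "\<bar>G (x,u,v) - G (x,0,0)\<bar> \<le> e" by (simp add: dist_real_def)
  qed (use d(1) in auto)
qed

lemma bounded_on_segment:
  fixes g g' :: "real \<Rightarrow> real"
  assumes "continuous_on UNIV g" "continuous_on UNIV g'"
  obtains P where "P \<ge> 0" "\<And>x. x \<in> {L..B} \<Longrightarrow> \<bar>g x\<bar> \<le> P" "\<And>x. x \<in> {L..B} \<Longrightarrow> \<bar>g' x\<bar> \<le> P"
proof -
  have "bounded (g ` {L..B} \<union> g' ` {L..B})"
    unfolding bounded_Un
    by (intro conjI compact_imp_bounded compact_continuous_image continuous_on_subset[OF assms(1)]
        continuous_on_subset[OF assms(2)]) auto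
  then obtain P where "\<forall>z\<in>g ` {L..B} \<union> g' ` {L..B}. norm z \<le> P" unfolding bounded_iff by blast
  then show ?thesis by (intro that[of "max 0 P"]) (auto simp: le_max_iff_disj)
qed

text \<open>The drift contains \<open>sr^2 / 2\<close> because the noise enters through
  \<open>e^b\<close>, which is \<open>1 + b + b^2 / 2\<close> to second order. The derivatives are
  arguments, so that \<open>scale_density\<close> and its derivative can be passed directly.\<close>

definition generator :: "real \<Rightarrow> real \<Rightarrow> real \<Rightarrow> real \<Rightarrow> (real \<Rightarrow> real) \<Rightarrow> (real \<Rightarrow> real) \<Rightarrow> real \<Rightarrow> real" where
  "generator mx mr sx sr F' F'' x =
     F' x * (mx + x * (mr + sr\<^sup>2 / 2)) + F'' x * (sx\<^sup>2 + sr\<^sup>2 * x\<^sup>2) / 2"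

text \<open>Second-order Taylor polynomial at \<open>(0, 0)\<close> of the map from
  \<open>(a, b)\<close> to \<open>F (a + x * exp b) - F x\<close>. The term \<open>x * F' x\<close>
  beside \<open>x^2 * F'' x\<close> comes from the curvature of the exponential.\<close>

definition taylor2 :: "(real \<Rightarrow> real) \<Rightarrow> (real \<Rightarrow> real) \<Rightarrow> real \<Rightarrow> real \<Rightarrow> real \<Rightarrow> real" where
  "taylor2 F' F'' x a b = F' x * (a + x * b) +
     (F'' x * a\<^sup>2 + 2 * x * F'' x * (a * b) + (x * F' x + x\<^sup>2 * F'' x) * b\<^sup>2) / 2"

lemma abs_quadratic_form_le:
  "\<bar>x * a\<^sup>2 + 2 * y * (a * b) + z * b\<^sup>2\<bar> \<le> \<bar>x\<bar> * a\<^sup>2 + 2 * \<bar>y\<bar> * \<bar>a * b\<bar> + \<bar>z\<bar> * b\<^sup>2" for a b x y z :: real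
proof -
  have "\<bar>x * a\<^sup>2\<bar> = \<bar>x\<bar> * a\<^sup>2" "\<bar>2 * y * (a * b)\<bar> = 2 * \<bar>y\<bar> * \<bar>a * b\<bar>" "\<bar>z * b\<^sup>2\<bar> = \<bar>z\<bar> * b\<^sup>2"
    by (simp_all add: abs_mult)
  then show ?thesis by linarith
qed

text \<open>Along the segment from \<open>(0, 0)\<close> to \<open>(a, b)\<close> the remainder is
  \<open>(f2 t - f2 0) / 2\<close>, a quadratic form in \<open>(a, b)\<close> whose coefficients are
  increments of continuous functions. Uniform continuity makes them at most \<open>e\<close> for all
  \<open>x\<close> of the interval at once.\<close>

lemma taylor_local:
  fixes F F' F'' :: "real \<Rightarrow> real"
  assumes F: "\<And>x. (F has_real_derivative F' x) (at x)"
    and F': "\<And>x. (F' has_real_derivative F'' x) (at x)"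
    and cont: "continuous_on UNIV F''" and e: "e > 0"
  obtains d where "d > 0" "d \<le> 1"
    "\<And>x a b. x \<in> {L..B} \<Longrightarrow> \<bar>a\<bar> \<le> d \<Longrightarrow> \<bar>b\<bar> \<le> d \<Longrightarrow>
       \<bar>F (a + x * exp b) - F x - taylor2 F' F'' x a b\<bar> \<le> e * (a\<^sup>2 + b\<^sup>2)"
proof -
  have contF': "continuous_on UNIV F'"
    using F' by (meson DERIV_isCont continuous_at_imp_continuous_on)
  let ?z = "\<lambda>(x,u,v). u + x * exp v :: real"
  have cz: "continuous_on UNIV ?z"
    by (auto simp: case_prod_beta intro!: continuous_intros)
  have c1: "continuous_on UNIV (\<lambda>p. F' (?z p))" "continuous_on UNIV (\<lambda>p. F'' (?z p))"
    by (auto intro!: continuous_on_compose2[OF contF' cz] continuous_on_compose2[OF cont cz])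
  \<comment> \<open>In \<open>f2\<close>, the second derivative along the segment,
    \<open>F''\<close>, \<open>G2\<close> and \<open>G3\<close> are the coefficients of
    \<open>a^2\<close>, \<open>2 a b\<close> and \<open>b^2\<close>.\<close>
  define G2 where "G2 p = F'' (?z p) * (fst p * exp (snd (snd p)))" for p
  define G3 where "G3 p = F'' (?z p) * (fst p * exp (snd (snd p)))\<^sup>2 +
      F' (?z p) * (fst p * exp (snd (snd p)))" for p
  have "continuous_on UNIV G2" "continuous_on UNIV G3"
    unfolding G2_def G3_def by (auto intro!: continuous_intros c1)
  note cG = this
  obtain d1 where d1p: "d1 > 0" "d1 \<le> 1" and
    d1: "\<And>x u v. x \<in> {L..B} \<Longrightarrow> \<bar>u\<bar> \<le> d1 \<Longrightarrow> \<bar>v\<bar> \<le> d1 \<Longrightarrow> \<bar>F'' (?z (x,u,v)) - F'' (?z (x,0,0))\<bar> \<le> e"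
    using uniform_at_base[OF c1(2) e, where L=L and B=B] by blast
  obtain d2 where d2p: "d2 > 0" "d2 \<le> 1" and
    d2: "\<And>x u v. x \<in> {L..B} \<Longrightarrow> \<bar>u\<bar> \<le> d2 \<Longrightarrow> \<bar>v\<bar> \<le> d2 \<Longrightarrow> \<bar>G2 (x,u,v) - G2 (x,0,0)\<bar> \<le> e"
    using uniform_at_base[OF cG(1) e, where L=L and B=B] by blast
  obtain d3 where d3p: "d3 > 0" "d3 \<le> 1" and
    d3: "\<And>x u v. x \<in> {L..B} \<Longrightarrow> \<bar>u\<bar> \<le> d3 \<Longrightarrow> \<bar>v\<bar> \<le> d3 \<Longrightarrow> \<bar>G3 (x,u,v) - G3 (x,0,0)\<bar> \<le> e"
    using uniform_at_base[OF cG(2) e, where L=L and B=B] by blast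
  note d = d1p d2p d3p
  show ?thesis
  proof (rule that[of "min d1 (min d2 d3)"])
    fix x a b :: real
    assume x: "x \<in> {L..B}" and a: "\<bar>a\<bar> \<le> min d1 (min d2 d3)" and b: "\<bar>b\<bar> \<le> min d1 (min d2 d3)"
    define f0 where "f0 t = F (t * a + x * exp (t * b))" for t
    define f1 where "f1 t = F' (t * a + x * exp (t * b)) * (a + x * b * exp (t * b))" for t
    define f2 where "f2 t = F'' (t * a + x * exp (t * b)) * (a + x * b * exp (t * b))\<^sup>2 +
       F' (t * a + x * exp (t * b)) * (x * b\<^sup>2 * exp (t * b))" for t
    define diff where "diff n = (if n = (0::nat) then f0 else if n = 1 then f1 else f2)" for n
    have D0: "(f0 has_real_derivative f1 t) (at t)" for t
      unfolding f0_def f1_def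
      by (rule derivative_eq_intros DERIV_chain2[OF F] refl | simp)+
    have D1: "(f1 has_real_derivative f2 t) (at t)" for t
      unfolding f1_def f2_def
      by (rule derivative_eq_intros DERIV_chain2[OF F'] refl | simp add: power2_eq_square algebra_simps)+
    have "\<exists>t. 0 < t \<and> t < 1 \<and> f0 1 = (\<Sum>m<2. diff m 0 / fact m * 1 ^ m) + diff 2 t / fact 2 * 1 ^ 2"
    proof (rule Maclaurin)
      show "\<forall>m t. m < 2 \<and> 0 \<le> t \<and> t \<le> 1 \<longrightarrow> (diff m has_real_derivative diff (Suc m) t) (at t)"
        using D0 D1 by (auto simp: diff_def less_2_cases_iff)
    qed (auto simp: diff_def)
    then obtain t where t: "0 < t" "t < 1" and "f0 1 = f0 0 + f1 0 + f2 t / 2"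
      by (auto simp: diff_def numeral_2_eq_2)
    moreover have "taylor2 F' F'' x a b = f1 0 + f2 0 / 2"
      by (simp add: taylor2_def f1_def f2_def power2_eq_square algebra_simps)
    ultimately have eq: "F (a + x * exp b) - F x - taylor2 F' F'' x a b = (f2 t - f2 0) / 2"
      by (simp add: f0_def field_simps)
    have ta: "\<bar>t * a\<bar> \<le> min d1 (min d2 d3)" "\<bar>t * b\<bar> \<le> min d1 (min d2 d3)"
      using t a b mult_left_le_one_le[of "\<bar>a\<bar>" t] mult_left_le_one_le[of "\<bar>b\<bar>" t] by (auto simp: abs_mult)
    let ?p = "(x, t * a, t * b)" and ?q = "(x, 0::real, 0::real)"
    have "f2 t - f2 0 = (F'' (?z ?p) - F'' (?z ?q)) * a\<^sup>2 + 2 * (G2 ?p - G2 ?q) * (a * b) + (G3 ?p - G3 ?q) * b\<^sup>2"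
      unfolding f2_def G2_def G3_def by (simp add: power2_eq_square algebra_simps)
    also have "\<bar>\<dots>\<bar> \<le> \<bar>F'' (?z ?p) - F'' (?z ?q)\<bar> * a\<^sup>2 + 2 * \<bar>G2 ?p - G2 ?q\<bar> * \<bar>a * b\<bar> + \<bar>G3 ?p - G3 ?q\<bar> * b\<^sup>2"
      by (rule abs_quadratic_form_le)
    also have "\<dots> \<le> e * a\<^sup>2 + 2 * e * \<bar>a * b\<bar> + e * b\<^sup>2"
      using d1[OF x, of "t*a" "t*b"] d2[OF x, of "t*a" "t*b"] d3[OF x, of "t*a" "t*b"] ta
      by (intro add_mono mult_right_mono mult_left_mono) auto
    also have "\<dots> \<le> 2 * e * (a\<^sup>2 + b\<^sup>2)"
    proof -
      have "2 * \<bar>a * b\<bar> \<le> a\<^sup>2 + b\<^sup>2"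
        using sum_squares_bound[of "\<bar>a\<bar>" "\<bar>b\<bar>"] by (simp add: abs_mult)
      then have "e * (2 * \<bar>a * b\<bar>) \<le> e * (a\<^sup>2 + b\<^sup>2)" using e by (intro mult_left_mono) auto
      then show ?thesis by (simp add: algebra_simps)
    qed
    finally show "\<bar>F (a + x * exp b) - F x - taylor2 F' F'' x a b\<bar> \<le> e * (a\<^sup>2 + b\<^sup>2)"
      unfolding eq by simp
  qed (use d in auto)
qed

text \<open>\<open>f\<close> stands for \<open>F\<close> made bounded by altering it at distance
  more than \<open>r\<close> from the interval. Small increments stay within that distance and fall
  under \<open>taylor_local\<close>. If one increment exceeds \<open>d\<close>, every term, bounded
  \<open>f\<close> included, is at most a multiple of \<open>a^2 + b^2\<close>; the truncated
  squares are what a Lindeberg condition controls.\<close>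

lemma taylor_global:
  fixes F F' F'' f :: "real \<Rightarrow> real"
  assumes F: "\<And>x. (F has_real_derivative F' x) (at x)"
    and F': "\<And>x. (F' has_real_derivative F'' x) (at x)"
    and cont: "continuous_on UNIV F''" and e: "e > 0"
    and r: "r > 0" and f: "\<And>x. x \<in> {L - r..B + r} \<Longrightarrow> f x = F x" and bd: "\<And>x. \<bar>f x\<bar> \<le> G"
  obtains d C where "d > 0" "d \<le> 1" "C \<ge> 0"
    "\<And>x a b. x \<in> {L..B} \<Longrightarrow> \<bar>f (a + x * exp b) - f x - taylor2 F' F'' x a b\<bar> \<le>
        e * (a\<^sup>2 + b\<^sup>2) + C * (a\<^sup>2 * indicator {d<..} \<bar>a\<bar> + b\<^sup>2 * indicator {d<..} \<bar>b\<bar>)"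
proof -
  obtain d1 where d1: "d1 > 0" "d1 \<le> 1"
    "\<And>x a b. x \<in> {L..B} \<Longrightarrow> \<bar>a\<bar> \<le> d1 \<Longrightarrow> \<bar>b\<bar> \<le> d1 \<Longrightarrow>
       \<bar>F (a + x * exp b) - F x - taylor2 F' F'' x a b\<bar> \<le> e * (a\<^sup>2 + b\<^sup>2)"
    using taylor_local[OF F F' cont e, where L=L and B=B] by blast
  have "continuous_on UNIV (\<lambda>(x,u,v). u + x * exp v - x :: real)"
    by (auto simp: case_prod_beta intro!: continuous_intros)
  then obtain d2 where d2: "d2 > 0" "d2 \<le> 1"
    "\<And>x a b. x \<in> {L..B} \<Longrightarrow> \<bar>a\<bar> \<le> d2 \<Longrightarrow> \<bar>b\<bar> \<le> d2 \<Longrightarrow> \<bar>a + x * exp b - x\<bar> \<le> r"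
    using uniform_at_base[of "\<lambda>(x,u,v). u + x * exp v - x" r L B, OF _ r] by auto
  define d where "d = min d1 d2"
  have d: "0 < d" "d \<le> 1" using d1 d2 by (auto simp: d_def)
  define X where "X = max \<bar>L\<bar> \<bar>B\<bar> + 1"
  have contF': "continuous_on UNIV F'"
    using F' by (meson DERIV_isCont continuous_at_imp_continuous_on)
  obtain P where P: "P \<ge> 0" "\<And>x. x \<in> {L..B} \<Longrightarrow> \<bar>F' x\<bar> \<le> P" "\<And>x. x \<in> {L..B} \<Longrightarrow> \<bar>F'' x\<bar> \<le> P"
    using bounded_on_segment[OF contF' cont] by blast
  have G: "G \<ge> 0" using bd[of 0] by linarith
  have X: "X \<ge> 1" "\<And>x. x \<in> {L..B} \<Longrightarrow> \<bar>x\<bar> \<le> X" by (auto simp: X_def)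
  \<comment> \<open>When one increment exceeds \<open>d\<close>, then
    \<open>a^2 + b^2 \<ge> d^2\<close>. The summands convert the oscillation \<open>2 * G\<close> of
    \<open>f\<close>, the linear part and the quadratic part of \<open>taylor2\<close> into
    multiples of \<open>a^2 + b^2\<close>.\<close>
  define C0 where "C0 = 2 * G / d\<^sup>2 + 2 * P * X / d + 3 * P * X\<^sup>2"
  have C0: "C0 \<ge> 0" using G P X d by (auto simp: C0_def)
  show ?thesis
  proof (rule that[of d "2 * C0"])
    fix x a b :: real assume x: "x \<in> {L..B}"
    let ?I = "a\<^sup>2 * indicator {d<..} \<bar>a\<bar> + b\<^sup>2 * indicator {d<..} \<bar>b\<bar>"
    show "\<bar>f (a + x * exp b) - f x - taylor2 F' F'' x a b\<bar> \<le> e * (a\<^sup>2 + b\<^sup>2) + 2 * C0 * ?I"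
    proof (cases "\<bar>a\<bar> \<le> d \<and> \<bar>b\<bar> \<le> d")
      case True
      have ab: "\<bar>a\<bar> \<le> d1" "\<bar>b\<bar> \<le> d1" "\<bar>a\<bar> \<le> d2" "\<bar>b\<bar> \<le> d2" using True by (auto simp: d_def)
      have "a + x * exp b \<in> {L - r..B + r}" "x \<in> {L - r..B + r}"
        using d2(3)[OF x ab(3,4)] x r by (auto simp: abs_le_iff)
      then have "f (a + x * exp b) = F (a + x * exp b)" "f x = F x" by (simp_all only: f)
      then have "\<bar>f (a + x * exp b) - f x - taylor2 F' F'' x a b\<bar> \<le> e * (a\<^sup>2 + b\<^sup>2)"
        using d1(3)[OF x ab(1,2)] by simp
      moreover have "0 \<le> 2 * C0 * ?I" using C0 by (auto intro!: mult_nonneg_nonneg)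
      ultimately show ?thesis by linarith
    next
      case False
      define q where "q = a\<^sup>2 + b\<^sup>2"
      have dq: "d\<^sup>2 \<le> q"
      proof -
        have "d\<^sup>2 \<le> a\<^sup>2 \<or> d\<^sup>2 \<le> b\<^sup>2" using False d
          by (auto simp: abs_le_square_iff[symmetric])
        then show ?thesis unfolding q_def using zero_le_power2[of a] zero_le_power2[of b] by linarith
      qed
      have qd: "1 \<le> q / d\<^sup>2" using dq d by simp
      have ad: "\<bar>a\<bar> + \<bar>b\<bar> \<le> 2 * (q / d)"
      proof -
        have "\<bar>a\<bar> \<le> sqrt q" "\<bar>b\<bar> \<le> sqrt q" by (auto simp: q_def real_sqrt_sum_squares_ge1 intro!: real_le_rsqrt)
        moreover have "d * sqrt q \<le> sqrt q * sqrt q"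
          using dq by (intro mult_right_mono real_le_rsqrt) (auto simp: q_def)
        then have "sqrt q \<le> q / d" using d by (simp add: field_simps q_def)
        ultimately show ?thesis by linarith
      qed
      have lin: "\<bar>F' x * (a + x * b)\<bar> \<le> 2 * P * X / d * q"
      proof -
        have "\<bar>a + x * b\<bar> \<le> X * (\<bar>a\<bar> + \<bar>b\<bar>)"
        proof -
          have "\<bar>x * b\<bar> \<le> X * \<bar>b\<bar>" unfolding abs_mult using X(2)[OF x] by (intro mult_right_mono) auto
          moreover have "\<bar>a\<bar> \<le> X * \<bar>a\<bar>" using X(1) by (simp add: mult_le_cancel_right1)
          ultimately show ?thesis by (simp add: distrib_left)
        qed
        also have "\<dots> \<le> X * (2 * (q / d))" using ad X(1) by (intro mult_left_mono) auto
        finally have "\<bar>F' x * (a + x * b)\<bar> \<le> P * (X * (2 * (q / d)))"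
          unfolding abs_mult using P(1) P(2)[OF x] by (intro mult_mono) auto
        then show ?thesis by (simp add: field_simps)
      qed
      have qu: "\<bar>(F'' x * a\<^sup>2 + 2 * x * F'' x * (a * b) + (x * F' x + x\<^sup>2 * F'' x) * b\<^sup>2) / 2\<bar> \<le> 3 * P * X\<^sup>2 * q"
      proof -
        have b0: "\<bar>x\<bar> \<le> X" "1 \<le> X" "\<bar>F' x\<bar> \<le> P" "\<bar>F'' x\<bar> \<le> P" using X P x by auto
        have X2: "X \<le> X\<^sup>2" "1 \<le> X\<^sup>2" using b0(2) self_le_power[of X 2] one_le_power[of X 2] by auto
        have x2: "x\<^sup>2 \<le> X\<^sup>2" using b0(1,2) by (simp add: abs_le_square_iff[symmetric])
        have 1: "\<bar>F'' x * a\<^sup>2\<bar> \<le> P * X\<^sup>2 * a\<^sup>2"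
        proof -
          have "\<bar>F'' x\<bar> * 1 \<le> P * X\<^sup>2" using b0 X2 P(1) by (intro mult_mono) auto
          then show ?thesis by (simp add: abs_mult mult_right_mono)
        qed
        have 2: "\<bar>2 * x * F'' x * (a * b)\<bar> \<le> P * X\<^sup>2 * q"
        proof -
          have "2 * \<bar>a * b\<bar> \<le> q" unfolding q_def
            using sum_squares_bound[of "\<bar>a\<bar>" "\<bar>b\<bar>"] by (simp add: abs_mult)
          moreover have "\<bar>x\<bar> * \<bar>F'' x\<bar> \<le> X\<^sup>2 * P" using b0 X2 P(1) by (intro mult_mono) auto
          ultimately have "(\<bar>x\<bar> * \<bar>F'' x\<bar>) * (2 * \<bar>a * b\<bar>) \<le> (X\<^sup>2 * P) * q" using P(1) by (intro mult_mono[where a="\<bar>x\<bar> * \<bar>F'' x\<bar>"]) auto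
          then show ?thesis by (simp add: abs_mult mult_ac)
        qed
        have 3: "\<bar>(x * F' x + x\<^sup>2 * F'' x) * b\<^sup>2\<bar> \<le> 2 * P * X\<^sup>2 * b\<^sup>2"
        proof -
          have "\<bar>x * F' x\<bar> \<le> X\<^sup>2 * P" unfolding abs_mult using b0 X2 P(1) by (intro mult_mono) auto
          moreover have "\<bar>x\<^sup>2 * F'' x\<bar> \<le> X\<^sup>2 * P" unfolding abs_mult using b0 x2 P(1) by (intro mult_mono) auto
          ultimately have "\<bar>x * F' x + x\<^sup>2 * F'' x\<bar> \<le> X\<^sup>2 * P + X\<^sup>2 * P" by (rule order_trans[OF abs_triangle_ineq add_mono])
          then have "\<bar>x * F' x + x\<^sup>2 * F'' x\<bar> \<le> 2 * P * X\<^sup>2" by (simp add: mult_ac)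
          then show ?thesis by (simp add: abs_mult mult_right_mono)
        qed
        have "P * X\<^sup>2 * a\<^sup>2 + 2 * P * X\<^sup>2 * b\<^sup>2 \<le> 2 * (P * X\<^sup>2 * q)"
          using P(1) by (simp add: q_def algebra_simps)
        with 1 2 3 show ?thesis using P(1) by (simp add: q_def)
      qed
      have g0: "\<bar>f (a + x * exp b) - f x\<bar> \<le> 2 * G * (q / d\<^sup>2)"
      proof -
        have "\<bar>f (a + x * exp b) - f x\<bar> \<le> 2 * G" using bd[of "a + x * exp b"] bd[of x] by linarith
        also have "\<dots> \<le> 2 * G * (q / d\<^sup>2)" using qd G mult_left_mono[of 1 "q / d\<^sup>2" "2 * G"] by simp
        finally show ?thesis .
      qed
      have "\<bar>f (a + x * exp b) - f x - taylor2 F' F'' x a b\<bar> \<le> C0 * q"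
      proof -
        have "C0 * q = 2 * G * (q / d\<^sup>2) + 2 * P * X / d * q + 3 * P * X\<^sup>2 * q"
          by (simp add: C0_def distrib_right)
        then show ?thesis using g0 lin qu unfolding taylor2_def by linarith
      qed
      \<comment> \<open>The larger of \<open>\<bar>a\<bar>\<close> and \<open>\<bar>b\<bar>\<close>
        exceeds \<open>d\<close>, and its square is at least half of \<open>q\<close>.\<close>
      also have "\<dots> \<le> C0 * (2 * ?I)"
      proof (intro mult_left_mono C0)
        have sq: "\<bar>u\<bar> \<le> d \<Longrightarrow> d < \<bar>v\<bar> \<Longrightarrow> u\<^sup>2 \<le> v\<^sup>2" for u v :: real
          by (simp add: abs_le_square_iff[symmetric])
        show "q \<le> 2 * ?I" using False sq[of a b] sq[of b a] by (auto simp: q_def indicator_def)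
      qed
      moreover have "0 \<le> e * (a\<^sup>2 + b\<^sup>2)" using e by simp
      ultimately show ?thesis by linarith
    qed
  qed (use d C0 in auto)
qed

text \<open>A single tolerance \<open>e\<close> serves as relative error of the moments and as
  truncation level of the Lindeberg terms. The mixed moment is compared with 0, since the noises
  driving \<open>a\<close> and \<open>b\<close> are independent.\<close>

definition diffusive_step :: "real \<Rightarrow> real \<Rightarrow> real \<Rightarrow> real \<Rightarrow> 'a measure \<Rightarrow> real \<Rightarrow> real \<Rightarrow>
    ('a \<Rightarrow> real) \<Rightarrow> ('a \<Rightarrow> real) \<Rightarrow> bool" where
  "diffusive_step mx mr sx sr M h e a b \<longleftrightarrow>
     a \<in> borel_measurable M \<and> b \<in> borel_measurable M \<and>
     integrable M (\<lambda>\<omega>. (a \<omega>)\<^sup>2) \<and> integrable M (\<lambda>\<omega>. (b \<omega>)\<^sup>2) \<and>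
     \<bar>(\<integral>\<omega>. a \<omega> \<partial>M) - mx * h\<bar> \<le> e * h \<and> \<bar>(\<integral>\<omega>. b \<omega> \<partial>M) - mr * h\<bar> \<le> e * h \<and>
     \<bar>(\<integral>\<omega>. (a \<omega>)\<^sup>2 \<partial>M) - sx\<^sup>2 * h\<bar> \<le> e * h \<and> \<bar>(\<integral>\<omega>. (b \<omega>)\<^sup>2 \<partial>M) - sr\<^sup>2 * h\<bar> \<le> e * h \<and>
     \<bar>\<integral>\<omega>. a \<omega> * b \<omega> \<partial>M\<bar> \<le> e * h \<and>
     (\<integral>\<omega>. (a \<omega>)\<^sup>2 * indicator {e<..} \<bar>a \<omega>\<bar> \<partial>M) \<le> e * h \<and>
     (\<integral>\<omega>. (b \<omega>)\<^sup>2 * indicator {e<..} \<bar>b \<omega>\<bar> \<partial>M) \<le> e * h"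

lemma (in prob_space) integrable_sq_imp:
  fixes a b :: "'a \<Rightarrow> real"
  assumes [measurable]: "a \<in> borel_measurable M" "b \<in> borel_measurable M"
    and i: "integrable M (\<lambda>\<omega>. (a \<omega>)\<^sup>2)" "integrable M (\<lambda>\<omega>. (b \<omega>)\<^sup>2)"
  shows "integrable M a" "integrable M (\<lambda>\<omega>. a \<omega> * b \<omega>)"
    "integrable M (\<lambda>\<omega>. (a \<omega>)\<^sup>2 * indicator {e<..} \<bar>a \<omega>\<bar>)"
proof -
  show "integrable M a"
    using square_integrable_imp_integrable[of a] i by auto
  show "integrable M (\<lambda>\<omega>. a \<omega> * b \<omega>)"
  proof (rule Bochner_Integration.integrable_bound[OF Bochner_Integration.integrable_add[OF i]])
    show "AE x in M. norm (a x * b x) \<le> norm ((a x)\<^sup>2 + (b x)\<^sup>2)"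
    proof (rule AE_I2)
      fix x show "norm (a x * b x) \<le> norm ((a x)\<^sup>2 + (b x)\<^sup>2)"
        using sum_squares_bound[of "\<bar>a x\<bar>" "\<bar>b x\<bar>"] abs_ge_zero[of "a x * b x"]
        unfolding real_norm_def abs_mult power2_abs by linarith
    qed
  qed simp
  show "integrable M (\<lambda>\<omega>. (a \<omega>)\<^sup>2 * indicator {e<..} \<bar>a \<omega>\<bar>)"
    by (rule Bochner_Integration.integrable_bound[OF i(1)]) (auto simp: indicator_def)
qed

text \<open>The expectation of \<open>taylor2\<close> is \<open>h * generator\<close> up to the
  moment errors, and the Lindeberg terms control the remainder. The tolerance \<open>d\<close> is
  chosen before the measure, the step, the point and \<open>h\<close>, so that it serves all chains
  and all meshes.\<close>

lemma diffusive_step_generator: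
  fixes F F' F'' f :: "real \<Rightarrow> real"
  assumes F: "\<And>x. (F has_real_derivative F' x) (at x)"
    and F': "\<And>x. (F' has_real_derivative F'' x) (at x)"
    and cont: "continuous_on UNIV F''" and e: "e > 0"
    and r: "r > 0" and f: "\<And>x. x \<in> {L - r..B + r} \<Longrightarrow> f x = F x" and bd: "\<And>x. \<bar>f x\<bar> \<le> G"
    and fm[measurable]: "f \<in> borel_measurable borel"
  obtains d where "d > 0"
    "\<And>(M :: 'a measure) h a b x d'. prob_space M \<Longrightarrow> d' \<le> d \<Longrightarrow> diffusive_step mx mr sx sr M h d' a b \<Longrightarrow> h > 0 \<Longrightarrow>
       x \<in> {L..B} \<Longrightarrow> \<bar>(\<integral>\<omega>. f (a \<omega> + x * exp (b \<omega>)) \<partial>M) - f x - h * generator mx mr sx sr F' F'' x\<bar> \<le> e * h"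
proof -
  \<comment> \<open>With second moments at most \<open>(sx^2 + 1) * h\<close> and
    \<open>(sr^2 + 1) * h\<close>, the term \<open>e1 * (a^2 + b^2)\<close> costs
    \<open>e / 2 * h\<close>.\<close>
  define e1 where "e1 = e / (2 * (sx\<^sup>2 + sr\<^sup>2 + 2))"
  have ss: "0 \<le> sx\<^sup>2" "0 \<le> sr\<^sup>2" by auto
  have e1: "e1 > 0" using e ss unfolding e1_def by (intro divide_pos_pos mult_pos_pos add_nonneg_pos add_nonneg_nonneg) auto
  obtain d C where dC: "d > 0" "d \<le> 1" "C \<ge> 0" and T:
    "\<And>x a b. x \<in> {L..B} \<Longrightarrow> \<bar>f (a + x * exp b) - f x - taylor2 F' F'' x a b\<bar> \<le>
        e1 * (a\<^sup>2 + b\<^sup>2) + C * (a\<^sup>2 * indicator {d<..} \<bar>a\<bar> + b\<^sup>2 * indicator {d<..} \<bar>b\<bar>)"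
    using taylor_global[OF F F' cont e1 r f bd] by blast
  define X where "X = max \<bar>L\<bar> \<bar>B\<bar> + 1"
  have contF': "continuous_on UNIV F'"
    using F' by (meson DERIV_isCont continuous_at_imp_continuous_on)
  obtain P where P: "P \<ge> 0" "\<And>x. x \<in> {L..B} \<Longrightarrow> \<bar>F' x\<bar> \<le> P" "\<And>x. x \<in> {L..B} \<Longrightarrow> \<bar>F'' x\<bar> \<le> P"
    using bounded_on_segment[OF contF' cont] by blast
  have X: "X \<ge> 1" "\<And>x. x \<in> {L..B} \<Longrightarrow> \<bar>x\<bar> \<le> X" by (auto simp: X_def)
  \<comment> \<open>Six moment errors with coefficients of at most \<open>P * X^2\<close>, and two
    Lindeberg terms with coefficient \<open>C\<close>; \<open>d0\<close> makes their sum at most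
    \<open>e / 2 * h\<close>.\<close>
  define A where "A = P * 6 * X\<^sup>2 + 2 * C"
  have A: "A \<ge> 0" using P dC by (simp add: A_def)
  define d0 where "d0 = min d (e / (2 * (A + 1)))"
  have d0: "d0 > 0" "d0 \<le> d" "d0 \<le> 1" using dC e A by (auto simp: d0_def intro!: divide_pos_pos)
  have Ad0: "A * d' \<le> e / 2" if "d' \<le> d0" for d'
  proof -
    have "A * d' \<le> A * (e / (2 * (A + 1)))" using A that by (intro mult_left_mono) (auto simp: d0_def)
    also have "\<dots> \<le> e / 2" using A e by (simp add: field_simps)
    finally show ?thesis .
  qed
  show ?thesis
  proof (rule that[of d0])
    fix M :: "'a measure" and h a b x d'
    assume M: "prob_space M" and d': "d' \<le> d0" and st: "diffusive_step mx mr sx sr M h d' a b" and h: "h > 0" and x: "x \<in> {L..B}"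
    interpret prob_space M by (rule M)
    note s = st[unfolded diffusive_step_def]
    have [measurable]: "a \<in> borel_measurable M" "b \<in> borel_measurable M" using s by auto
    have i2: "integrable M (\<lambda>\<omega>. (a \<omega>)\<^sup>2)" "integrable M (\<lambda>\<omega>. (b \<omega>)\<^sup>2)" using s by auto
    have i1: "integrable M a" "integrable M b" "integrable M (\<lambda>\<omega>. a \<omega> * b \<omega>)"
      by (rule integrable_sq_imp(1)[OF _ _ i2] integrable_sq_imp(1)[OF _ _ i2(2,1)] integrable_sq_imp(2)[OF _ _ i2]; simp)+
    have iI: "integrable M (\<lambda>\<omega>. (a \<omega>)\<^sup>2 * indicator {c<..} \<bar>a \<omega>\<bar>)" "integrable M (\<lambda>\<omega>. (b \<omega>)\<^sup>2 * indicator {c<..} \<bar>b \<omega>\<bar>)" for c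
      by (rule integrable_sq_imp(3)[OF _ _ i2] integrable_sq_imp(3)[OF _ _ i2(2,1)]; simp)+
    have d'0: "0 \<le> d'" using s h zero_le_mult_iff[of d' h] by linarith
    have dd: "d' \<le> d" "d' \<le> 1" using d' d0 by auto
    \<comment> \<open>The hypothesis truncates at \<open>d'\<close>, the Taylor estimate at
      \<open>d\<close>; the higher level leaves the smaller integral.\<close>
    have lind: "(\<integral>\<omega>. (u \<omega>)\<^sup>2 * indicator {d<..} \<bar>u \<omega>\<bar> \<partial>M) \<le> d' * h"
      if u[measurable]: "u \<in> borel_measurable M" "integrable M (\<lambda>\<omega>. (u \<omega>)\<^sup>2)"
        "(\<integral>\<omega>. (u \<omega>)\<^sup>2 * indicator {d'<..} \<bar>u \<omega>\<bar> \<partial>M) \<le> d' * h" for u :: "'a \<Rightarrow> real"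
    proof -
      have "(\<integral>\<omega>. (u \<omega>)\<^sup>2 * indicator {d<..} \<bar>u \<omega>\<bar> \<partial>M) \<le> (\<integral>\<omega>. (u \<omega>)\<^sup>2 * indicator {d'<..} \<bar>u \<omega>\<bar> \<partial>M)"
        using u(2) dd integrable_sq_imp(3)[OF u(1) u(1) u(2) u(2)] by (intro integral_mono) (auto simp: indicator_def)
      with u(3) show ?thesis by linarith
    qed
    have if_: "integrable M (\<lambda>\<omega>. f (a \<omega> + x * exp (b \<omega>)))"
      by (rule integrable_const_bound[where B=G]) (use bd in auto)
    have it: "integrable M (\<lambda>\<omega>. taylor2 F' F'' x (a \<omega>) (b \<omega>))"
      unfolding taylor2_def using i1 i2
      by (intro Bochner_Integration.integrable_add integrable_mult_right integrable_divide) auto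
    have Et: "(\<integral>\<omega>. taylor2 F' F'' x (a \<omega>) (b \<omega>) \<partial>M) =
        F' x * ((\<integral>\<omega>. a \<omega> \<partial>M) + x * (\<integral>\<omega>. b \<omega> \<partial>M)) +
        (F'' x * (\<integral>\<omega>. (a \<omega>)\<^sup>2 \<partial>M) + 2 * x * F'' x * (\<integral>\<omega>. a \<omega> * b \<omega> \<partial>M) + (x * F' x + x\<^sup>2 * F'' x) * (\<integral>\<omega>. (b \<omega>)\<^sup>2 \<partial>M)) / 2"
      unfolding taylor2_def using i1 i2
      by simp
    have "\<bar>(\<integral>\<omega>. f (a \<omega> + x * exp (b \<omega>)) \<partial>M) - f x - (\<integral>\<omega>. taylor2 F' F'' x (a \<omega>) (b \<omega>) \<partial>M)\<bar> =
        \<bar>\<integral>\<omega>. f (a \<omega> + x * exp (b \<omega>)) - f x - taylor2 F' F'' x (a \<omega>) (b \<omega>) \<partial>M\<bar>"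
      using if_ it by (simp add: prob_space)
    also have "\<dots> \<le> (\<integral>\<omega>. e1 * ((a \<omega>)\<^sup>2 + (b \<omega>)\<^sup>2) +
        C * ((a \<omega>)\<^sup>2 * indicator {d<..} \<bar>a \<omega>\<bar> + (b \<omega>)\<^sup>2 * indicator {d<..} \<bar>b \<omega>\<bar>) \<partial>M)"
      using if_ it i1 i2 iI T[OF x]
      by (intro order_trans[OF integral_abs_bound] integral_mono) auto
    also have "\<dots> = e1 * ((\<integral>\<omega>. (a \<omega>)\<^sup>2 \<partial>M) + (\<integral>\<omega>. (b \<omega>)\<^sup>2 \<partial>M)) +
        C * ((\<integral>\<omega>. (a \<omega>)\<^sup>2 * indicator {d<..} \<bar>a \<omega>\<bar> \<partial>M) + (\<integral>\<omega>. (b \<omega>)\<^sup>2 * indicator {d<..} \<bar>b \<omega>\<bar> \<partial>M))"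
      using i2 iI by simp
    also have "\<dots> \<le> e1 * ((sx\<^sup>2 + 1) * h + (sr\<^sup>2 + 1) * h) + C * (d' * h + d' * h)"
    proof -
      have "d' * h \<le> 1 * h" using dd h by (intro mult_right_mono) auto
      then have "(\<integral>\<omega>. (a \<omega>)\<^sup>2 \<partial>M) \<le> (sx\<^sup>2 + 1) * h" "(\<integral>\<omega>. (b \<omega>)\<^sup>2 \<partial>M) \<le> (sr\<^sup>2 + 1) * h"
        using s by (simp_all add: distrib_right abs_le_iff)
      moreover have "(\<integral>\<omega>. (a \<omega>)\<^sup>2 * indicator {d<..} \<bar>a \<omega>\<bar> \<partial>M) \<le> d' * h" "(\<integral>\<omega>. (b \<omega>)\<^sup>2 * indicator {d<..} \<bar>b \<omega>\<bar> \<partial>M) \<le> d' * h"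
        using s by (auto intro!: lind)
      ultimately show ?thesis using e1 dC by (intro add_mono mult_left_mono) auto
    qed
    also have "\<dots> = e / 2 * h + 2 * C * d' * h"
    proof -
      have "e1 * (sx\<^sup>2 + sr\<^sup>2 + 2) = e / 2"
      proof -
        define q where "q = sx\<^sup>2 + sr\<^sup>2 + 2"
        have "q > 0" using ss by (simp add: q_def add_nonneg_pos)
        then show ?thesis by (simp add: e1_def flip: q_def)
      qed
      moreover have "e1 * ((sx\<^sup>2 + 1) * h + (sr\<^sup>2 + 1) * h) = e1 * (sx\<^sup>2 + sr\<^sup>2 + 2) * h" by (simp add: algebra_simps)
      ultimately have "e1 * ((sx\<^sup>2 + 1) * h + (sr\<^sup>2 + 1) * h) = e / 2 * h" by metis
      then show ?thesis by (simp add: algebra_simps)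
    qed
    finally have 1: "\<bar>(\<integral>\<omega>. f (a \<omega> + x * exp (b \<omega>)) \<partial>M) - f x - (\<integral>\<omega>. taylor2 F' F'' x (a \<omega>) (b \<omega>) \<partial>M)\<bar> \<le> e / 2 * h + 2 * C * d' * h" .
    let ?da = "(\<integral>\<omega>. a \<omega> \<partial>M) - mx * h" and ?db = "(\<integral>\<omega>. b \<omega> \<partial>M) - mr * h" and ?daa = "(\<integral>\<omega>. (a \<omega>)\<^sup>2 \<partial>M) - sx\<^sup>2 * h"
      and ?dbb = "(\<integral>\<omega>. (b \<omega>)\<^sup>2 \<partial>M) - sr\<^sup>2 * h" and ?dab = "\<integral>\<omega>. a \<omega> * b \<omega> \<partial>M"
    have b0: "\<bar>x\<bar> \<le> X" "1 \<le> X" "\<bar>F' x\<bar> \<le> P" "\<bar>F'' x\<bar> \<le> P" using X P x by auto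
    have X2: "X \<le> X\<^sup>2" "1 \<le> X\<^sup>2" using b0(2) self_le_power[of X 2] one_le_power[of X 2] by auto
    have x2: "x\<^sup>2 \<le> X\<^sup>2" using b0(1,2) by (simp add: abs_le_square_iff[symmetric])
    have k: "\<bar>F' x\<bar> \<le> P * X\<^sup>2" "\<bar>F'' x\<bar> \<le> P * X\<^sup>2"
      using mult_mono[OF b0(3) X2(2)] mult_mono[OF b0(4) X2(2)] P(1) by auto
    have k': "\<bar>F' x * x\<bar> \<le> P * X\<^sup>2" "\<bar>F'' x * x\<bar> \<le> P * X\<^sup>2" "\<bar>F'' x * x\<^sup>2\<bar> \<le> P * X\<^sup>2"
      unfolding abs_mult using b0 X2 x2 P(1) by (auto intro!: mult_mono)
    have m: "\<bar>u * v\<bar> \<le> P * X\<^sup>2 * (d' * h)" if "\<bar>u\<bar> \<le> P * X\<^sup>2" "\<bar>v\<bar> \<le> d' * h" for u v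
      unfolding abs_mult using that P(1) by (intro mult_mono) auto
    have "(\<integral>\<omega>. taylor2 F' F'' x (a \<omega>) (b \<omega>) \<partial>M) - h * generator mx mr sx sr F' F'' x =
        F' x * ?da + (F' x * x) * ?db + ((F'' x) * ?daa) / 2 + (F'' x * x) * ?dab + ((F' x * x) * ?dbb) / 2 + ((F'' x * x\<^sup>2) * ?dbb) / 2"
      unfolding Et generator_def by (simp add: field_simps power2_eq_square)
    also have "\<bar>\<dots>\<bar> \<le> 6 * (P * X\<^sup>2 * (d' * h))"
    proof -
      have ss: "\<bar>?da\<bar> \<le> d' * h" "\<bar>?db\<bar> \<le> d' * h" "\<bar>?daa\<bar> \<le> d' * h" "\<bar>?dbb\<bar> \<le> d' * h" "\<bar>?dab\<bar> \<le> d' * h"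
        using s by auto
      note mm = m[OF k(1) ss(1)] m[OF k'(1) ss(2)] m[OF k(2) ss(3)] m[OF k'(2) ss(5)] m[OF k'(1) ss(4)] m[OF k'(3) ss(4)]
      have "0 \<le> P * X\<^sup>2 * (d' * h)" using mm(1) by (rule order_trans[OF abs_ge_zero])
      then show ?thesis
        using mm[THEN abs_le_D1] mm[THEN abs_le_D2] by (intro abs_leI) linarith+
    qed
    finally have 2: "\<bar>(\<integral>\<omega>. taylor2 F' F'' x (a \<omega>) (b \<omega>) \<partial>M) - h * generator mx mr sx sr F' F'' x\<bar> \<le> 6 * (P * X\<^sup>2 * (d' * h))" .
    have "6 * (P * X\<^sup>2 * (d' * h)) + 2 * C * d' * h = (A * d') * h" by (simp add: A_def algebra_simps)
    also have "\<dots> \<le> e / 2 * h" using Ad0[OF d'] h by (intro mult_right_mono) auto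
    finally show "\<bar>(\<integral>\<omega>. f (a \<omega> + x * exp (b \<omega>)) \<partial>M) - f x - h * generator mx mr sx sr F' F'' x\<bar> \<le> e * h"
      using 1 2 by linarith
  qed (use d0 in auto)
qed

section \<open>Ruin of affine chains\<close>

text \<open>Freezing: under independence the joint law is the product of the marginals, and Fubini
  integrates \<open>Y\<close> with \<open>X\<close> held fixed. A second copy of \<open>M\<close>
  plays the part of the second factor.\<close>

lemma (in prob_space) expectation_indep_var:
  fixes \<Phi> :: "'s \<times> 's \<Rightarrow> real"
  assumes ind: "indep_var S X T Y" and m[measurable]: "\<Phi> \<in> borel_measurable (S \<Otimes>\<^sub>M T)"
    and bd: "\<And>z. \<bar>\<Phi> z\<bar> \<le> G"
  shows "(\<integral>\<omega>. \<Phi> (X \<omega>, Y \<omega>) \<partial>M) = (\<integral>\<omega>. (\<integral>\<omega>'. \<Phi> (X \<omega>, Y \<omega>') \<partial>M) \<partial>M)"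
proof -
  have [measurable]: "X \<in> measurable M S" "Y \<in> measurable M T"
    using indep_var_rv1[OF ind] indep_var_rv2[OF ind] by auto
  interpret X: prob_space "distr M S X" by (rule prob_space_distr) simp
  interpret Y: prob_space "distr M T Y" by (rule prob_space_distr) simp
  interpret XY: pair_prob_space "distr M S X" "distr M T Y" ..
  have "(\<integral>\<omega>. \<Phi> (X \<omega>, Y \<omega>) \<partial>M) = (\<integral>z. \<Phi> z \<partial>distr M (S \<Otimes>\<^sub>M T) (\<lambda>\<omega>. (X \<omega>, Y \<omega>)))"
    by (subst integral_distr) auto
  also have "\<dots> = (\<integral>z. \<Phi> z \<partial>(distr M S X \<Otimes>\<^sub>M distr M T Y))"
    using ind unfolding indep_var_distribution_eq by simp
  also have "\<dots> = (\<integral>x. (\<integral>y. \<Phi> (x, y) \<partial>distr M T Y) \<partial>distr M S X)"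
    by (rule XY.integral_fst'[symmetric], rule XY.integrable_const_bound[where B=G]) (use bd in auto)
  also have "\<dots> = (\<integral>\<omega>. (\<integral>\<omega>'. \<Phi> (X \<omega>, Y \<omega>') \<partial>M) \<partial>M)"
  proof (subst integral_distr)
    show "(\<lambda>x. \<integral>y. \<Phi> (x, y) \<partial>distr M T Y) \<in> borel_measurable S"
      by (rule Y.borel_measurable_lebesgue_integral) simp
    show "(\<integral>\<omega>. (\<integral>y. \<Phi> (X \<omega>, y) \<partial>distr M T Y) \<partial>M) = (\<integral>\<omega>. (\<integral>\<omega>'. \<Phi> (X \<omega>, Y \<omega>') \<partial>M) \<partial>M)"
      by (intro Bochner_Integration.integral_cong refl, subst integral_distr) auto
  qed simp
  finally show ?thesis .
qed

lemma sets_All_le: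
  fixes k :: nat
  assumes "\<And>j. j \<le> k \<Longrightarrow> X j \<in> measurable M N" "I \<in> sets N"
  shows "{\<omega> \<in> space M. \<forall>j\<le>k. X j \<omega> \<in> I} \<in> sets M"
proof -
  have "{\<omega> \<in> space M. \<forall>j\<le>k. X j \<omega> \<in> I} = (\<Inter>j\<in>{..k}. X j -` I \<inter> space M)" by auto
  also have "\<dots> \<in> sets M" using assms by (intro sets.finite_INT) auto
  finally show ?thesis .
qed

text \<open>Defined for a deterministic coefficient sequence: this makes the position a measurable
  function on a finite product space, to which independence of the coefficients applies.\<close>

fun chain :: "real \<Rightarrow> (nat \<Rightarrow> real \<times> real) \<Rightarrow> nat \<Rightarrow> real" where
  "chain y p 0 = y"
| "chain y p (Suc k) = fst (p k) + chain y p k * exp (snd (p k))"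

lemma chain_cong: "(\<And>i. i < k \<Longrightarrow> p i = q i) \<Longrightarrow> chain y p k = chain y q k"
  by (induction k) auto

lemma chain_measurable:
  assumes "k \<le> n"
  shows "(\<lambda>p. chain y p k) \<in> borel_measurable (Pi\<^sub>M {..<n} (\<lambda>_. borel))"
  using assms
proof (induction k)
  case (Suc k)
  have "(\<lambda>p. p k) \<in> measurable (Pi\<^sub>M {..<n} (\<lambda>_. borel :: (real \<times> real) measure)) borel"
    using Suc.prems by (intro measurable_component_singleton) auto
  moreover have "fst \<in> borel_measurable (borel :: (real \<times> real) measure)" "snd \<in> borel_measurable (borel :: (real \<times> real) measure)"
    by (auto intro!: borel_measurable_continuous_onI continuous_intros)
  ultimately have [measurable]: "(\<lambda>p. fst (p k)) \<in> borel_measurable (Pi\<^sub>M {..<n} (\<lambda>_. borel :: (real \<times> real) measure))"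
    "(\<lambda>p. snd (p k)) \<in> borel_measurable (Pi\<^sub>M {..<n} (\<lambda>_. borel :: (real \<times> real) measure))"
    by (auto intro: measurable_compose)
  have [measurable]: "(\<lambda>p. chain y p k) \<in> borel_measurable (Pi\<^sub>M {..<n} (\<lambda>_. borel))" using Suc by auto
  show ?case by simp
qed simp

text \<open>Independence is required between the pairs only: in the skeleton of the diffusion both
  entries of a pair depend on the same stretch of \<open>W\<close>.\<close>

locale indep_chain = prob_space +
  fixes p :: "nat \<Rightarrow> 'a \<Rightarrow> real \<times> real" and K :: nat
  assumes indep: "indep_vars (\<lambda>_. borel) p {..<K}"
begin

lemma p_measurable: "k < K \<Longrightarrow> p k \<in> borel_measurable M"
  using indep unfolding indep_vars_def by auto

lemma chain_rv[measurable]: "k \<le> K \<Longrightarrow> (\<lambda>\<omega>. chain y (\<lambda>i. p i \<omega>) k) \<in> borel_measurable M"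
proof -
  assume k: "k \<le> K"
  have "(\<lambda>\<omega>. restrict (\<lambda>i. p i \<omega>) {..<K}) \<in> measurable M (Pi\<^sub>M {..<K} (\<lambda>_. borel))"
    by (rule measurable_restrict) (auto intro: p_measurable)
  from measurable_compose[OF this chain_measurable[OF k, of y]]
  show ?thesis
    by (rule measurable_cong[THEN iffD1, rotated]) (use k in \<open>auto intro!: chain_cong\<close>)
qed

definition confined :: "real \<Rightarrow> real set \<Rightarrow> nat \<Rightarrow> 'a set" where
  "confined y I k = {\<omega> \<in> space M. \<forall>j\<le>k. chain y (\<lambda>i. p i \<omega>) j \<in> I}"

lemma confined_sets[measurable]: "k \<le> K \<Longrightarrow> I \<in> sets borel \<Longrightarrow> confined y I k \<in> sets M"
  unfolding confined_def by (rule sets_All_le) (auto intro: chain_rv)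

text \<open>The event and the position are functions of the coefficients before \<open>k\<close>,
  which are independent of \<open>p k\<close>; the inner integral draws a fresh copy of
  \<open>p k\<close>.\<close>

lemma chain_markov:
  fixes f :: "real \<Rightarrow> real"
  assumes k: "k < K" and [measurable]: "I \<in> sets borel" "f \<in> borel_measurable borel"
    and bd: "\<And>x. \<bar>f x\<bar> \<le> G"
  shows "(\<integral>\<omega>. indicator (confined y I k) \<omega> * f (chain y (\<lambda>i. p i \<omega>) (Suc k)) \<partial>M) =
    (\<integral>\<omega>. indicator (confined y I k) \<omega> *
       (\<integral>\<omega>'. f (fst (p k \<omega>') + chain y (\<lambda>i. p i \<omega>) k * exp (snd (p k \<omega>'))) \<partial>M) \<partial>M)"
proof -
  let ?S = "Pi\<^sub>M {..<k} (\<lambda>_. borel :: (real \<times> real) measure)" and ?T = "Pi\<^sub>M {k} (\<lambda>_. borel :: (real \<times> real) measure)"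
  have ind: "indep_var ?S (\<lambda>\<omega>. restrict (\<lambda>i. p i \<omega>) {..<k}) ?T (\<lambda>\<omega>. restrict (\<lambda>i. p i \<omega>) {k})"
    using k by (intro indep_var_restrict[OF indep]) auto
  define \<Phi> :: "(nat \<Rightarrow> real \<times> real) \<times> (nat \<Rightarrow> real \<times> real) \<Rightarrow> real" where
    "\<Phi> z = indicator {q. \<forall>j\<le>k. chain y q j \<in> I} (fst z) * f (fst (snd z k) + chain y (fst z) k * exp (snd (snd z k)))" for z
  have [measurable]: "(\<lambda>q. chain y q j) \<in> borel_measurable ?S" if "j \<le> k" for j
    using that by (rule chain_measurable)
  have fs: "fst \<in> borel_measurable (borel :: (real \<times> real) measure)" "snd \<in> borel_measurable (borel :: (real \<times> real) measure)"
    by (auto intro!: borel_measurable_continuous_onI continuous_intros)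
  have "(\<lambda>q. q k) \<in> measurable ?T borel" by (rule measurable_component_singleton) simp
  then have [measurable]: "(\<lambda>q. fst (q k)) \<in> borel_measurable ?T" "(\<lambda>q. snd (q k)) \<in> borel_measurable ?T"
    using fs by (auto intro: measurable_compose)
  have "{q \<in> space ?S. \<forall>j\<le>k. chain y q j \<in> I} \<in> sets ?S"
    by (rule sets_All_le[where N=borel]) (auto intro: chain_measurable)
  then have "Measurable.pred ?S (\<lambda>q. \<forall>j\<le>k. chain y q j \<in> I)" by (simp add: pred_def)
  then have [measurable]: "(\<lambda>q. indicator {q. \<forall>j\<le>k. chain y q j \<in> I} q :: real) \<in> borel_measurable ?S"
    by (subst borel_measurable_indicator_iff) (auto simp: pred_def space_PiM Int_def conj_commute)
  have m: "\<Phi> \<in> borel_measurable (?S \<Otimes>\<^sub>M ?T)"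
    unfolding \<Phi>_def by measurable
  have bd\<Phi>: "\<bar>\<Phi> z\<bar> \<le> G" for z
  proof -
    have "\<bar>\<Phi> z\<bar> \<le> \<bar>f (fst (snd z k) + chain y (fst z) k * exp (snd (snd z k)))\<bar>"
      unfolding \<Phi>_def by (auto simp: indicator_def)
    then show ?thesis using bd order_trans by blast
  qed
  have r: "chain y (restrict (\<lambda>i. p i \<omega>) {..<k}) j = chain y (\<lambda>i. p i \<omega>) j" if "j \<le> k" for j \<omega>
    using that by (auto intro!: chain_cong)
  have e: "\<Phi> (restrict (\<lambda>i. p i \<omega>) {..<k}, restrict (\<lambda>i. p i \<omega>') {k}) =
      indicator (confined y I k) \<omega> * f (fst (p k \<omega>') + chain y (\<lambda>i. p i \<omega>) k * exp (snd (p k \<omega>')))"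
    if "\<omega> \<in> space M" for \<omega> \<omega>'
    unfolding \<Phi>_def confined_def using that by (auto simp: indicator_def r)
  have "(\<integral>\<omega>. indicator (confined y I k) \<omega> * f (chain y (\<lambda>i. p i \<omega>) (Suc k)) \<partial>M) =
      (\<integral>\<omega>. \<Phi> (restrict (\<lambda>i. p i \<omega>) {..<k}, restrict (\<lambda>i. p i \<omega>) {k}) \<partial>M)"
    by (intro Bochner_Integration.integral_cong refl) (simp add: e)
  also have "\<dots> = (\<integral>\<omega>. (\<integral>\<omega>'. \<Phi> (restrict (\<lambda>i. p i \<omega>) {..<k}, restrict (\<lambda>i. p i \<omega>') {k}) \<partial>M) \<partial>M)"
    by (rule expectation_indep_var[OF ind m bd\<Phi>])
  also have "\<dots> = (\<integral>\<omega>. indicator (confined y I k) \<omega> *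
       (\<integral>\<omega>'. f (fst (p k \<omega>') + chain y (\<lambda>i. p i \<omega>) k * exp (snd (p k \<omega>'))) \<partial>M) \<partial>M)"
    by (intro Bochner_Integration.integral_cong refl) (simp add: e)
  finally show ?thesis .
qed

lemma confined_Suc:
  "confined y I (Suc k) = {\<omega> \<in> confined y I k. chain y (\<lambda>i. p i \<omega>) (Suc k) \<in> I}"
  unfolding confined_def by (auto simp: le_Suc_eq simp del: chain.simps)

lemma one_step_integrable:
  fixes f :: "real \<Rightarrow> real"
  assumes k: "k < K" and [measurable]: "f \<in> borel_measurable borel" "I \<in> sets borel"
    and bd: "\<And>x. \<bar>f x\<bar> \<le> G"
  shows "integrable M (\<lambda>\<omega>. indicator (confined y I k) \<omega> *
       (\<integral>\<omega>'. f (fst (p k \<omega>') + chain y (\<lambda>i. p i \<omega>) k * exp (snd (p k \<omega>'))) \<partial>M))"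
proof -
  have [measurable]: "p k \<in> borel_measurable M" using p_measurable[OF k] .
  have fs: "fst \<in> borel_measurable (borel :: (real \<times> real) measure)" "snd \<in> borel_measurable (borel :: (real \<times> real) measure)"
    by (auto intro!: borel_measurable_continuous_onI continuous_intros)
  have [measurable]: "(\<lambda>\<omega>. fst (p k \<omega>)) \<in> borel_measurable M" "(\<lambda>\<omega>. snd (p k \<omega>)) \<in> borel_measurable M"
    using fs by (auto intro: measurable_compose)
  have [measurable]: "(\<lambda>\<omega>. chain y (\<lambda>i. p i \<omega>) k) \<in> borel_measurable M" "confined y I k \<in> sets M" using k by auto
  show ?thesis
  proof (rule integrable_const_bound[where B=G])
    have "\<bar>\<integral>\<omega>'. f (fst (p k \<omega>') + c * exp (snd (p k \<omega>'))) \<partial>M\<bar> \<le> G" for c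
    proof -
      have "\<bar>\<integral>\<omega>'. f (fst (p k \<omega>') + c * exp (snd (p k \<omega>'))) \<partial>M\<bar> \<le> (\<integral>\<omega>'. \<bar>f (fst (p k \<omega>') + c * exp (snd (p k \<omega>')))\<bar> \<partial>M)"
        by (rule integral_abs_bound)
      also have "\<dots> \<le> (\<integral>\<omega>'. G \<partial>M)"
        by (rule integral_mono) (auto intro!: integrable_const_bound[where B=G] simp: bd)
      finally show ?thesis by (simp add: prob_space)
    qed
    moreover have "0 \<le> G" using bd[of 0] by linarith
    ultimately show "AE \<omega> in M. norm (indicator (confined y I k) \<omega> *
       (\<integral>\<omega>'. f (fst (p k \<omega>') + chain y (\<lambda>i. p i \<omega>) k * exp (snd (p k \<omega>'))) \<partial>M)) \<le> G"
      by (auto simp: indicator_def)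
  qed measurable
qed

text \<open>Optional stopping as an induction: the mean of \<open>V\<close> over the surviving paths
  plus the mass already ruined is at most \<open>V y\<close> at all times, since ruin exchanges a
  value \<open>V \<ge> 1\<close> for mass 1. \<open>K\<close> does not enter the bound.\<close>

lemma ruin_prob_le:
  fixes V :: "real \<Rightarrow> real"
  assumes [measurable]: "V \<in> borel_measurable borel" and V0: "\<And>x. 0 \<le> V x" and bd: "\<And>x. V x \<le> G"
    and V1: "\<And>x. x < 0 \<Longrightarrow> 1 \<le> V x"
    and super: "\<And>k x. k < K \<Longrightarrow> 0 \<le> x \<Longrightarrow> (\<integral>\<omega>. V (fst (p k \<omega>) + x * exp (snd (p k \<omega>))) \<partial>M) \<le> V x"
    and y: "0 \<le> y"
  shows "prob {\<omega> \<in> space M. \<exists>k\<le>K. chain y (\<lambda>i. p i \<omega>) k < 0} \<le> V y"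
proof -
  let ?A = "confined y {0..}" and ?X = "\<lambda>k \<omega>. chain y (\<lambda>i. p i \<omega>) k"
  have abd: "\<bar>V x\<bar> \<le> G" for x using V0[of x] bd[of x] by auto
  have "(\<integral>\<omega>. indicator (?A k) \<omega> * V (?X k \<omega>) \<partial>M) + 1 - prob (?A k) \<le> V y" if "k \<le> K" for k
    using that
  proof (induction k)
    case 0
    have "?A 0 = space M" using y by (auto simp: confined_def)
    then have "(\<integral>\<omega>. indicator (?A 0) \<omega> * V (?X 0 \<omega>) \<partial>M) = (\<integral>\<omega>. V y \<partial>M)"
      by (intro Bochner_Integration.integral_cong) auto
    then show ?case using \<open>?A 0 = space M\<close> by (simp add: prob_space)
  next
    case (Suc k)
    then have k: "k < K" by auto
    have [measurable]: "?A k \<in> sets M" "?A (Suc k) \<in> sets M" "?X k \<in> borel_measurable M" "?X (Suc k) \<in> borel_measurable M"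
      using k by (simp_all del: chain.simps add: chain_rv)
    have int: "integrable M (\<lambda>\<omega>. indicator (?A i) \<omega> * V (?X j \<omega>))" if "i \<le> K" "j \<le> K" for i j
    proof (rule integrable_const_bound[where B=G])
      show "AE \<omega> in M. norm (indicator (?A i) \<omega> * V (?X j \<omega>)) \<le> G"
        using V0 bd by (auto simp: indicator_def intro: order_trans[OF V0 bd])
      have [measurable]: "?A i \<in> sets M" "?X j \<in> borel_measurable M" using that by auto
      show "(\<lambda>\<omega>. indicator (?A i) \<omega> * V (?X j \<omega>)) \<in> borel_measurable M" by measurable
    qed
    have "(\<integral>\<omega>. indicator (?A (Suc k)) \<omega> * V (?X (Suc k) \<omega>) \<partial>M) + (prob (?A k) - prob (?A (Suc k))) =
        (\<integral>\<omega>. indicator (?A (Suc k)) \<omega> * V (?X (Suc k) \<omega>) + (indicator (?A k) \<omega> - indicator (?A (Suc k)) \<omega>) \<partial>M)"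
      using int[of "Suc k" "Suc k"] k by (simp add: Bochner_Integration.integral_add Bochner_Integration.integral_diff integrable_indicator_iff emeasure_eq_measure)
    \<comment> \<open>Paths ruined in this step lie in \<open>?A k\<close> but not in
      \<open>?A (Suc k)\<close>; on them the mass 1 is at most \<open>V\<close>.\<close>
    also have "\<dots> \<le> (\<integral>\<omega>. indicator (?A k) \<omega> * V (?X (Suc k) \<omega>) \<partial>M)"
    proof (rule integral_mono)
      show "integrable M (\<lambda>\<omega>. indicator (?A (Suc k)) \<omega> * V (?X (Suc k) \<omega>) + (indicator (?A k) \<omega> - indicator (?A (Suc k)) \<omega>))"
        using int[of "Suc k" "Suc k"] k
        by (intro Bochner_Integration.integrable_add Bochner_Integration.integrable_diff) (auto simp: emeasure_eq_measure)
      show "integrable M (\<lambda>\<omega>. indicator (?A k) \<omega> * V (?X (Suc k) \<omega>))" using int[of k "Suc k"] k by auto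
      fix \<omega>
      show "indicator (?A (Suc k)) \<omega> * V (?X (Suc k) \<omega>) + (indicator (?A k) \<omega> - indicator (?A (Suc k)) \<omega>)
          \<le> indicator (?A k) \<omega> * V (?X (Suc k) \<omega>)"
        unfolding confined_Suc using V1[of "?X (Suc k) \<omega>"] by (auto simp: indicator_def simp del: chain.simps)
    qed
    also have "\<dots> = (\<integral>\<omega>. indicator (?A k) \<omega> *
       (\<integral>\<omega>'. V (fst (p k \<omega>') + ?X k \<omega> * exp (snd (p k \<omega>'))) \<partial>M) \<partial>M)"
      by (rule chain_markov[OF k _ _ abd]) auto
    also have "\<dots> \<le> (\<integral>\<omega>. indicator (?A k) \<omega> * V (?X k \<omega>) \<partial>M)"
    proof (rule integral_mono)
      show "integrable M (\<lambda>\<omega>. indicator (?A k) \<omega> *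
         (\<integral>\<omega>'. V (fst (p k \<omega>') + ?X k \<omega> * exp (snd (p k \<omega>'))) \<partial>M))"
        by (rule one_step_integrable[OF k _ _ abd]) auto
      show "integrable M (\<lambda>\<omega>. indicator (?A k) \<omega> * V (?X k \<omega>))" using int k by auto
      show "indicator (?A k) \<omega> * (\<integral>\<omega>'. V (fst (p k \<omega>') + ?X k \<omega> * exp (snd (p k \<omega>'))) \<partial>M)
          \<le> indicator (?A k) \<omega> * V (?X k \<omega>)" for \<omega>
        using super[OF k, of "?X k \<omega>"] by (auto simp: indicator_def confined_def)
    qed
    finally show ?case using Suc by auto
  qed
  from this[of K] have "1 - prob (?A K) \<le> V y"
  proof -
    assume "K \<le> K \<Longrightarrow> (\<integral>\<omega>. indicator (?A K) \<omega> * V (?X K \<omega>) \<partial>M) + 1 - prob (?A K) \<le> V y"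
    moreover have "0 \<le> (\<integral>\<omega>. indicator (?A K) \<omega> * V (?X K \<omega>) \<partial>M)"
      by (rule Bochner_Integration.integral_nonneg) (simp add: V0)
    ultimately show ?thesis by simp
  qed
  moreover have "{\<omega> \<in> space M. \<exists>k\<le>K. ?X k \<omega> < 0} = space M - ?A K"
    by (auto simp: confined_def not_le)
  then have "prob {\<omega> \<in> space M. \<exists>k\<le>K. ?X k \<omega> < 0} = 1 - prob (?A K)"
    using prob_compl[of "?A K"] by simp
  ultimately show ?thesis by simp
qed

text \<open>Optional stopping with a strict drift: the mean of \<open>g\<close> over the confined
  paths plus the mass already ruined gains at least \<open>c\<close> times the confined mass in each
  step. The same drift bounds the probability of staying in \<open>[L, B]\<close> for
  \<open>K\<close> steps by \<open>(2 G + 1) / (K c)\<close>, which is the source of the error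
  term.\<close>

lemma ruin_prob_ge:
  fixes g :: "real \<Rightarrow> real"
  assumes [measurable]: "g \<in> borel_measurable borel" and bd: "\<And>x. \<bar>g x\<bar> \<le> G"
    and g1: "\<And>x. x < L \<Longrightarrow> g x \<le> 1" and gB: "\<And>x. x > B \<Longrightarrow> g x \<le> 0" and c: "0 < c"
    and sub: "\<And>k x. k < K \<Longrightarrow> x \<in> {L..B} \<Longrightarrow> g x + c \<le> (\<integral>\<omega>. g (fst (p k \<omega>) + x * exp (snd (p k \<omega>))) \<partial>M)"
    and y: "y \<in> {L..B}" and K: "0 < K"
  shows "g y - G * (2 * G + 1) / (real K * c) \<le> prob {\<omega> \<in> space M. \<exists>k\<le>K. chain y (\<lambda>i. p i \<omega>) k < L}"
proof -
  let ?A = "confined y {L..B}" and ?X = "\<lambda>k \<omega>. chain y (\<lambda>i. p i \<omega>) k"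
  let ?R = "\<lambda>k. {\<omega> \<in> space M. \<exists>j\<le>k. ?X j \<omega> < L}"
  let ?m = "\<lambda>k. (\<integral>\<omega>. indicator (?A k) \<omega> * g (?X k \<omega>) \<partial>M)"
  have G: "0 \<le> G" using bd[of 0] by linarith
  have Am[measurable]: "?A k \<in> sets M" if "k \<le> K" for k using that by auto
  have Rm[measurable]: "?R k \<in> sets M" if "k \<le> K" for k
  proof -
    have "?R k = (\<Union>j\<in>{..k}. {\<omega> \<in> space M. ?X j \<omega> < L})" by auto
    also have "\<dots> \<in> sets M"
    proof (rule sets.finite_UN)
      fix j assume "j \<in> {..k}"
      then have [measurable]: "?X j \<in> borel_measurable M" using that by (intro chain_rv) auto
      show "{\<omega> \<in> space M. ?X j \<omega> < L} \<in> sets M" by measurable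
    qed simp
    finally show ?thesis .
  qed
  have int: "integrable M (\<lambda>\<omega>. indicator (?A i) \<omega> * g (?X j \<omega>))" if "i \<le> K" "j \<le> K" for i j
  proof (rule integrable_const_bound[where B=G])
    show "AE \<omega> in M. norm (indicator (?A i) \<omega> * g (?X j \<omega>)) \<le> G"
      using bd G by (auto simp: indicator_def)
    have [measurable]: "?A i \<in> sets M" "?X j \<in> borel_measurable M" using that by auto
    show "(\<lambda>\<omega>. indicator (?A i) \<omega> * g (?X j \<omega>)) \<in> borel_measurable M" by measurable
  qed
  have mono: "prob (?A (Suc k)) \<le> prob (?A k)" if "k < K" for k
    using that by (intro finite_measure_mono) (auto simp: confined_Suc)
  have "g y + real k * c * prob (?A k) \<le> ?m k + prob (?R k)" if "k \<le> K" for k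
    using that
  proof (induction k)
    case 0
    have "?A 0 = space M" using y by (auto simp: confined_def)
    then have "?m 0 = (\<integral>\<omega>. g y \<partial>M)"
      by (intro Bochner_Integration.integral_cong) auto
    then show ?case using \<open>?A 0 = space M\<close> by (simp add: prob_space)
  next
    case (Suc k)
    then have k: "k < K" by auto
    let ?D = "{\<omega> \<in> ?A k. ?X (Suc k) \<omega> < L}"
    have "?D = ?A k \<inter> {\<omega> \<in> space M. ?X (Suc k) \<omega> < L}" by (auto simp: confined_def)
    moreover have "{\<omega> \<in> space M. ?X (Suc k) \<omega> < L} \<in> sets M" "?A k \<in> sets M"
      using k chain_rv[of "Suc k"] Am[of k] by (simp_all del: chain.simps)
    ultimately have D[measurable]: "?D \<in> sets M" by simp
    have "?m k + c * prob (?A k) = (\<integral>\<omega>. indicator (?A k) \<omega> * g (?X k \<omega>) + c * indicator (?A k) \<omega> \<partial>M)"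
      using int[of k k] k by (simp add: emeasure_eq_measure)
    also have "\<dots> \<le> (\<integral>\<omega>. indicator (?A k) \<omega> *
       (\<integral>\<omega>'. g (fst (p k \<omega>') + ?X k \<omega> * exp (snd (p k \<omega>'))) \<partial>M) \<partial>M)"
    proof (rule integral_mono)
      show "integrable M (\<lambda>\<omega>. indicator (?A k) \<omega> *
         (\<integral>\<omega>'. g (fst (p k \<omega>') + ?X k \<omega> * exp (snd (p k \<omega>'))) \<partial>M))"
        by (rule one_step_integrable[OF k _ _ bd]) auto
      show "integrable M (\<lambda>\<omega>. indicator (?A k) \<omega> * g (?X k \<omega>) + c * indicator (?A k) \<omega>)"
        using int[of k k] k by (auto simp: emeasure_eq_measure)
      show "indicator (?A k) \<omega> * g (?X k \<omega>) + c * indicator (?A k) \<omega> \<le> indicator (?A k) \<omega> *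
          (\<integral>\<omega>'. g (fst (p k \<omega>') + ?X k \<omega> * exp (snd (p k \<omega>'))) \<partial>M)" for \<omega>
        using sub[OF k, of "?X k \<omega>"] by (auto simp: indicator_def confined_def)
    qed
    also have "\<dots> = (\<integral>\<omega>. indicator (?A k) \<omega> * g (?X (Suc k) \<omega>) \<partial>M)"
      by (rule chain_markov[OF k _ _ bd, symmetric]) auto
    \<comment> \<open>Leaving above \<open>B\<close> contributes at most 0 to the left side; leaving
      below \<open>L\<close> contributes at most 1, which \<open>?D\<close> pays.\<close>
    also have "\<dots> \<le> (\<integral>\<omega>. indicator (?A (Suc k)) \<omega> * g (?X (Suc k) \<omega>) + indicator ?D \<omega> \<partial>M)"
    proof (rule integral_mono)
      show "integrable M (\<lambda>\<omega>. indicator (?A k) \<omega> * g (?X (Suc k) \<omega>))"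
        using int[of k "Suc k"] k by simp
      show "integrable M (\<lambda>\<omega>. indicator (?A (Suc k)) \<omega> * g (?X (Suc k) \<omega>) + indicator ?D \<omega>)"
        using int[of "Suc k" "Suc k"] k D by (intro Bochner_Integration.integrable_add) (auto simp: emeasure_eq_measure simp del: chain.simps)
      show "indicator (?A k) \<omega> * g (?X (Suc k) \<omega>) \<le> indicator (?A (Suc k)) \<omega> * g (?X (Suc k) \<omega>) + indicator ?D \<omega>" for \<omega>
        unfolding confined_Suc using g1[of "?X (Suc k) \<omega>"] gB[of "?X (Suc k) \<omega>"]
        by (auto simp: indicator_def not_le simp del: chain.simps)
    qed
    also have "\<dots> = ?m (Suc k) + prob ?D"
      using int[of "Suc k" "Suc k"] k D by (simp add: emeasure_eq_measure del: chain.simps)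
    finally have 1: "?m k + c * prob (?A k) \<le> ?m (Suc k) + prob ?D" .
    have "prob (?R k) + prob ?D = prob (?R k \<union> ?D)"
      using k D Rm[of k] by (intro finite_measure_Union[symmetric]) (auto simp: confined_def simp del: chain.simps)
    also have "\<dots> \<le> prob (?R (Suc k))"
    proof (rule finite_measure_mono)
      show "?R (Suc k) \<in> sets M" using k by (intro Rm) simp
      have "?A k \<subseteq> space M" by (auto simp: confined_def)
      then show "?R k \<union> ?D \<subseteq> ?R (Suc k)" using le_SucI le_refl by blast
    qed
    finally have 2: "prob (?R k) + prob ?D \<le> prob (?R (Suc k))" .
    \<comment> \<open>The accumulated drift is weighted with the current probability of confinement,
      which decreases.\<close>
    have "real (Suc k) * c * prob (?A (Suc k)) \<le> real (Suc k) * c * prob (?A k)"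
      using mono[OF k] c by (intro mult_left_mono) auto
    also have "\<dots> = real k * c * prob (?A k) + c * prob (?A k)" by (simp add: algebra_simps)
    finally show ?case using 1 2 Suc by linarith
  qed
  from this[of K] have m: "g y + real K * c * prob (?A K) \<le> ?m K + prob (?R K)" by simp
  have mK: "?m K \<le> G * prob (?A K)"
  proof -
    have "?m K \<le> (\<integral>\<omega>. G * indicator (?A K) \<omega> \<partial>M)"
    proof (rule integral_mono)
      show "indicator (?A K) \<omega> * g (?X K \<omega>) \<le> G * indicator (?A K) \<omega>" for \<omega>
        using bd[of "?X K \<omega>"] by (auto simp: indicator_def)
    qed (use int[of K K] in \<open>auto simp: emeasure_eq_measure\<close>)
    then show ?thesis by simp
  qed
  \<comment> \<open>All other terms are bounded by \<open>G\<close> or 1, so the accumulated drift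
    forces the probability of confinement down to order \<open>1 / (K c)\<close>.\<close>
  have "G * prob (?A K) \<le> G" using G by (simp add: mult_left_le)
  then have "real K * c * prob (?A K) \<le> 2 * G + 1"
    using m mK bd[of y] prob_le_1[of "?R K"] by linarith
  then have "prob (?A K) \<le> (2 * G + 1) / (real K * c)"
    using c K by (simp add: field_simps)
  then have "G * prob (?A K) \<le> G * ((2 * G + 1) / (real K * c))" using G by (intro mult_left_mono)
  moreover have "0 \<le> real K * c * prob (?A K)" using c by simp
  ultimately show ?thesis using m mK by (simp add: field_simps)
qed

end

section \<open>A supersolution far from the ruin level\<close>

text \<open>\<open>exp (- b)\<close> is the discount factor of a step and
  \<open>exp (- b) * a\<close> its discounted payment. The means \<open>u\<close> and
  \<open>v\<close> are prescribed exactly, since the shift \<open>v / (1 - u)\<close> of the far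
  field must be common to all steps of a chain.\<close>

definition contracting_step :: "'a measure \<Rightarrow> real \<Rightarrow> real \<Rightarrow> real \<Rightarrow> real \<Rightarrow> real \<Rightarrow> ('a \<Rightarrow> real) \<Rightarrow> ('a \<Rightarrow> real) \<Rightarrow> bool" where
  "contracting_step M h c C u v a b \<longleftrightarrow>
     a \<in> borel_measurable M \<and> b \<in> borel_measurable M \<and>
     integrable M (\<lambda>\<omega>. (exp (- b \<omega>))\<^sup>2) \<and> integrable M (\<lambda>\<omega>. (exp (- b \<omega>) * a \<omega>)\<^sup>2) \<and>
     (\<integral>\<omega>. exp (- b \<omega>) \<partial>M) = u \<and> (\<integral>\<omega>. exp (- b \<omega>) * a \<omega> \<partial>M) = v \<and>
     (\<integral>\<omega>. (exp (- b \<omega>))\<^sup>2 \<partial>M) \<le> 1 - c * h \<and> (\<integral>\<omega>. (exp (- b \<omega>) * a \<omega>)\<^sup>2 \<partial>M) \<le> C * h \<and>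
     \<bar>v\<bar> \<le> C * h \<and> 1 - C * h \<le> u"

text \<open>For \<open>x + \<kappa> > 0\<close> this is Cantelli's one-sided Chebyshev bound for the
  event that a variable of mean \<open>\<kappa>\<close> and variance \<open>\<beta>\<close> is at
  most \<open>- x\<close>: the discounted sum of all payments consumes the capital
  \<open>x\<close>.\<close>

definition far_field :: "real \<Rightarrow> real \<Rightarrow> real \<Rightarrow> real" where
  "far_field \<kappa> \<beta> x = (if x + \<kappa> \<le> 0 then 1 else \<beta> / ((x + \<kappa>)\<^sup>2 + \<beta>))"

lemma far_field_measurable[measurable]: "far_field \<kappa> \<beta> \<in> borel_measurable borel"
  unfolding far_field_def by measurable

lemma far_field_bounds:
  assumes "\<beta> > 0"
  shows "0 \<le> far_field \<kappa> \<beta> x" "far_field \<kappa> \<beta> x \<le> 1"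
proof -
  have "0 < (x + \<kappa>)\<^sup>2 + \<beta>" using assms by (simp add: add_nonneg_pos)
  then show "0 \<le> far_field \<kappa> \<beta> x" "far_field \<kappa> \<beta> x \<le> 1"
    using assms by (auto simp: far_field_def)
qed

text \<open>The far field is the infimum over \<open>D \<ge> 0\<close> of these quadratics: \<open>D\<close> is the discount factor
  in units of the initial capital, so the quadratic form is the usual \<open>L\<^sup>2\<close> bound for the discounted sum.\<close>
lemma far_field_le:
  assumes \<beta>: "\<beta> > 0" and D: "D \<ge> 0"
  shows "far_field \<kappa> \<beta> z \<le> (D * (z + \<kappa>) - 1)\<^sup>2 + \<beta> * D\<^sup>2"
proof (cases "z + \<kappa> \<le> 0")
  case True
  then have "D * (z + \<kappa>) \<le> 0" using D by (simp add: mult_nonneg_nonpos)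
  then have "1 \<le> (1 - D * (z + \<kappa>))\<^sup>2" by (intro one_le_power) simp
  also have "\<dots> = (D * (z + \<kappa>) - 1)\<^sup>2" by (rule power2_commute)
  also have "\<dots> \<le> (D * (z + \<kappa>) - 1)\<^sup>2 + \<beta> * D\<^sup>2" using \<beta> by simp
  finally show ?thesis using True by (simp add: far_field_def)
next
  case False
  define w where "w = z + \<kappa>"
  have q: "0 < w\<^sup>2 + \<beta>" using \<beta> by (simp add: add_nonneg_pos)
  \<comment> \<open>Completing the square; the right side vanishes for the minimising
    \<open>D\<close>.\<close>
  have "((D * w - 1)\<^sup>2 + \<beta> * D\<^sup>2) * (w\<^sup>2 + \<beta>) - \<beta> = (D * (w\<^sup>2 + \<beta>) - w)\<^sup>2"
    by (simp add: power2_eq_square algebra_simps)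
  then have "\<beta> \<le> ((D * w - 1)\<^sup>2 + \<beta> * D\<^sup>2) * (w\<^sup>2 + \<beta>)" by (smt (verit) zero_le_power2)
  then have "\<beta> / (w\<^sup>2 + \<beta>) \<le> (D * w - 1)\<^sup>2 + \<beta> * D\<^sup>2" using q by (simp add: pos_divide_le_eq)
  then show ?thesis using False by (simp add: far_field_def w_def)
qed

text \<open>This \<open>D\<close> is the minimiser of the quadratic in \<open>far_field_le\<close>,
  so the bound is attained there; being positive, it is admissible.\<close>

lemma far_field_eq:
  assumes \<beta>: "\<beta> > 0" and z: "z + \<kappa> > 0"
  defines "D \<equiv> (z + \<kappa>) / ((z + \<kappa>)\<^sup>2 + \<beta>)"
  shows "D > 0" "far_field \<kappa> \<beta> z = (D * (z + \<kappa>) - 1)\<^sup>2 + \<beta> * D\<^sup>2"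
proof -
  define w where "w = z + \<kappa>"
  define q where "q = w\<^sup>2 + \<beta>"
  have q: "0 < q" using \<beta> by (simp add: add_nonneg_pos q_def)
  have D: "D = w / q" by (simp add: D_def w_def q_def)
  show "D > 0" using z q by (simp add: D w_def)
  have "D * w - 1 = (w\<^sup>2 - q) / q" using q by (simp add: D diff_divide_distrib power2_eq_square)
  then have "D * w - 1 = - \<beta> / q" by (simp add: q_def)
  then have "(D * w - 1)\<^sup>2 + \<beta> * D\<^sup>2 = (- \<beta> / q)\<^sup>2 + \<beta> * D\<^sup>2" by simp
  also have "\<dots> = \<beta> * (\<beta> + w\<^sup>2) / q\<^sup>2"
    by (simp add: D power_divide add_divide_distrib distrib_left power2_eq_square)
  also have "\<beta> + w\<^sup>2 = q" by (simp add: q_def)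
  also have "\<beta> * q / q\<^sup>2 = \<beta> / q" using q by (simp add: power2_eq_square)
  finally show "far_field \<kappa> \<beta> z = (D * (z + \<kappa>) - 1)\<^sup>2 + \<beta> * D\<^sup>2"
    using z by (simp add: far_field_def w_def q_def)
qed

locale contraction =
  fixes h c C u v :: real
  assumes h: "h > 0" and c: "c > 0" and C: "C \<ge> 0"
begin

text \<open>\<open>\<kappa>\<close> solves \<open>\<kappa> = v + u * \<kappa>\<close>, as the mean
  of the discounted sum of all future payments does. \<open>\<kappa>max\<close> comes from
  \<open>\<bar>v\<bar> \<le> C h\<close> and \<open>1 - u \<ge> c h / 2\<close>.
  \<open>\<beta>\<close> makes the variance of one discounted step at most
  \<open>\<beta> c h\<close>, the amount that discounting takes off \<open>\<beta>\<close>; the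
  \<open>+ 1\<close> keeps it positive.\<close>

definition "\<kappa> = v / (1 - u)"
definition "\<kappa>max = 2 * C / c"
definition "\<beta> = 2 * C * (1 + 2 * \<kappa>max\<^sup>2) / c + 1"

lemma \<beta>_pos: "\<beta> > 0"
  unfolding \<beta>_def using c C by (intro add_nonneg_pos divide_nonneg_pos mult_nonneg_nonneg) auto

context
  fixes M :: "'a measure" and a b
  assumes M: "prob_space M" and st: "contracting_step M h c C u v a b"
begin

interpretation prob_space M by (rule M)

lemma ab_measurable[measurable]: "a \<in> borel_measurable M" "b \<in> borel_measurable M"
  using st by (auto simp: contracting_step_def)

lemma exp_integrable: "integrable M (\<lambda>\<omega>. (exp (- b \<omega>))\<^sup>2)" "integrable M (\<lambda>\<omega>. (exp (- b \<omega>) * a \<omega>)\<^sup>2)"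
  "integrable M (\<lambda>\<omega>. exp (- b \<omega>))" "integrable M (\<lambda>\<omega>. exp (- b \<omega>) * a \<omega>)"
proof -
  show 1: "integrable M (\<lambda>\<omega>. (exp (- b \<omega>))\<^sup>2)" "integrable M (\<lambda>\<omega>. (exp (- b \<omega>) * a \<omega>)\<^sup>2)"
    using st by (auto simp: contracting_step_def)
  show "integrable M (\<lambda>\<omega>. exp (- b \<omega>))" "integrable M (\<lambda>\<omega>. exp (- b \<omega>) * a \<omega>)"
    by (rule square_integrable_imp_integrable; use 1 in simp)+
qed

text \<open>By Jensen \<open>u^2\<close> is at most the second moment, hence
  \<open>u^2 \<le> 1 - c h \<le> (1 - c h / 2)^2\<close>. In the quotient \<open>\<kappa>\<close>
  the factor \<open>h\<close> cancels, so its bound is uniform in the mesh.\<close>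

lemma kappa_bound: "c * h / 2 \<le> 1 - u" "\<bar>\<kappa>\<bar> \<le> \<kappa>max" "v + \<kappa> * u = \<kappa>"
proof -
  let ?e = "\<lambda>\<omega>. exp (- b \<omega>)"
  have s: "(\<integral>\<omega>. ?e \<omega> \<partial>M) = u" "(\<integral>\<omega>. (?e \<omega>)\<^sup>2 \<partial>M) \<le> 1 - c * h" "\<bar>v\<bar> \<le> C * h"
    using st by (auto simp: contracting_step_def)
  have "0 \<le> variance ?e" by (rule Bochner_Integration.integral_nonneg) simp
  also have "variance ?e = (\<integral>\<omega>. (?e \<omega>)\<^sup>2 \<partial>M) - u\<^sup>2"
    using exp_integrable s(1) by (subst variance_eq) auto
  finally have "u\<^sup>2 \<le> 1 - c * h" using s by simp
  also have "\<dots> \<le> (1 - c * h / 2)\<^sup>2"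
    using zero_le_power2[of "c * h / 2"] by (simp add: power2_diff)
  finally have "u\<^sup>2 \<le> (1 - c * h / 2)\<^sup>2" .
  moreover have "0 \<le> (\<integral>\<omega>. (?e \<omega>)\<^sup>2 \<partial>M)" by (rule Bochner_Integration.integral_nonneg) simp
  then have "0 \<le> 1 - c * h / 2" using s(2) by linarith
  ultimately show 1: "c * h / 2 \<le> 1 - u" using power2_le_imp_le[of u "1 - c * h / 2"] by simp
  have pos: "0 < c * h / 2" using h c by simp
  then have "1 - u > 0" using 1 by linarith
  have "\<bar>\<kappa>\<bar> \<le> C * h / (c * h / 2)"
    unfolding \<kappa>_def abs_divide using s(3) 1 pos C h by (intro frac_le) auto
  also have "\<dots> = \<kappa>max" using h c by (simp add: \<kappa>max_def field_simps)
  finally show "\<bar>\<kappa>\<bar> \<le> \<kappa>max" .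
  show "v + \<kappa> * u = \<kappa>" using \<open>1 - u > 0\<close> by (simp add: \<kappa>_def field_simps)
qed

text \<open>Let \<open>D\<close> be optimal at \<open>x\<close> and use \<open>D * exp (- b)\<close>
  as competitor at the next position. With \<open>T = exp (- b) * (a + \<kappa>)\<close>, of mean
  \<open>\<kappa>\<close>, the expression to be squared becomes
  \<open>(D * (x + \<kappa>) - 1) + D * (T - \<kappa>)\<close>. Its square gains \<open>D^2\<close>
  times the variance of \<open>T\<close>, which the loss \<open>\<beta> D^2 c h\<close> from
  discounting outweighs.\<close>

lemma far_field_super: "(\<integral>\<omega>. far_field \<kappa> \<beta> (a \<omega> + x * exp (b \<omega>)) \<partial>M) \<le> far_field \<kappa> \<beta> x"
proof (cases "x + \<kappa> \<le> 0")
  case True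
  have "(\<integral>\<omega>. far_field \<kappa> \<beta> (a \<omega> + x * exp (b \<omega>)) \<partial>M) \<le> (\<integral>\<omega>. 1 \<partial>M)"
    using far_field_bounds[OF \<beta>_pos] by (intro integral_mono integrable_const_bound[where B=1]) auto
  also have "\<dots> = far_field \<kappa> \<beta> x" using True by (simp add: far_field_def prob_space)
  finally show ?thesis .
next
  case False
  define D where "D = (x + \<kappa>) / ((x + \<kappa>)\<^sup>2 + \<beta>)"
  have D: "D > 0" "far_field \<kappa> \<beta> x = (D * (x + \<kappa>) - 1)\<^sup>2 + \<beta> * D\<^sup>2"
    using far_field_eq[OF \<beta>_pos, of x \<kappa>] False unfolding D_def by auto
  let ?e = "\<lambda>\<omega>. exp (- b \<omega>)"
  define T where "T \<omega> = ?e \<omega> * a \<omega> + \<kappa> * ?e \<omega>" for \<omega>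
  have s: "(\<integral>\<omega>. ?e \<omega> \<partial>M) = u" "(\<integral>\<omega>. (?e \<omega>)\<^sup>2 \<partial>M) \<le> 1 - c * h" "(\<integral>\<omega>. ?e \<omega> * a \<omega> \<partial>M) = v"
    "(\<integral>\<omega>. (?e \<omega> * a \<omega>)\<^sup>2 \<partial>M) \<le> C * h" "1 - C * h \<le> u"
    using st by (auto simp: contracting_step_def)
  have iT: "integrable M T" unfolding T_def using exp_integrable by auto
  have [measurable]: "T \<in> borel_measurable M" using iT by simp
  have ET: "(\<integral>\<omega>. T \<omega> \<partial>M) = \<kappa>" unfolding T_def using exp_integrable s kappa_bound by simp
  \<comment> \<open>\<open>T - \<kappa>\<close> is split into \<open>exp (- b) * a\<close> and
    \<open>\<kappa> * (exp (- b) - 1)\<close>; both have second moments of order \<open>h\<close>,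
    the latter by \<open>(1 - c h) - 2 u + 1 \<le> 2 C h\<close>.\<close>
  define Z where "Z \<omega> = 2 * (?e \<omega> * a \<omega>)\<^sup>2 + 2 * \<kappa>\<^sup>2 * ((?e \<omega>)\<^sup>2 - 2 * ?e \<omega> + 1)" for \<omega>
  have iZ: "integrable M Z" unfolding Z_def using exp_integrable by auto
  have TZ: "(T \<omega> - \<kappa>)\<^sup>2 \<le> Z \<omega>" for \<omega>
  proof -
    have "T \<omega> - \<kappa> = ?e \<omega> * a \<omega> + \<kappa> * (?e \<omega> - 1)" by (simp add: T_def algebra_simps)
    moreover have "(p + q)\<^sup>2 \<le> 2 * p\<^sup>2 + 2 * q\<^sup>2" for p q :: real
      using zero_le_power2[of "p - q"] by (simp add: power2_eq_square algebra_simps)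
    ultimately have "(T \<omega> - \<kappa>)\<^sup>2 \<le> 2 * (?e \<omega> * a \<omega>)\<^sup>2 + 2 * (\<kappa> * (?e \<omega> - 1))\<^sup>2" by metis
    also have "\<dots> = Z \<omega>" by (simp add: Z_def power2_eq_square algebra_simps)
    finally show ?thesis .
  qed
  have iV: "integrable M (\<lambda>\<omega>. (T \<omega> - \<kappa>)\<^sup>2)"
    by (rule Bochner_Integration.integrable_bound[OF iZ]) (use TZ in \<open>auto intro!: AE_I2 intro: order_trans[OF TZ]\<close>)
  have VT: "(\<integral>\<omega>. (T \<omega> - \<kappa>)\<^sup>2 \<partial>M) \<le> \<beta> * (c * h)"
  proof -
    have "(\<integral>\<omega>. (T \<omega> - \<kappa>)\<^sup>2 \<partial>M) \<le> (\<integral>\<omega>. Z \<omega> \<partial>M)" by (rule integral_mono[OF iV iZ TZ])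
    also have "\<dots> = 2 * (\<integral>\<omega>. (?e \<omega> * a \<omega>)\<^sup>2 \<partial>M) + 2 * \<kappa>\<^sup>2 * ((\<integral>\<omega>. (?e \<omega>)\<^sup>2 \<partial>M) - 2 * u + 1)"
      unfolding Z_def using exp_integrable s(1) by (simp add: prob_space)
    also have "\<dots> \<le> 2 * (C * h) + 2 * \<kappa>\<^sup>2 * (2 * (C * h))"
    proof -
      have "(\<integral>\<omega>. (?e \<omega>)\<^sup>2 \<partial>M) - 2 * u + 1 \<le> 2 * (C * h)"
        using s(2,5) mult_pos_pos[OF c h] by linarith
      then show ?thesis using s(4) by (intro add_mono mult_left_mono) auto
    qed
    also have "\<dots> \<le> 2 * (C * h) + 2 * \<kappa>max\<^sup>2 * (2 * (C * h))"
    proof -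
      have "\<kappa>\<^sup>2 \<le> \<kappa>max\<^sup>2" using kappa_bound(2) by (metis abs_ge_zero power2_abs power_mono)
      then show ?thesis using C h by (intro add_mono mult_right_mono) auto
    qed
    also have "\<dots> = (\<beta> - 1) * (c * h)" using c by (simp add: \<beta>_def field_simps)
    also have "\<dots> \<le> \<beta> * (c * h)" using c h by (intro mult_right_mono) auto
    finally show ?thesis .
  qed
  \<comment> \<open>The quadratic of \<open>far_field_le\<close> at the competitor; its term linear
    in \<open>T - \<kappa>\<close> has mean 0.\<close>
  define Q where "Q \<omega> = (D * (x + \<kappa>) - 1)\<^sup>2 + 2 * D * (D * (x + \<kappa>) - 1) * (T \<omega> - \<kappa>) + D\<^sup>2 * (T \<omega> - \<kappa>)\<^sup>2 + \<beta> * D\<^sup>2 * (?e \<omega>)\<^sup>2" for \<omega>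
  have iQ: "integrable M Q"
    unfolding Q_def using iT iV exp_integrable by auto
  have "(\<integral>\<omega>. far_field \<kappa> \<beta> (a \<omega> + x * exp (b \<omega>)) \<partial>M) \<le> (\<integral>\<omega>. Q \<omega> \<partial>M)"
  proof (rule integral_mono[OF _ iQ])
    show "integrable M (\<lambda>\<omega>. far_field \<kappa> \<beta> (a \<omega> + x * exp (b \<omega>)))"
      using far_field_bounds[OF \<beta>_pos] by (intro integrable_const_bound[where B=1]) auto
    fix \<omega>
    have ee: "?e \<omega> * exp (b \<omega>) = 1" by (simp add: exp_minus)
    have "(D * ?e \<omega>) * ((a \<omega> + x * exp (b \<omega>)) + \<kappa>) - 1 = D * T \<omega> + D * x * (?e \<omega> * exp (b \<omega>)) - 1"
      by (simp add: T_def algebra_simps)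
    also have "\<dots> = (D * (x + \<kappa>) - 1) + D * (T \<omega> - \<kappa>)" unfolding ee by (simp add: algebra_simps)
    finally have "((D * ?e \<omega>) * ((a \<omega> + x * exp (b \<omega>)) + \<kappa>) - 1)\<^sup>2 + \<beta> * (D * ?e \<omega>)\<^sup>2 = Q \<omega>"
      by (simp only:) (simp add: Q_def power2_eq_square algebra_simps)
    then show "far_field \<kappa> \<beta> (a \<omega> + x * exp (b \<omega>)) \<le> Q \<omega>"
      using far_field_le[OF \<beta>_pos, of "D * ?e \<omega>" \<kappa> "a \<omega> + x * exp (b \<omega>)"] D(1) by simp
  qed
  also have "\<dots> = (D * (x + \<kappa>) - 1)\<^sup>2 + D\<^sup>2 * (\<integral>\<omega>. (T \<omega> - \<kappa>)\<^sup>2 \<partial>M) + \<beta> * D\<^sup>2 * (\<integral>\<omega>. (?e \<omega>)\<^sup>2 \<partial>M)"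
    unfolding Q_def using iT iV exp_integrable ET by (simp add: prob_space)
  also have "\<dots> \<le> (D * (x + \<kappa>) - 1)\<^sup>2 + D\<^sup>2 * (\<beta> * (c * h)) + \<beta> * D\<^sup>2 * (1 - c * h)"
    using VT s(2) \<beta>_pos by (intro add_mono mult_left_mono) auto
  also have "\<dots> = far_field \<kappa> \<beta> x" unfolding D(2) by (simp add: algebra_simps)
  finally show ?thesis .
qed

end

text \<open>The shift by \<open>\<kappa>\<close> can leave the far field below 1 at a negative
  \<open>x\<close>. Then \<open>0 < x + \<kappa> \<le> \<kappa>max\<close>, and the factor
  compensates the worst case.\<close>

lemma far_field_negative:
  assumes \<kappa>: "\<bar>\<kappa>\<bar> \<le> \<kappa>max" and x: "x < 0"
  shows "1 \<le> (\<kappa>max\<^sup>2 + \<beta>) / \<beta> * far_field \<kappa> \<beta> x"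
proof (cases "x + \<kappa> \<le> 0")
  case True
  then show ?thesis using \<beta>_pos by (simp add: far_field_def)
next
  case False
  then have "(x + \<kappa>)\<^sup>2 \<le> \<kappa>max\<^sup>2" using \<kappa> x by (intro power_mono) auto
  moreover have "0 < (x + \<kappa>)\<^sup>2 + \<beta>" using \<beta>_pos by (simp add: add_nonneg_pos)
  ultimately show ?thesis using False \<beta>_pos by (simp add: far_field_def)
qed

lemma far_field_decay:
  assumes \<kappa>: "\<bar>\<kappa>\<bar> \<le> \<kappa>max" and x: "\<kappa>max < B" "B \<le> x"
  shows "(\<kappa>max\<^sup>2 + \<beta>) / \<beta> * far_field \<kappa> \<beta> x \<le> (\<kappa>max\<^sup>2 + \<beta>) / (B - \<kappa>max)\<^sup>2"
proof -
  have p: "x + \<kappa> > 0" using \<kappa> x by auto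
  have "(B - \<kappa>max)\<^sup>2 \<le> (x + \<kappa>)\<^sup>2" using \<kappa> x by (intro power_mono) auto
  also have "\<dots> \<le> (x + \<kappa>)\<^sup>2 + \<beta>" using \<beta>_pos by simp
  finally have "(\<kappa>max\<^sup>2 + \<beta>) / ((x + \<kappa>)\<^sup>2 + \<beta>) \<le> (\<kappa>max\<^sup>2 + \<beta>) / (B - \<kappa>max)\<^sup>2"
    using \<beta>_pos x by (intro divide_left_mono mult_pos_pos add_nonneg_pos) auto
  then show ?thesis using p \<beta>_pos by (simp add: far_field_def)
qed

end

section \<open>The scale function\<close>

locale scale_function =
  fixes mx mr sx sr :: real
  assumes sx: "sx > 0" and sr: "sr > 0"
begin

abbreviation vol2 :: "real \<Rightarrow> real" where "vol2 z \<equiv> sx\<^sup>2 + sr\<^sup>2 * z\<^sup>2"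

text \<open>The scale density \<open>exp (- \<integral> 2 * drift / vol2)\<close> of the diffusion:
  the linear part of the drift gives the power of \<open>vol2\<close>, the constant
  \<open>mx\<close> gives the arctangent. At \<open>- z\<close> it is the integrand of
  \<open>H_fun\<close>.\<close>

definition scale_density :: "real \<Rightarrow> real" where
  "scale_density z = vol2 z powr (- (1/2 + mr / sr\<^sup>2)) * exp (- (2 * mx / (sx * sr) * arctan (sr / sx * z)))"

definition scale_density' :: "real \<Rightarrow> real" where
  "scale_density' z = scale_density z * (- ((sr\<^sup>2 + 2 * mr) * z + 2 * mx) / vol2 z)"

lemma vol2_pos: "vol2 z > 0"
  using sx by (intro add_pos_nonneg) auto

lemma scale_density_pos: "scale_density z > 0"
  unfolding scale_density_def using vol2_pos[of z] by simp

lemma scale_density_deriv: "(scale_density has_real_derivative scale_density' z) (at z)"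
proof -
  let ?e = "- (1/2 + mr / sr\<^sup>2)" and ?E = "\<lambda>z. exp (- (2 * mx / (sx * sr) * arctan (sr / sx * z)))"
  have 1: "((\<lambda>z. vol2 z powr ?e) has_real_derivative ?e * vol2 z powr (?e - 1) * (2 * sr\<^sup>2 * z)) (at z)"
  proof -
    have "(vol2 has_real_derivative 2 * sr\<^sup>2 * z) (at z)"
      by (auto intro!: derivative_eq_intros)
    from DERIV_fun_powr[OF this vol2_pos, of ?e] show ?thesis by simp
  qed
  have v: "(sr / sx * z)\<^sup>2 + 1 = vol2 z / sx\<^sup>2" using sx by (simp add: field_simps power2_eq_square)
  have p: "0 < (sr / sx * z)\<^sup>2 + 1" by (simp add: add_nonneg_pos)
  have 2: "((\<lambda>z. ?E z) has_real_derivative ?E z * (- (2 * mx / vol2 z))) (at z)"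
  proof -
    have "((\<lambda>z. ?E z) has_real_derivative ?E z * (- (2 * mx / (sx * sr) * (inverse (1 + (sr / sx * z)\<^sup>2) * (sr / sx))))) (at z)"
      by (rule derivative_eq_intros DERIV_arctan refl | simp)+
    also have "2 * mx / (sx * sr) * (inverse (1 + (sr / sx * z)\<^sup>2) * (sr / sx)) = 2 * mx / vol2 z"
      using v sx sr vol2_pos[of z] by (simp add: add.commute power2_eq_square divide_simps)
    finally show ?thesis .
  qed
  have "(scale_density has_real_derivative
      ?e * vol2 z powr (?e - 1) * (2 * sr\<^sup>2 * z) * ?E z + vol2 z powr ?e * (?E z * (- (2 * mx / vol2 z)))) (at z)"
    unfolding scale_density_def[abs_def] using DERIV_mult[OF 1 2] by (simp add: algebra_simps)
  also have "?e * vol2 z powr (?e - 1) * (2 * sr\<^sup>2 * z) * ?E z + vol2 z powr ?e * (?E z * (- (2 * mx / vol2 z))) = scale_density' z"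
  proof -
    have d: "vol2 z powr (?e - 1) = vol2 z powr ?e / vol2 z"
      unfolding powr_diff[of _ ?e 1] using vol2_pos[of z] by simp
    have e: "?e * (2 * sr\<^sup>2 * z) = - (sr\<^sup>2 + 2 * mr) * z" using sr by (simp add: field_simps)
    have "?e * vol2 z powr (?e - 1) * (2 * sr\<^sup>2 * z) * ?E z = (?e * (2 * sr\<^sup>2 * z)) * (vol2 z powr ?e * ?E z / vol2 z)"
      unfolding d by simp
    then show ?thesis unfolding e scale_density'_def scale_density_def
      by (simp add: add_divide_distrib diff_divide_distrib algebra_simps)
  qed
  finally show ?thesis .
qed

lemma scale_density_cont: "isCont scale_density z" "continuous_on S scale_density" "continuous_on S scale_density'"
proof -
  show 1: "isCont scale_density z" for z using scale_density_deriv DERIV_isCont by blast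
  then show 2: "continuous_on S scale_density" for S by (simp add: continuous_at_imp_continuous_on)
  show "continuous_on S scale_density'"
    unfolding scale_density'_def[abs_def] using vol2_pos by (intro continuous_intros 2) (simp add: less_imp_neq[symmetric])
qed

lemma generator_scale: "generator mx mr sx sr scale_density scale_density' x = 0"
  unfolding generator_def scale_density'_def using vol2_pos[of x] by (simp add: field_simps)

text \<open>The normalisation makes \<open>T - scale y\<close> and \<open>T\<close> the tails of the
  density beyond \<open>y\<close> and beyond 0 when \<open>scale\<close> tends to
  \<open>T\<close>.\<close>

definition scale :: "real \<Rightarrow> real" where
  "scale = (SOME S. S 0 = 0 \<and> (\<forall>x. (S has_real_derivative scale_density x) (at x)))"

lemma scale_0: "scale 0 = 0" and scale_deriv: "(scale has_real_derivative scale_density x) (at x)"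
proof -
  obtain F where F: "\<And>x. (F has_vector_derivative scale_density x) (at x)"
    using einterval_antiderivative[of "-\<infinity>" \<infinity> scale_density] scale_density_cont(1) by auto
  have "\<exists>S. S 0 = 0 \<and> (\<forall>x. (S has_real_derivative scale_density x) (at x))"
    using F by (intro exI[of _ "\<lambda>x. F x - F 0"])
      (auto simp: has_real_derivative_iff_has_vector_derivative intro!: derivative_eq_intros)
  then have "scale 0 = 0 \<and> (\<forall>x. (scale has_real_derivative scale_density x) (at x))"
    unfolding scale_def by (rule someI_ex)
  then show "scale 0 = 0" "(scale has_real_derivative scale_density x) (at x)" by auto
qed

lemma scale_less: "x < y \<Longrightarrow> scale x < scale y"
  by (rule DERIV_pos_imp_increasing) (use scale_deriv scale_density_pos in blast)+

lemma scale_le: "x \<le> y \<Longrightarrow> scale x \<le> scale y"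
  using scale_less by (cases "x = y") (auto simp: less_imp_le)

lemma scale_cont: "isCont scale x" "continuous_on S scale"
proof -
  show "isCont scale x" for x using scale_deriv by (rule DERIV_isCont)
  then show "continuous_on S scale" by (simp add: continuous_at_imp_continuous_on)
qed

lemma arctan_factor_bounds:
  "exp (- (\<bar>2 * mx / (sx * sr)\<bar> * pi)) \<le> exp (- (2 * mx / (sx * sr) * arctan t))"
  "exp (- (2 * mx / (sx * sr) * arctan t)) \<le> exp (\<bar>2 * mx / (sx * sr)\<bar> * pi)"
proof -
  have "\<bar>arctan t\<bar> \<le> pi" using arctan_bounded[of t] pi_gt_zero by linarith
  then have "\<bar>2 * mx / (sx * sr)\<bar> * \<bar>arctan t\<bar> \<le> \<bar>2 * mx / (sx * sr)\<bar> * pi"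
    by (rule mult_left_mono) simp
  then have "\<bar>2 * mx / (sx * sr) * arctan t\<bar> \<le> \<bar>2 * mx / (sx * sr)\<bar> * pi" by (simp add: abs_mult)
  then show "exp (- (\<bar>2 * mx / (sx * sr)\<bar> * pi)) \<le> exp (- (2 * mx / (sx * sr) * arctan t))"
  "exp (- (2 * mx / (sx * sr) * arctan t)) \<le> exp (\<bar>2 * mx / (sx * sr)\<bar> * pi)"
    unfolding exp_le_cancel_iff by linarith+
qed

text \<open>For \<open>mr \<le> 0\<close> the exponent of \<open>vol2\<close> is at least
  \<open>- 1/2\<close>, so the density decays no faster than \<open>1 / z\<close> and its integral
  grows at least like a logarithm.\<close>

lemma scale_unbounded:
  assumes "mr \<le> 0"
  shows "filterlim scale at_top at_top"
proof -
  define k where "k = (sx\<^sup>2) powr (- (mr / sr\<^sup>2)) * exp (- (\<bar>2 * mx / (sx * sr)\<bar> * pi))"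
  have k: "k > 0" using sx by (simp add: k_def)
  have lower: "k / (sx + sr * z) \<le> scale_density z" if z: "z \<ge> 0" for z
  proof -
    have "sqrt (vol2 z) \<le> sx + sr * z"
    proof (rule real_le_lsqrt)
      have "(sx + sr * z)\<^sup>2 = vol2 z + 2 * sx * sr * z" by (simp add: power2_eq_square algebra_simps)
      then show "vol2 z \<le> (sx + sr * z)\<^sup>2" using sx sr z by simp
    qed (use sx sr z in simp)
    moreover have "vol2 z powr (- 1/2) = 1 / sqrt (vol2 z)"
    proof -
      have "vol2 z powr (- 1/2) = inverse (vol2 z powr (1/2))"
        using powr_minus[of "vol2 z" "1/2"] by (simp only: minus_divide_left)
      also have "vol2 z powr (1/2) = sqrt (vol2 z)" by (rule powr_half_sqrt[OF less_imp_le[OF vol2_pos]])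
      finally show ?thesis by (simp only: inverse_eq_divide)
    qed
    ultimately have a: "1 / (sx + sr * z) \<le> vol2 z powr (- 1/2)"
      using sx sr z vol2_pos[of z] by (simp add: frac_le)
    have b: "(sx\<^sup>2) powr (- (mr / sr\<^sup>2)) \<le> vol2 z powr (- (mr / sr\<^sup>2))"
      using assms sx by (intro powr_mono2) (auto simp: divide_nonpos_nonneg)
    have "k / (sx + sr * z) = ((sx\<^sup>2) powr (- (mr / sr\<^sup>2)) * (1 / (sx + sr * z))) * exp (- (\<bar>2 * mx / (sx * sr)\<bar> * pi))"
      by (simp add: k_def)
    also have "\<dots> \<le> (vol2 z powr (- (mr / sr\<^sup>2)) * vol2 z powr (- 1/2)) * exp (- (2 * mx / (sx * sr) * arctan (sr / sx * z)))"
      using a b arctan_factor_bounds(1) sx sr z by (intro mult_mono) auto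
    also have "\<dots> = scale_density z"
    proof -
      have eq: "- (mr / sr\<^sup>2) + - 1 / 2 = - (1 / 2 + mr / sr\<^sup>2)" by simp
      show ?thesis unfolding scale_density_def powr_add[symmetric] eq ..
    qed
    finally show ?thesis .
  qed
  have lb: "k / sr * (ln (sx + sr * x) - ln sx) \<le> scale x" if x: "x \<ge> 0" for x
  proof -
    have "scale 0 - k / sr * (ln (sx + sr * 0) - ln sx) \<le> scale x - k / sr * (ln (sx + sr * x) - ln sx)"
    proof (rule DERIV_nonneg_imp_nondecreasing[OF x])
      fix z assume z: "0 \<le> z" "z \<le> x"
      have "sx + sr * z > 0" using sx sr z by (simp add: add_pos_nonneg)
      then have "((\<lambda>x. scale x - k / sr * (ln (sx + sr * x) - ln sx)) has_real_derivative scale_density z - k / (sx + sr * z)) (at z)"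
      proof -
        have "((\<lambda>x. ln (sx + sr * x)) has_real_derivative sr / (sx + sr * z)) (at z)"
          using \<open>sx + sr * z > 0\<close> by (auto intro!: derivative_eq_intros)
        from DERIV_diff[OF scale_deriv DERIV_cmult[OF DERIV_diff[OF this DERIV_const], of "k / sr"]]
        show ?thesis using sr by simp
      qed
      then show "\<exists>d. ((\<lambda>x. scale x - k / sr * (ln (sx + sr * x) - ln sx)) has_real_derivative d) (at z) \<and> 0 \<le> d"
        using lower[OF z(1)] by auto
    qed
    then show ?thesis by (simp add: scale_0)
  qed
  have ev: "eventually (\<lambda>x. k / sr * (ln (sx + sr * x) - ln sx) \<le> scale x) at_top"
    using eventually_ge_at_top[of 0] by (rule eventually_mono) (rule lb)
  have "filterlim (\<lambda>x. k / sr * (ln (sx + sr * x) - ln sx)) at_top at_top"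
  proof (rule filterlim_tendsto_pos_mult_at_top[OF tendsto_const])
    show "0 < k / sr" using k sr by simp
    have "filterlim (\<lambda>x. sx + sr * x) at_top at_top"
      using sr by (intro filterlim_tendsto_add_at_top[OF tendsto_const] filterlim_tendsto_pos_mult_at_top[OF tendsto_const _ filterlim_ident])
    then have "filterlim (\<lambda>x. - ln sx + ln (sx + sr * x)) at_top at_top"
      using filterlim_compose[OF ln_at_top] by (intro filterlim_tendsto_add_at_top[OF tendsto_const]) blast
    then show "filterlim (\<lambda>x. ln (sx + sr * x) - ln sx) at_top at_top" by simp
  qed
  then show ?thesis by (rule filterlim_at_top_mono[OF _ ev])
qed

text \<open>The density is at most of order \<open>z^(-1-q)\<close> with
  \<open>q = 2 mr / sr^2 > 0\<close>, hence integrable at infinity; strict monotonicity keeps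
  \<open>scale\<close> below its limit.\<close>

lemma scale_convergent:
  assumes mr: "mr > 0"
  obtains T where "(scale \<longlongrightarrow> T) at_top" "\<And>x. scale x < T"
proof -
  define q where "q = 2 * mr / sr\<^sup>2"
  have q: "q > 0" using mr sr by (simp add: q_def)
  define k where "k = (sr\<^sup>2) powr (- (1/2 + mr / sr\<^sup>2)) * exp (\<bar>2 * mx / (sx * sr)\<bar> * pi)"
  have k: "k > 0" using sr by (simp add: k_def)
  have upper: "scale_density z \<le> k * z powr (- 1 - q)" if z: "z > 0" for z
  proof -
    let ?e = "- (1/2 + mr / sr\<^sup>2)"
    have "0 < mr / sr\<^sup>2" using mr sr by simp
    then have e: "?e \<le> 0" by linarith
    have "vol2 z powr ?e \<le> (sr\<^sup>2 * z\<^sup>2) powr ?e"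
      using z sr sx e by (intro powr_mono2') auto
    also have "\<dots> = (sr\<^sup>2) powr ?e * (z powr 2) powr ?e" using z sr by (simp add: powr_mult powr_numeral)
    also have "(z powr 2) powr ?e = z powr (- 1 - q)" unfolding powr_powr q_def by (simp add: algebra_simps)
    finally have "scale_density z \<le> ((sr\<^sup>2) powr ?e * z powr (- 1 - q)) * exp (\<bar>2 * mx / (sx * sr)\<bar> * pi)"
      unfolding scale_density_def by (intro mult_mono arctan_factor_bounds(2)) auto
    then show ?thesis by (simp add: k_def mult_ac)
  qed
  have bd: "scale x \<le> scale 1 + k / q" if x: "x \<ge> 1" for x
  proof -
    have "- (k / q) * 1 powr (- q) - scale 1 \<le> - (k / q) * x powr (- q) - scale x"
    proof (rule DERIV_nonneg_imp_nondecreasing[OF x])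
      fix z assume z: "1 \<le> z" "z \<le> x"
      have "((\<lambda>x. - (k / q) * x powr (- q) - scale x) has_real_derivative k * z powr (- 1 - q) - scale_density z) (at z)"
      proof -
        have "((\<lambda>x. x powr (- q)) has_real_derivative (- q) * z powr (- q - 1)) (at z)"
          using z by (intro has_real_derivative_powr) auto
        moreover have "- q - 1 = - 1 - q" by simp
        ultimately have "((\<lambda>x. x powr (- q)) has_real_derivative (- q) * z powr (- 1 - q)) (at z)" by metis
        from DERIV_diff[OF DERIV_cmult[OF this, of "- (k / q)"] scale_deriv] show ?thesis using q by simp
      qed
      then show "\<exists>d. ((\<lambda>x. - (k / q) * x powr (- q) - scale x) has_real_derivative d) (at z) \<and> 0 \<le> d"
        using upper[of z] z by auto
    qed
    moreover have "0 \<le> k / q * x powr (- q)" using k q by simp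
    ultimately show ?thesis by simp
  qed
  define T where "T = (SUP x. scale x)"
  have bdd: "bdd_above (range scale)"
    by (intro bdd_aboveI2[of _ _ "scale 1 + k / q"]) (metis bd k q scale_le divide_pos_pos less_eq_real_def linear add_increasing2 order_trans)
  have lim: "(scale \<longlongrightarrow> T) at_top"
  proof (rule increasing_tendsto)
    show "\<forall>\<^sub>F x in at_top. scale x \<le> T"
      unfolding T_def using bdd by (auto intro!: always_eventually cSUP_upper)
    fix y assume "y < T"
    then obtain x0 where "y < scale x0" unfolding T_def using less_cSUP_iff[OF _ bdd, of y] by auto
    show "\<forall>\<^sub>F x in at_top. y < scale x"
      using eventually_ge_at_top[of x0]
    proof eventually_elim
      case (elim x)
      then show ?case using scale_le[of x0 x] \<open>y < scale x0\<close> by linarith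
    qed
  qed
  have "scale x < T" for x
    using scale_less[of x "x + 1"] cSUP_upper[OF _ bdd, of "x + 1"] unfolding T_def by simp
  with lim show ?thesis by (rule that)
qed

text \<open>Reflection at 0 carries the integral over \<open>{.. - y}\<close> to the integral of the
  scale density over \<open>{y..}\<close>.\<close>

lemma H_fun_eq:
  assumes lim: "(scale \<longlongrightarrow> T) at_top" and T: "\<And>x. scale x < T"
  shows "H_fun mx mr sx sr (- y) = T - scale y"
proof -
  have [measurable]: "scale_density \<in> borel_measurable borel"
    by (rule borel_measurable_continuous_onI) (rule scale_density_cont)
  have "H_fun mx mr sx sr (- y) = (\<integral>z. indicator {.. - y} z * scale_density (- z) \<partial>lborel)"
    unfolding H_fun_def set_lebesgue_integral_def scale_density_def
    by (intro Bochner_Integration.integral_cong refl) (simp add: arctan_minus)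
  also have "\<dots> = (\<integral>z. indicator {.. - y} (0 + (-1) * z) * scale_density (- (0 + (-1) * z)) \<partial>lborel)"
    by (subst lborel_integral_real_affine[where c="-1" and t=0]) auto
  also have "\<dots> = (\<integral>z. scale_density z * indicator {y..} z \<partial>lborel)"
    by (intro Bochner_Integration.integral_cong refl) (auto simp: indicator_def)
  also have "\<dots> = enn2real (\<integral>\<^sup>+z. ennreal (scale_density z * indicator {y..} z) \<partial>lborel)"
    by (rule integral_eq_nn_integral) (auto intro!: AE_I2 simp: less_imp_le[OF scale_density_pos])
  also have "(\<integral>\<^sup>+z. ennreal (scale_density z * indicator {y..} z) \<partial>lborel) = (\<integral>\<^sup>+z. ennreal (scale_density z) * indicator {y..} z \<partial>lborel)"
    by (intro nn_integral_cong) (auto simp: indicator_def)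
  also have "\<dots> = T - scale y"
    by (rule nn_integral_FTC_atLeast) (auto intro!: lim scale_deriv less_imp_le scale_density_pos)
  also have "enn2real (ennreal (T - scale y)) = T - scale y" using T[of y] by simp
  finally show ?thesis .
qed

text \<open>The generator of \<open>exp (l x)\<close> is
  \<open>l exp (l x) (drift + l vol2 / 2)\<close>. On a bounded interval the drift is at least
  \<open>- K\<close>, and \<open>l\<close> is chosen with \<open>l sx^2 / 2 = K + 1\<close>; that is
  possible because \<open>sx\<close> does not vanish.\<close>

lemma exp_supersolution:
  obtains l m where "l > 0" "m > 0"
    "\<And>x. x \<in> {L..B} \<Longrightarrow> m \<le> generator mx mr sx sr (\<lambda>x. l * exp (l * x)) (\<lambda>x. l\<^sup>2 * exp (l * x)) x"
proof -
  define X where "X = max \<bar>L\<bar> \<bar>B\<bar>"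
  define K where "K = \<bar>mx\<bar> + X * \<bar>mr + sr\<^sup>2 / 2\<bar>"
  have X: "X \<ge> 0" "\<And>x. x \<in> {L..B} \<Longrightarrow> \<bar>x\<bar> \<le> X" by (auto simp: X_def)
  have K: "K \<ge> 0" using X by (simp add: K_def)
  define l where "l = 2 * (K + 1) / sx\<^sup>2"
  have l: "l > 0" using K sx by (simp add: l_def)
  show ?thesis
  proof (rule that[of l "l * exp (- (l * X))"])
    fix x assume x: "x \<in> {L..B}"
    have "\<bar>x * (mr + sr\<^sup>2 / 2)\<bar> \<le> X * \<bar>mr + sr\<^sup>2 / 2\<bar>"
      unfolding abs_mult using X(2)[OF x] by (rule mult_right_mono) simp
    then have 1: "- K \<le> mx + x * (mr + sr\<^sup>2 / 2)" unfolding K_def by linarith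
    have 2: "K + 1 \<le> l * vol2 x / 2"
    proof -
      have "K + 1 = l * sx\<^sup>2 / 2" using sx by (simp add: l_def)
      also have "\<dots> \<le> l * vol2 x / 2" using l by (intro divide_right_mono mult_left_mono) auto
      finally show ?thesis .
    qed
    have "- (l * X) \<le> l * x" using X(2)[OF x] l mult_left_mono[of "-X" x l] by auto
    then have "l * exp (- (l * X)) * 1 \<le> l * exp (l * x) * (mx + x * (mr + sr\<^sup>2 / 2) + l * vol2 x / 2)"
      using 1 2 l by (intro mult_mono) auto
    also have "\<dots> = generator mx mr sx sr (\<lambda>x. l * exp (l * x)) (\<lambda>x. l\<^sup>2 * exp (l * x)) x"
      unfolding generator_def by (simp add: power2_eq_square algebra_simps)
    finally show "l * exp (- (l * X)) \<le> generator mx mr sx sr (\<lambda>x. l * exp (l * x)) (\<lambda>x. l\<^sup>2 * exp (l * x)) x" by simp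
  qed (use l in auto)
qed

end

section \<open>Ruin bounds from the scale function\<close>

text \<open>Freezing a test function outside an interval bounds it and leaves it unchanged inside,
  as \<open>diffusive_step_generator\<close> requires.\<close>

definition clip :: "real \<Rightarrow> real \<Rightarrow> real \<Rightarrow> real" where
  "clip l u x = max l (min u x)"

lemma clip_measurable[measurable]: "clip l u \<in> borel_measurable borel"
  unfolding clip_def by measurable

lemma clip_in: "l \<le> u \<Longrightarrow> clip l u x \<in> {l..u}"
  by (auto simp: clip_def)

lemma clip_eq: "x \<in> {l..u} \<Longrightarrow> clip l u x = x"
  by (auto simp: clip_def)

context scale_function
begin

text \<open>Perturbing the scale function by the exponential makes the one-step drift strict,
  with room to absorb the discretisation error.\<close>
definition perturbed :: "real \<Rightarrow> real \<Rightarrow> real \<Rightarrow> real \<Rightarrow> real \<Rightarrow> real" where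
  "perturbed A N e l x = (A - scale x + e * exp (l * x)) / N"

lemma perturbed_deriv:
  "(perturbed A N e l has_real_derivative (e * (l * exp (l * x)) - scale_density x) / N) (at x)"
  unfolding perturbed_def[abs_def]
  by (rule DERIV_cdivide) (rule derivative_eq_intros scale_deriv refl | simp)+

lemma perturbed_deriv2:
  "((\<lambda>x. (e * (l * exp (l * x)) - scale_density x) / N) has_real_derivative
     (e * (l\<^sup>2 * exp (l * x)) - scale_density' x) / N) (at x)"
  by (rule DERIV_cdivide) (rule derivative_eq_intros scale_density_deriv refl | simp add: power2_eq_square)+

lemma perturbed_generator:
  "generator mx mr sx sr (\<lambda>x. (e * (l * exp (l * x)) - scale_density x) / N)
     (\<lambda>x. (e * (l\<^sup>2 * exp (l * x)) - scale_density' x) / N) x =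
   e * generator mx mr sx sr (\<lambda>x. l * exp (l * x)) (\<lambda>x. l\<^sup>2 * exp (l * x)) x / N"
proof -
  have "generator mx mr sx sr (\<lambda>x. (e * (l * exp (l * x)) - scale_density x) / N)
     (\<lambda>x. (e * (l\<^sup>2 * exp (l * x)) - scale_density' x) / N) x =
   (e * generator mx mr sx sr (\<lambda>x. l * exp (l * x)) (\<lambda>x. l\<^sup>2 * exp (l * x)) x -
     generator mx mr sx sr scale_density scale_density' x) / N"
    unfolding generator_def by (simp add: algebra_simps add_divide_distrib diff_divide_distrib)
  then show ?thesis by (simp add: generator_scale)
qed

text \<open>One statement for both signs of \<open>e\<close>: for \<open>e > 0\<close> the drift is
  upward, for \<open>e < 0\<close> downward. It amounts to at least
  \<open>\<bar>e\<bar> m / N\<close> per unit of time, half of which is reserved for the one-step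
  error \<open>t\<close>.\<close>

lemma perturbed_step:
  fixes A N e r L B l m :: real
  assumes e: "e \<noteq> 0" and N: "N > 0" and r: "r > 0" and LB: "L \<le> B" and l: "l > 0" and m: "m > 0"
    and gen: "\<And>x. x \<in> {L..B} \<Longrightarrow> m \<le> generator mx mr sx sr (\<lambda>x. l * exp (l * x)) (\<lambda>x. l\<^sup>2 * exp (l * x)) x"
    and f_def: "f = (\<lambda>x. perturbed A N e l (clip (L - r) (B + r) x))"
  obtains d G where "d > 0" "\<And>x. \<bar>f x\<bar> \<le> G"
    "\<And>(M :: 'a measure) h a b x. prob_space M \<Longrightarrow> diffusive_step mx mr sx sr M h d a b \<Longrightarrow> h > 0 \<Longrightarrow>
       x \<in> {L..B} \<Longrightarrow> e > 0 \<Longrightarrow> f x + h * (e * m / (2 * N)) \<le> (\<integral>\<omega>. f (a \<omega> + x * exp (b \<omega>)) \<partial>M)"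
    "\<And>(M :: 'a measure) h a b x. prob_space M \<Longrightarrow> diffusive_step mx mr sx sr M h d a b \<Longrightarrow> h > 0 \<Longrightarrow>
       x \<in> {L..B} \<Longrightarrow> e < 0 \<Longrightarrow> (\<integral>\<omega>. f (a \<omega> + x * exp (b \<omega>)) \<partial>M) \<le> f x"
proof -
  let ?F = "perturbed A N e l" and ?F' = "\<lambda>x. (e * (l * exp (l * x)) - scale_density x) / N"
  let ?F'' = "\<lambda>x. (e * (l\<^sup>2 * exp (l * x)) - scale_density' x) / N"
  have contF: "continuous_on UNIV ?F"
    unfolding perturbed_def[abs_def] by (intro continuous_intros scale_cont) (use N in auto)
  have cont'': "continuous_on UNIV ?F''"
    by (intro continuous_intros scale_density_cont) (use N in auto)
  obtain G where G: "\<And>x. x \<in> {L - r..B + r} \<Longrightarrow> \<bar>?F x\<bar> \<le> G"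
  proof -
    show thesis
    proof (rule bounded_on_segment[OF contF contF, where L="L - r" and B="B + r"], goal_cases)
      case (1 G)
      show ?case by (rule that[OF 1(2)])
    qed
  qed
  have bd: "\<bar>f x\<bar> \<le> G" for x unfolding f_def by (rule G, rule clip_in) (use LB r in auto)
  have [measurable]: "?F \<in> borel_measurable borel" by (rule borel_measurable_continuous_onI[OF contF])
  have fm: "f \<in> borel_measurable borel" unfolding f_def by measurable
  have ff: "f x = ?F x" if "x \<in> {L - r..B + r}" for x using that by (simp add: f_def clip_eq)
  define t where "t = \<bar>e\<bar> * m / (2 * N)"
  have t: "t > 0" using e m N by (simp add: t_def)
  obtain d where d: "d > 0"
    "\<And>(M :: 'a measure) h a b x d'. prob_space M \<Longrightarrow> d' \<le> d \<Longrightarrow> diffusive_step mx mr sx sr M h d' a b \<Longrightarrow> h > 0 \<Longrightarrow>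
       x \<in> {L..B} \<Longrightarrow> \<bar>(\<integral>\<omega>. f (a \<omega> + x * exp (b \<omega>)) \<partial>M) - f x - h * generator mx mr sx sr ?F' ?F'' x\<bar> \<le> t * h"
  proof -
    show thesis
    proof (rule diffusive_step_generator[where 'a='a and mx=mx and mr=mr and sx=sx and sr=sr and L=L and B=B and r=r, OF perturbed_deriv[where A=A and N=N and e=e and l=l] perturbed_deriv2[where N=N and e=e and l=l] cont'' t r _ bd fm], goal_cases)
      case (1 x)
      then show ?case by (rule ff)
    next
      case (2 d)
      show ?case by (rule that[OF 2])
    qed
  qed
  show ?thesis
  proof (rule that[OF d(1) bd])
    fix M :: "'a measure" and h a b x
    assume A: "prob_space M" "diffusive_step mx mr sx sr M h d a b" "h > 0" "x \<in> {L..B}" "e > 0"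
    have "h * (e * m / N) \<le> h * generator mx mr sx sr ?F' ?F'' x"
      unfolding perturbed_generator using gen[OF A(4)] A N by (intro mult_left_mono divide_right_mono) auto
    moreover have "h * (e * m / N) = h * (e * m / (2 * N)) + t * h" using A N by (simp add: t_def field_simps)
    ultimately show "f x + h * (e * m / (2 * N)) \<le> (\<integral>\<omega>. f (a \<omega> + x * exp (b \<omega>)) \<partial>M)"
      using abs_le_D2[OF d(2)[OF A(1) order_refl A(2-4)]] by linarith
  next
    fix M :: "'a measure" and h a b x
    assume A: "prob_space M" "diffusive_step mx mr sx sr M h d a b" "h > 0" "x \<in> {L..B}" "e < 0"
    have "h * generator mx mr sx sr ?F' ?F'' x \<le> h * (e * m / N)"
      unfolding perturbed_generator using gen[OF A(4)] A N
      by (intro mult_left_mono divide_right_mono mult_left_mono_neg) auto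
    moreover have "h * (e * m / N) \<le> - (t * h)"
    proof -
      have "h * (e * m / N) = 2 * - (t * h)" using A N by (simp add: t_def field_simps)
      moreover have "0 < t * h" using t A by simp
      ultimately show ?thesis by linarith
    qed
    ultimately show "(\<integral>\<omega>. f (a \<omega> + x * exp (b \<omega>)) \<partial>M) \<le> f x"
      using abs_le_D1[OF d(2)[OF A(1) order_refl A(2-4)]] by linarith
  qed
qed

text \<open>The test function is the scale function normalised to 0 at \<open>B\<close> and to 1 at
  \<open>- 2 * r = L - r\<close>, then perturbed. The thirds of \<open>eps\<close> pay for moving
  the lower level from 0 to \<open>- 2 * r\<close>, for the perturbation, and for the paths that
  have not left \<open>[L, B]\<close> by time \<open>T\<close>.\<close>

lemma chain_ruin_lower:
  assumes y: "0 \<le> y" "y < B" and eps: "eps > 0"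
  obtains L d T where "L < 0" "d > 0"
    "\<And>(M :: 'a measure) p K h. indep_chain M p K \<Longrightarrow> h > 0 \<Longrightarrow>
       (\<And>k. k < K \<Longrightarrow> diffusive_step mx mr sx sr M h d (\<lambda>\<omega>. fst (p k \<omega>)) (\<lambda>\<omega>. snd (p k \<omega>))) \<Longrightarrow>
       0 < K \<Longrightarrow> T \<le> real K * h \<Longrightarrow>
       (scale B - scale y) / scale B - eps \<le> measure M {\<omega> \<in> space M. \<exists>k\<le>K. chain y (\<lambda>i. p i \<omega>) k < L}"
proof -
  have sB: "scale B > 0" "scale y < scale B" using scale_less[of 0 B] scale_less[of y B] scale_0 y by auto
  \<comment> \<open>Continuity of \<open>scale\<close> at 0 yields a level \<open>- 2 * r\<close>
    that costs less than \<open>eps / 3\<close>.\<close>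
  have "isCont (\<lambda>r. (scale B - scale y) / (scale B - scale (- 2 * r))) 0"
    by (intro continuous_intros isCont_o2[OF _ scale_cont(1)]) (use sB scale_0 in auto)
  then have "((\<lambda>r. (scale B - scale y) / (scale B - scale (- 2 * r))) \<longlongrightarrow> (scale B - scale y) / scale B) (at_right 0)"
    unfolding isCont_def by (simp add: scale_0 filterlim_at_split)
  then have "eventually (\<lambda>r. (scale B - scale y) / scale B - eps / 3 < (scale B - scale y) / (scale B - scale (- 2 * r))) (at_right 0)"
    by (rule order_tendstoD) (use eps in simp)
  moreover have "eventually (\<lambda>r::real. r \<in> {0<..<1}) (at_right 0)" by (rule eventually_at_right_real) simp
  ultimately have "eventually (\<lambda>r. r \<in> {0<..<1} \<and> (scale B - scale y) / scale B - eps / 3 < (scale B - scale y) / (scale B - scale (- 2 * r))) (at_right 0)"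
    by eventually_elim simp
  then have "\<exists>r. r \<in> {0<..<1} \<and> (scale B - scale y) / scale B - eps / 3 < (scale B - scale y) / (scale B - scale (- 2 * r))"
    by (rule eventually_happens'[OF trivial_limit_at_right_real])
  then obtain r where r: "0 < r" "r < 1"
    and rr: "(scale B - scale y) / scale B - eps / 3 < (scale B - scale y) / (scale B - scale (- 2 * r))"
    by auto
  define L where "L = - r"
  define N where "N = scale B - scale (- 2 * r)"
  have N: "N > 0" using scale_less[of "- 2 * r" B] r y by (simp add: N_def)
  obtain l m where l: "l > 0" and m: "m > 0" and
    gen: "\<And>x. x \<in> {L..B} \<Longrightarrow> m \<le> generator mx mr sx sr (\<lambda>x. l * exp (l * x)) (\<lambda>x. l\<^sup>2 * exp (l * x)) x"
    using exp_supersolution[of L B] by blast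
  define e where "e = eps / 3 * N / exp (l * (B + r))"
  have e: "e > 0" using eps N by (simp add: e_def)
  \<comment> \<open>Subtracting the largest value of the perturbation keeps \<open>f \<le> 1\<close>
    below \<open>L\<close> and \<open>f \<le> 0\<close> above \<open>B\<close>.\<close>
  define A where "A = scale B - e * exp (l * (B + r))"
  define f where "f = (\<lambda>x. perturbed A N e l (clip (L - r) (B + r) x))"
  have LB: "L - r \<le> B + r" "L \<le> B" using r y by (auto simp: L_def)
  obtain d G where d: "d > 0" and bd: "\<And>x. \<bar>f x\<bar> \<le> G" and step:
    "\<And>(M :: 'a measure) h a b x. prob_space M \<Longrightarrow> diffusive_step mx mr sx sr M h d a b \<Longrightarrow> h > 0 \<Longrightarrow>
       x \<in> {L..B} \<Longrightarrow> e > 0 \<Longrightarrow> f x + h * (e * m / (2 * N)) \<le> (\<integral>\<omega>. f (a \<omega> + x * exp (b \<omega>)) \<partial>M)"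
    "\<And>(M :: 'a measure) h a b x. prob_space M \<Longrightarrow> diffusive_step mx mr sx sr M h d a b \<Longrightarrow> h > 0 \<Longrightarrow>
       x \<in> {L..B} \<Longrightarrow> e < 0 \<Longrightarrow> (\<integral>\<omega>. f (a \<omega> + x * exp (b \<omega>)) \<partial>M) \<le> f x"
  proof -
    show thesis
    proof (rule perturbed_step[where 'a='a, OF less_imp_neq[THEN not_sym, OF e] N r(1) LB(2) l m _ f_def], goal_cases)
      case (1 x)
      then show ?case by (rule gen)
    next
      case (2 d G)
      show ?case by (rule that[OF 2])
    qed
  qed
  have [measurable]: "perturbed A N e l \<in> borel_measurable borel"
    by (rule borel_measurable_continuous_onI, unfold perturbed_def[abs_def], intro continuous_intros scale_cont) (use N in auto)
  have fm: "f \<in> borel_measurable borel" unfolding f_def by measurable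
  have exple: "e * exp (l * clip (L - r) (B + r) x) \<le> e * exp (l * (B + r))" for x
    using clip_in[OF LB(1), of x] e l by auto
  have f1: "f x \<le> 1" if "x < L" for x
  proof -
    have "scale (- 2 * r) \<le> scale (clip (L - r) (B + r) x)"
      using clip_in[OF LB(1), of x] by (intro scale_le) (auto simp: L_def)
    then show ?thesis using N exple[of x] by (simp add: f_def perturbed_def A_def N_def)
  qed
  have fB: "f x \<le> 0" if "x > B" for x
  proof -
    have "scale B \<le> scale (clip (L - r) (B + r) x)"
      using that LB r by (intro scale_le) (auto simp: clip_def)
    then show ?thesis using N exple[of x] by (simp add: f_def perturbed_def A_def divide_le_0_iff)
  qed
  have fy: "(scale B - scale y) / scale B - 2 * (eps / 3) \<le> f y"
  proof -
    have "clip (L - r) (B + r) y = y" using y r by (intro clip_eq) (auto simp: L_def)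
    then have "f y = (scale B - scale y) / N - e * exp (l * (B + r)) / N + e * exp (l * y) / N"
      by (simp add: f_def perturbed_def A_def add_divide_distrib diff_divide_distrib)
    moreover have "e * exp (l * (B + r)) / N = eps / 3" using N by (simp add: e_def)
    moreover have "0 \<le> e * exp (l * y) / N" using e N by simp
    ultimately show ?thesis using rr[folded N_def] by linarith
  qed
  have G: "G \<ge> 0" using bd[of 0] by linarith
  define q where "q = e * m / (2 * N)"
  have q: "q > 0" using e m N by (simp add: q_def)
  show ?thesis
  \<comment> \<open>The error \<open>G (2 G + 1) / (K h q)\<close> of \<open>ruin_prob_ge\<close> is
    at most \<open>eps / 3\<close> once \<open>K h\<close> reaches this time, whatever the
    mesh.\<close>
  proof (rule that[of L d "G * (2 * G + 1) / q / (eps / 3)"])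
    fix M :: "'a measure" and p K h
    assume ch: "indep_chain M p K" and h: "h > 0"
      and st: "\<And>k. k < K \<Longrightarrow> diffusive_step mx mr sx sr M h d (\<lambda>\<omega>. fst (p k \<omega>)) (\<lambda>\<omega>. snd (p k \<omega>))"
      and K: "0 < K" "G * (2 * G + 1) / q / (eps / 3) \<le> real K * h"
    interpret indep_chain M p K by (rule ch)
    have "f y - G * (2 * G + 1) / (real K * (h * q)) \<le> prob {\<omega> \<in> space M. \<exists>k\<le>K. chain y (\<lambda>i. p i \<omega>) k < L}"
    proof (rule ruin_prob_ge[OF fm bd f1 fB])
      show "0 < h * q" using h q by simp
      show "f x + h * q \<le> (\<integral>\<omega>. f (fst (p k \<omega>) + x * exp (snd (p k \<omega>))) \<partial>M)" if "k < K" "x \<in> {L..B}" for k x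
        unfolding q_def by (rule step(1)[OF prob_space_axioms st[OF that(1)] h that(2) e])
      show "y \<in> {L..B}" using y r by (auto simp: L_def)
    qed (use K in auto)
    moreover have "G * (2 * G + 1) / (real K * (h * q)) \<le> eps / 3"
      using K h q eps by (simp add: field_simps)
    ultimately show "(scale B - scale y) / scale B - eps \<le> prob {\<omega> \<in> space M. \<exists>k\<le>K. chain y (\<lambda>i. p i \<omega>) k < L}"
      using fy by linarith
  qed (use r d in \<open>auto simp: L_def\<close>)
qed

text \<open>The supersolution is the minimum \<open>V\<close> of \<open>f + p0\<close> and
  \<open>g\<close>; the one-step inequality for \<open>f\<close> holds on \<open>[0, B]\<close>,
  that for \<open>g\<close> everywhere. Half of \<open>eps\<close> pays for the perturbation of the
  scale function, half for \<open>p0\<close>.\<close>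

lemma chain_ruin_upper:
  assumes y: "0 \<le> y" and eps: "eps > 0" and c: "c > 0" and C: "C \<ge> 0"
    and T: "\<And>x. scale x < T" and lim: "(scale \<longlongrightarrow> T) at_top"
  obtains d where "d > 0"
    "\<And>(M :: 'a measure) p K h u v. indep_chain M p K \<Longrightarrow> h > 0 \<Longrightarrow>
       (\<And>k. k < K \<Longrightarrow> diffusive_step mx mr sx sr M h d (\<lambda>\<omega>. fst (p k \<omega>)) (\<lambda>\<omega>. snd (p k \<omega>))) \<Longrightarrow>
       (\<And>k. k < K \<Longrightarrow> contracting_step M h c C u v (\<lambda>\<omega>. fst (p k \<omega>)) (\<lambda>\<omega>. snd (p k \<omega>))) \<Longrightarrow>
       0 < K \<Longrightarrow>
       measure M {\<omega> \<in> space M. \<exists>k\<le>K. chain y (\<lambda>i. p i \<omega>) k < 0} \<le> (T - scale y) / T + eps"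
proof -
  have Tp: "T > 0" using T[of 0] scale_0 by simp
  define kb where "kb = 2 * C / c"
  define bet where "bet = 2 * C * (1 + 2 * kb\<^sup>2) / c + 1"
  have bet: "bet > 0" unfolding bet_def using c C by (intro add_nonneg_pos divide_nonneg_pos mult_nonneg_nonneg) auto
  have kb: "kb \<ge> 0" using c C by (simp add: kb_def)
  \<comment> \<open>Large enough that the far field beyond \<open>B\<close> falls below
    \<open>eps / 2\<close>; the summand 1 gives \<open>s \<le> s^2\<close>, the summand
    \<open>y\<close> gives \<open>y < B\<close>.\<close>
  define s where "s = 1 + y + 2 * (kb\<^sup>2 + bet) / eps"
  define B where "B = kb + s"
  have r0: "0 < 2 * (kb\<^sup>2 + bet) / eps" using bet eps by (simp add: add_nonneg_pos)
  have s1: "1 \<le> s" "2 * (kb\<^sup>2 + bet) / eps < s" using r0 y unfolding s_def by linarith+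
  have "s \<le> s\<^sup>2" using s1 by (simp add: self_le_power)
  then have "2 * (kb\<^sup>2 + bet) / eps < s\<^sup>2" using s1 by linarith
  then have "(kb\<^sup>2 + bet) / s\<^sup>2 < eps / 2" using eps s1 by (simp add: field_simps)
  then have B: "(kb\<^sup>2 + bet) / (B - kb)\<^sup>2 < eps / 2" "kb < B" "y < B"
    using s1 kb r0 unfolding B_def s_def by (simp_all add: s_def)
  define p0 where "p0 = (kb\<^sup>2 + bet) / (B - kb)\<^sup>2"
  have p0: "p0 \<ge> 0" using bet by (simp add: p0_def)
  obtain l m where l: "l > 0" and m: "m > 0" and
    gen: "\<And>x. x \<in> {0..B} \<Longrightarrow> m \<le> generator mx mr sx sr (\<lambda>x. l * exp (l * x)) (\<lambda>x. l\<^sup>2 * exp (l * x)) x"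
    using exp_supersolution[of 0 B] by blast
  define e where "e = eps / 2 * T / exp (l * (B + 1))"
  have e: "e > 0" using eps Tp by (simp add: e_def)
  \<comment> \<open>Here the perturbation enters with a minus sign; adding its largest value keeps
    \<open>f \<ge> 0\<close> everywhere and \<open>f \<ge> 1\<close> below 0.\<close>
  define A where "A = T + e * exp (l * (B + 1))"
  define f where "f = (\<lambda>x. perturbed A T (- e) l (clip (0 - 1) (B + 1) x))"
  have nB: "0 \<le> B" and ne: "- e \<noteq> 0" using y B e by auto
  obtain d G where d: "d > 0" and bd: "\<And>x. \<bar>f x\<bar> \<le> G" and step:
    "\<And>(M :: 'a measure) h a b x. prob_space M \<Longrightarrow> diffusive_step mx mr sx sr M h d a b \<Longrightarrow> h > 0 \<Longrightarrow>
       x \<in> {0..B} \<Longrightarrow> - e > 0 \<Longrightarrow> f x + h * (- e * m / (2 * T)) \<le> (\<integral>\<omega>. f (a \<omega> + x * exp (b \<omega>)) \<partial>M)"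
    "\<And>(M :: 'a measure) h a b x. prob_space M \<Longrightarrow> diffusive_step mx mr sx sr M h d a b \<Longrightarrow> h > 0 \<Longrightarrow>
       x \<in> {0..B} \<Longrightarrow> - e < 0 \<Longrightarrow> (\<integral>\<omega>. f (a \<omega> + x * exp (b \<omega>)) \<partial>M) \<le> f x"
  proof -
    show thesis
    proof (rule perturbed_step[where 'a='a, OF ne Tp zero_less_one nB l m _ f_def], goal_cases)
      case (1 x)
      then show ?case by (rule gen)
    next
      case (2 d G)
      show ?case by (rule that[OF 2])
    qed
  qed
  have [measurable]: "perturbed A T (- e) l \<in> borel_measurable borel"
    by (rule borel_measurable_continuous_onI, unfold perturbed_def[abs_def], intro continuous_intros scale_cont) (use Tp in auto)
  have fm[measurable]: "f \<in> borel_measurable borel" unfolding f_def by measurable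
  have exple: "e * exp (l * clip (0 - 1) (B + 1) x) \<le> e * exp (l * (B + 1))" for x
  proof -
    have "clip (0 - 1) (B + 1) x \<le> B + 1" using y B by (auto simp: clip_def)
    then show ?thesis using e l by simp
  qed
  have f0: "0 \<le> f x" for x
  proof -
    have "0 \<le> T - scale (clip (0 - 1) (B + 1) x) + (e * exp (l * (B + 1)) - e * exp (l * clip (0 - 1) (B + 1) x))"
      using T[of "clip (0 - 1) (B + 1) x"] exple[of x] by linarith
    then show ?thesis using Tp by (simp add: f_def perturbed_def A_def algebra_simps)
  qed
  have f1: "1 \<le> f x" if "x < 0" for x
  proof -
    have "scale (clip (0 - 1) (B + 1) x) \<le> scale 0"
      using that y B by (intro scale_le) (auto simp: clip_def)
    then have "T \<le> T - scale (clip (0 - 1) (B + 1) x) + (e * exp (l * (B + 1)) - e * exp (l * clip (0 - 1) (B + 1) x))"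
      using exple[of x] scale_0 by linarith
    then show ?thesis using Tp by (simp add: f_def perturbed_def A_def algebra_simps)
  qed
  have fy: "f y \<le> (T - scale y) / T + eps / 2"
  proof -
    have "clip (0 - 1) (B + 1) y = y" using y B by (intro clip_eq) auto
    then have "f y = (T - scale y) / T + e * exp (l * (B + 1)) / T - e * exp (l * y) / T"
      by (simp add: f_def perturbed_def A_def add_divide_distrib diff_divide_distrib)
    moreover have "e * exp (l * (B + 1)) / T = eps / 2" using Tp by (simp add: e_def)
    moreover have "0 \<le> e * exp (l * y) / T" using e Tp by simp
    ultimately show ?thesis by linarith
  qed
  show ?thesis
  proof (rule that[OF d])
    fix M :: "'a measure" and p K h u v
    assume ch: "indep_chain M p K" and h: "h > 0"
      and st: "\<And>k. k < K \<Longrightarrow> diffusive_step mx mr sx sr M h d (\<lambda>\<omega>. fst (p k \<omega>)) (\<lambda>\<omega>. snd (p k \<omega>))"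
      and ct: "\<And>k. k < K \<Longrightarrow> contracting_step M h c C u v (\<lambda>\<omega>. fst (p k \<omega>)) (\<lambda>\<omega>. snd (p k \<omega>))"
      and K: "0 < K"
    interpret indep_chain M p K by (rule ch)
    interpret ct: contraction h c C u v by unfold_locales (use h c C in auto)
    have [simp]: "ct.\<kappa>max = kb" "ct.\<beta> = bet" by (simp_all add: ct.\<kappa>max_def ct.\<beta>_def kb_def bet_def)
    have kap: "\<bar>ct.\<kappa>\<bar> \<le> kb" using ct.kappa_bound(2)[OF prob_space_axioms ct[OF K]] by simp
    define g where "g x = (kb\<^sup>2 + bet) / bet * far_field ct.\<kappa> bet x" for x
    have R: "(kb\<^sup>2 + bet) / bet \<ge> 0" using bet by simp
    have gb: "0 \<le> g x" "g x \<le> (kb\<^sup>2 + bet) / bet" for x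
      using mult_nonneg_nonneg[OF R far_field_bounds(1)[OF bet]] mult_left_le[OF far_field_bounds(2)[OF bet] R]
      unfolding g_def by auto
    have gm[measurable]: "g \<in> borel_measurable borel" unfolding g_def by measurable
    have g1: "1 \<le> g x" if "x < 0" for x
      unfolding g_def using ct.far_field_negative kap that by simp
    have gB: "g x \<le> p0" if "B \<le> x" for x
      unfolding g_def p0_def using ct.far_field_decay[of B x] kap that B by simp
    define V where "V x = min (f x + p0) (g x)" for x
    have Vm: "V \<in> borel_measurable borel" unfolding V_def by measurable
    have "prob {\<omega> \<in> space M. \<exists>k\<le>K. chain y (\<lambda>i. p i \<omega>) k < 0} \<le> V y"
    proof (rule ruin_prob_le[OF Vm])
      show V0: "0 \<le> V x" for x using f0[of x] p0 gb(1)[of x] by (simp add: V_def)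
      show Vb: "V x \<le> (kb\<^sup>2 + bet) / bet" for x using gb(2)[of x] by (simp add: V_def min.coboundedI2)
      show "1 \<le> V x" if "x < 0" for x using f1[OF that] g1[OF that] p0 by (simp add: V_def)
      fix k x assume k: "k < K" and x: "(0::real) \<le> x"
      let ?Z = "\<lambda>\<omega>. fst (p k \<omega>) + x * exp (snd (p k \<omega>))"
      have [measurable]: "(\<lambda>\<omega>. fst (p k \<omega>)) \<in> borel_measurable M" "(\<lambda>\<omega>. snd (p k \<omega>)) \<in> borel_measurable M"
        using st[OF k] by (auto simp: diffusive_step_def)
      have iV: "integrable M (\<lambda>\<omega>. V (?Z \<omega>))"
        by (rule integrable_const_bound[where B="(kb\<^sup>2 + bet) / bet"]) (use V0 Vb Vm in auto)
      have ig: "integrable M (\<lambda>\<omega>. g (?Z \<omega>))"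
        by (rule integrable_const_bound[where B="(kb\<^sup>2 + bet) / bet"]) (use gb in auto)
      have if_: "integrable M (\<lambda>\<omega>. f (?Z \<omega>))"
        by (rule integrable_const_bound[where B=G]) (use bd in auto)
      have 1: "(\<integral>\<omega>. V (?Z \<omega>) \<partial>M) \<le> g x"
      proof -
        have "(\<integral>\<omega>. V (?Z \<omega>) \<partial>M) \<le> (\<integral>\<omega>. g (?Z \<omega>) \<partial>M)"
          by (rule integral_mono[OF iV ig]) (simp add: V_def)
        also have "\<dots> \<le> g x"
        proof -
          have "(\<integral>\<omega>. far_field ct.\<kappa> bet (?Z \<omega>) \<partial>M) \<le> far_field ct.\<kappa> bet x"
            using ct.far_field_super[OF prob_space_axioms ct[OF k], of x] by simp
          then show ?thesis unfolding g_def integral_mult_right_zero using R by (rule mult_left_mono)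
        qed
        finally show ?thesis .
      qed
      show "(\<integral>\<omega>. V (?Z \<omega>) \<partial>M) \<le> V x"
      proof (cases "x \<le> B")
        case True
        have "(\<integral>\<omega>. V (?Z \<omega>) \<partial>M) \<le> (\<integral>\<omega>. f (?Z \<omega>) + p0 \<partial>M)"
          by (rule integral_mono[OF iV]) (use if_ in \<open>auto simp: V_def\<close>)
        also have "\<dots> = (\<integral>\<omega>. f (?Z \<omega>) \<partial>M) + p0" using if_ by (simp add: prob_space)
        also have "\<dots> \<le> f x + p0"
          using step(2)[OF prob_space_axioms st[OF k] h, of x] x True e by simp
        finally show ?thesis using 1 by (simp add: V_def)
      next
        case False
        \<comment> \<open>Beyond \<open>B\<close> the far field is at most \<open>p0\<close>, so
          \<open>V x = g x\<close> and the inequality for \<open>g\<close> suffices.\<close>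
        then have "g x \<le> f x + p0" using gB[of x] f0[of x] by linarith
        then show ?thesis using 1 by (simp add: V_def)
      qed
    qed (rule y)
    also have "V y \<le> f y + p0" by (simp add: V_def)
    also have "\<dots> \<le> (T - scale y) / T + eps" using fy B(1) unfolding p0_def by linarith
    finally show "prob {\<omega> \<in> space M. \<exists>k\<le>K. chain y (\<lambda>i. p i \<omega>) k < 0} \<le> (T - scale y) / T + eps" .
  qed
qed

end

section \<open>The discrete model\<close>

definition centred_scaling :: "real \<Rightarrow> nat \<Rightarrow> real \<Rightarrow> real" where
  "centred_scaling m n z = m / real n + (z - m) / sqrt (real n)"

lemma centred_scaling_measurable[measurable]: "centred_scaling m n \<in> borel_measurable borel"
  unfolding centred_scaling_def by measurable

text \<open>The fourth-order Lagrange remainder is nonnegative.\<close>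

lemma exp_lower_cubic: "1 + x + x\<^sup>2 / 2 + x ^ 3 / 6 \<le> exp (x::real)"
proof -
  obtain t where "exp x = (\<Sum>m<4. x ^ m / fact m) + exp t / fact 4 * x ^ 4"
    using Maclaurin_exp_le[of x 4] by auto
  moreover have "(\<Sum>m<4. x ^ m / fact m) = 1 + x + x\<^sup>2 / 2 + x ^ 3 / 6"
    by (simp add: eval_nat_numeral)
  moreover have "0 \<le> exp t / fact 4 * x ^ 4" by simp
  ultimately show ?thesis by linarith
qed

text \<open>For \<open>\<bar>x\<bar> \<le> d\<close> the cubic term of
  \<open>exp_lower_cubic\<close> is at least \<open>- d x^2 / 6\<close>, which the loss of
  \<open>d x^2 / 2\<close> absorbs. For larger \<open>\<bar>x\<bar>\<close> the subtracted
  \<open>x^2\<close> reduces the claim to \<open>1 + x \<le> exp x\<close>.\<close>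

lemma exp_lower_quadratic:
  assumes d: "0 < d" "d \<le> 1"
  shows "1 + x + (1 - d) * x\<^sup>2 / 2 - x\<^sup>2 * indicator {d<..} \<bar>x\<bar> \<le> exp (x::real)"
proof (cases "\<bar>x\<bar> \<le> d")
  case True
  have "\<bar>x ^ 3\<bar> \<le> d * x\<^sup>2"
    using mult_right_mono[OF True, of "x\<^sup>2"] by (simp add: power_abs eval_nat_numeral abs_mult)
  then have "- (3 * (d * x\<^sup>2)) \<le> x ^ 3" using d mult_nonneg_nonneg[of d "x\<^sup>2"] by (auto simp: abs_le_iff)
  moreover have "(1 - d) * x\<^sup>2 / 2 = x\<^sup>2 / 2 - d * x\<^sup>2 / 2" by (simp add: algebra_simps diff_divide_distrib)
  moreover have "x\<^sup>2 * indicator {d<..} \<bar>x\<bar> = 0" using True by simp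
  ultimately show ?thesis using exp_lower_cubic[of x] by linarith
next
  case False
  have "(1 - d) * x\<^sup>2 \<le> 1 * x\<^sup>2" using d by (intro mult_right_mono) auto
  then have "(1 - d) * x\<^sup>2 / 2 \<le> x\<^sup>2" using zero_le_power2[of x] by linarith
  moreover have "x\<^sup>2 * indicator {d<..} \<bar>x\<bar> = x\<^sup>2" using False by simp
  ultimately show ?thesis using exp_ge_add_one_self[of x] by linarith
qed

section \<open>Centred and scaled square-integrable variables\<close>

context prob_space
begin

context
  fixes Z :: "'a \<Rightarrow> real"
  assumes Z[measurable]: "Z \<in> borel_measurable M" and Z2: "integrable M (\<lambda>\<omega>. (Z \<omega>)\<^sup>2)"
begin

lemma Z_integrable: "integrable M Z"
  using square_integrable_imp_integrable[of Z] Z2 by auto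

lemma centred_integrable: "integrable M (\<lambda>\<omega>. (Z \<omega> - c)\<^sup>2)"
  using Z_integrable Z2 by (simp add: power2_diff)

lemma centred_scaling_moments:
  assumes n: "n > 0"
  defines "m \<equiv> expectation Z"
  shows "integrable M (\<lambda>\<omega>. (centred_scaling m n (Z \<omega>))\<^sup>2)"
    "expectation (\<lambda>\<omega>. centred_scaling m n (Z \<omega>)) = m / real n"
    "expectation (\<lambda>\<omega>. (centred_scaling m n (Z \<omega>))\<^sup>2) = m\<^sup>2 / (real n)\<^sup>2 + variance Z / real n"
proof -
  have e: "(centred_scaling m n z)\<^sup>2 = m\<^sup>2 / (real n)\<^sup>2 + 2 * m / (real n * sqrt (real n)) * (z - m) + (z - m)\<^sup>2 / real n" for z
    unfolding centred_scaling_def power2_sum using n by (simp add: power_divide)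
  have i: "integrable M (\<lambda>\<omega>. Z \<omega> - m)" using Z_integrable by simp
  have z: "expectation (\<lambda>\<omega>. Z \<omega> - m) = 0" using Z_integrable by (simp add: prob_space m_def)
  show "integrable M (\<lambda>\<omega>. (centred_scaling m n (Z \<omega>))\<^sup>2)"
    unfolding e using i centred_integrable by auto
  show "expectation (\<lambda>\<omega>. centred_scaling m n (Z \<omega>)) = m / real n"
    unfolding centred_scaling_def using i z by (simp add: prob_space)
  have "expectation (\<lambda>\<omega>. (centred_scaling m n (Z \<omega>))\<^sup>2) =
      m\<^sup>2 / (real n)\<^sup>2 + 2 * m / (real n * sqrt (real n)) * expectation (\<lambda>\<omega>. Z \<omega> - m) + variance Z / real n"
    unfolding e m_def[symmetric] using i centred_integrable[of m] by (simp add: prob_space del: Bochner_Integration.integral_diff)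
  then show "expectation (\<lambda>\<omega>. (centred_scaling m n (Z \<omega>))\<^sup>2) = m\<^sup>2 / (real n)\<^sup>2 + variance Z / real n"
    unfolding z by simp
qed

text \<open>Multiplied by \<open>n\<close>, the integrand is eventually 0 at each point, since the
  scaled value tends to 0, and it is dominated by \<open>2 m^2 + 2 (Z - m)^2\<close>.\<close>

lemma centred_scaling_lindeberg:
  assumes e: "e > 0" "e' > 0"
  shows "eventually (\<lambda>n. expectation (\<lambda>\<omega>. (centred_scaling m n (Z \<omega>))\<^sup>2 * indicator {e<..} \<bar>centred_scaling m n (Z \<omega>)\<bar>) \<le> e' * (1 / real n)) sequentially"
proof -
  let ?s = "\<lambda>n \<omega>. real n * ((centred_scaling m n (Z \<omega>))\<^sup>2 * indicator {e<..} \<bar>centred_scaling m n (Z \<omega>)\<bar>)"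
  have lim: "(\<lambda>n. expectation (?s n)) \<longlonglongrightarrow> expectation (\<lambda>_. 0)"
  proof (rule integral_dominated_convergence[where w="\<lambda>\<omega>. 2 * m\<^sup>2 + 2 * (Z \<omega> - m)\<^sup>2"])
    show "integrable M (\<lambda>\<omega>. 2 * m\<^sup>2 + 2 * (Z \<omega> - m)\<^sup>2)" using centred_integrable by simp
    show "AE \<omega> in M. (\<lambda>n. ?s n \<omega>) \<longlonglongrightarrow> 0"
    proof (rule AE_I2)
      fix \<omega>
      have "(\<lambda>n. inverse (real n)) \<longlonglongrightarrow> 0" by (rule lim_inverse_n)
      moreover from tendsto_real_sqrt[OF this] have "(\<lambda>n. inverse (sqrt (real n))) \<longlonglongrightarrow> 0"
        by (simp add: real_sqrt_inverse)
      ultimately have "(\<lambda>n. m * inverse (real n) + (Z \<omega> - m) * inverse (sqrt (real n))) \<longlonglongrightarrow> m * 0 + (Z \<omega> - m) * 0"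
        by (intro tendsto_intros)
      then have "(\<lambda>n. \<bar>centred_scaling m n (Z \<omega>)\<bar>) \<longlonglongrightarrow> 0"
        using tendsto_rabs[of _ 0] by (simp add: centred_scaling_def divide_inverse)
      then have "eventually (\<lambda>n. \<bar>centred_scaling m n (Z \<omega>)\<bar> < e) sequentially"
        using e(1) by (rule order_tendstoD)
      then have "eventually (\<lambda>n. ?s n \<omega> = 0) sequentially" by eventually_elim simp
      then show "(\<lambda>n. ?s n \<omega>) \<longlonglongrightarrow> 0" by (rule tendsto_eventually)
    qed
    show "AE \<omega> in M. norm (?s n \<omega>) \<le> 2 * m\<^sup>2 + 2 * (Z \<omega> - m)\<^sup>2" for n
    proof (rule AE_I2)
      fix \<omega>
      have b0: "0 \<le> 2 * m\<^sup>2 + 2 * (Z \<omega> - m)\<^sup>2" by simp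
      show "norm (?s n \<omega>) \<le> 2 * m\<^sup>2 + 2 * (Z \<omega> - m)\<^sup>2"
      proof (cases "n = 0")
        case False
        then have n: "real n \<ge> 1" by simp
        have "(p + q)\<^sup>2 \<le> 2 * p\<^sup>2 + 2 * q\<^sup>2" for p q :: real
          using zero_le_power2[of "p - q"] by (simp add: power2_eq_square algebra_simps)
        then have "(centred_scaling m n (Z \<omega>))\<^sup>2 \<le> 2 * (m / real n)\<^sup>2 + 2 * ((Z \<omega> - m) / sqrt (real n))\<^sup>2"
          unfolding centred_scaling_def .
        also have "\<dots> = 2 * (m\<^sup>2 / (real n)\<^sup>2) + 2 * ((Z \<omega> - m)\<^sup>2 / real n)" using n by (simp add: power_divide)
        finally have "real n * (centred_scaling m n (Z \<omega>))\<^sup>2 \<le> real n * (2 * (m\<^sup>2 / (real n)\<^sup>2) + 2 * ((Z \<omega> - m)\<^sup>2 / real n))"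
          using n by (intro mult_left_mono) auto
        also have "\<dots> = 2 * (m\<^sup>2 / real n) + 2 * (Z \<omega> - m)\<^sup>2" using n by (simp add: field_simps power2_eq_square)
        also have "m\<^sup>2 / real n \<le> m\<^sup>2" using n divide_left_mono[of 1 "real n" "m\<^sup>2"] by simp
        finally have "real n * (centred_scaling m n (Z \<omega>))\<^sup>2 \<le> 2 * m\<^sup>2 + 2 * (Z \<omega> - m)\<^sup>2" by simp
        then show ?thesis using b0 by (simp add: indicator_def)
      qed (use b0 in simp)
    qed
  qed auto
  then have "(\<lambda>n. real n * expectation (\<lambda>\<omega>. (centred_scaling m n (Z \<omega>))\<^sup>2 * indicator {e<..} \<bar>centred_scaling m n (Z \<omega>)\<bar>)) \<longlonglongrightarrow> 0"
    by simp
  then have "eventually (\<lambda>n. real n * expectation (\<lambda>\<omega>. (centred_scaling m n (Z \<omega>))\<^sup>2 * indicator {e<..} \<bar>centred_scaling m n (Z \<omega>)\<bar>) < e') sequentially"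
    using e(2) by (rule order_tendstoD)
  then show ?thesis using eventually_gt_at_top[of 0]
    by eventually_elim (simp add: pos_le_divide_eq mult.commute less_imp_le)
qed

text \<open>To second order, \<open>n (E exp (- 2 Z\<^sub>n) - 1)\<close> is asymptotically at least \<open>2 (Var Z - E Z)\<close> for the scaled \<open>Z\<^sub>n\<close>.\<close>
lemma exp_moment_drift:
  assumes int: "\<And>n. n \<ge> n0 \<Longrightarrow> integrable M (\<lambda>\<omega>. exp (- 2 * centred_scaling (expectation Z) n (Z \<omega>)))"
    and le: "\<And>n. n \<ge> n0 \<Longrightarrow> expectation (\<lambda>\<omega>. exp (- 2 * centred_scaling (expectation Z) n (Z \<omega>))) \<le> 1 - c / real n"
  shows "c \<le> 2 * (expectation Z - variance Z)"
proof (rule field_le_epsilon)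
  let ?m = "expectation Z"
  define v where "v = variance Z"
  fix e :: real assume e: "0 < e"
  have v0: "0 \<le> v" unfolding v_def by (rule Bochner_Integration.integral_nonneg) simp
  \<comment> \<open>Chosen for \<open>2 d v \<le> e / 2\<close>; \<open>v + 1\<close> covers a
    vanishing variance.\<close>
  define d where "d = min 1 (e / (4 * (v + 1)))"
  have d: "0 < d" "d \<le> 1" using e v0 by (auto simp: d_def intro!: divide_pos_pos)
  have dv: "2 * d * v \<le> e / 2"
  proof -
    have "d \<le> e / (4 * (v + 1))" by (simp add: d_def)
    then have "d * (4 * (v + 1)) \<le> e" using v0 by (simp add: pos_le_divide_eq)
    then show ?thesis using d by (simp add: algebra_simps)
  qed
  \<comment> \<open>The exponent is \<open>- 2\<close> times the scaled variable, so truncating the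
    exponent at \<open>d\<close> means truncating the variable at \<open>d / 2\<close>.\<close>
  have "eventually (\<lambda>n. expectation (\<lambda>\<omega>. (centred_scaling ?m n (Z \<omega>))\<^sup>2 * indicator {d / 2<..} \<bar>centred_scaling ?m n (Z \<omega>)\<bar>) \<le> e / 8 * (1 / real n)) sequentially"
    using centred_scaling_lindeberg[of "d/2" "e/8" ?m] d e by simp
  then have "eventually (\<lambda>n. expectation (\<lambda>\<omega>. (centred_scaling ?m n (Z \<omega>))\<^sup>2 * indicator {d / 2<..} \<bar>centred_scaling ?m n (Z \<omega>)\<bar>) \<le> e / 8 * (1 / real n) \<and> n \<ge> n0 \<and> n > 0) sequentially"
    using eventually_ge_at_top[of n0] eventually_gt_at_top[of 0] by eventually_elim simp
  \<comment> \<open>One large \<open>n\<close> suffices: multiplied by \<open>n\<close>, the final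
    inequality relates quantities that do not depend on \<open>n\<close>.\<close>
  from eventually_happens'[OF sequentially_bot this] obtain n where lin:
    "expectation (\<lambda>\<omega>. (centred_scaling ?m n (Z \<omega>))\<^sup>2 * indicator {d / 2<..} \<bar>centred_scaling ?m n (Z \<omega>)\<bar>) \<le> e / 8 * (1 / real n)"
    and n: "n \<ge> n0" "n > 0"
    by auto
  let ?g = "\<lambda>\<omega>. centred_scaling ?m n (Z \<omega>)"
  note mom = centred_scaling_moments[OF n(2), folded v_def]
  have ig: "integrable M ?g" using square_integrable_imp_integrable[of ?g] mom(1) by auto
  have iI: "integrable M (\<lambda>\<omega>. (?g \<omega>)\<^sup>2 * indicator {d / 2<..} \<bar>?g \<omega>\<bar>)"
    by (rule integrable_sq_imp(3)[OF _ _ mom(1) mom(1)]) auto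
  let ?q = "\<lambda>\<omega>. 1 - 2 * ?g \<omega> + 2 * (1 - d) * (?g \<omega>)\<^sup>2 - 4 * ((?g \<omega>)\<^sup>2 * indicator {d / 2<..} \<bar>?g \<omega>\<bar>)"
  have "expectation ?q \<le> expectation (\<lambda>\<omega>. exp (- 2 * ?g \<omega>))"
  proof (rule integral_mono)
    show "integrable M ?q" using ig mom(1) iI by auto
    show "integrable M (\<lambda>\<omega>. exp (- 2 * ?g \<omega>))" by (rule int[OF n(1)])
    fix \<omega>
    have "indicator {d<..} \<bar>- 2 * ?g \<omega>\<bar> = (indicator {d / 2<..} \<bar>?g \<omega>\<bar> :: real)" by (auto simp: indicator_def)
    then have "1 + - 2 * ?g \<omega> + (1 - d) * (4 * (?g \<omega>)\<^sup>2) / 2 - 4 * (?g \<omega>)\<^sup>2 * indicator {d / 2<..} \<bar>?g \<omega>\<bar> \<le> exp (- 2 * ?g \<omega>)"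
      using exp_lower_quadratic[OF d, of "- 2 * ?g \<omega>"] by (simp add: power_mult_distrib)
    moreover have "(1 - d) * (4 * (?g \<omega>)\<^sup>2) / 2 = 2 * (1 - d) * (?g \<omega>)\<^sup>2" by simp
    ultimately show "?q \<omega> \<le> exp (- 2 * ?g \<omega>)" by linarith
  qed
  moreover have "expectation ?q = 1 - 2 * (?m / real n) + 2 * (1 - d) * (?m\<^sup>2 / (real n)\<^sup>2 + v / real n)
      - 4 * expectation (\<lambda>\<omega>. (?g \<omega>)\<^sup>2 * indicator {d / 2<..} \<bar>?g \<omega>\<bar>)"
    using ig mom iI by (simp add: prob_space)
  moreover have "2 * (1 - d) * (v / real n) \<le> 2 * (1 - d) * (?m\<^sup>2 / (real n)\<^sup>2 + v / real n)"
    using d by (intro mult_left_mono) auto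
  ultimately have "c / real n \<le> 2 * (?m / real n) - 2 * (1 - d) * (v / real n) + 4 * (e / 8 * (1 / real n))"
    using le[OF n(1)] lin by linarith
  also have "\<dots> = (2 * ?m - 2 * (1 - d) * v + e / 2) / real n" by (simp add: add_divide_distrib diff_divide_distrib)
  finally have "c \<le> 2 * ?m - 2 * (1 - d) * v + e / 2" using n(2) by (simp add: divide_le_cancel)
  then show "c \<le> 2 * (?m - variance Z) + e" unfolding v_def[symmetric] using dv by (simp add: algebra_simps)
qed

end

end

text \<open>Bernoulli's inequality gives \<open>1 - c \<le> (1 - c / n)^n\<close>, so a larger
  \<open>r\<close> would have too large a power. This turns the hypothesis on \<open>n\<close>-th
  powers into a contraction of order \<open>1 / n\<close> per step.\<close>

lemma power_le_imp_le_bernoulli: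
  fixes r c :: real
  assumes n: "n > 0" and c: "0 \<le> c" "c \<le> 1" and r: "r ^ n \<le> 1 - c"
  shows "r \<le> 1 - c / real n"
proof (rule ccontr)
  assume "\<not> ?thesis"
  then have lt: "1 - c / real n < r" by simp
  have cn: "c / real n \<le> 1" using c n by (simp add: divide_le_eq)
  have "1 + real n * (- (c / real n)) \<le> (1 + - (c / real n)) ^ n"
    by (rule Bernoulli_inequality) (use cn in simp)
  also have "\<dots> < r ^ n" using lt cn n by (intro power_strict_mono) auto
  finally show False using r n by simp
qed

text \<open>With \<open>n > 0\<close> a finite power forces a finite moment, so the bound on the
  extended integral also yields integrability.\<close>

lemma exp_moment_bound:
  assumes M: "prob_space M" and g[measurable]: "g \<in> borel_measurable M" and n: "n > 0" and C: "0 \<le> C" "C < 1"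
    and le: "(\<integral>\<^sup>+ \<omega>. ennreal (exp (- 2 * g \<omega>)) \<partial>M) ^ n \<le> ennreal C"
  shows "integrable M (\<lambda>\<omega>. exp (- 2 * g \<omega>))" "(\<integral>\<omega>. exp (- 2 * g \<omega>) \<partial>M) \<le> 1 - (1 - C) / real n"
proof -
  let ?X = "\<integral>\<^sup>+ \<omega>. ennreal (exp (- 2 * g \<omega>)) \<partial>M"
  have "?X ^ n < \<infinity>" using le by (rule le_less_trans) simp
  then have fin: "?X < \<infinity>" using n by (simp add: power_less_top_ennreal)
  show int: "integrable M (\<lambda>\<omega>. exp (- 2 * g \<omega>))"
    by (rule integrableI_nonneg) (use fin in auto)
  have "?X = ennreal (\<integral>\<omega>. exp (- 2 * g \<omega>) \<partial>M)"
    by (rule nn_integral_eq_integral[OF int]) simp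
  then have "ennreal ((\<integral>\<omega>. exp (- 2 * g \<omega>) \<partial>M) ^ n) \<le> ennreal C"
    using le by (simp add: ennreal_power)
  then have le': "(\<integral>\<omega>. exp (- 2 * g \<omega>) \<partial>M) ^ n \<le> 1 - (1 - C)" using C by (simp add: ennreal_le_iff)
  show "(\<integral>\<omega>. exp (- 2 * g \<omega>) \<partial>M) \<le> 1 - (1 - C) / real n"
    by (rule power_le_imp_le_bernoulli[OF n _ _ le']) (use C in auto)
qed

text \<open>The bound is asked for \<open>i > 0\<close> only, because the chain estimates assume at
  least one step.\<close>

lemma (in finite_measure) measure_UN_incseq_le:
  assumes A: "range A \<subseteq> sets M" "incseq A" and le: "\<And>i. i > 0 \<Longrightarrow> measure M (A i) \<le> c"
  shows "measure M (\<Union>i. A i) \<le> c"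
proof (rule LIMSEQ_le_const2[OF finite_Lim_measure_incseq[OF A]])
  show "\<exists>N. \<forall>n\<ge>N. measure M (A n) \<le> c" using le by (intro exI[of _ 1]) auto
qed

lemma first_neg_time_finite: "first_neg_time f < \<infinity> \<longleftrightarrow> (\<exists>t>0. f t < 0)"
proof
  assume "\<exists>t>0. f t < 0"
  then obtain t where t: "t > 0" "f t < 0" by auto
  then have "first_neg_time f \<le> ereal t" unfolding first_neg_time_def by (intro Inf_lower) auto
  then show "first_neg_time f < \<infinity>" by (rule le_less_trans) simp
next
  assume fin: "first_neg_time f < \<infinity>"
  show "\<exists>t>0. f t < 0"
  proof (rule ccontr)
    assume "\<not> ?thesis"
    then have e: "{t. t > 0 \<and> f t < 0} = {}" by auto
    have "first_neg_time f = \<infinity>" unfolding first_neg_time_def e by (simp add: top_ereal_def)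
    with fin show False by simp
  qed
qed

lemma (in prob_space) same_law:
  fixes f :: "real \<Rightarrow> real"
  assumes [measurable]: "X \<in> borel_measurable M" "Y \<in> borel_measurable M" and d: "distr M borel X = distr M borel Y"
    and [measurable]: "f \<in> borel_measurable borel"
  shows "expectation (\<lambda>\<omega>. f (X \<omega>)) = expectation (\<lambda>\<omega>. f (Y \<omega>))"
    "integrable M (\<lambda>\<omega>. f (X \<omega>)) \<longleftrightarrow> integrable M (\<lambda>\<omega>. f (Y \<omega>))"
proof -
  have "expectation (\<lambda>\<omega>. f (X \<omega>)) = (\<integral>x. f x \<partial>distr M borel X)" by (subst integral_distr) auto
  also have "\<dots> = expectation (\<lambda>\<omega>. f (Y \<omega>))" unfolding d by (subst integral_distr) auto
  finally show "expectation (\<lambda>\<omega>. f (X \<omega>)) = expectation (\<lambda>\<omega>. f (Y \<omega>))" .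
  have "integrable M (\<lambda>\<omega>. f (X \<omega>)) \<longleftrightarrow> integrable (distr M borel X) f" by (subst integrable_distr_eq) auto
  also have "\<dots> \<longleftrightarrow> integrable M (\<lambda>\<omega>. f (Y \<omega>))" unfolding d by (subst integrable_distr_eq) auto
  finally show "integrable M (\<lambda>\<omega>. f (X \<omega>)) \<longleftrightarrow> integrable M (\<lambda>\<omega>. f (Y \<omega>))" .
qed

section \<open>Ruin bounds for the discrete model\<close>

locale random_coefficients = prob_space +
  fixes xi rho :: "nat \<Rightarrow> 'a \<Rightarrow> real"
  assumes xi_rv: "\<And>k. k \<ge> 1 \<Longrightarrow> xi k \<in> borel_measurable M"
    and rho_rv: "\<And>k. k \<ge> 1 \<Longrightarrow> rho k \<in> borel_measurable M"
    and indep: "indep_vars (\<lambda>_. borel)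
           (\<lambda>i. case i of Inl k \<Rightarrow> xi k | Inr k \<Rightarrow> rho k) (Inl ` {1..} \<union> Inr ` {1..})"
    and xi_law: "\<And>k. k \<ge> 1 \<Longrightarrow> distr M borel (xi k) = distr M borel (xi 1)"
    and rho_law: "\<And>k. k \<ge> 1 \<Longrightarrow> distr M borel (rho k) = distr M borel (rho 1)"
    and xi_sq: "integrable M (\<lambda>\<omega>. (xi 1 \<omega>)^2)"
    and rho_sq: "integrable M (\<lambda>\<omega>. (ln (rho 1 \<omega>))^2)"
    and xi_var: "integral\<^sup>L M (\<lambda>\<omega>. (xi 1 \<omega> - integral\<^sup>L M (xi 1))^2) > 0"
    and rho_var: "integral\<^sup>L M (\<lambda>\<omega>. (ln (rho 1 \<omega>) - integral\<^sup>L M (\<lambda>\<omega>. ln (rho 1 \<omega>)))^2) > 0"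
begin

definition "mx = expectation (xi 1)"
definition "mr = expectation (\<lambda>\<omega>. ln (rho 1 \<omega>))"
definition "sx = sqrt (expectation (\<lambda>\<omega>. (xi 1 \<omega> - expectation (xi 1))\<^sup>2))"
definition "sr = sqrt (expectation (\<lambda>\<omega>. (ln (rho 1 \<omega>) - expectation (\<lambda>\<omega>. ln (rho 1 \<omega>)))\<^sup>2))"

lemma sx2: "sx\<^sup>2 = variance (xi 1)" and sr2: "sr\<^sup>2 = variance (\<lambda>\<omega>. ln (rho 1 \<omega>))"
  using xi_var rho_var by (simp_all add: sx_def sr_def)

sublocale scale_function mx mr sx sr
  using xi_var rho_var by unfold_locales (simp_all add: sx_def sr_def)

text \<open>The random sequences are indexed from 1 and the coefficients of a chain from 0, hence
  \<open>Suc k\<close>.\<close>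

definition step :: "nat \<Rightarrow> nat \<Rightarrow> 'a \<Rightarrow> real \<times> real" where
  "step n k \<omega> = (xi_n mx xi n (Suc k) \<omega>, gamma_n mr rho n (Suc k) \<omega>)"

lemma xi_n_eq: "xi_n mx xi n k \<omega> = centred_scaling mx n (xi k \<omega>)"
  by (simp add: xi_n_def centred_scaling_def)

lemma gamma_n_eq: "gamma_n mr rho n k \<omega> = centred_scaling mr n (ln (rho k \<omega>))"
  by (simp add: gamma_n_def centred_scaling_def)

lemma step_measurable[measurable]:
  "(\<lambda>\<omega>. fst (step n k \<omega>)) \<in> borel_measurable M" "(\<lambda>\<omega>. snd (step n k \<omega>)) \<in> borel_measurable M"
proof -
  have [measurable]: "xi (Suc k) \<in> borel_measurable M" "rho (Suc k) \<in> borel_measurable M"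
    using xi_rv rho_rv by auto
  show "(\<lambda>\<omega>. fst (step n k \<omega>)) \<in> borel_measurable M" "(\<lambda>\<omega>. snd (step n k \<omega>)) \<in> borel_measurable M"
    unfolding step_def xi_n_def gamma_n_def by simp_all
qed

lemma theta_disc_chain: "theta_disc y mx mr xi rho n \<omega> k = chain y (\<lambda>i. step n i \<omega>) k"
  by (induction k) (simp_all add: step_def)

lemma ruin_iff:
  assumes "n > 0" "y \<ge> 0"
  shows "first_neg_time (theta_proc y mx mr xi rho n \<omega>) < \<infinity> \<longleftrightarrow> (\<exists>k. chain y (\<lambda>i. step n i \<omega>) k < 0)"
  unfolding first_neg_time_finite theta_proc_def theta_disc_chain
proof
  assume "\<exists>k. chain y (\<lambda>i. step n i \<omega>) k < 0"
  then obtain k where k: "chain y (\<lambda>i. step n i \<omega>) k < 0" by auto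
  \<comment> \<open>\<open>first_neg_time\<close> looks at positive times only; step 0 is ruled out
    by \<open>y \<ge> 0\<close>.\<close>
  then have "k \<noteq> 0" using assms by (cases k) auto
  moreover have "nat \<lfloor>real n * (real k / real n)\<rfloor> = k" using assms by simp
  ultimately show "\<exists>t>0. chain y (\<lambda>i. step n i \<omega>) (nat \<lfloor>real n * t\<rfloor>) < 0"
    using k assms by (intro exI[of _ "real k / real n"]) simp
qed auto

lemma step_indep: "indep_vars (\<lambda>_. borel) (step n) UNIV"
proof -
  let ?X = "\<lambda>i. case i of Inl k \<Rightarrow> xi k | Inr k \<Rightarrow> rho k"
  let ?K = "\<lambda>k. {Inl (Suc k), Inr (Suc k)} :: (nat + nat) set"
  have 1: "indep_vars (\<lambda>k. Pi\<^sub>M (?K k) (\<lambda>_. borel)) (\<lambda>k \<omega>. restrict (\<lambda>i. ?X i \<omega>) (?K k)) UNIV"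
    by (rule indep_vars_restrict[OF indep]) (auto simp: disjoint_family_on_def)
  let ?f = "\<lambda>k q. (centred_scaling mx n (q (Inl (Suc k))), centred_scaling mr n (ln (q (Inr (Suc k))))) :: real \<times> real"
  have "indep_vars (\<lambda>_. borel) (\<lambda>k \<omega>. ?f k (restrict (\<lambda>i. ?X i \<omega>) (?K k))) UNIV"
  proof (rule indep_vars_compose2[OF 1])
    fix k
    have [measurable]: "(\<lambda>q. q (Inl (Suc k))) \<in> borel_measurable (Pi\<^sub>M (?K k) (\<lambda>_. borel :: real measure))"
      "(\<lambda>q. q (Inr (Suc k))) \<in> borel_measurable (Pi\<^sub>M (?K k) (\<lambda>_. borel :: real measure))"
      by (auto intro!: measurable_component_singleton)
    show "?f k \<in> borel_measurable (Pi\<^sub>M (?K k) (\<lambda>_. borel))"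
      by (intro borel_measurable_Pair) measurable
  qed
  then show ?thesis
    by (rule indep_vars_cong[THEN iffD1, rotated -1]) (auto simp: step_def fun_eq_iff xi_n_eq gamma_n_eq)
qed

lemma step_chain: "indep_chain M (step n) K"
  by unfold_locales (rule indep_vars_subset[OF step_indep], simp)

lemma xi_rho_indep:
  assumes "k \<ge> 1"
  shows "indep_var borel (xi k) borel (rho k)"
proof -
  let ?X = "\<lambda>i. case i of Inl k \<Rightarrow> xi k | Inr k \<Rightarrow> rho k"
  have "indep_var (Pi\<^sub>M {Inl k} (\<lambda>_. borel)) (\<lambda>\<omega>. restrict (\<lambda>i. ?X i \<omega>) {Inl k}) (Pi\<^sub>M {Inr k} (\<lambda>_. borel)) (\<lambda>\<omega>. restrict (\<lambda>i. ?X i \<omega>) {Inr k})"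
    using assms by (intro indep_var_restrict[OF indep]) auto
  from indep_var_compose[OF this, of "\<lambda>q. q (Inl k)" borel "\<lambda>q. q (Inr k)" borel]
  show ?thesis by (simp add: comp_def)
qed

lemma step_product:
  fixes f g :: "real \<Rightarrow> real"
  assumes [measurable]: "f \<in> borel_measurable borel" "g \<in> borel_measurable borel"
    and i: "integrable M (\<lambda>\<omega>. f (fst (step n k \<omega>)))" "integrable M (\<lambda>\<omega>. g (snd (step n k \<omega>)))"
  shows "integrable M (\<lambda>\<omega>. f (fst (step n k \<omega>)) * g (snd (step n k \<omega>)))"
    "expectation (\<lambda>\<omega>. f (fst (step n k \<omega>)) * g (snd (step n k \<omega>))) =
      expectation (\<lambda>\<omega>. f (fst (step n k \<omega>))) * expectation (\<lambda>\<omega>. g (snd (step n k \<omega>)))"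
proof -
  have "indep_var borel ((\<lambda>z. f (centred_scaling mx n z)) \<circ> xi (Suc k)) borel ((\<lambda>z. g (centred_scaling mr n (ln z))) \<circ> rho (Suc k))"
    by (rule indep_var_compose[OF xi_rho_indep]) auto
  then have ind: "indep_var borel (\<lambda>\<omega>. f (fst (step n k \<omega>))) borel (\<lambda>\<omega>. g (snd (step n k \<omega>)))"
    by (simp add: comp_def step_def xi_n_eq gamma_n_eq)
  show "integrable M (\<lambda>\<omega>. f (fst (step n k \<omega>)) * g (snd (step n k \<omega>)))"
    "expectation (\<lambda>\<omega>. f (fst (step n k \<omega>)) * g (snd (step n k \<omega>))) =
      expectation (\<lambda>\<omega>. f (fst (step n k \<omega>))) * expectation (\<lambda>\<omega>. g (snd (step n k \<omega>)))"
    using indep_var_integrable[OF ind i] indep_var_lebesgue_integral[OF ind i] by auto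
qed

lemma step_law:
  fixes f :: "real \<Rightarrow> real"
  assumes [measurable]: "f \<in> borel_measurable borel"
  shows "expectation (\<lambda>\<omega>. f (fst (step n k \<omega>))) = expectation (\<lambda>\<omega>. f (centred_scaling mx n (xi 1 \<omega>)))"
    "integrable M (\<lambda>\<omega>. f (fst (step n k \<omega>))) \<longleftrightarrow> integrable M (\<lambda>\<omega>. f (centred_scaling mx n (xi 1 \<omega>)))"
    "expectation (\<lambda>\<omega>. f (snd (step n k \<omega>))) = expectation (\<lambda>\<omega>. f (centred_scaling mr n (ln (rho 1 \<omega>))))"
    "integrable M (\<lambda>\<omega>. f (snd (step n k \<omega>))) \<longleftrightarrow> integrable M (\<lambda>\<omega>. f (centred_scaling mr n (ln (rho 1 \<omega>))))"
proof -
  have rv: "xi (Suc k) \<in> borel_measurable M" "rho (Suc k) \<in> borel_measurable M"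
     "xi 1 \<in> borel_measurable M" "rho 1 \<in> borel_measurable M"
    using xi_rv rho_rv by auto
  have l: "distr M borel (xi (Suc k)) = distr M borel (xi 1)" "distr M borel (rho (Suc k)) = distr M borel (rho 1)"
    by (rule xi_law, simp, rule rho_law, simp)
  have m1: "(\<lambda>z. f (centred_scaling mx n z)) \<in> borel_measurable borel"
    by (rule measurable_compose[OF centred_scaling_measurable assms])
  have m2: "(\<lambda>z. f (centred_scaling mr n (ln z))) \<in> borel_measurable borel"
    by (rule measurable_compose[OF measurable_compose[OF borel_measurable_ln[OF measurable_ident_sets[OF refl]] centred_scaling_measurable] assms])
  note 1 = same_law[OF rv(1,3) l(1) m1] and 2 = same_law[OF rv(2,4) l(2) m2]
  show "expectation (\<lambda>\<omega>. f (fst (step n k \<omega>))) = expectation (\<lambda>\<omega>. f (centred_scaling mx n (xi 1 \<omega>)))"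
    "integrable M (\<lambda>\<omega>. f (fst (step n k \<omega>))) \<longleftrightarrow> integrable M (\<lambda>\<omega>. f (centred_scaling mx n (xi 1 \<omega>)))"
    "expectation (\<lambda>\<omega>. f (snd (step n k \<omega>))) = expectation (\<lambda>\<omega>. f (centred_scaling mr n (ln (rho 1 \<omega>))))"
    "integrable M (\<lambda>\<omega>. f (snd (step n k \<omega>))) \<longleftrightarrow> integrable M (\<lambda>\<omega>. f (centred_scaling mr n (ln (rho 1 \<omega>))))"
    unfolding step_def fst_conv snd_conv xi_n_eq gamma_n_eq by (rule 1 2)+
qed

lemma base_rv[measurable]: "xi (Suc 0) \<in> borel_measurable M" "(\<lambda>\<omega>. ln (rho (Suc 0) \<omega>)) \<in> borel_measurable M"
proof -
  show "xi (Suc 0) \<in> borel_measurable M" using xi_rv by simp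
  have [measurable]: "rho (Suc 0) \<in> borel_measurable M" using rho_rv by simp
  show "(\<lambda>\<omega>. ln (rho (Suc 0) \<omega>)) \<in> borel_measurable M" by measurable
qed

lemma base_rv1: "xi 1 \<in> borel_measurable M" "(\<lambda>\<omega>. ln (rho 1 \<omega>)) \<in> borel_measurable M"
  using base_rv by simp_all

lemma step_moments:
  assumes n: "n > 0"
  shows "integrable M (\<lambda>\<omega>. (fst (step n k \<omega>))\<^sup>2)" "integrable M (\<lambda>\<omega>. (snd (step n k \<omega>))\<^sup>2)"
    "integrable M (\<lambda>\<omega>. fst (step n k \<omega>))" "integrable M (\<lambda>\<omega>. snd (step n k \<omega>))"
    "expectation (\<lambda>\<omega>. fst (step n k \<omega>)) = mx / real n" "expectation (\<lambda>\<omega>. snd (step n k \<omega>)) = mr / real n"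
    "expectation (\<lambda>\<omega>. (fst (step n k \<omega>))\<^sup>2) = mx\<^sup>2 / (real n)\<^sup>2 + sx\<^sup>2 / real n"
    "expectation (\<lambda>\<omega>. (snd (step n k \<omega>))\<^sup>2) = mr\<^sup>2 / (real n)\<^sup>2 + sr\<^sup>2 / real n"
proof -
  note m1 = centred_scaling_moments[OF base_rv1(1) xi_sq n, folded mx_def sx2]
  note m2 = centred_scaling_moments[OF base_rv1(2) rho_sq n, folded mr_def sr2]
  show i: "integrable M (\<lambda>\<omega>. (fst (step n k \<omega>))\<^sup>2)" "integrable M (\<lambda>\<omega>. (snd (step n k \<omega>))\<^sup>2)"
    using m1(1) m2(1) step_law(2,4)[of "\<lambda>z. z\<^sup>2" n k] by simp_all
  show "integrable M (\<lambda>\<omega>. fst (step n k \<omega>))" "integrable M (\<lambda>\<omega>. snd (step n k \<omega>))"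
    by (rule square_integrable_imp_integrable; use i in simp)+
  show "expectation (\<lambda>\<omega>. fst (step n k \<omega>)) = mx / real n" "expectation (\<lambda>\<omega>. snd (step n k \<omega>)) = mr / real n"
    using m1(2) m2(2) step_law(1,3)[of "\<lambda>z. z" n k] by simp_all
  show "expectation (\<lambda>\<omega>. (fst (step n k \<omega>))\<^sup>2) = mx\<^sup>2 / (real n)\<^sup>2 + sx\<^sup>2 / real n"
    "expectation (\<lambda>\<omega>. (snd (step n k \<omega>))\<^sup>2) = mr\<^sup>2 / (real n)\<^sup>2 + sr\<^sup>2 / real n"
    using m1(3) m2(3) step_law(1,3)[of "\<lambda>z. z\<^sup>2" n k] by simp_all
qed

text \<open>The means are exact. By independence the mixed moment is the product of the means; it
  and the errors of the second moments are of order \<open>1 / n^2\<close>. The truncated moments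
  are covered by \<open>centred_scaling_lindeberg\<close>.\<close>

lemma step_diffusive:
  assumes e: "e > 0"
  shows "eventually (\<lambda>n. \<forall>k. diffusive_step mx mr sx sr M (1 / real n) e (\<lambda>\<omega>. fst (step n k \<omega>)) (\<lambda>\<omega>. snd (step n k \<omega>))) sequentially"
proof -
  have c0: "eventually (\<lambda>n. \<bar>c\<bar> / real n < e) sequentially" for c
    by (rule order_tendstoD[OF tendsto_divide_0[OF tendsto_const]])
      (use e in \<open>auto intro: filterlim_real_sequentially filterlim_at_top_imp_at_infinity\<close>)
  have l1: "eventually (\<lambda>n. expectation (\<lambda>\<omega>. (centred_scaling mx n (xi 1 \<omega>))\<^sup>2 * indicator {e<..} \<bar>centred_scaling mx n (xi 1 \<omega>)\<bar>) \<le> e * (1 / real n)) sequentially"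
    by (rule centred_scaling_lindeberg[OF base_rv1(1) xi_sq e e])
  have l2: "eventually (\<lambda>n. expectation (\<lambda>\<omega>. (centred_scaling mr n (ln (rho 1 \<omega>)))\<^sup>2 * indicator {e<..} \<bar>centred_scaling mr n (ln (rho 1 \<omega>))\<bar>) \<le> e * (1 / real n)) sequentially"
    by (rule centred_scaling_lindeberg[OF base_rv1(2) rho_sq e e])
  show ?thesis
    using l1 l2 c0[of "mx\<^sup>2"] c0[of "mr\<^sup>2"] c0[of "mx * mr"] eventually_gt_at_top[of 0]
  proof eventually_elim
    case (elim n)
    have n: "n > 0" by fact
    have sq: "\<bar>c / (real n)\<^sup>2\<bar> \<le> e * (1 / real n)" if "\<bar>c\<bar> / real n < e" for c
    proof -
      have "\<bar>c / (real n)\<^sup>2\<bar> = \<bar>c\<bar> / real n * (1 / real n)" by (simp add: power2_eq_square abs_mult)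
      also have "\<dots> \<le> e * (1 / real n)" using that by (intro mult_right_mono) auto
      finally show ?thesis .
    qed
    note s = sq[OF elim(3)] sq[OF elim(4)] sq[OF elim(5)]
    show ?case
    proof
      fix k
      have "expectation (\<lambda>\<omega>. fst (step n k \<omega>) * snd (step n k \<omega>)) = mx * mr / (real n)\<^sup>2"
        using step_product(2)[of "\<lambda>z. z" "\<lambda>z. z" n k] step_moments[OF n, of k] by (simp add: power2_eq_square)
      then have "\<bar>expectation (\<lambda>\<omega>. fst (step n k \<omega>) * snd (step n k \<omega>))\<bar> \<le> e * (1 / real n)" using s(3) by simp
      moreover have "expectation (\<lambda>\<omega>. (fst (step n k \<omega>))\<^sup>2 * indicator {e<..} \<bar>fst (step n k \<omega>)\<bar>) \<le> e * (1 / real n)"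
        using elim(1) step_law(1)[of "\<lambda>z. z\<^sup>2 * indicator {e<..} \<bar>z\<bar>" n k] by simp
      moreover have "expectation (\<lambda>\<omega>. (snd (step n k \<omega>))\<^sup>2 * indicator {e<..} \<bar>snd (step n k \<omega>)\<bar>) \<le> e * (1 / real n)"
        using elim(2) step_law(3)[of "\<lambda>z. z\<^sup>2 * indicator {e<..} \<bar>z\<bar>" n k] by simp
      ultimately show "diffusive_step mx mr sx sr M (1 / real n) e (\<lambda>\<omega>. fst (step n k \<omega>)) (\<lambda>\<omega>. snd (step n k \<omega>))"
        unfolding diffusive_step_def using step_moments[OF n, of k] s e by simp
    qed
  qed
qed

text \<open>Independence of \<open>xi\<close> and \<open>rho\<close> factors the moments of the
  discounted payment. Jensen gives \<open>u \<le> 1\<close>, and \<open>1 + x \<le> exp x\<close>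
  gives \<open>1 - mr / n \<le> u\<close>.\<close>

lemma step_contracting:
  assumes n: "n > 0" and c: "c > 0"
    and int: "integrable M (\<lambda>\<omega>. exp (- 2 * gamma_n mr rho n 1 \<omega>))"
    and le: "expectation (\<lambda>\<omega>. exp (- 2 * gamma_n mr rho n 1 \<omega>)) \<le> 1 - c / real n"
  defines "u \<equiv> expectation (\<lambda>\<omega>. exp (- gamma_n mr rho n 1 \<omega>))"
  shows "contracting_step M (1 / real n) c (mx\<^sup>2 + sx\<^sup>2 + \<bar>mx\<bar> + \<bar>mr\<bar>) u (u * (mx / real n)) (\<lambda>\<omega>. fst (step n k \<omega>)) (\<lambda>\<omega>. snd (step n k \<omega>))"
proof -
  let ?C = "mx\<^sup>2 + sx\<^sup>2 + \<bar>mx\<bar> + \<bar>mr\<bar>"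
  have n1: "real n \<ge> 1" using n by simp
  have e2: "(exp (- z))\<^sup>2 = exp (- 2 * z)" for z :: real by (simp add: power2_eq_square flip: exp_add)
  have iE: "integrable M (\<lambda>\<omega>. (exp (- snd (step n k \<omega>)))\<^sup>2)"
    using int step_law(4)[of "\<lambda>z. exp (- 2 * z)" n k] unfolding e2 gamma_n_eq by simp
  have iE1: "integrable M (\<lambda>\<omega>. exp (- snd (step n k \<omega>)))"
    by (rule square_integrable_imp_integrable; use iE in simp)
  have u: "expectation (\<lambda>\<omega>. exp (- snd (step n k \<omega>))) = u"
    unfolding u_def gamma_n_eq using step_law(3)[of "\<lambda>z. exp (- z)" n k] by simp
  have E2: "expectation (\<lambda>\<omega>. (exp (- snd (step n k \<omega>)))\<^sup>2) \<le> 1 - c / real n"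
    using le step_law(3)[of "\<lambda>z. exp (- 2 * z)" n k] unfolding e2 gamma_n_eq by simp
  have E21: "expectation (\<lambda>\<omega>. (exp (- snd (step n k \<omega>)))\<^sup>2) \<le> 1"
    using E2 c n1 by (smt (verit) divide_nonneg_nonneg)
  have E20: "0 \<le> expectation (\<lambda>\<omega>. (exp (- snd (step n k \<omega>)))\<^sup>2)" by (rule Bochner_Integration.integral_nonneg) simp
  note m = step_moments[OF n, of k]
  have u0: "0 \<le> u" unfolding u_def by (rule Bochner_Integration.integral_nonneg) simp
  have "0 \<le> variance (\<lambda>\<omega>. exp (- snd (step n k \<omega>)))" by (rule Bochner_Integration.integral_nonneg) simp
  also have "\<dots> = expectation (\<lambda>\<omega>. (exp (- snd (step n k \<omega>)))\<^sup>2) - u\<^sup>2"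
    using variance_eq[OF iE1 iE] unfolding u .
  finally have "u\<^sup>2 \<le> 1\<^sup>2" using E21 by simp
  then have u1: "u \<le> 1" by (rule power2_le_imp_le) simp
  have i1: "integrable M (\<lambda>\<omega>. (exp (- snd (step n k \<omega>)) * fst (step n k \<omega>))\<^sup>2)"
    and E1: "expectation (\<lambda>\<omega>. (exp (- snd (step n k \<omega>)) * fst (step n k \<omega>))\<^sup>2) =
      (mx\<^sup>2 / (real n)\<^sup>2 + sx\<^sup>2 / real n) * expectation (\<lambda>\<omega>. (exp (- snd (step n k \<omega>)))\<^sup>2)"
    using step_product[of "\<lambda>z. z\<^sup>2" "\<lambda>z. (exp (- z))\<^sup>2" n k] m iE by (simp_all add: power_mult_distrib mult.commute)
  have E3: "expectation (\<lambda>\<omega>. exp (- snd (step n k \<omega>)) * fst (step n k \<omega>)) = u * (mx / real n)"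
    using step_product[of "\<lambda>z. z" "\<lambda>z. exp (- z)" n k] m iE1 u by (simp add: mult.commute)
  have sq: "mx\<^sup>2 / (real n)\<^sup>2 \<le> mx\<^sup>2 / real n" using n1 by (intro divide_left_mono) (auto simp: power2_eq_square)
  have C: "?C * (1 / real n) = mx\<^sup>2 / real n + sx\<^sup>2 / real n + \<bar>mx\<bar> / real n + \<bar>mr\<bar> / real n"
    by (simp add: add_divide_distrib)
  have nn: "0 \<le> mx\<^sup>2 / real n" "0 \<le> sx\<^sup>2 / real n" "0 \<le> \<bar>mx\<bar> / real n" "0 \<le> \<bar>mr\<bar> / real n" by auto
  have "(mx\<^sup>2 / (real n)\<^sup>2 + sx\<^sup>2 / real n) * expectation (\<lambda>\<omega>. (exp (- snd (step n k \<omega>)))\<^sup>2)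
      \<le> (mx\<^sup>2 / real n + sx\<^sup>2 / real n) * 1"
    using sq E21 E20 nn by (intro mult_mono add_mono) auto
  then have b1: "expectation (\<lambda>\<omega>. (exp (- snd (step n k \<omega>)) * fst (step n k \<omega>))\<^sup>2) \<le> ?C * (1 / real n)"
    unfolding E1 C by (rule order_trans) simp
  have "\<bar>u * (mx / real n)\<bar> \<le> \<bar>mx\<bar> / real n"
    using u0 u1 mult_right_mono[OF u1 nn(3)] by (simp add: abs_mult)
  then have b2: "\<bar>u * (mx / real n)\<bar> \<le> ?C * (1 / real n)" unfolding C using nn by linarith
  have "1 - mr / real n \<le> u"
  proof -
    have "1 - mr / real n = expectation (\<lambda>\<omega>. 1 + (- snd (step n k \<omega>)))" using m by (simp add: prob_space)
    also have "\<dots> \<le> expectation (\<lambda>\<omega>. exp (- snd (step n k \<omega>)))"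
      using m iE1 by (intro integral_mono exp_ge_add_one_self) auto
    finally show ?thesis using u by simp
  qed
  moreover have "mr / real n \<le> \<bar>mr\<bar> / real n" by (intro divide_right_mono) auto
  ultimately have b3: "1 - ?C * (1 / real n) \<le> u" unfolding C using nn by linarith
  show ?thesis
    unfolding contracting_step_def using iE i1 u E3 E2 b1 b2 b3 by simp
qed

lemma ruin_sets:
  "{\<omega> \<in> space M. \<exists>k\<le>K. chain y (\<lambda>i. step n i \<omega>) k < L} \<in> sets M" for K :: nat
proof -
  interpret indep_chain M "step n" K by (rule step_chain)
  have "{\<omega> \<in> space M. \<exists>k\<le>K. chain y (\<lambda>i. step n i \<omega>) k < L} =
      (\<Union>k\<in>{..K}. {\<omega> \<in> space M. chain y (\<lambda>i. step n i \<omega>) k < L})" by auto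
  also have "\<dots> \<in> sets M"
  proof (rule sets.finite_UN)
    fix k assume "k \<in> {..K}"
    then have [measurable]: "(\<lambda>\<omega>. chain y (\<lambda>i. step n i \<omega>) k) \<in> borel_measurable M" by (intro chain_rv) auto
    show "{\<omega> \<in> space M. chain y (\<lambda>i. step n i \<omega>) k < L} \<in> sets M" by measurable
  qed simp
  finally show ?thesis .
qed

definition ruin_prob :: "real \<Rightarrow> nat \<Rightarrow> real" where
  "ruin_prob y n = prob {\<omega> \<in> space M. first_neg_time (theta_proc y mx mr xi rho n \<omega>) < \<infinity>}"

lemma ruin_event:
  assumes "n > 0" "y \<ge> 0"
  shows "{\<omega> \<in> space M. first_neg_time (theta_proc y mx mr xi rho n \<omega>) < \<infinity>} =
     (\<Union>K. {\<omega> \<in> space M. \<exists>k\<le>K. chain y (\<lambda>i. step n i \<omega>) k < 0})"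
  unfolding ruin_iff[OF assms] by auto

lemma ruin_prob_lower:
  assumes y: "0 \<le> y" "y < B" and e: "e > 0"
  shows "eventually (\<lambda>n. (scale B - scale y) / scale B - e \<le> ruin_prob y n) sequentially"
proof -
  obtain L d T where L: "L < 0" and d: "d > 0" and low:
    "\<And>(M :: 'a measure) p K h. indep_chain M p K \<Longrightarrow> h > 0 \<Longrightarrow>
       (\<And>k. k < K \<Longrightarrow> diffusive_step mx mr sx sr M h d (\<lambda>\<omega>. fst (p k \<omega>)) (\<lambda>\<omega>. snd (p k \<omega>))) \<Longrightarrow>
       0 < K \<Longrightarrow> T \<le> real K * h \<Longrightarrow>
       (scale B - scale y) / scale B - e \<le> measure M {\<omega> \<in> space M. \<exists>k\<le>K. chain y (\<lambda>i. p i \<omega>) k < L}"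
  proof -
    show thesis
    proof (rule chain_ruin_lower[where 'a='a, OF y e], goal_cases)
      case (1 L d T)
      show ?case by (rule that[OF 1])
    qed
  qed
  show ?thesis
    using step_diffusive[OF d] eventually_gt_at_top[of 0]
  proof eventually_elim
    case (elim n)
    \<comment> \<open>Enough steps of length \<open>1 / n\<close> to reach the time
      \<open>T\<close>, and at least one.\<close>
    define K where "K = nat \<lceil>\<bar>T\<bar> * real n\<rceil> + 1"
    have K: "K > 0" "\<bar>T\<bar> * real n \<le> real K" unfolding K_def by (simp, linarith)
    have "T * real n \<le> \<bar>T\<bar> * real n" by (intro mult_right_mono) auto
    also have "\<dots> \<le> real K" by (rule K(2))
    finally have "T * real n \<le> real K" .
    then have TK: "T \<le> real K * (1 / real n)" using elim(2) by (simp add: pos_le_divide_eq)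
    have "(scale B - scale y) / scale B - e \<le> prob {\<omega> \<in> space M. \<exists>k\<le>K. chain y (\<lambda>i. step n i \<omega>) k < L}"
    proof (rule low[OF step_chain])
      show "1 / real n > 0" using elim(2) by simp
      show "diffusive_step mx mr sx sr M (1 / real n) d (\<lambda>\<omega>. fst (step n k \<omega>)) (\<lambda>\<omega>. snd (step n k \<omega>))" for k
        using elim(1) by blast
    qed (rule K TK)+
    also have "\<dots> \<le> ruin_prob y n"
      unfolding ruin_prob_def ruin_event[OF elim(2) y(1)]
    proof (rule finite_measure_mono)
      show "{\<omega> \<in> space M. \<exists>k\<le>K. chain y (\<lambda>i. step n i \<omega>) k < L} \<subseteq> (\<Union>K. {\<omega> \<in> space M. \<exists>k\<le>K. chain y (\<lambda>i. step n i \<omega>) k < 0})"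
        using L by fastforce
      show "(\<Union>K. {\<omega> \<in> space M. \<exists>k\<le>K. chain y (\<lambda>i. step n i \<omega>) k < 0}) \<in> sets M"
        by (intro sets.countable_UN image_subsetI ruin_sets)
    qed
    finally show ?case .
  qed
qed

text \<open>The bound of \<open>chain_ruin_upper\<close> does not depend on the number of steps, so
  it passes to the increasing union over all horizons.\<close>

lemma ruin_prob_upper:
  assumes y: "0 \<le> y" and e: "e > 0" and c: "c > 0"
    and T: "\<And>x. scale x < T" and lim: "(scale \<longlongrightarrow> T) at_top"
    and mom: "\<And>n. n \<ge> n0 \<Longrightarrow> integrable M (\<lambda>\<omega>. exp (- 2 * gamma_n mr rho n 1 \<omega>)) \<and>
       expectation (\<lambda>\<omega>. exp (- 2 * gamma_n mr rho n 1 \<omega>)) \<le> 1 - c / real n"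
  shows "eventually (\<lambda>n. ruin_prob y n \<le> (T - scale y) / T + e) sequentially"
proof -
  let ?C = "mx\<^sup>2 + sx\<^sup>2 + \<bar>mx\<bar> + \<bar>mr\<bar>"
  have C: "?C \<ge> 0" by simp
  obtain d where d: "d > 0" and up:
    "\<And>(M :: 'a measure) p K h u v. indep_chain M p K \<Longrightarrow> h > 0 \<Longrightarrow>
       (\<And>k. k < K \<Longrightarrow> diffusive_step mx mr sx sr M h d (\<lambda>\<omega>. fst (p k \<omega>)) (\<lambda>\<omega>. snd (p k \<omega>))) \<Longrightarrow>
       (\<And>k. k < K \<Longrightarrow> contracting_step M h c ?C u v (\<lambda>\<omega>. fst (p k \<omega>)) (\<lambda>\<omega>. snd (p k \<omega>))) \<Longrightarrow>
       0 < K \<Longrightarrow>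
       measure M {\<omega> \<in> space M. \<exists>k\<le>K. chain y (\<lambda>i. p i \<omega>) k < 0} \<le> (T - scale y) / T + e"
  proof -
    show thesis
    proof (rule chain_ruin_upper[where 'a='a, OF y e c C T lim], goal_cases)
      case (1 d)
      show ?case by (rule that[OF 1])
    qed
  qed
  show ?thesis
    using step_diffusive[OF d] eventually_gt_at_top[of 0] eventually_ge_at_top[of n0]
  proof eventually_elim
    case (elim n)
    show ?case
      unfolding ruin_prob_def ruin_event[OF elim(2) y]
    proof (rule measure_UN_incseq_le)
      show "range (\<lambda>K. {\<omega> \<in> space M. \<exists>k\<le>K. chain y (\<lambda>i. step n i \<omega>) k < 0}) \<subseteq> sets M"
        by (intro image_subsetI ruin_sets)
      show "incseq (\<lambda>K. {\<omega> \<in> space M. \<exists>k\<le>K. chain y (\<lambda>i. step n i \<omega>) k < 0})"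
        by (intro incseq_SucI) (auto intro: le_SucI)
      show "prob {\<omega> \<in> space M. \<exists>k\<le>K. chain y (\<lambda>i. step n i \<omega>) k < 0} \<le> (T - scale y) / T + e" if "K > 0" for K
      proof (rule up[OF step_chain])
        show "1 / real n > 0" using elim(2) by simp
        show "diffusive_step mx mr sx sr M (1 / real n) d (\<lambda>\<omega>. fst (step n k \<omega>)) (\<lambda>\<omega>. snd (step n k \<omega>))" for k
          using elim(1) by blast
        show "contracting_step M (1 / real n) c ?C (expectation (\<lambda>\<omega>. exp (- gamma_n mr rho n 1 \<omega>)))
            (expectation (\<lambda>\<omega>. exp (- gamma_n mr rho n 1 \<omega>)) * (mx / real n)) (\<lambda>\<omega>. fst (step n k \<omega>)) (\<lambda>\<omega>. snd (step n k \<omega>))" for k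
          using mom[OF elim(3)] by (intro step_contracting[OF elim(2) c]) blast+
        show "0 < K" by (rule that)
      qed
    qed
  qed
qed

end

section \<open>The diffusion and its exact skeleton\<close>

text \<open>Completing the square: exponential tilting shifts the mean of a centred Gaussian by
  \<open>c \<sigma>^2\<close>.\<close>

lemma mult_exp_normal_density:
  assumes "\<sigma> > 0"
  shows "normal_density 0 \<sigma> x * exp (c * x) = exp (c\<^sup>2 * \<sigma>\<^sup>2 / 2) * normal_density (c * \<sigma>\<^sup>2) \<sigma> x"
proof -
  have "- (x - 0)\<^sup>2 / (2 * \<sigma>\<^sup>2) + c * x = c\<^sup>2 * \<sigma>\<^sup>2 / 2 + - (x - c * \<sigma>\<^sup>2)\<^sup>2 / (2 * \<sigma>\<^sup>2)"
    using assms by (simp add: field_simps power2_eq_square)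
  then show ?thesis unfolding normal_density_def by (simp add: mult_exp_exp)
qed

lemma (in prob_space) expectation_mult_indep_vars:
  fixes f g :: "real \<Rightarrow> real"
  assumes ind: "indep_vars (\<lambda>_. borel) X J" and ab: "a \<in> J" "b \<in> J" "a \<noteq> b"
    and [measurable]: "f \<in> borel_measurable borel" "g \<in> borel_measurable borel"
    and i: "integrable M (\<lambda>\<omega>. f (X a \<omega>))" "integrable M (\<lambda>\<omega>. g (X b \<omega>))"
  shows "integrable M (\<lambda>\<omega>. f (X a \<omega>) * g (X b \<omega>))"
    "expectation (\<lambda>\<omega>. f (X a \<omega>) * g (X b \<omega>)) = expectation (\<lambda>\<omega>. f (X a \<omega>)) * expectation (\<lambda>\<omega>. g (X b \<omega>))"
proof -
  let ?Y = "\<lambda>i x. if i = a then f x else g x"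
  have "indep_vars (\<lambda>_. borel) X {a, b}" using indep_vars_subset[OF ind] ab by simp
  then have ind2: "indep_vars (\<lambda>_. borel) (\<lambda>i \<omega>. ?Y i (X i \<omega>)) {a, b}"
    by (rule indep_vars_compose2) simp
  have ii: "integrable M (\<lambda>\<omega>. ?Y i (X i \<omega>))" if "i \<in> {a, b}" for i
    using that i ab(3) by auto
  note r = indep_vars_integrable[OF _ ind2 ii] indep_vars_lebesgue_integral[OF _ ind2 ii]
  show "integrable M (\<lambda>\<omega>. f (X a \<omega>) * g (X b \<omega>))"
    "expectation (\<lambda>\<omega>. f (X a \<omega>) * g (X b \<omega>)) = expectation (\<lambda>\<omega>. f (X a \<omega>)) * expectation (\<lambda>\<omega>. g (X b \<omega>))"
    using r ab(3) by simp_all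
qed

section \<open>Brownian increments and the sigma-algebra of a path\<close>

locale brownian_motion = prob_space +
  fixes B :: "real \<Rightarrow> 'a \<Rightarrow> real"
  assumes BM: "std_BM M B"
begin

lemma B_rv[measurable]: "B t \<in> borel_measurable M"
  using BM by (auto simp: std_BM_def)

lemma B_0: "\<omega> \<in> space M \<Longrightarrow> B 0 \<omega> = 0"
  using BM by (auto simp: std_BM_def)

lemma B_dist:
  assumes "0 \<le> s" "s < t"
  shows "distributed M lborel (\<lambda>\<omega>. B t \<omega> - B s \<omega>) (\<lambda>x. ennreal (normal_density 0 (sqrt (t - s)) x))"
  using BM assms by (auto simp: std_BM_def)

lemma B_indep:
  fixes ts :: "nat \<Rightarrow> real"
  assumes "0 \<le> ts 0" "\<And>i. i < k \<Longrightarrow> ts i < ts (Suc i)"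
  shows "indep_vars (\<lambda>_. borel) (\<lambda>i \<omega>. B (ts (Suc i)) \<omega> - B (ts i) \<omega>) {..<k}"
  using BM assms by (auto simp: std_BM_def)

lemma increment_exp:
  assumes st: "0 \<le> s" "s \<le> t"
  shows "integrable M (\<lambda>\<omega>. exp (c * (B t \<omega> - B s \<omega>)))"
    "expectation (\<lambda>\<omega>. exp (c * (B t \<omega> - B s \<omega>))) = exp (c\<^sup>2 * (t - s) / 2)"
proof -
  have "integrable M (\<lambda>\<omega>. exp (c * (B t \<omega> - B s \<omega>))) \<and>
    expectation (\<lambda>\<omega>. exp (c * (B t \<omega> - B s \<omega>))) = exp (c\<^sup>2 * (t - s) / 2)"
  \<comment> \<open>\<open>std_BM\<close> prescribes the law of increments for \<open>s < t\<close>
    only.\<close>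
  proof (cases "s = t")
    case True
    then show ?thesis by (simp add: prob_space)
  next
    case False
    then have lt: "s < t" using st by simp
    define \<sigma> where "\<sigma> = sqrt (t - s)"
    have \<sigma>: "\<sigma> > 0" "\<sigma>\<^sup>2 = t - s" using lt by (auto simp: \<sigma>_def)
    note D = B_dist[OF st(1) lt, folded \<sigma>_def]
    have "integrable lborel (\<lambda>x. normal_density 0 \<sigma> x * exp (c * x))"
      unfolding mult_exp_normal_density[OF \<sigma>(1)] using \<sigma>(1) by simp
    then have 1: "integrable M (\<lambda>\<omega>. exp (c * (B t \<omega> - B s \<omega>)))"
      by (subst (asm) distributed_integrable[OF D]) (auto simp: normal_density_nonneg)
    have "(\<integral>x. normal_density 0 \<sigma> x * exp (c * x) \<partial>lborel) = exp (c\<^sup>2 * \<sigma>\<^sup>2 / 2)"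
      unfolding mult_exp_normal_density[OF \<sigma>(1)] using \<sigma>(1) by simp
    then have "expectation (\<lambda>\<omega>. exp (c * (B t \<omega> - B s \<omega>))) = exp (c\<^sup>2 * \<sigma>\<^sup>2 / 2)"
      by (subst (asm) distributed_integral[OF D]) (auto simp: normal_density_nonneg)
    with 1 show ?thesis by (simp add: \<sigma>)
  qed
  then show "integrable M (\<lambda>\<omega>. exp (c * (B t \<omega> - B s \<omega>)))"
    "expectation (\<lambda>\<omega>. exp (c * (B t \<omega> - B s \<omega>))) = exp (c\<^sup>2 * (t - s) / 2)" by auto
qed

lemma increment_moments:
  assumes st: "0 \<le> s" "s \<le> t"
  shows "integrable M (\<lambda>\<omega>. (B t \<omega> - B s \<omega>) ^ k)"
    "expectation (\<lambda>\<omega>. B t \<omega> - B s \<omega>) = 0"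
    "expectation (\<lambda>\<omega>. (B t \<omega> - B s \<omega>)\<^sup>2) = t - s"
    "expectation (\<lambda>\<omega>. (B t \<omega> - B s \<omega>) ^ 4) = 3 * (t - s)\<^sup>2"
proof -
  have "integrable M (\<lambda>\<omega>. (B t \<omega> - B s \<omega>) ^ k) \<and> expectation (\<lambda>\<omega>. B t \<omega> - B s \<omega>) = 0 \<and>
    expectation (\<lambda>\<omega>. (B t \<omega> - B s \<omega>)\<^sup>2) = t - s \<and> expectation (\<lambda>\<omega>. (B t \<omega> - B s \<omega>) ^ 4) = 3 * (t - s)\<^sup>2"
  proof (cases "s = t")
    case True
    then show ?thesis by (simp add: prob_space)
  next
    case False
    then have lt: "s < t" using st by simp
    define \<sigma> where "\<sigma> = sqrt (t - s)"
    have \<sigma>: "\<sigma> > 0" "\<sigma>\<^sup>2 = t - s" using lt by (auto simp: \<sigma>_def)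
    note D = B_dist[OF st(1) lt, folded \<sigma>_def]
    have int: "expectation (\<lambda>\<omega>. (B t \<omega> - B s \<omega>) ^ k) = (\<integral>x. normal_density 0 \<sigma> x * x ^ k \<partial>lborel)" for k
      by (rule distributed_integral[OF D, symmetric]) (auto simp: normal_density_nonneg)
    have "integrable lborel (\<lambda>x. normal_density 0 \<sigma> x * x ^ k)"
      using integrable_normal_moment[OF \<sigma>(1), of 0 k] by simp
    then have 1: "integrable M (\<lambda>\<omega>. (B t \<omega> - B s \<omega>) ^ k)"
      by (subst (asm) distributed_integrable[OF D]) (auto simp: normal_density_nonneg)
    have 2: "expectation (\<lambda>\<omega>. B t \<omega> - B s \<omega>) = 0"
      using int[of 1] integral_normal_moment_odd[OF \<sigma>(1), of 0 0] by simp
    have 3: "expectation (\<lambda>\<omega>. (B t \<omega> - B s \<omega>)\<^sup>2) = t - s"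
      using int[of 2] integral_normal_moment_even[OF \<sigma>(1), of 0 1] \<sigma> by simp
    have 4: "expectation (\<lambda>\<omega>. (B t \<omega> - B s \<omega>) ^ 4) = 3 * (t - s)\<^sup>2"
      using int[of 4] integral_normal_moment_even[OF \<sigma>(1), of 0 2] \<sigma>
      by (simp add: fact_numeral power_divide)
    from 1 2 3 4 show ?thesis by simp
  qed
  then show "integrable M (\<lambda>\<omega>. (B t \<omega> - B s \<omega>) ^ k)"
    "expectation (\<lambda>\<omega>. B t \<omega> - B s \<omega>) = 0"
    "expectation (\<lambda>\<omega>. (B t \<omega> - B s \<omega>)\<^sup>2) = t - s"
    "expectation (\<lambda>\<omega>. (B t \<omega> - B s \<omega>) ^ 4) = 3 * (t - s)\<^sup>2" by auto
qed

text \<open>\<open>std_BM\<close> gives independence of consecutive increments over strictly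
  increasing times. Degenerate intervals are therefore split off, and a gap between \<open>s\<close>
  and \<open>t\<close> is filled by a middle increment.\<close>

lemma increments_product:
  fixes f g :: "real \<Rightarrow> real"
  assumes t: "0 \<le> r" "r \<le> s" "s \<le> t" "t \<le> u"
    and [measurable]: "f \<in> borel_measurable borel" "g \<in> borel_measurable borel"
    and i: "integrable M (\<lambda>\<omega>. f (B s \<omega> - B r \<omega>))" "integrable M (\<lambda>\<omega>. g (B u \<omega> - B t \<omega>))"
  shows "integrable M (\<lambda>\<omega>. f (B s \<omega> - B r \<omega>) * g (B u \<omega> - B t \<omega>))"
    "expectation (\<lambda>\<omega>. f (B s \<omega> - B r \<omega>) * g (B u \<omega> - B t \<omega>)) =
      expectation (\<lambda>\<omega>. f (B s \<omega> - B r \<omega>)) * expectation (\<lambda>\<omega>. g (B u \<omega> - B t \<omega>))"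
proof -
  have "integrable M (\<lambda>\<omega>. f (B s \<omega> - B r \<omega>) * g (B u \<omega> - B t \<omega>)) \<and>
    expectation (\<lambda>\<omega>. f (B s \<omega> - B r \<omega>) * g (B u \<omega> - B t \<omega>)) =
      expectation (\<lambda>\<omega>. f (B s \<omega> - B r \<omega>)) * expectation (\<lambda>\<omega>. g (B u \<omega> - B t \<omega>))"
  proof -
    consider "r = s" | "t = u" | "r < s" "t < u" "s = t" | "r < s" "t < u" "s < t" using t by linarith
    then show ?thesis
    proof cases
      case 1
      then show ?thesis using i by (simp add: prob_space)
    next
      case 2
      then show ?thesis using i by (simp add: prob_space)
    next
      case 3
      define ts :: "nat \<Rightarrow> real" where "ts i = (if i = 0 then r else if i = 1 then s else u)" for i
      have "indep_vars (\<lambda>_. borel) (\<lambda>i \<omega>. B (ts (Suc i)) \<omega> - B (ts i) \<omega>) {..<2}"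
        by (rule B_indep) (use t 3 in \<open>auto simp: ts_def\<close>)
      note r = expectation_mult_indep_vars[OF this, of 0 1 f g]
      show ?thesis using r i 3 by (simp add: ts_def)
    next
      case 4
      define ts :: "nat \<Rightarrow> real" where "ts i = (if i = 0 then r else if i = 1 then s else if i = 2 then t else u)" for i
      have "indep_vars (\<lambda>_. borel) (\<lambda>i \<omega>. B (ts (Suc i)) \<omega> - B (ts i) \<omega>) {..<3}"
        by (rule B_indep) (use t 4 in \<open>auto simp: ts_def less_Suc_eq numeral_eq_Suc\<close>)
      note r = expectation_mult_indep_vars[OF this, of 0 2 f g]
      show ?thesis using r i 4 by (simp add: ts_def)
    qed
  qed
  then show "integrable M (\<lambda>\<omega>. f (B s \<omega> - B r \<omega>) * g (B u \<omega> - B t \<omega>))"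
    "expectation (\<lambda>\<omega>. f (B s \<omega> - B r \<omega>) * g (B u \<omega> - B t \<omega>)) =
      expectation (\<lambda>\<omega>. f (B s \<omega> - B r \<omega>)) * expectation (\<lambda>\<omega>. g (B u \<omega> - B t \<omega>))" by auto
qed

text \<open>The sigma-algebra on the sample space generated by the path on \<open>{0..}\<close>.
  Independence of the paths as random functions passes to all variables measurable with respect to
  it.\<close>

definition path_algebra :: "'a measure" where
  "path_algebra = vimage_algebra (space M) (\<lambda>\<omega>. restrict (\<lambda>t. B t \<omega>) {0..}) (Pi\<^sub>M {0..} (\<lambda>_. borel))"

lemma space_path_algebra: "space path_algebra = space M"
  by (simp add: path_algebra_def)

lemma path_space: "(\<lambda>\<omega>. restrict (\<lambda>t. B t \<omega>) {0..}) \<in> space M \<rightarrow> space (Pi\<^sub>M {0..} (\<lambda>_. borel))"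
  by (auto simp: space_PiM)

lemma B_path: "0 \<le> t \<Longrightarrow> B t \<in> borel_measurable path_algebra"
proof -
  assume t: "0 \<le> t"
  have "(\<lambda>\<omega>. restrict (\<lambda>t. B t \<omega>) {0..}) \<in> measurable path_algebra (Pi\<^sub>M {0..} (\<lambda>_. borel))"
    unfolding path_algebra_def by (rule measurable_vimage_algebra1[OF path_space])
  then have "(\<lambda>\<omega>. restrict (\<lambda>t. B t \<omega>) {0..} t) \<in> borel_measurable path_algebra"
    by (rule measurable_compose) (rule measurable_component_singleton, use t in simp)
  then show ?thesis using t by simp
qed

lemma path_algebra_sub:
  assumes "F \<in> measurable path_algebra S"
  shows "F \<in> measurable M S"
proof (rule measurableI)
  fix \<omega> assume "\<omega> \<in> space M"
  then show "F \<omega> \<in> space S" using measurable_space[OF assms] by (simp add: space_path_algebra)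
next
  fix A assume A: "A \<in> sets S"
  have "F -` A \<inter> space M \<in> sets path_algebra" using measurable_sets[OF assms A] by (simp add: space_path_algebra)
  then obtain S' where S': "S' \<in> sets (Pi\<^sub>M {0..} (\<lambda>_. borel :: real measure))"
    "F -` A \<inter> space M = (\<lambda>\<omega>. restrict (\<lambda>t. B t \<omega>) {0..}) -` S' \<inter> space M"
    unfolding path_algebra_def sets_vimage_algebra2[OF path_space] by auto
  have "(\<lambda>\<omega>. restrict (\<lambda>t. B t \<omega>) {0..}) \<in> measurable M (Pi\<^sub>M {0..} (\<lambda>_. borel))"
    by (rule measurable_restrict) simp
  from measurable_sets[OF this S'(1)] show "F -` A \<inter> space M \<in> sets M" unfolding S'(2) .
qed

end

section \<open>Two independent Brownian paths and weighted sums of increments\<close>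

locale gou_paths = scale_function mx mr sx sr + prob_space N
  for mx mr sx sr :: real and N :: "'b measure" +
  fixes W W' :: "real \<Rightarrow> 'b \<Rightarrow> real"
  assumes W: "std_BM N W" and W': "std_BM N W'"
    and indep: "indep_var
            (Pi\<^sub>M {0..} (\<lambda>_. borel)) (\<lambda>\<omega>. restrict (\<lambda>t. W t \<omega>) {0..})
            (Pi\<^sub>M {0..} (\<lambda>_. borel)) (\<lambda>\<omega>. restrict (\<lambda>t. W' t \<omega>) {0..})"
begin

sublocale W: brownian_motion N W by unfold_locales (rule W)
sublocale W': brownian_motion N W' by unfold_locales (rule W')

abbreviation "\<F> \<equiv> W.path_algebra"
abbreviation "\<F>' \<equiv> W'.path_algebra"

definition R :: "real \<Rightarrow> 'b \<Rightarrow> real" where "R t \<omega> = mr * t + sr * W t \<omega>"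
definition X :: "real \<Rightarrow> 'b \<Rightarrow> real" where "X t \<omega> = mx * t + sx * W' t \<omega>"

lemma W_path[measurable]: "0 \<le> t \<Longrightarrow> W t \<in> borel_measurable \<F>" by (rule W.B_path)

lemma R_path[measurable]: "0 \<le> t \<Longrightarrow> R t \<in> borel_measurable \<F>"
  unfolding R_def[abs_def] by measurable

lemma R_rv[measurable]: "R t \<in> borel_measurable N" and X_rv[measurable]: "X t \<in> borel_measurable N"
  unfolding R_def[abs_def] X_def[abs_def] by measurable

lemma paths_indep_sets:
  assumes A: "A \<in> sets \<F>" and B: "B \<in> sets \<F>'"
  shows "prob (A \<inter> B) = prob A * prob B"
proof -
  have "indep_set
      (sigma_sets (space N) {(\<lambda>\<omega>. restrict (\<lambda>t. W t \<omega>) {0..}) -` A \<inter> space N | A. A \<in> sets (Pi\<^sub>M {0..} (\<lambda>_. borel))})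
      (sigma_sets (space N) {(\<lambda>\<omega>. restrict (\<lambda>t. W' t \<omega>) {0..}) -` A \<inter> space N | A. A \<in> sets (Pi\<^sub>M {0..} (\<lambda>_. borel))})"
    using indep unfolding indep_var_eq by blast
  moreover have "A \<in> sigma_sets (space N) {(\<lambda>\<omega>. restrict (\<lambda>t. W t \<omega>) {0..}) -` A \<inter> space N | A. A \<in> sets (Pi\<^sub>M {0..} (\<lambda>_. borel))}"
    using A unfolding W.path_algebra_def sets_vimage_algebra .
  moreover have "B \<in> sigma_sets (space N) {(\<lambda>\<omega>. restrict (\<lambda>t. W' t \<omega>) {0..}) -` A \<inter> space N | A. A \<in> sets (Pi\<^sub>M {0..} (\<lambda>_. borel))}"
    using B unfolding W'.path_algebra_def sets_vimage_algebra .
  ultimately show ?thesis unfolding indep_sets2_eq by blast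
qed

lemma paths_indep_var:
  fixes f g :: "'b \<Rightarrow> real"
  assumes f: "f \<in> borel_measurable \<F>" and g: "g \<in> borel_measurable \<F>'"
  shows "indep_var borel f borel g"
proof -
  have sub: "sigma_sets (space N) {f -` A \<inter> space N | A. A \<in> sets borel} \<subseteq> sets \<F>"
    using sets.sigma_sets_subset[of "{f -` A \<inter> space N | A. A \<in> sets borel}" \<F>] measurable_sets[OF f]
    by (auto simp: W.space_path_algebra)
  have sub': "sigma_sets (space N) {g -` A \<inter> space N | A. A \<in> sets borel} \<subseteq> sets \<F>'"
    using sets.sigma_sets_subset[of "{g -` A \<inter> space N | A. A \<in> sets borel}" \<F>'] measurable_sets[OF g]
    by (auto simp: W'.space_path_algebra)
  have rv: "f \<in> borel_measurable N" "g \<in> borel_measurable N"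
    by (rule W.path_algebra_sub[OF f], rule W'.path_algebra_sub[OF g])
  have ev: "sigma_sets (space N) {h -` A \<inter> space N | A. A \<in> sets borel} \<subseteq> events"
    if "h \<in> borel_measurable N" for h :: "'b \<Rightarrow> real"
    using sets.sigma_sets_subset[of "{h -` A \<inter> space N | A. A \<in> sets borel}" N] measurable_sets[OF that] by auto
  show ?thesis
    unfolding indep_var_eq indep_sets2_eq
    using rv ev[OF rv(1)] ev[OF rv(2)] paths_indep_sets subsetD[OF sub] subsetD[OF sub'] by blast
qed

lemma paths_product:
  fixes f g :: "'b \<Rightarrow> real"
  assumes "f \<in> borel_measurable \<F>" "g \<in> borel_measurable \<F>'" "integrable N f" "integrable N g"
  shows "integrable N (\<lambda>\<omega>. f \<omega> * g \<omega>)" "expectation (\<lambda>\<omega>. f \<omega> * g \<omega>) = expectation f * expectation g"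
  using indep_var_integrable[OF paths_indep_var] indep_var_lebesgue_integral[OF paths_indep_var] assms by auto

text \<open>Left-point sums of coefficients that depend on \<open>W\<close> only, against the increments of \<open>X\<close>:
  conditionally on \<open>W\<close> they are Gaussian, which replaces the Ito isometry.\<close>
definition wiener_sum :: "(nat \<Rightarrow> 'b \<Rightarrow> real) \<Rightarrow> real \<Rightarrow> real \<Rightarrow> nat \<Rightarrow> 'b \<Rightarrow> real" where
  "wiener_sum c s d n \<omega> = (\<Sum>i<n. c i \<omega> * (X (s + real (Suc i) * d) \<omega> - X (s + real i * d) \<omega>))"

definition noise :: "real \<Rightarrow> real \<Rightarrow> nat \<Rightarrow> 'b \<Rightarrow> real" where
  "noise s d i \<omega> = W' (s + real (Suc i) * d) \<omega> - W' (s + real i * d) \<omega>"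

context
  fixes c :: "nat \<Rightarrow> 'b \<Rightarrow> real" and s d :: real and n :: nat
  assumes c: "\<And>i. i < n \<Longrightarrow> c i \<in> borel_measurable \<F>"
    and c2: "\<And>i. i < n \<Longrightarrow> integrable N (\<lambda>\<omega>. (c i \<omega>)\<^sup>2)"
    and s: "0 \<le> s" and d: "0 \<le> d"
begin

lemma coeff_rv: "i < n \<Longrightarrow> c i \<in> borel_measurable N"
  by (rule W.path_algebra_sub[OF c])

lemma coeff_integrable: "i < n \<Longrightarrow> integrable N (c i)"
  using square_integrable_imp_integrable[OF coeff_rv c2] by simp

lemma coeff_prod_integrable: "i < n \<Longrightarrow> j < n \<Longrightarrow> integrable N (\<lambda>\<omega>. c i \<omega> * c j \<omega>)"
  by (rule integrable_sq_imp(2)[OF coeff_rv coeff_rv c2 c2])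

lemma times: "0 \<le> s + real i * d" "s + real i * d \<le> s + real (Suc i) * d"
  "i \<le> j \<Longrightarrow> s + real i * d \<le> s + real j * d"
  using s d by (auto intro!: mult_right_mono add_nonneg_nonneg)

lemma noise_path: "noise s d i \<in> borel_measurable \<F>'"
proof -
  have [measurable]: "W' (s + real (Suc i) * d) \<in> borel_measurable \<F>'" "W' (s + real i * d) \<in> borel_measurable \<F>'"
    by (rule W'.B_path, rule times)+
  show ?thesis unfolding noise_def[abs_def] by measurable
qed

lemma noise_moments: "integrable N (noise s d i)" "expectation (noise s d i) = 0"
  "integrable N (\<lambda>\<omega>. noise s d i \<omega> * noise s d j \<omega>)"
  "expectation (\<lambda>\<omega>. noise s d i \<omega> * noise s d j \<omega>) = (if i = j then d else 0)"
proof -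
  note m = W'.increment_moments[OF times(1) times(2)]
  have i1: "integrable N (\<lambda>\<omega>. W' (s + real (Suc i) * d) \<omega> - W' (s + real i * d) \<omega>)" for i
    using m(1)[of i 1] by simp
  show "integrable N (noise s d i)" "expectation (noise s d i) = 0"
    unfolding noise_def[abs_def] using i1 m(2) by auto
  have lt: "integrable N (\<lambda>\<omega>. noise s d i \<omega> * noise s d j \<omega>) \<and> expectation (\<lambda>\<omega>. noise s d i \<omega> * noise s d j \<omega>) = 0" if "i < j" for i j
  proof -
    note p = W'.increments_product[OF times(1)[of i] times(2)[of i] times(3)[of "Suc i" j] times(2)[of j], of "\<lambda>x. x" "\<lambda>x. x"]
    show ?thesis
      using that p[OF _ _ _ i1 i1] m(2)[of i] unfolding noise_def by simp
  qed
  have eq: "integrable N (\<lambda>\<omega>. noise s d i \<omega> * noise s d i \<omega>) \<and> expectation (\<lambda>\<omega>. noise s d i \<omega> * noise s d i \<omega>) = d" for i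
    using m(1)[of i 2] m(3)[of i] unfolding noise_def power2_eq_square by (simp add: algebra_simps)
  consider "i = j" | "i < j" | "j < i" by linarith
  then have "integrable N (\<lambda>\<omega>. noise s d i \<omega> * noise s d j \<omega>) \<and>
     expectation (\<lambda>\<omega>. noise s d i \<omega> * noise s d j \<omega>) = (if i = j then d else 0)"
    using lt[of i j] lt[of j i] eq[of i] by cases (auto simp: mult.commute)
  then show "integrable N (\<lambda>\<omega>. noise s d i \<omega> * noise s d j \<omega>)"
    "expectation (\<lambda>\<omega>. noise s d i \<omega> * noise s d j \<omega>) = (if i = j then d else 0)" by auto
qed

lemma wiener_sum_split:
  "wiener_sum c s d n \<omega> = mx * d * (\<Sum>i<n. c i \<omega>) + sx * (\<Sum>i<n. c i \<omega> * noise s d i \<omega>)"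
proof -
  have "X (s + real (Suc i) * d) \<omega> - X (s + real i * d) \<omega> = mx * d + sx * noise s d i \<omega>" for i
    by (simp add: X_def noise_def algebra_simps)
  then show ?thesis
    by (simp add: wiener_sum_def sum_distrib_left sum.distrib algebra_simps)
qed

text \<open>Each product splits into a factor depending on \<open>W\<close> and one depending on
  \<open>W'\<close>, and distinct noises are uncorrelated. The coefficients may look into the future
  of \<open>W\<close>, as those of \<open>step_a\<close> do: independence of the paths takes the
  place of adaptedness.\<close>

lemma noise_sum:
  "integrable N (\<lambda>\<omega>. \<Sum>i<n. c i \<omega> * noise s d i \<omega>)" "expectation (\<lambda>\<omega>. \<Sum>i<n. c i \<omega> * noise s d i \<omega>) = 0"
  "integrable N (\<lambda>\<omega>. (\<Sum>i<n. c i \<omega> * noise s d i \<omega>)\<^sup>2)"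
  "expectation (\<lambda>\<omega>. (\<Sum>i<n. c i \<omega> * noise s d i \<omega>)\<^sup>2) = d * (\<Sum>i<n. expectation (\<lambda>\<omega>. (c i \<omega>)\<^sup>2))"
proof -
  have p: "integrable N (\<lambda>\<omega>. c i \<omega> * noise s d i \<omega>)" "expectation (\<lambda>\<omega>. c i \<omega> * noise s d i \<omega>) = 0" if "i < n" for i
    using paths_product[OF c[OF that] noise_path[of i] coeff_integrable[OF that] noise_moments(1)] noise_moments(2) by auto
  show "integrable N (\<lambda>\<omega>. \<Sum>i<n. c i \<omega> * noise s d i \<omega>)" "expectation (\<lambda>\<omega>. \<Sum>i<n. c i \<omega> * noise s d i \<omega>) = 0"
    using p by (auto simp: Bochner_Integration.integral_sum)
  have q: "integrable N (\<lambda>\<omega>. (c i \<omega> * c j \<omega>) * (noise s d i \<omega> * noise s d j \<omega>))"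
    "expectation (\<lambda>\<omega>. (c i \<omega> * c j \<omega>) * (noise s d i \<omega> * noise s d j \<omega>)) = (if i = j then d * expectation (\<lambda>\<omega>. (c i \<omega>)\<^sup>2) else 0)"
    if ij: "i < n" "j < n" for i j
  proof -
    have m1: "(\<lambda>\<omega>. c i \<omega> * c j \<omega>) \<in> borel_measurable \<F>" using c ij by simp
    have m2: "(\<lambda>\<omega>. noise s d i \<omega> * noise s d j \<omega>) \<in> borel_measurable \<F>'" using noise_path by simp
    note r = paths_product[OF m1 m2 coeff_prod_integrable[OF ij] noise_moments(3)]
    show "integrable N (\<lambda>\<omega>. (c i \<omega> * c j \<omega>) * (noise s d i \<omega> * noise s d j \<omega>))" by (rule r(1))
    show "expectation (\<lambda>\<omega>. (c i \<omega> * c j \<omega>) * (noise s d i \<omega> * noise s d j \<omega>)) = (if i = j then d * expectation (\<lambda>\<omega>. (c i \<omega>)\<^sup>2) else 0)"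
      unfolding r(2) noise_moments(4) by (simp add: power2_eq_square mult.commute)
  qed
  have sq: "(\<Sum>i<n. c i \<omega> * noise s d i \<omega>)\<^sup>2 = (\<Sum>i<n. \<Sum>j<n. (c i \<omega> * c j \<omega>) * (noise s d i \<omega> * noise s d j \<omega>))" for \<omega>
    unfolding power2_eq_square sum_product by (intro sum.cong refl) (simp add: mult_ac)
  show "integrable N (\<lambda>\<omega>. (\<Sum>i<n. c i \<omega> * noise s d i \<omega>)\<^sup>2)"
    unfolding sq using q by (intro Bochner_Integration.integrable_sum) auto
  have "expectation (\<lambda>\<omega>. (\<Sum>i<n. c i \<omega> * noise s d i \<omega>)\<^sup>2) = (\<Sum>i<n. \<Sum>j<n. (if i = j then d * expectation (\<lambda>\<omega>. (c i \<omega>)\<^sup>2) else 0))"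
    unfolding sq using q by (subst Bochner_Integration.integral_sum, fastforce intro: Bochner_Integration.integrable_sum, intro sum.cong refl)
       (subst Bochner_Integration.integral_sum, auto intro!: sum.cong)
  also have "\<dots> = d * (\<Sum>i<n. expectation (\<lambda>\<omega>. (c i \<omega>)\<^sup>2))"
    by (simp add: sum_distrib_left)
  finally show "expectation (\<lambda>\<omega>. (\<Sum>i<n. c i \<omega> * noise s d i \<omega>)\<^sup>2) = d * (\<Sum>i<n. expectation (\<lambda>\<omega>. (c i \<omega>)\<^sup>2))" .
qed

text \<open>The drift part is bounded by Cauchy-Schwarz, the noise part by \<open>noise_sum\<close>.
  The factor \<open>d\<close> offsets the number \<open>n\<close> of summands, so that the bound
  survives refinement of the mesh.\<close>

lemma wiener_sum_moments:
  "integrable N (wiener_sum c s d n)" "expectation (wiener_sum c s d n) = mx * d * (\<Sum>i<n. expectation (c i))"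
  "integrable N (\<lambda>\<omega>. (wiener_sum c s d n \<omega>)\<^sup>2)"
  "expectation (\<lambda>\<omega>. (wiener_sum c s d n \<omega>)\<^sup>2) \<le> 2 * d * (mx\<^sup>2 * (real n * d) + sx\<^sup>2) * (\<Sum>i<n. expectation (\<lambda>\<omega>. (c i \<omega>)\<^sup>2))"
proof -
  have i: "integrable N (\<lambda>\<omega>. \<Sum>i<n. c i \<omega>)" using coeff_integrable by auto
  show iw: "integrable N (wiener_sum c s d n)" unfolding wiener_sum_split[abs_def] using i noise_sum(1) by auto
  show "expectation (wiener_sum c s d n) = mx * d * (\<Sum>i<n. expectation (c i))"
    unfolding wiener_sum_split[abs_def] using i noise_sum(1,2) coeff_integrable
    by (simp add: Bochner_Integration.integral_sum)
  define Z where "Z \<omega> = 2 * (mx * d)\<^sup>2 * (real n * (\<Sum>i<n. (c i \<omega>)\<^sup>2)) + 2 * sx\<^sup>2 * (\<Sum>i<n. c i \<omega> * noise s d i \<omega>)\<^sup>2" for \<omega>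
  have iZ: "integrable N Z" unfolding Z_def using c2 noise_sum(3)
    by (intro Bochner_Integration.integrable_add integrable_mult_right Bochner_Integration.integrable_sum) auto
  have le: "(wiener_sum c s d n \<omega>)\<^sup>2 \<le> Z \<omega>" for \<omega>
  proof -
    have "(p + q)\<^sup>2 \<le> 2 * p\<^sup>2 + 2 * q\<^sup>2" for p q :: real
      using zero_le_power2[of "p - q"] by (simp add: power2_eq_square algebra_simps)
    then have "(wiener_sum c s d n \<omega>)\<^sup>2 \<le> 2 * (mx * d * (\<Sum>i<n. c i \<omega>))\<^sup>2 + 2 * (sx * (\<Sum>i<n. c i \<omega> * noise s d i \<omega>))\<^sup>2"
      unfolding wiener_sum_split .
    also have "\<dots> = 2 * (mx * d)\<^sup>2 * (\<Sum>i<n. c i \<omega>)\<^sup>2 + 2 * sx\<^sup>2 * (\<Sum>i<n. c i \<omega> * noise s d i \<omega>)\<^sup>2"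
      by (simp add: power_mult_distrib)
    also have "\<dots> \<le> Z \<omega>"
      unfolding Z_def using sum_squared_le_sum_of_squares[of "\<lambda>i. c i \<omega>" "{..<n}"]
      by (intro add_mono mult_left_mono) (auto simp: mult.commute)
    finally show ?thesis .
  qed
  show i2: "integrable N (\<lambda>\<omega>. (wiener_sum c s d n \<omega>)\<^sup>2)"
    by (rule Bochner_Integration.integrable_bound[OF iZ])
       (use iw in \<open>auto intro!: AE_I2 intro: order_trans[OF le]\<close>)
  have "expectation (\<lambda>\<omega>. (wiener_sum c s d n \<omega>)\<^sup>2) \<le> expectation Z"
    by (rule integral_mono[OF i2 iZ le])
  also have "expectation Z = 2 * (mx * d)\<^sup>2 * (real n * (\<Sum>i<n. expectation (\<lambda>\<omega>. (c i \<omega>)\<^sup>2))) +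
      2 * sx\<^sup>2 * (d * (\<Sum>i<n. expectation (\<lambda>\<omega>. (c i \<omega>)\<^sup>2)))"
  proof -
    have iS: "integrable N (\<lambda>\<omega>. \<Sum>i<n. (c i \<omega>)\<^sup>2)" by (rule Bochner_Integration.integrable_sum) (use c2 in auto)
    have "expectation (\<lambda>\<omega>. \<Sum>i<n. (c i \<omega>)\<^sup>2) = (\<Sum>i<n. expectation (\<lambda>\<omega>. (c i \<omega>)\<^sup>2))"
      by (rule Bochner_Integration.integral_sum) (use c2 in auto)
    moreover have "expectation Z = 2 * (mx * d)\<^sup>2 * (real n * expectation (\<lambda>\<omega>. \<Sum>i<n. (c i \<omega>)\<^sup>2)) +
        2 * sx\<^sup>2 * expectation (\<lambda>\<omega>. (\<Sum>i<n. c i \<omega> * noise s d i \<omega>)\<^sup>2)"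
      unfolding Z_def integral_mult_right_zero[symmetric]
      by (rule Bochner_Integration.integral_add) (intro integrable_mult_right iS noise_sum(3))+
    ultimately show ?thesis by (simp only: noise_sum(4))
  qed
  also have "\<dots> = 2 * d * (mx\<^sup>2 * (real n * d) + sx\<^sup>2) * (\<Sum>i<n. expectation (\<lambda>\<omega>. (c i \<omega>)\<^sup>2))"
    by (simp add: power2_eq_square algebra_simps)
  finally show "expectation (\<lambda>\<omega>. (wiener_sum c s d n \<omega>)\<^sup>2) \<le> 2 * d * (mx\<^sup>2 * (real n * d) + sx\<^sup>2) * (\<Sum>i<n. expectation (\<lambda>\<omega>. (c i \<omega>)\<^sup>2))" .
qed

end

lemma R_exp:
  assumes "0 \<le> s" "s \<le> t"
  shows "integrable N (\<lambda>\<omega>. exp (c * (R t \<omega> - R s \<omega>)))"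
    "expectation (\<lambda>\<omega>. exp (c * (R t \<omega> - R s \<omega>))) = exp ((c * mr + c\<^sup>2 * sr\<^sup>2 / 2) * (t - s))"
proof -
  have e: "exp (c * (R t \<omega> - R s \<omega>)) = exp (c * mr * (t - s)) * exp ((c * sr) * (W t \<omega> - W s \<omega>))" for \<omega>
    by (simp add: R_def algebra_simps flip: exp_add)
  note m = W.increment_exp[OF assms, of "c * sr"]
  show "integrable N (\<lambda>\<omega>. exp (c * (R t \<omega> - R s \<omega>)))"
    unfolding e using m(1) by simp
  have "expectation (\<lambda>\<omega>. exp (c * (R t \<omega> - R s \<omega>))) = exp (c * mr * (t - s)) * exp ((c * sr)\<^sup>2 * (t - s) / 2)"
    unfolding e using m(2) by simp
  then show "expectation (\<lambda>\<omega>. exp (c * (R t \<omega> - R s \<omega>))) = exp ((c * mr + c\<^sup>2 * sr\<^sup>2 / 2) * (t - s))"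
    by (simp add: algebra_simps power_mult_distrib flip: exp_add)
qed

end

lemma exp_increment_bounds:
  fixes a t :: real
  assumes "0 \<le> t" "t \<le> 1"
  shows "exp (a * t) \<le> 1 + \<bar>a\<bar> * exp \<bar>a\<bar> * t" "1 - \<bar>a\<bar> * t \<le> exp (a * t)" "\<bar>exp (a * t) - 1\<bar> \<le> \<bar>a\<bar> * exp \<bar>a\<bar> * t"
proof -
  show l: "1 - \<bar>a\<bar> * t \<le> exp (a * t)"
  proof -
    have "- (\<bar>a\<bar> * t) \<le> a * t" using assms mult_right_mono[of "- \<bar>a\<bar>" a t] by simp
    then show ?thesis using exp_ge_add_one_self[of "a * t"] by linarith
  qed
  show u: "exp (a * t) \<le> 1 + \<bar>a\<bar> * exp \<bar>a\<bar> * t"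
  proof -
    have "a * t \<le> \<bar>a\<bar> * t" using assms by (intro mult_right_mono) auto
    then have "exp (a * t) \<le> exp (\<bar>a\<bar> * t)" by simp
    also have "\<dots> \<le> 1 + \<bar>a\<bar> * t * exp (\<bar>a\<bar> * t)"
    proof -
      \<comment> \<open>From \<open>1 - x \<le> exp (- x)\<close>; rearranged, this is
        \<open>exp x \<le> 1 + x * exp x\<close>.\<close>
      have "(1 - \<bar>a\<bar> * t) * exp (\<bar>a\<bar> * t) \<le> exp (- (\<bar>a\<bar> * t)) * exp (\<bar>a\<bar> * t)"
        using exp_ge_add_one_self[of "- (\<bar>a\<bar> * t)"] by (intro mult_right_mono) auto
      then show ?thesis by (simp add: algebra_simps flip: exp_add)
    qed
    also have "\<bar>a\<bar> * t * exp (\<bar>a\<bar> * t) \<le> \<bar>a\<bar> * t * exp \<bar>a\<bar>"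
      using assms by (intro mult_left_mono) (auto simp: mult_left_le)
    finally show ?thesis by (simp add: mult_ac)
  qed
  have "\<bar>a\<bar> * t * 1 \<le> \<bar>a\<bar> * t * exp \<bar>a\<bar>" using assms by (intro mult_left_mono) auto
  then show "\<bar>exp (a * t) - 1\<bar> \<le> \<bar>a\<bar> * exp \<bar>a\<bar> * t"
    using l u by (simp add: abs_le_iff mult_ac)
qed

context gou_paths
begin

text \<open>\<open>b\<close> and \<open>a\<close> are the growth rates of \<open>E exp (c R)\<close>
  and \<open>E exp (2 c R)\<close>. The square in \<open>R_exp_minus_one\<close> has expectation
  \<open>exp (a t) - 2 exp (b t) + 1\<close>, which the first two summands bound linearly for
  \<open>t \<le> 1\<close>; the last summand bounds \<open>exp (b t) - 1\<close>.\<close>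

definition exp_const :: "real \<Rightarrow> real" where
  "exp_const c = (let a = 2 * c * mr + 2 * c\<^sup>2 * sr\<^sup>2; b = c * mr + c\<^sup>2 * sr\<^sup>2 / 2 in
     \<bar>a\<bar> * exp \<bar>a\<bar> + 2 * \<bar>b\<bar> + \<bar>b\<bar> * exp \<bar>b\<bar>)"

lemma R_exp_minus_one:
  assumes st: "0 \<le> s" "s \<le> t" "t - s \<le> 1"
  shows "integrable N (\<lambda>\<omega>. (exp (c * (R t \<omega> - R s \<omega>)) - 1)\<^sup>2)"
    "expectation (\<lambda>\<omega>. (exp (c * (R t \<omega> - R s \<omega>)) - 1)\<^sup>2) \<le> exp_const c * (t - s)"
    "\<bar>expectation (\<lambda>\<omega>. exp (c * (R t \<omega> - R s \<omega>)) - 1)\<bar> \<le> exp_const c * (t - s)"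
    "exp_const c \<ge> 0"
proof -
  define a where "a = 2 * c * mr + 2 * c\<^sup>2 * sr\<^sup>2"
  define b where "b = c * mr + c\<^sup>2 * sr\<^sup>2 / 2"
  have k: "exp_const c = \<bar>a\<bar> * exp \<bar>a\<bar> + 2 * \<bar>b\<bar> + \<bar>b\<bar> * exp \<bar>b\<bar>"
    by (simp add: exp_const_def a_def b_def Let_def)
  have nn: "0 \<le> \<bar>a\<bar> * exp \<bar>a\<bar>" "0 \<le> \<bar>b\<bar>" "0 \<le> \<bar>b\<bar> * exp \<bar>b\<bar>" by auto
  then show "exp_const c \<ge> 0" unfolding k by linarith
  have sq: "(exp (c * (R t \<omega> - R s \<omega>)) - 1)\<^sup>2 = exp ((2 * c) * (R t \<omega> - R s \<omega>)) - 2 * exp (c * (R t \<omega> - R s \<omega>)) + 1" for \<omega>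
    by (simp add: power2_eq_square algebra_simps flip: exp_add)
  note r1 = R_exp[OF st(1,2), of c, folded b_def] and r2 = R_exp[OF st(1,2), of "2 * c"]
  have a2: "2 * c * mr + (2 * c)\<^sup>2 * sr\<^sup>2 / 2 = a" by (simp add: a_def power2_eq_square)
  show "integrable N (\<lambda>\<omega>. (exp (c * (R t \<omega> - R s \<omega>)) - 1)\<^sup>2)"
    unfolding sq using r1 r2 by auto
  have d: "0 \<le> t - s" using st by simp
  have "expectation (\<lambda>\<omega>. (exp (c * (R t \<omega> - R s \<omega>)) - 1)\<^sup>2) = exp (a * (t - s)) - 2 * exp (b * (t - s)) + 1"
    unfolding sq using r1 r2 a2 by (simp add: prob_space)
  also have "\<dots> \<le> (\<bar>a\<bar> * exp \<bar>a\<bar> + 2 * \<bar>b\<bar>) * (t - s)"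
    using exp_increment_bounds(1)[OF d st(3), of a] exp_increment_bounds(2)[OF d st(3), of b]
    unfolding distrib_right by linarith
  also have "\<dots> \<le> exp_const c * (t - s)" unfolding k using nn d by (intro mult_right_mono) auto
  finally show "expectation (\<lambda>\<omega>. (exp (c * (R t \<omega> - R s \<omega>)) - 1)\<^sup>2) \<le> exp_const c * (t - s)" .
  have "\<bar>expectation (\<lambda>\<omega>. exp (c * (R t \<omega> - R s \<omega>)) - 1)\<bar> = \<bar>exp (b * (t - s)) - 1\<bar>"
    using r1 by (simp add: prob_space)
  also have "\<dots> \<le> (\<bar>b\<bar> * exp \<bar>b\<bar>) * (t - s)" using exp_increment_bounds(3)[OF d st(3), of b] by simp
  also have "\<dots> \<le> exp_const c * (t - s)" unfolding k using nn d by (intro mult_right_mono) auto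
  finally show "\<bar>expectation (\<lambda>\<omega>. exp (c * (R t \<omega> - R s \<omega>)) - 1)\<bar> \<le> exp_const c * (t - s)" .
qed

end

section \<open>Moments under perturbations small in mean square\<close>

context prob_space
begin

lemma power4_le: "(p + q) ^ 4 \<le> 8 * p ^ 4 + 8 * q ^ 4" for p q :: real
proof -
  have s: "(a + b)\<^sup>2 \<le> 2 * a\<^sup>2 + 2 * b\<^sup>2" for a b :: real
    using zero_le_power2[of "a - b"] by (simp add: power2_eq_square algebra_simps)
  have "(p + q) ^ 4 = ((p + q)\<^sup>2)\<^sup>2" by simp
  also have "\<dots> \<le> (2 * p\<^sup>2 + 2 * q\<^sup>2)\<^sup>2" using s[of p q] by (rule power_mono) simp
  also have "\<dots> \<le> 2 * (2 * p\<^sup>2)\<^sup>2 + 2 * (2 * q\<^sup>2)\<^sup>2" by (rule s)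
  also have "\<dots> = 8 * p ^ 4 + 8 * q ^ 4" by (simp add: power_mult_distrib)
  finally show ?thesis .
qed

text \<open>Above the truncation level \<open>e^2 \<le> Z^2\<close>, so the square can be traded for
  a fourth power.\<close>

lemma truncated_second_moment:
  fixes Z :: "'a \<Rightarrow> real" and e :: real
  assumes [measurable]: "Z \<in> borel_measurable M" and i: "integrable M (\<lambda>\<omega>. Z \<omega> ^ 4)" and e: "e > 0"
  shows "integrable M (\<lambda>\<omega>. (Z \<omega>)\<^sup>2 * indicator {e<..} \<bar>Z \<omega>\<bar>)"
    "expectation (\<lambda>\<omega>. (Z \<omega>)\<^sup>2 * indicator {e<..} \<bar>Z \<omega>\<bar>) \<le> expectation (\<lambda>\<omega>. Z \<omega> ^ 4) / e\<^sup>2"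
proof -
  have le: "z\<^sup>2 * indicator {e<..} \<bar>z\<bar> \<le> z ^ 4 / e\<^sup>2" for z :: real
  proof (cases "\<bar>z\<bar> > e")
    case True
    then have "e\<^sup>2 \<le> z\<^sup>2" using e by (simp add: abs_le_square_iff[symmetric])
    then have "z\<^sup>2 * e\<^sup>2 \<le> z\<^sup>2 * z\<^sup>2" by (intro mult_left_mono) auto
    then show ?thesis using e True by (simp add: pos_le_divide_eq power4_eq_xxxx power2_eq_square mult_ac)
  qed simp
  have i4: "integrable M (\<lambda>\<omega>. Z \<omega> ^ 4 / e\<^sup>2)" using i by simp
  show ii: "integrable M (\<lambda>\<omega>. (Z \<omega>)\<^sup>2 * indicator {e<..} \<bar>Z \<omega>\<bar>)"
    by (rule Bochner_Integration.integrable_bound[OF i4]) (auto intro!: AE_I2 order_trans[OF le])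
  have "expectation (\<lambda>\<omega>. (Z \<omega>)\<^sup>2 * indicator {e<..} \<bar>Z \<omega>\<bar>) \<le> expectation (\<lambda>\<omega>. Z \<omega> ^ 4 / e\<^sup>2)"
    by (rule integral_mono[OF ii i4 le])
  then show "expectation (\<lambda>\<omega>. (Z \<omega>)\<^sup>2 * indicator {e<..} \<bar>Z \<omega>\<bar>) \<le> expectation (\<lambda>\<omega>. Z \<omega> ^ 4) / e\<^sup>2" by simp
qed

lemma am_gm_weighted:
  fixes p q w :: real
  assumes "w > 0"
  shows "2 * \<bar>p * q\<bar> \<le> w * p\<^sup>2 + q\<^sup>2 / w"
proof -
  have "2 * (\<bar>p\<bar> * sqrt w) * (\<bar>q\<bar> / sqrt w) \<le> (\<bar>p\<bar> * sqrt w)\<^sup>2 + (\<bar>q\<bar> / sqrt w)\<^sup>2" by (rule sum_squares_bound)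
  then show ?thesis using assms by (simp add: power_mult_distrib power_divide abs_mult mult_ac)
qed

text \<open>The cross terms are split with a free weight \<open>w\<close>: with \<open>E X^2\<close>
  of order \<open>h\<close> and \<open>E D^2\<close> of order \<open>h^2\<close>, the later choice
  \<open>w = sqrt h\<close> makes both parts of order \<open>h^(3/2)\<close>.\<close>

lemma perturbed_moments:
  fixes X D b :: "'a \<Rightarrow> real" and w e :: real
  assumes [measurable]: "X \<in> borel_measurable M" "D \<in> borel_measurable M" "b \<in> borel_measurable M"
    and i: "integrable M (\<lambda>\<omega>. (X \<omega>)\<^sup>2)" "integrable M (\<lambda>\<omega>. (D \<omega>)\<^sup>2)" "integrable M (\<lambda>\<omega>. (b \<omega>)\<^sup>2)"
      "integrable M (\<lambda>\<omega>. X \<omega> ^ 4)" and w: "w > 0" and e: "e > 0"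
  shows "integrable M (\<lambda>\<omega>. (X \<omega> + D \<omega>)\<^sup>2)"
    "\<bar>expectation (\<lambda>\<omega>. (X \<omega> + D \<omega>)\<^sup>2) - expectation (\<lambda>\<omega>. (X \<omega>)\<^sup>2)\<bar> \<le>
       expectation (\<lambda>\<omega>. (D \<omega>)\<^sup>2) + (w * expectation (\<lambda>\<omega>. (X \<omega>)\<^sup>2) + expectation (\<lambda>\<omega>. (D \<omega>)\<^sup>2) / w)"
    "\<bar>expectation (\<lambda>\<omega>. (X \<omega> + D \<omega>) * b \<omega>) - expectation (\<lambda>\<omega>. X \<omega> * b \<omega>)\<bar> \<le>
       w * expectation (\<lambda>\<omega>. (b \<omega>)\<^sup>2) + expectation (\<lambda>\<omega>. (D \<omega>)\<^sup>2) / w"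
    "expectation (\<lambda>\<omega>. (X \<omega> + D \<omega>)\<^sup>2 * indicator {e<..} \<bar>X \<omega> + D \<omega>\<bar>) \<le>
       16 * expectation (\<lambda>\<omega>. X \<omega> ^ 4) / e\<^sup>2 + 4 * expectation (\<lambda>\<omega>. (D \<omega>)\<^sup>2)"
proof -
  have XD: "integrable M (\<lambda>\<omega>. X \<omega> * D \<omega>)" by (rule integrable_sq_imp(2)[OF _ _ i(1,2)]) auto
  have Xb: "integrable M (\<lambda>\<omega>. X \<omega> * b \<omega>)" by (rule integrable_sq_imp(2)[OF _ _ i(1,3)]) auto
  have Db: "integrable M (\<lambda>\<omega>. D \<omega> * b \<omega>)" by (rule integrable_sq_imp(2)[OF _ _ i(2,3)]) auto
  have sq: "(X \<omega> + D \<omega>)\<^sup>2 = (X \<omega>)\<^sup>2 + 2 * (X \<omega> * D \<omega>) + (D \<omega>)\<^sup>2" for \<omega>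
    by (simp add: power2_eq_square algebra_simps)
  show iS: "integrable M (\<lambda>\<omega>. (X \<omega> + D \<omega>)\<^sup>2)" unfolding sq using i XD by auto
  have "\<bar>expectation (\<lambda>\<omega>. 2 * (X \<omega> * D \<omega>))\<bar> \<le> expectation (\<lambda>\<omega>. w * (X \<omega>)\<^sup>2 + (D \<omega>)\<^sup>2 / w)"
  proof (intro order_trans[OF integral_abs_bound] integral_mono)
    show "\<bar>2 * (X \<omega> * D \<omega>)\<bar> \<le> w * (X \<omega>)\<^sup>2 + (D \<omega>)\<^sup>2 / w" for \<omega>
      using am_gm_weighted[OF w, of "X \<omega>" "D \<omega>"] by (simp add: abs_mult)
  qed (use i XD in auto)
  also have "\<dots> = w * expectation (\<lambda>\<omega>. (X \<omega>)\<^sup>2) + expectation (\<lambda>\<omega>. (D \<omega>)\<^sup>2) / w"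
    using i by simp
  finally have 1: "\<bar>expectation (\<lambda>\<omega>. 2 * (X \<omega> * D \<omega>))\<bar> \<le> w * expectation (\<lambda>\<omega>. (X \<omega>)\<^sup>2) + expectation (\<lambda>\<omega>. (D \<omega>)\<^sup>2) / w" .
  have 2: "expectation (\<lambda>\<omega>. (X \<omega> + D \<omega>)\<^sup>2) = expectation (\<lambda>\<omega>. (X \<omega>)\<^sup>2) + expectation (\<lambda>\<omega>. 2 * (X \<omega> * D \<omega>)) + expectation (\<lambda>\<omega>. (D \<omega>)\<^sup>2)"
    unfolding sq using i XD by simp
  have D0: "0 \<le> expectation (\<lambda>\<omega>. (D \<omega>)\<^sup>2)" by (rule Bochner_Integration.integral_nonneg) simp
  show "\<bar>expectation (\<lambda>\<omega>. (X \<omega> + D \<omega>)\<^sup>2) - expectation (\<lambda>\<omega>. (X \<omega>)\<^sup>2)\<bar> \<le>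
       expectation (\<lambda>\<omega>. (D \<omega>)\<^sup>2) + (w * expectation (\<lambda>\<omega>. (X \<omega>)\<^sup>2) + expectation (\<lambda>\<omega>. (D \<omega>)\<^sup>2) / w)"
    using 1 2 D0 by linarith
  have "expectation (\<lambda>\<omega>. (X \<omega> + D \<omega>) * b \<omega>) - expectation (\<lambda>\<omega>. X \<omega> * b \<omega>) = expectation (\<lambda>\<omega>. D \<omega> * b \<omega>)"
    unfolding distrib_right using Xb Db by simp
  also have "\<bar>\<dots>\<bar> \<le> expectation (\<lambda>\<omega>. w * (b \<omega>)\<^sup>2 + (D \<omega>)\<^sup>2 / w)"
  proof (intro order_trans[OF integral_abs_bound] integral_mono)
    show "\<bar>D \<omega> * b \<omega>\<bar> \<le> w * (b \<omega>)\<^sup>2 + (D \<omega>)\<^sup>2 / w" for \<omega>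
      using am_gm_weighted[OF w, of "b \<omega>" "D \<omega>"] abs_ge_zero[of "b \<omega> * D \<omega>"] by (simp add: mult.commute)
  qed (use i Db in auto)
  also have "\<dots> = w * expectation (\<lambda>\<omega>. (b \<omega>)\<^sup>2) + expectation (\<lambda>\<omega>. (D \<omega>)\<^sup>2) / w"
    using i by simp
  finally show "\<bar>expectation (\<lambda>\<omega>. (X \<omega> + D \<omega>) * b \<omega>) - expectation (\<lambda>\<omega>. X \<omega> * b \<omega>)\<bar> \<le>
       w * expectation (\<lambda>\<omega>. (b \<omega>)\<^sup>2) + expectation (\<lambda>\<omega>. (D \<omega>)\<^sup>2) / w" .
  have e2: "e / 2 > 0" using e by simp
  \<comment> \<open>The larger of the two is at least half of the sum: either it is
    \<open>x\<close>, which then exceeds \<open>e / 2\<close>, or the left side is at most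
    \<open>4 y^2\<close>.\<close>
  have pt: "(x + y)\<^sup>2 * indicator {e<..} \<bar>x + y\<bar> \<le> 4 * (x\<^sup>2 * indicator {e / 2<..} \<bar>x\<bar>) + 4 * y\<^sup>2" for x y :: real
  proof (cases "\<bar>x + y\<bar> > e")
    case True
    show ?thesis
    proof (cases "\<bar>y\<bar> < \<bar>x\<bar>")
      case xy: True
      then have "\<bar>x + y\<bar> \<le> \<bar>2 * x\<bar>" "\<bar>x\<bar> > e / 2" using True by linarith+
      then have "(x + y)\<^sup>2 \<le> (2 * x)\<^sup>2" unfolding abs_le_square_iff by simp
      then show ?thesis using \<open>\<bar>x\<bar> > e / 2\<close> by (simp add: power_mult_distrib indicator_def add_increasing2)
    next
      case False
      then have "\<bar>x + y\<bar> \<le> \<bar>2 * y\<bar>" by linarith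
      then have "(x + y)\<^sup>2 \<le> (2 * y)\<^sup>2" unfolding abs_le_square_iff by simp
      then show ?thesis by (simp add: power_mult_distrib indicator_def add_increasing)
    qed
  qed (simp add: indicator_def)
  note t = truncated_second_moment[OF _ i(4) e2]
  have "expectation (\<lambda>\<omega>. (X \<omega> + D \<omega>)\<^sup>2 * indicator {e<..} \<bar>X \<omega> + D \<omega>\<bar>) \<le>
      expectation (\<lambda>\<omega>. 4 * ((X \<omega>)\<^sup>2 * indicator {e / 2<..} \<bar>X \<omega>\<bar>) + 4 * (D \<omega>)\<^sup>2)"
  proof (rule integral_mono[OF _ _ pt])
    show "integrable M (\<lambda>\<omega>. (X \<omega> + D \<omega>)\<^sup>2 * indicator {e<..} \<bar>X \<omega> + D \<omega>\<bar>)"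
      by (rule integrable_sq_imp(3)[OF _ _ iS iS]) auto
    show "integrable M (\<lambda>\<omega>. 4 * ((X \<omega>)\<^sup>2 * indicator {e / 2<..} \<bar>X \<omega>\<bar>) + 4 * (D \<omega>)\<^sup>2)"
      using t(1) i by auto
  qed
  also have "\<dots> = 4 * expectation (\<lambda>\<omega>. (X \<omega>)\<^sup>2 * indicator {e / 2<..} \<bar>X \<omega>\<bar>) + 4 * expectation (\<lambda>\<omega>. (D \<omega>)\<^sup>2)"
    using t(1) i by simp
  also have "\<dots> \<le> 4 * (expectation (\<lambda>\<omega>. X \<omega> ^ 4) / (e / 2)\<^sup>2) + 4 * expectation (\<lambda>\<omega>. (D \<omega>)\<^sup>2)"
    using t(2) by (intro add_mono mult_left_mono) auto
  also have "\<dots> = 16 * expectation (\<lambda>\<omega>. X \<omega> ^ 4) / e\<^sup>2 + 4 * expectation (\<lambda>\<omega>. (D \<omega>)\<^sup>2)"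
    by (simp add: power_divide)
  finally show "expectation (\<lambda>\<omega>. (X \<omega> + D \<omega>)\<^sup>2 * indicator {e<..} \<bar>X \<omega> + D \<omega>\<bar>) \<le>
       16 * expectation (\<lambda>\<omega>. X \<omega> ^ 4) / e\<^sup>2 + 4 * expectation (\<lambda>\<omega>. (D \<omega>)\<^sup>2)" .
qed

end

lemma (in brownian_motion) drifted_increment_moments:
  fixes m s t h :: real
  assumes t: "0 \<le> t" and h: "0 \<le> h" "h \<le> 1"
  defines "Z \<equiv> \<lambda>\<omega>. m * h + s * (B (t + h) \<omega> - B t \<omega>)"
  shows "integrable M Z" "integrable M (\<lambda>\<omega>. (Z \<omega>)\<^sup>2)" "integrable M (\<lambda>\<omega>. Z \<omega> ^ 4)"
    "expectation Z = m * h" "expectation (\<lambda>\<omega>. (Z \<omega>)\<^sup>2) = m\<^sup>2 * h\<^sup>2 + s\<^sup>2 * h"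
    "expectation (\<lambda>\<omega>. Z \<omega> ^ 4) \<le> 8 * (m ^ 4 + 3 * s ^ 4) * h\<^sup>2"
proof -
  have tt: "t \<le> t + h" using h by simp
  let ?d = "\<lambda>\<omega>. B (t + h) \<omega> - B t \<omega>"
  note mo = increment_moments[OF t tt]
  have i: "integrable M ?d" "integrable M (\<lambda>\<omega>. (?d \<omega>)\<^sup>2)" "integrable M (\<lambda>\<omega>. ?d \<omega> ^ 4)"
    using mo(1)[of 1] mo(1)[of 2] mo(1)[of 4] by simp_all
  have e: "expectation ?d = 0" "expectation (\<lambda>\<omega>. (?d \<omega>)\<^sup>2) = h" "expectation (\<lambda>\<omega>. ?d \<omega> ^ 4) = 3 * h\<^sup>2"
    using mo(2-4) by simp_all
  show iZ: "integrable M Z" unfolding Z_def using i(1) by (intro Bochner_Integration.integrable_add integrable_mult_right) auto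
  have "expectation Z = m * h + s * expectation ?d"
    unfolding Z_def using i(1) by (subst Bochner_Integration.integral_add) (auto simp: prob_space)
  then show "expectation Z = m * h" unfolding e by simp
  have sq: "(Z \<omega>)\<^sup>2 = m\<^sup>2 * h\<^sup>2 + 2 * (m * h * s) * ?d \<omega> + s\<^sup>2 * (?d \<omega>)\<^sup>2" for \<omega>
    unfolding Z_def power2_sum by (simp add: power_mult_distrib)
  show "integrable M (\<lambda>\<omega>. (Z \<omega>)\<^sup>2)" unfolding sq using i
    by (intro Bochner_Integration.integrable_add integrable_mult_right) auto
  have "expectation (\<lambda>\<omega>. (Z \<omega>)\<^sup>2) = m\<^sup>2 * h\<^sup>2 + 2 * (m * h * s) * expectation ?d + s\<^sup>2 * expectation (\<lambda>\<omega>. (?d \<omega>)\<^sup>2)"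
    unfolding sq using i
    by (subst Bochner_Integration.integral_add, (auto)[2], subst Bochner_Integration.integral_add) (auto simp: prob_space simp del: Bochner_Integration.integral_diff)
  then show "expectation (\<lambda>\<omega>. (Z \<omega>)\<^sup>2) = m\<^sup>2 * h\<^sup>2 + s\<^sup>2 * h" unfolding e by simp
  have le: "Z \<omega> ^ 4 \<le> 8 * (m * h) ^ 4 + 8 * s ^ 4 * ?d \<omega> ^ 4" for \<omega>
    unfolding Z_def using power4_le[of "m * h" "s * ?d \<omega>"] by (simp add: power_mult_distrib)
  have ib: "integrable M (\<lambda>\<omega>. 8 * (m * h) ^ 4 + 8 * s ^ 4 * ?d \<omega> ^ 4)"
    using i by (intro Bochner_Integration.integrable_add integrable_mult_right) auto
  show i4: "integrable M (\<lambda>\<omega>. Z \<omega> ^ 4)"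
    by (rule Bochner_Integration.integrable_bound[OF ib]) (use iZ in \<open>auto intro!: AE_I2 order_trans[OF le]\<close>)
  have "expectation (\<lambda>\<omega>. Z \<omega> ^ 4) \<le> expectation (\<lambda>\<omega>. 8 * (m * h) ^ 4 + 8 * s ^ 4 * ?d \<omega> ^ 4)"
    by (rule integral_mono[OF i4 ib le])
  also have "\<dots> = 8 * (m * h) ^ 4 + 8 * s ^ 4 * expectation (\<lambda>\<omega>. ?d \<omega> ^ 4)"
    using i by (subst Bochner_Integration.integral_add) (auto simp: prob_space)
  also have "\<dots> = 8 * m ^ 4 * h ^ 4 + 24 * s ^ 4 * h\<^sup>2" unfolding e by (simp add: power_mult_distrib)
  also have "\<dots> \<le> 8 * m ^ 4 * h\<^sup>2 + 24 * s ^ 4 * h\<^sup>2"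
    using power_decreasing[of 2 4 h] h by (intro add_mono mult_left_mono) auto
  finally show "expectation (\<lambda>\<omega>. Z \<omega> ^ 4) \<le> 8 * (m ^ 4 + 3 * s ^ 4) * h\<^sup>2" by (simp add: algebra_simps)
qed

section \<open>One step of the skeleton\<close>

context gou_paths
begin

definition step_b :: "real \<Rightarrow> nat \<Rightarrow> 'b \<Rightarrow> real" where
  "step_b h k \<omega> = R (real k * h + h) \<omega> - R (real k * h) \<omega>"

text \<open>Over one step the diffusion satisfies \<open>Y_(t+h) = a + Y_t * exp b\<close>, where
  \<open>a\<close> is the integral of \<open>exp (R_(t+h) - R_s)\<close> against \<open>X\<close>
  over the step. This is its left-point Riemann sum with \<open>n\<close> cells.\<close>

definition step_a :: "real \<Rightarrow> nat \<Rightarrow> nat \<Rightarrow> 'b \<Rightarrow> real" where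
  "step_a h n k = wiener_sum (\<lambda>i \<omega>. exp (R (real k * h + h) \<omega> - R (real k * h + real i * (h / real n)) \<omega>))
     (real k * h) (h / real n) n"

text \<open>What \<open>step_a\<close> adds to the plain increment of \<open>X\<close>. The factor
  \<open>1 *\<close> gives the coefficients the shape of \<open>R_exp_minus_one\<close> at
  \<open>c = 1\<close>.\<close>

definition defect :: "real \<Rightarrow> nat \<Rightarrow> nat \<Rightarrow> 'b \<Rightarrow> real" where
  "defect h n k = wiener_sum (\<lambda>i \<omega>. exp (1 * (R (real k * h + h) \<omega> - R (real k * h + real i * (h / real n)) \<omega>)) - 1)
     (real k * h) (h / real n) n"

context
  fixes h :: real and n k :: nat
  assumes h: "0 < h" "h \<le> 1" and n: "0 < n"
begin

lemma grid: "0 \<le> real k * h" "0 \<le> h / real n" "real n * (h / real n) = h"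
  "0 \<le> real k * h + real i * (h / real n)"
  "i < n \<Longrightarrow> real i * (h / real n) \<le> h"
proof -
  have a: "0 \<le> real k * h" "0 \<le> h / real n" "real n * (h / real n) = h" using h n by auto
  then show "0 \<le> real k * h" "0 \<le> h / real n" "real n * (h / real n) = h" by blast+
  from a show "0 \<le> real k * h + real i * (h / real n)" by (intro add_nonneg_nonneg[OF a(1)] mult_nonneg_nonneg[OF of_nat_0_le_iff])
  assume "i < n"
  then have "real i * (h / real n) \<le> real n * (h / real n)" using a by (intro mult_right_mono) auto
  then show "real i * (h / real n) \<le> h" using a by simp
qed

lemma coeff_path: "(\<lambda>\<omega>. exp (R (real k * h + h) \<omega> - R (real k * h + real i * (h / real n)) \<omega>)) \<in> borel_measurable \<F>"
  "(\<lambda>\<omega>. exp (- (R (real k * h + real i * (h / real n)) \<omega> - R (real k * h) \<omega>))) \<in> borel_measurable \<F>"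
proof -
  have [measurable]: "R (real k * h + h) \<in> borel_measurable \<F>" "R (real k * h + real i * (h / real n)) \<in> borel_measurable \<F>"
    "R (real k * h) \<in> borel_measurable \<F>"
    by (rule R_path, use h grid in auto)+
  show "(\<lambda>\<omega>. exp (R (real k * h + h) \<omega> - R (real k * h + real i * (h / real n)) \<omega>)) \<in> borel_measurable \<F>"
  "(\<lambda>\<omega>. exp (- (R (real k * h + real i * (h / real n)) \<omega> - R (real k * h) \<omega>))) \<in> borel_measurable \<F>" by measurable
qed

lemma X_increment:
  "X (real k * h + h) \<omega> - X (real k * h) \<omega> = wiener_sum (\<lambda>_ _. 1) (real k * h) (h / real n) n \<omega>"
proof -
  have "wiener_sum (\<lambda>_ _. 1) (real k * h) (h / real n) n \<omega> =
      (\<Sum>i<n. X (real k * h + real (Suc i) * (h / real n)) \<omega> - X (real k * h + real i * (h / real n)) \<omega>)"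
    unfolding wiener_sum_def by (simp only: mult_1_left)
  also have "\<dots> = X (real k * h + real n * (h / real n)) \<omega> - X (real k * h + real 0 * (h / real n)) \<omega>"
    by (rule sum_lessThan_telescope)
  finally show ?thesis unfolding grid(3) by simp
qed

lemma step_a_eq: "step_a h n k \<omega> = (X (real k * h + h) \<omega> - X (real k * h) \<omega>) + defect h n k \<omega>"
  unfolding step_a_def X_increment defect_def wiener_sum_def sum.distrib[symmetric]
  by (intro sum.cong refl) (simp add: left_diff_distrib)

text \<open>The coefficients have mean and second moment of order \<open>h\<close>, and summation
  over a step of length \<open>h\<close> gives another factor \<open>h\<close>. The bounds do not
  depend on \<open>n\<close>.\<close>

lemma defect_moments:
  "integrable N (defect h n k)" "integrable N (\<lambda>\<omega>. (defect h n k \<omega>)\<^sup>2)"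
  "\<bar>expectation (defect h n k)\<bar> \<le> \<bar>mx\<bar> * exp_const 1 * h\<^sup>2"
  "expectation (\<lambda>\<omega>. (defect h n k \<omega>)\<^sup>2) \<le> 2 * (mx\<^sup>2 + sx\<^sup>2) * exp_const 1 * h\<^sup>2"
proof -
  let ?c = "\<lambda>i \<omega>. exp (1 * (R (real k * h + h) \<omega> - R (real k * h + real i * (h / real n)) \<omega>)) - 1"
  let ?d = "h / real n"
  have t: "0 \<le> real k * h + real i * ?d" "real k * h + real i * ?d \<le> real k * h + h"
     "real k * h + h - (real k * h + real i * ?d) \<le> 1" "real k * h + h - (real k * h + real i * ?d) \<le> h"
    if "i < n" for i
  proof -
    have "0 \<le> real i * ?d" using grid(2) by (intro mult_nonneg_nonneg) auto
    then show "0 \<le> real k * h + real i * ?d" "real k * h + real i * ?d \<le> real k * h + h"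
     "real k * h + h - (real k * h + real i * ?d) \<le> 1" "real k * h + h - (real k * h + real i * ?d) \<le> h"
      using grid(4)[of i] grid(5)[OF that] h by linarith+
  qed
  note r = R_exp_minus_one[OF t(1-3), where c=1]
  have E0: "exp_const 1 \<ge> 0" using r(4)[OF n n n] .
  have c: "?c i \<in> borel_measurable \<F>" for i using coeff_path(1)[of i] by simp
  have c2: "integrable N (\<lambda>\<omega>. (?c i \<omega>)\<^sup>2)" if "i < n" for i using r(1)[OF that that that] .
  have w: "integrable N (defect h n k)" "expectation (defect h n k) = mx * ?d * (\<Sum>i<n. expectation (?c i))"
    "integrable N (\<lambda>\<omega>. (defect h n k \<omega>)\<^sup>2)"
    "expectation (\<lambda>\<omega>. (defect h n k \<omega>)\<^sup>2) \<le> 2 * ?d * (mx\<^sup>2 * (real n * ?d) + sx\<^sup>2) * (\<Sum>i<n. expectation (\<lambda>\<omega>. (?c i \<omega>)\<^sup>2))"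
    unfolding defect_def by (rule wiener_sum_moments[OF c _ grid(1,2)], erule c2)+
  show "integrable N (defect h n k)" "integrable N (\<lambda>\<omega>. (defect h n k \<omega>)\<^sup>2)" using w(1,3) by auto
  have le1: "exp_const 1 * (real k * h + h - (real k * h + real i * ?d)) \<le> exp_const 1 * h" if "i < n" for i
    using t(4)[OF that] E0 by (rule mult_left_mono)
  have "\<bar>\<Sum>i<n. expectation (?c i)\<bar> \<le> (\<Sum>i<n. exp_const 1 * h)"
    by (rule order_trans[OF sum_abs sum_mono]) (use r(3) le1 in \<open>fastforce intro: order_trans\<close>)
  then have "\<bar>expectation (defect h n k)\<bar> \<le> \<bar>mx\<bar> * ?d * (real n * (exp_const 1 * h))"
    unfolding w(2) abs_mult using grid(2) h by (intro mult_mono) auto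
  also have "\<dots> = \<bar>mx\<bar> * exp_const 1 * h\<^sup>2" using n by (simp add: power2_eq_square)
  finally show "\<bar>expectation (defect h n k)\<bar> \<le> \<bar>mx\<bar> * exp_const 1 * h\<^sup>2" .
  have "(\<Sum>i<n. expectation (\<lambda>\<omega>. (?c i \<omega>)\<^sup>2)) \<le> (\<Sum>i<n. exp_const 1 * h)"
    by (rule sum_mono) (use r(2) le1 in \<open>fastforce intro: order_trans\<close>)
  then have "expectation (\<lambda>\<omega>. (defect h n k \<omega>)\<^sup>2) \<le> 2 * ?d * (mx\<^sup>2 * (real n * ?d) + sx\<^sup>2) * (real n * (exp_const 1 * h))"
    using grid(2) h by (intro order_trans[OF w(4)] mult_left_mono mult_nonneg_nonneg add_nonneg_nonneg) auto
  also have "\<dots> \<le> 2 * ?d * (mx\<^sup>2 * 1 + sx\<^sup>2) * (real n * (exp_const 1 * h))"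
    using grid(2,3) h E0 by (intro mult_right_mono mult_left_mono add_mono) auto
  also have "\<dots> = 2 * (mx\<^sup>2 + sx\<^sup>2) * exp_const 1 * h\<^sup>2" using n by (simp add: power2_eq_square)
  finally show "expectation (\<lambda>\<omega>. (defect h n k \<omega>)\<^sup>2) \<le> 2 * (mx\<^sup>2 + sx\<^sup>2) * exp_const 1 * h\<^sup>2" .
qed

end

end

context gou_paths
begin

text \<open>All errors are at most \<open>K * w * h\<close> with \<open>w = sqrt h\<close>, the
  weight in \<open>perturbed_moments\<close>, and \<open>K * w \<le> e\<close> once
  \<open>h \<le> w0^2\<close>. The threshold does not depend on the number \<open>n\<close> of
  cells, so that the limit in \<open>n\<close> can be taken at a fixed mesh
  \<open>h\<close>.\<close>

lemma step_diffusive: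
  assumes e: "e > 0"
  obtains h0 where "h0 > 0" "h0 \<le> 1"
    "\<And>h n k. 0 < h \<Longrightarrow> h \<le> h0 \<Longrightarrow> 0 < n \<Longrightarrow> diffusive_step mx mr sx sr N h e (step_a h n k) (step_b h k)"
proof -
  define K1 where "K1 = 2 * (mx\<^sup>2 + sx\<^sup>2) * exp_const 1"
  define K4 where "K4 = 8 * (mx ^ 4 + 3 * sx ^ 4)"
  define K5 where "K5 = 8 * (mr ^ 4 + 3 * sr ^ 4)"
  \<comment> \<open>The groups serve, in this order, the mean and the second moment of
    \<open>step_a\<close>, the second moment of \<open>step_b\<close>, the mixed moment and the two
    truncated moments.\<close>
  define K where "K = \<bar>mx\<bar> * exp_const 1 + (2 * K1 + mx\<^sup>2 + sx\<^sup>2 + mx\<^sup>2) + mr\<^sup>2 +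
     (\<bar>mx * mr\<bar> + mr\<^sup>2 + sr\<^sup>2 + K1) + (16 * K4 / e\<^sup>2 + 4 * K1) + K5 / e\<^sup>2"
  have E0: "exp_const 1 \<ge> 0" using R_exp_minus_one(4)[of 0 0 1] by simp
  have nn: "0 \<le> \<bar>mx\<bar> * exp_const 1" "0 \<le> K1" "0 \<le> mx\<^sup>2" "0 \<le> sx\<^sup>2" "0 \<le> mr\<^sup>2" "0 \<le> sr\<^sup>2" "0 \<le> \<bar>mx * mr\<bar>"
     "0 \<le> K4 / e\<^sup>2" "0 \<le> K5 / e\<^sup>2" "0 \<le> K4" "0 \<le> K5"
    using E0 by (auto simp: K1_def K4_def K5_def)
  have "16 * K4 / e\<^sup>2 = 16 * (K4 / e\<^sup>2)" by simp
  then have K0: "0 \<le> K" "\<bar>mx\<bar> * exp_const 1 \<le> K" "2 * K1 + mx\<^sup>2 + sx\<^sup>2 + mx\<^sup>2 \<le> K" "mr\<^sup>2 \<le> K"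
     "\<bar>mx * mr\<bar> + mr\<^sup>2 + sr\<^sup>2 + K1 \<le> K" "16 * K4 / e\<^sup>2 + 4 * K1 \<le> K" "K5 / e\<^sup>2 \<le> K"
    using nn unfolding K_def by linarith+
  define w0 where "w0 = min 1 (e / (K + 1))"
  have w0: "w0 > 0" "w0 \<le> 1" using e K0(1) by (auto simp: w0_def)
  show ?thesis
  proof (rule that[of "w0\<^sup>2"])
    show "w0\<^sup>2 > 0" "w0\<^sup>2 \<le> 1" using w0 by (auto simp: power_le_one)
    fix h :: real and n k :: nat
    assume h: "0 < h" "h \<le> w0\<^sup>2" and n: "0 < n"
    have h1: "h \<le> 1" using h(2) power_le_one[of w0 2] w0 by linarith
    define w where "w = sqrt h"
    have w: "w > 0" "w * w = h" using h by (auto simp: w_def)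
    have "w \<le> w0" unfolding w_def using h(2) w0 by (intro real_le_lsqrt) auto
    then have w1: "w \<le> 1" and wK: "w * (K + 1) \<le> e"
      using w0 K0(1) by (auto simp: w0_def pos_le_divide_eq)
    have wKe: "c * (w * h) \<le> e * h" if "c \<le> K" for c
    proof -
      have "c * w \<le> (K + 1) * w" using that w by (intro mult_right_mono) auto
      then have "c * w \<le> e" using wK by (simp add: mult.commute)
      from mult_right_mono[OF this, of h] h show ?thesis by (simp add: mult_ac)
    qed
    have h2: "h\<^sup>2 \<le> w * h"
    proof -
      have "w * (w * h) \<le> 1 * (w * h)" using w w1 h by (intro mult_right_mono) auto
      then show ?thesis using w(2) by (simp add: power2_eq_square mult.assoc[symmetric])
    qed
    let ?t = "real k * h"
    have t0: "0 \<le> ?t" using h by simp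
    let ?X = "\<lambda>\<omega>. X (?t + h) \<omega> - X ?t \<omega>" and ?D = "defect h n k" and ?b = "step_b h k"
    have X: "?X \<omega> = mx * h + sx * (W' (?t + h) \<omega> - W' ?t \<omega>)" for \<omega> by (simp add: X_def algebra_simps)
    have b: "?b \<omega> = mr * h + sr * (W (?t + h) \<omega> - W ?t \<omega>)" for \<omega> by (simp add: step_b_def R_def algebra_simps)
    have h0: "0 \<le> h" using h by simp
    note mX = W'.drifted_increment_moments[OF t0 h0 h1, of mx sx, folded X]
    note mb = W.drifted_increment_moments[OF t0 h0 h1, of mr sr, folded b]
    note mD = defect_moments[OF h(1) h1 n, of k, folded K1_def]
    have a: "step_a h n k = (\<lambda>\<omega>. ?X \<omega> + ?D \<omega>)" using step_a_eq[OF h(1) h1 n] by (simp add: fun_eq_iff)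
    have rv: "?X \<in> borel_measurable N" "?D \<in> borel_measurable N" "?b \<in> borel_measurable N"
      using mX(1) mD(1) mb(1) by auto
    note pm = perturbed_moments[OF rv mX(2) mD(2) mb(2) mX(3) w(1) e]
    have D2: "expectation (\<lambda>\<omega>. (?D \<omega>)\<^sup>2) \<le> K1 * h\<^sup>2" by (rule mD(4))
    have "K1 * h\<^sup>2 \<le> K1 * (w * h)" using h2 nn by (intro mult_left_mono) auto
    then have D2': "expectation (\<lambda>\<omega>. (?D \<omega>)\<^sup>2) \<le> K1 * (w * h)" using D2 by linarith
    have D2w: "expectation (\<lambda>\<omega>. (?D \<omega>)\<^sup>2) / w \<le> K1 * (w * h)"
    proof -
      have "expectation (\<lambda>\<omega>. (?D \<omega>)\<^sup>2) \<le> K1 * (w * h) * w"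
        using D2 w(2) by (simp add: power2_eq_square mult_ac)
      then show ?thesis using w(1) by (simp add: pos_divide_le_eq)
    qed
    have sq: "m\<^sup>2 * h\<^sup>2 \<le> m\<^sup>2 * (w * h)" for m :: real using h2 by (intro mult_left_mono) auto
    have hh: "h\<^sup>2 \<le> h" using h h1 by (simp add: power2_eq_square mult_left_le)
    have second: "w * (m\<^sup>2 * h\<^sup>2 + s\<^sup>2 * h) \<le> (m\<^sup>2 + s\<^sup>2) * (w * h)" for m s :: real
    proof -
      have "w * (m\<^sup>2 * h\<^sup>2 + s\<^sup>2 * h) \<le> w * (m\<^sup>2 * h + s\<^sup>2 * h)"
        using w hh by (intro mult_left_mono add_mono) auto
      then show ?thesis by (simp add: algebra_simps)
    qed
    have c1: "\<bar>expectation (step_a h n k) - mx * h\<bar> \<le> e * h"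
    proof -
      have "expectation (step_a h n k) = mx * h + expectation ?D"
        unfolding a using mX(1,4) mD(1) by (subst Bochner_Integration.integral_add) auto
      then have "\<bar>expectation (step_a h n k) - mx * h\<bar> \<le> \<bar>mx\<bar> * exp_const 1 * h\<^sup>2" using mD(3) by simp
      also have "\<dots> \<le> \<bar>mx\<bar> * exp_const 1 * (w * h)" using h2 nn by (intro mult_left_mono) auto
      also have "\<dots> \<le> e * h" by (rule wKe[OF K0(2)])
      finally show ?thesis .
    qed
    have c2: "\<bar>expectation ?b - mr * h\<bar> \<le> e * h" using mb(4) e h by simp
    have c3: "\<bar>expectation (\<lambda>\<omega>. (step_a h n k \<omega>)\<^sup>2) - sx\<^sup>2 * h\<bar> \<le> e * h"
    proof -
      have "\<bar>expectation (\<lambda>\<omega>. (step_a h n k \<omega>)\<^sup>2) - (mx\<^sup>2 * h\<^sup>2 + sx\<^sup>2 * h)\<bar> \<le>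
         K1 * (w * h) + ((mx\<^sup>2 + sx\<^sup>2) * (w * h) + K1 * (w * h))"
        using pm(2) D2' D2w second[of mx sx] unfolding a mX(5) by linarith
      then have "\<bar>expectation (\<lambda>\<omega>. (step_a h n k \<omega>)\<^sup>2) - sx\<^sup>2 * h\<bar> \<le>
         K1 * (w * h) + ((mx\<^sup>2 + sx\<^sup>2) * (w * h) + K1 * (w * h)) + mx\<^sup>2 * (w * h)"
        using sq[of mx] zero_le_power2[of "mx * h"] unfolding power_mult_distrib by linarith
      also have "\<dots> = (2 * K1 + mx\<^sup>2 + sx\<^sup>2 + mx\<^sup>2) * (w * h)" by (simp add: algebra_simps)
      also have "\<dots> \<le> e * h" by (rule wKe[OF K0(3)])
      finally show ?thesis .
    qed
    have c4: "\<bar>expectation (\<lambda>\<omega>. (?b \<omega>)\<^sup>2) - sr\<^sup>2 * h\<bar> \<le> e * h"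
      unfolding mb(5) using sq[of mr] wKe[OF K0(4)] by simp
    have c5: "\<bar>expectation (\<lambda>\<omega>. step_a h n k \<omega> * ?b \<omega>)\<bar> \<le> e * h"
    proof -
      have th: "0 \<le> ?t + h" using t0 h by simp
      have m1: "?b \<in> borel_measurable \<F>" unfolding step_b_def[abs_def]
        using R_path[OF t0] R_path[OF th] by simp
      have m2: "?X \<in> borel_measurable \<F>'" unfolding X_def using W'.B_path[OF t0] W'.B_path[OF th] by simp
      have "expectation (\<lambda>\<omega>. ?X \<omega> * ?b \<omega>) = mx * mr * h\<^sup>2"
        using paths_product(2)[OF m1 m2 mb(1) mX(1)] mX(4) mb(4) by (simp add: power2_eq_square mult_ac)
      then have "\<bar>expectation (\<lambda>\<omega>. ?X \<omega> * ?b \<omega>)\<bar> \<le> \<bar>mx * mr\<bar> * (w * h)"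
        using h2 by (simp add: abs_mult mult_left_mono)
      then have "\<bar>expectation (\<lambda>\<omega>. step_a h n k \<omega> * ?b \<omega>)\<bar> \<le> \<bar>mx * mr\<bar> * (w * h) + ((mr\<^sup>2 + sr\<^sup>2) * (w * h) + K1 * (w * h))"
        using pm(3) D2w second[of mr sr] unfolding a mb(5) by linarith
      also have "\<dots> = (\<bar>mx * mr\<bar> + mr\<^sup>2 + sr\<^sup>2 + K1) * (w * h)" by (simp add: algebra_simps)
      also have "\<dots> \<le> e * h" by (rule wKe[OF K0(5)])
      finally show ?thesis .
    qed
    have c6: "expectation (\<lambda>\<omega>. (step_a h n k \<omega>)\<^sup>2 * indicator {e<..} \<bar>step_a h n k \<omega>\<bar>) \<le> e * h"
    proof -
      have "16 * expectation (\<lambda>\<omega>. ?X \<omega> ^ 4) / e\<^sup>2 \<le> 16 * (K4 * h\<^sup>2) / e\<^sup>2"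
        using mX(6) unfolding K4_def by (intro divide_right_mono mult_left_mono) auto
      also have "\<dots> = 16 * K4 / e\<^sup>2 * h\<^sup>2" by simp
      also have "\<dots> \<le> 16 * K4 / e\<^sup>2 * (w * h)" using h2 nn by (intro mult_left_mono) auto
      finally have "expectation (\<lambda>\<omega>. (step_a h n k \<omega>)\<^sup>2 * indicator {e<..} \<bar>step_a h n k \<omega>\<bar>) \<le> 16 * K4 / e\<^sup>2 * (w * h) + 4 * (K1 * (w * h))"
        using pm(4) D2' unfolding a by linarith
      also have "\<dots> = (16 * K4 / e\<^sup>2 + 4 * K1) * (w * h)" by (simp add: algebra_simps)
      also have "\<dots> \<le> e * h" by (rule wKe[OF K0(6)])
      finally show ?thesis .
    qed
    have c7: "expectation (\<lambda>\<omega>. (?b \<omega>)\<^sup>2 * indicator {e<..} \<bar>?b \<omega>\<bar>) \<le> e * h"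
    proof -
      have "expectation (\<lambda>\<omega>. (?b \<omega>)\<^sup>2 * indicator {e<..} \<bar>?b \<omega>\<bar>) \<le> expectation (\<lambda>\<omega>. ?b \<omega> ^ 4) / e\<^sup>2"
        by (rule truncated_second_moment(2)[OF rv(3) mb(3) e])
      also have "\<dots> \<le> K5 * h\<^sup>2 / e\<^sup>2" using mb(6) unfolding K5_def by (intro divide_right_mono) auto
      also have "\<dots> = K5 / e\<^sup>2 * h\<^sup>2" by simp
      also have "\<dots> \<le> K5 / e\<^sup>2 * (w * h)" using h2 nn by (intro mult_left_mono) auto
      also have "\<dots> \<le> e * h" by (rule wKe[OF K0(7)])
      finally show ?thesis .
    qed
    have "step_a h n k \<in> borel_measurable N" unfolding a using rv by simp
    moreover have "integrable N (\<lambda>\<omega>. (step_a h n k \<omega>)\<^sup>2)" unfolding a by (rule pm(1))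
    ultimately show "diffusive_step mx mr sx sr N h e (step_a h n k) (step_b h k)"
      unfolding diffusive_step_def using rv(3) mb(2) c1 c2 c3 c4 c5 c6 c7 by blast
  qed
qed

text \<open>Discounting turns the coefficients of \<open>step_a\<close> into
  \<open>exp (- (R_s - R_t))\<close>, whose second moments are at most 1 because
  \<open>sr^2 < mr\<close>. As the increments are stationary, the means \<open>u\<close> and
  \<open>v\<close> do not depend on \<open>k\<close>.\<close>

lemma step_contracting:
  assumes mu: "sr\<^sup>2 < mr" and h: "0 < h" "h \<le> 1" "2 * (mr - sr\<^sup>2) * h \<le> 1" and n: "0 < n"
  defines "b \<equiv> sr\<^sup>2 / 2 - mr"
  shows "contracting_step N h (mr - sr\<^sup>2) (2 * (mx\<^sup>2 + sx\<^sup>2) + \<bar>mx\<bar> * exp \<bar>b\<bar> + \<bar>b\<bar>) (exp (b * h))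
     (mx * (h / real n) * (\<Sum>i<n. exp (b * (real i * (h / real n))))) (step_a h n k) (step_b h k)"
proof -
  let ?t = "real k * h" and ?d = "h / real n"
  let ?c = "\<lambda>i \<omega>. exp (- (R (?t + real i * ?d) \<omega> - R ?t \<omega>))"
  let ?\<kappa> = "mr - sr\<^sup>2"
  note g = grid[OF h(1,2) n]
  have t0: "0 \<le> ?t" using h by simp
  have ti: "0 \<le> ?t" "?t \<le> ?t + real i * ?d" for i using h n by auto
  have sub: "?t + h - ?t = h" by simp
  have b1: "- 1 * mr + (- 1)\<^sup>2 * sr\<^sup>2 / 2 = b" "- 2 * mr + (- 2)\<^sup>2 * sr\<^sup>2 / 2 = - (2 * ?\<kappa>)"
    by (simp_all add: b_def)
  have mb: "step_b h k \<in> borel_measurable N" unfolding step_b_def[abs_def] by simp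
  have e2: "(exp (- z))\<^sup>2 = exp (- 2 * z)" for z :: real by (simp add: power2_eq_square flip: exp_add)
  have th: "?t \<le> ?t + h" using h by simp
  note r1 = R_exp[OF t0 th, of "- 1", unfolded b1 sub] and r2 = R_exp[OF t0 th, of "- 2", unfolded b1 sub]
  have i1: "integrable N (\<lambda>\<omega>. (exp (- step_b h k \<omega>))\<^sup>2)"
    unfolding e2 step_b_def by (rule r2(1))
  have u: "expectation (\<lambda>\<omega>. exp (- step_b h k \<omega>)) = exp (b * h)"
    using r1(2) unfolding step_b_def by simp
  \<comment> \<open>Applied to \<open>x = 2 (mr - sr^2) h\<close>: half of the exponential rate
    survives as a linear bound.\<close>
  have x: "exp (- x) \<le> 1 - x / 2" if "0 \<le> x" "x \<le> 1" for x :: real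
  proof -
    have "1 \<le> (1 - x / 2) * (1 + x)" using that mult_left_le[of x x] by (simp add: field_simps)
    also have "\<dots> \<le> (1 - x / 2) * exp x" using that exp_ge_add_one_self[of x] by (intro mult_left_mono) auto
    finally show ?thesis by (simp add: exp_minus field_simps)
  qed
  have E2: "expectation (\<lambda>\<omega>. (exp (- step_b h k \<omega>))\<^sup>2) \<le> 1 - ?\<kappa> * h"
  proof -
    have "expectation (\<lambda>\<omega>. (exp (- step_b h k \<omega>))\<^sup>2) = exp (- (2 * ?\<kappa>) * h)"
      unfolding e2 step_b_def by (rule r2(2))
    also have "\<dots> = exp (- (2 * ?\<kappa> * h))" by (simp only: mult_minus_left)
    also have "\<dots> \<le> 1 - 2 * ?\<kappa> * h / 2" by (rule x) (use h mu in auto)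
    also have "2 * z * h / 2 = z * h" for z :: real by simp
    finally show ?thesis .
  qed
  have ea: "exp (- step_b h k \<omega>) * step_a h n k \<omega> = wiener_sum ?c ?t ?d n \<omega>" for \<omega>
  proof -
    have "exp (- step_b h k \<omega>) * exp (R (?t + h) \<omega> - R (?t + real i * ?d) \<omega>) = ?c i \<omega>" for i
      by (simp add: step_b_def flip: exp_add)
    then show ?thesis
      unfolding step_a_def wiener_sum_def sum_distrib_left mult.assoc[symmetric] by simp
  qed
  have c: "?c i \<in> borel_measurable \<F>" for i by (rule coeff_path[OF h(1,2) n])
  have c2: "integrable N (\<lambda>\<omega>. (?c i \<omega>)\<^sup>2)" for i
    unfolding e2 using R_exp(1)[OF ti, of "- 2" i] by simp
  note w = wiener_sum_moments[where c="?c" and n=n, OF c c2 g(1,2)]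
  have Ec: "expectation (?c i) = exp (b * (real i * ?d))" for i
    using R_exp(2)[OF ti, of "- 1" i] unfolding b1 by simp
  have Ec2: "expectation (\<lambda>\<omega>. (?c i \<omega>)\<^sup>2) \<le> 1" for i
  proof -
    have "expectation (\<lambda>\<omega>. (?c i \<omega>)\<^sup>2) = exp (- (2 * ?\<kappa>) * (real i * ?d))"
      unfolding e2 using R_exp(2)[OF ti, of "- 2" i] unfolding b1 by simp
    also have "\<dots> \<le> 1"
      unfolding exp_le_one_iff using mu g(2) by (intro mult_nonpos_nonneg mult_nonneg_nonneg) auto
    finally show ?thesis .
  qed
  have i2: "integrable N (\<lambda>\<omega>. (exp (- step_b h k \<omega>) * step_a h n k \<omega>)\<^sup>2)"
    unfolding ea by (rule w(3))
  have v: "expectation (\<lambda>\<omega>. exp (- step_b h k \<omega>) * step_a h n k \<omega>) = mx * ?d * (\<Sum>i<n. exp (b * (real i * ?d)))"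
    unfolding ea using w(2) unfolding Ec by simp
  have nn: "0 \<le> mx\<^sup>2 * h" "0 \<le> sx\<^sup>2 * h" "0 \<le> \<bar>mx\<bar> * exp \<bar>b\<bar> * h" "0 \<le> \<bar>b\<bar> * h" using h by auto
  have C: "(2 * (mx\<^sup>2 + sx\<^sup>2) + \<bar>mx\<bar> * exp \<bar>b\<bar> + \<bar>b\<bar>) * h = 2 * (mx\<^sup>2 * h + sx\<^sup>2 * h) + \<bar>mx\<bar> * exp \<bar>b\<bar> * h + \<bar>b\<bar> * h"
    by (simp add: algebra_simps)
  have v2: "expectation (\<lambda>\<omega>. (exp (- step_b h k \<omega>) * step_a h n k \<omega>)\<^sup>2) \<le> 2 * (mx\<^sup>2 * h + sx\<^sup>2 * h)"
  proof -
    have "expectation (\<lambda>\<omega>. (exp (- step_b h k \<omega>) * step_a h n k \<omega>)\<^sup>2) \<le> 2 * ?d * (mx\<^sup>2 * (real n * ?d) + sx\<^sup>2) * (\<Sum>i<n. 1)"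
      unfolding ea using g(2) Ec2 by (intro order_trans[OF w(4)] mult_left_mono sum_mono mult_nonneg_nonneg add_nonneg_nonneg) auto
    also have "\<dots> = 2 * h * (mx\<^sup>2 * h + sx\<^sup>2)" using n by simp
    also have "\<dots> \<le> 2 * h * (mx\<^sup>2 * 1 + sx\<^sup>2)" using h by (intro mult_left_mono add_mono) auto
    finally show ?thesis by (simp add: algebra_simps)
  qed
  have v1: "\<bar>mx * ?d * (\<Sum>i<n. exp (b * (real i * ?d)))\<bar> \<le> \<bar>mx\<bar> * exp \<bar>b\<bar> * h"
  proof -
    have "(\<Sum>i<n. exp (b * (real i * ?d))) \<le> (\<Sum>i<n. exp \<bar>b\<bar>)"
    proof (rule sum_mono)
      fix i assume "i \<in> {..<n}"
      then have "real i * ?d \<le> 1" using g(5)[of i] h(2) order_trans by blast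
      moreover have "0 \<le> real i * ?d" using g(2) by (intro mult_nonneg_nonneg) auto
      ultimately have "\<bar>b\<bar> * (real i * ?d) \<le> \<bar>b\<bar> * 1" "b * (real i * ?d) \<le> \<bar>b\<bar> * (real i * ?d)"
        by (intro mult_left_mono mult_right_mono; simp)+
      then show "exp (b * (real i * ?d)) \<le> exp \<bar>b\<bar>" by simp
    qed
    then have "\<bar>mx\<bar> * ?d * (\<Sum>i<n. exp (b * (real i * ?d))) \<le> \<bar>mx\<bar> * ?d * (real n * exp \<bar>b\<bar>)"
      using g(2) h(1) by (intro mult_left_mono) auto
    moreover have "\<bar>mx\<bar> * ?d * (real n * exp \<bar>b\<bar>) = \<bar>mx\<bar> * exp \<bar>b\<bar> * h" using n by simp
    moreover have "0 \<le> (\<Sum>i<n. exp (b * (real i * ?d)))" by (intro sum_nonneg) simp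
    ultimately show ?thesis using g(2) h(1) by (simp add: abs_mult)
  qed
  have v0: "1 - \<bar>b\<bar> * h \<le> exp (b * h)" using exp_increment_bounds(2)[of h b] h by simp
  have bounds: "expectation (\<lambda>\<omega>. (exp (- step_b h k \<omega>) * step_a h n k \<omega>)\<^sup>2) \<le> 2 * (mx\<^sup>2 * h + sx\<^sup>2 * h) + \<bar>mx\<bar> * exp \<bar>b\<bar> * h + \<bar>b\<bar> * h"
    "\<bar>mx * ?d * (\<Sum>i<n. exp (b * (real i * ?d)))\<bar> \<le> 2 * (mx\<^sup>2 * h + sx\<^sup>2 * h) + \<bar>mx\<bar> * exp \<bar>b\<bar> * h + \<bar>b\<bar> * h"
    "1 - (2 * (mx\<^sup>2 * h + sx\<^sup>2 * h) + \<bar>mx\<bar> * exp \<bar>b\<bar> * h + \<bar>b\<bar> * h) \<le> exp (b * h)"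
  proof -
    note pq = mult_nonneg_nonneg[OF zero_le_numeral add_nonneg_nonneg[OF nn(1,2)]]
    show "expectation (\<lambda>\<omega>. (exp (- step_b h k \<omega>) * step_a h n k \<omega>)\<^sup>2) \<le> 2 * (mx\<^sup>2 * h + sx\<^sup>2 * h) + \<bar>mx\<bar> * exp \<bar>b\<bar> * h + \<bar>b\<bar> * h"
      by (rule order_trans[OF v2]) (use nn in simp)
    show "\<bar>mx * ?d * (\<Sum>i<n. exp (b * (real i * ?d)))\<bar> \<le> 2 * (mx\<^sup>2 * h + sx\<^sup>2 * h) + \<bar>mx\<bar> * exp \<bar>b\<bar> * h + \<bar>b\<bar> * h"
      by (rule order_trans[OF v1 add_increasing2[OF nn(4) add_increasing[OF pq order_refl]]])
    show "1 - (2 * (mx\<^sup>2 * h + sx\<^sup>2 * h) + \<bar>mx\<bar> * exp \<bar>b\<bar> * h + \<bar>b\<bar> * h) \<le> exp (b * h)"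
      by (rule order_trans[OF diff_left_mono[OF add_increasing[OF add_nonneg_nonneg[OF pq nn(3)] order_refl]] v0])
  qed
  have "step_a h n k \<in> borel_measurable N"
  proof -
    have "(\<lambda>\<omega>. exp (step_b h k \<omega>) * wiener_sum ?c ?t ?d n \<omega>) \<in> borel_measurable N"
      using mb w(1) by simp
    moreover have "exp (step_b h k \<omega>) * wiener_sum ?c ?t ?d n \<omega> = step_a h n k \<omega>" for \<omega>
      unfolding ea[symmetric] by (simp add: exp_minus)
    ultimately show ?thesis by simp
  qed
  then show ?thesis
    using bounds mb i1 i2 u v E2 unfolding contracting_step_def C by blast
qed

section \<open>Independence of the steps of the skeleton\<close>

definition increments :: "real \<Rightarrow> nat + nat \<Rightarrow> 'b \<Rightarrow> real" where
  "increments d j \<omega> = (case j of Inl i \<Rightarrow> W (real (Suc i) * d) \<omega> - W (real i * d) \<omega>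
     | Inr i \<Rightarrow> W' (real (Suc i) * d) \<omega> - W' (real i * d) \<omega>)"

text \<open>Finitely many events split into those of \<open>W\<close> and those of
  \<open>W'\<close>; the paths are independent of each other, and within each path the increments
  are independent.\<close>

lemma increments_indep:
  assumes d: "d > 0"
  shows "indep_vars (\<lambda>_. borel) (increments d) UNIV"
  unfolding indep_vars_def2
proof (intro conjI ballI)
  fix j show "increments d j \<in> borel_measurable N"
    by (cases j) (auto simp: increments_def[abs_def])
next
  let ?F = "\<lambda>j. {increments d j -` A \<inter> space N | A. A \<in> sets borel}"
  have iW: "indep_vars (\<lambda>_. borel) (\<lambda>i. increments d (Inl i)) {..<m}" for m
    using W.B_indep[of "\<lambda>i. real i * d" m] d by (simp add: increments_def[abs_def])
  have iW': "indep_vars (\<lambda>_. borel) (\<lambda>i. increments d (Inr i)) {..<m}" for m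
    using W'.B_indep[of "\<lambda>i. real i * d" m] d by (simp add: increments_def[abs_def])
  have mW: "increments d (Inl i) \<in> borel_measurable \<F>" for i
  proof -
    have [measurable]: "W (real (Suc i) * d) \<in> borel_measurable \<F>" "W (real i * d) \<in> borel_measurable \<F>"
      by (rule W.B_path, use d in simp)+
    show ?thesis unfolding increments_def[abs_def] sum.case by measurable
  qed
  have mW': "increments d (Inr i) \<in> borel_measurable \<F>'" for i
  proof -
    have [measurable]: "W' (real (Suc i) * d) \<in> borel_measurable \<F>'" "W' (real i * d) \<in> borel_measurable \<F>'"
      by (rule W'.B_path, use d in simp)+
    show ?thesis unfolding increments_def[abs_def] sum.case by measurable
  qed
  show "indep_sets ?F UNIV"
  proof (rule indep_setsI)
    fix j show "?F j \<subseteq> events"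
    proof -
      have "increments d j \<in> borel_measurable N" by (cases j) (auto simp: increments_def[abs_def])
      then show ?thesis by (auto intro: measurable_sets)
    qed
  next
    fix A :: "nat + nat \<Rightarrow> 'b set" and J :: "(nat + nat) set"
    assume J: "J \<noteq> {}" "finite J" and A: "\<forall>j\<in>J. A j \<in> ?F j"
    define J1 where "J1 = Inl -` J" define J2 where "J2 = Inr -` J"
    have fin: "finite J1" "finite J2" using J(2) by (auto simp: J1_def J2_def intro!: finite_vimageI)
    have J12: "J = Inl ` J1 \<union> Inr ` J2"
      unfolding J1_def J2_def by (auto simp: image_iff) (metis sum.exhaust)
    have A1: "A (Inl i) \<in> ?F (Inl i)" if "i \<in> J1" for i using A that by (auto simp: J1_def)
    have A2: "A (Inr i) \<in> ?F (Inr i)" if "i \<in> J2" for i using A that by (auto simp: J2_def)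
    \<comment> \<open>The intersection with \<open>space N\<close> makes an empty index set yield
      the sure event.\<close>
    define E1 where "E1 = space N \<inter> (\<Inter>i\<in>J1. A (Inl i))"
    define E2 where "E2 = space N \<inter> (\<Inter>i\<in>J2. A (Inr i))"
    have A1F: "A (Inl i) \<in> sets \<F>" if "i \<in> J1" for i
      using A1[OF that] measurable_sets[OF mW[of i]] by (auto simp: W.space_path_algebra)
    have A2F: "A (Inr i) \<in> sets \<F>'" if "i \<in> J2" for i
      using A2[OF that] measurable_sets[OF mW'[of i]] by (auto simp: W'.space_path_algebra)
    have E1: "E1 \<in> sets \<F>"
      using sets.finite_INT[of J1 "\<lambda>i. A (Inl i)" \<F>] fin(1) A1F sets.top[of \<F>]
      by (cases "J1 = {}") (auto simp: E1_def W.space_path_algebra)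
    have E2: "E2 \<in> sets \<F>'"
      using sets.finite_INT[of J2 "\<lambda>i. A (Inr i)" \<F>'] fin(2) A2F sets.top[of \<F>']
      by (cases "J2 = {}") (auto simp: E2_def W'.space_path_algebra)
    have "(\<Inter>j\<in>J. A j) = E1 \<inter> E2"
    proof -
      obtain j where "j \<in> J" using J(1) by auto
      then have "A j \<subseteq> space N" using A by auto
      then have "(\<Inter>j\<in>J. A j) \<subseteq> space N" using \<open>j \<in> J\<close> by auto
      then show ?thesis unfolding E1_def E2_def J12 by auto
    qed
    then have "prob (\<Inter>j\<in>J. A j) = prob E1 * prob E2" using paths_indep_sets[OF E1 E2] by simp
    also have "prob E1 = (\<Prod>i\<in>J1. prob (A (Inl i)))"
    proof (cases "J1 = {}")
      case False
      obtain m where m: "J1 \<subseteq> {..<m}" using finite_nat_iff_bounded fin(1) by blast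
      have iset: "indep_sets (\<lambda>i. ?F (Inl i)) {..<m}" using iW[of m] unfolding indep_vars_def2 by blast
      have "prob (\<Inter>i\<in>J1. A (Inl i)) = (\<Prod>i\<in>J1. prob (A (Inl i)))"
        by (rule indep_setsD[OF iset m False fin(1)]) (use A1 in blast)
      moreover have "E1 = (\<Inter>i\<in>J1. A (Inl i))" using False A1 unfolding E1_def by fastforce
      ultimately show ?thesis by simp
    qed (simp add: E1_def prob_space)
    also have "prob E2 = (\<Prod>i\<in>J2. prob (A (Inr i)))"
    proof (cases "J2 = {}")
      case False
      obtain m where m: "J2 \<subseteq> {..<m}" using finite_nat_iff_bounded fin(2) by blast
      have iset: "indep_sets (\<lambda>i. ?F (Inr i)) {..<m}" using iW'[of m] unfolding indep_vars_def2 by blast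
      have "prob (\<Inter>i\<in>J2. A (Inr i)) = (\<Prod>i\<in>J2. prob (A (Inr i)))"
        by (rule indep_setsD[OF iset m False fin(2)]) (use A2 in blast)
      moreover have "E2 = (\<Inter>i\<in>J2. A (Inr i))" using False A2 unfolding E2_def by fastforce
      ultimately show ?thesis by simp
    qed (simp add: E2_def prob_space)
    also have "(\<Prod>i\<in>J1. prob (A (Inl i))) * (\<Prod>i\<in>J2. prob (A (Inr i))) = (\<Prod>j\<in>J. prob (A j))"
      unfolding J12 using fin by (subst prod.union_disjoint) (auto simp: prod.reindex)
    finally show "prob (\<Inter>j\<in>J. A j) = (\<Prod>j\<in>J. prob (A j))" .
  qed
qed

text \<open>Step \<open>k\<close> is a function of the increments of both paths over the
  \<open>k\<close>-th block of \<open>n\<close> cells of length \<open>h / n\<close>, and the blocks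
  are disjoint.\<close>

lemma step_chain:
  assumes h: "0 < h" and n: "0 < n"
  shows "indep_chain N (\<lambda>k \<omega>. (step_a h n k \<omega>, step_b h k \<omega>)) K"
proof -
  define d where "d = h / real n"
  have d: "d > 0" and hd: "h = real n * d" using h n by (auto simp: d_def)
  let ?J = "\<lambda>k. (Inl ` {k * n..<k * n + n} \<union> Inr ` {k * n..<k * n + n}) :: (nat + nat) set"
  have 1: "indep_vars (\<lambda>k. Pi\<^sub>M (?J k) (\<lambda>_. borel)) (\<lambda>k \<omega>. restrict (\<lambda>j. increments d j \<omega>) (?J k)) {..<K}"
  proof (rule indep_vars_restrict[OF increments_indep[OF d]])
    have "i = j" if "x \<in> {i * n..<i * n + n}" "x \<in> {j * n..<j * n + n}" for i j x
    proof -
      have "x div n = i" "x div n = j" using that n by (auto intro!: div_nat_eqI simp: algebra_simps)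
      then show ?thesis by simp
    qed
    then show "disjoint_family_on ?J {..<K}" by (fastforce simp: disjoint_family_on_def)
  qed simp
  \<comment> \<open>\<open>?rb k i\<close> rebuilds the increment of \<open>R\<close> from the start
    of cell \<open>i\<close> to the end of block \<open>k\<close>.\<close>
  let ?rb = "\<lambda>k i q. mr * (real (n - i) * d) + sr * (\<Sum>l\<in>{i..<n}. q (Inl (k * n + l)))"
  let ?f = "\<lambda>k q. (\<Sum>i<n. exp (?rb k i q) * (mx * d + sx * q (Inr (k * n + i))), ?rb k 0 q) :: real \<times> real"
  have 2: "indep_vars (\<lambda>_. borel) (\<lambda>k \<omega>. ?f k (restrict (\<lambda>j. increments d j \<omega>) (?J k))) {..<K}"
  proof (rule indep_vars_compose2[OF 1])
    fix k
    have [measurable]: "(\<lambda>q. q (Inl (k * n + i))) \<in> borel_measurable (Pi\<^sub>M (?J k) (\<lambda>_. borel :: real measure))"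
      "(\<lambda>q. q (Inr (k * n + i))) \<in> borel_measurable (Pi\<^sub>M (?J k) (\<lambda>_. borel :: real measure))" if "i < n" for i
      using that by (auto intro!: measurable_component_singleton)
    have rb: "?rb k i \<in> borel_measurable (Pi\<^sub>M (?J k) (\<lambda>_. borel))" for i
      by (intro borel_measurable_add borel_measurable_times borel_measurable_const borel_measurable_sum) simp
    have "(\<lambda>q. \<Sum>i<n. exp (?rb k i q) * (mx * d + sx * q (Inr (k * n + i)))) \<in> borel_measurable (Pi\<^sub>M (?J k) (\<lambda>_. borel))"
      using rb by (intro borel_measurable_sum borel_measurable_times borel_measurable_add borel_measurable_const
          measurable_compose[OF _ borel_measurable_exp]) auto
    then show "?f k \<in> borel_measurable (Pi\<^sub>M (?J k) (\<lambda>_. borel))"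
      using rb[of 0] by (intro borel_measurable_Pair) auto
  qed
  have t: "real k * h + real i * (h / real n) = real (k * n + i) * d" for k i
    using n by (simp add: hd algebra_simps)
  have t': "real k * h + h = real (k * n + n) * d" "real k * h = real (k * n) * d" for k by (simp_all add: hd algebra_simps)
  have R: "R (real (k * n + n) * d) \<omega> - R (real (k * n + i) * d) \<omega> =
      mr * (real (n - i) * d) + sr * (\<Sum>l\<in>{i..<n}. increments d (Inl (k * n + l)) \<omega>)" if "i \<le> n" for k i \<omega>
  proof -
    have eq: "(\<Sum>l\<in>{i..<n}. increments d (Inl (k * n + l)) \<omega>) = W (real (k * n + n) * d) \<omega> - W (real (k * n + i) * d) \<omega>"
      using sum_Suc_diff'[OF that, of "\<lambda>l. W (real (k * n + l) * d) \<omega>"] by (simp add: increments_def)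
    show ?thesis unfolding eq using that by (simp add: R_def of_nat_diff algebra_simps)
  qed
  have "?f k (restrict (\<lambda>j. increments d j \<omega>) (?J k)) = (step_a h n k \<omega>, step_b h k \<omega>)" for k \<omega>
  proof -
    let ?q = "restrict (\<lambda>j. increments d j \<omega>) (?J k)"
    have q: "?q (Inl (k * n + l)) = increments d (Inl (k * n + l)) \<omega>" "?q (Inr (k * n + l)) = increments d (Inr (k * n + l)) \<omega>"
      if "l < n" for l using that by auto
    have rb: "?rb k i ?q = R (real (k * n + n) * d) \<omega> - R (real (k * n + i) * d) \<omega>" if "i \<le> n" for i
      unfolding R[OF that] by (intro arg_cong2[where f="(+)"] arg_cong2[where f="(*)"] sum.cong refl) (auto simp: q)
    have X: "mx * d + sx * ?q (Inr (k * n + i)) = X (real (k * n + Suc i) * d) \<omega> - X (real (k * n + i) * d) \<omega>" if "i < n" for i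
      unfolding q[OF that] by (simp add: X_def increments_def algebra_simps)
    have "(\<Sum>i<n. exp (?rb k i ?q) * (mx * d + sx * ?q (Inr (k * n + i)))) = step_a h n k \<omega>"
      unfolding step_a_def wiener_sum_def t t'(1)
      by (intro sum.cong refl) (subst rb, simp, subst X, simp_all)
    moreover have "?rb k 0 ?q = step_b h k \<omega>"
      unfolding rb[OF le0] step_b_def t'(1) by (simp only: t'(2) add_0_right)
    ultimately show ?thesis by (simp only:)
  qed
  with 2 show ?thesis by unfold_locales simp
qed

end

section \<open>From the skeleton to the stochastic integral\<close>

lemma sum_lessThan_add: "(\<Sum>j<m + n. f j) = (\<Sum>j<m. f j) + (\<Sum>i<n. f (m + i))" for f :: "nat \<Rightarrow> real"
  by (induction n) (auto simp: add.assoc)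

lemma sum_blocks:
  fixes f :: "nat \<Rightarrow> real"
  assumes "k > 0"
  shows "(\<Sum>i<n. \<Sum>l<k. f (i * k + l)) = (\<Sum>j<n * k. f j)"
  by (induction n) (simp_all add: sum_lessThan_add add.commute[of k])

context prob_space
begin

lemma markov_square:
  fixes D :: "'a \<Rightarrow> real"
  assumes [measurable]: "D \<in> borel_measurable M" and i: "integrable M (\<lambda>\<omega>. (D \<omega>)\<^sup>2)" and e: "e > 0"
  shows "prob {\<omega> \<in> space M. \<bar>D \<omega>\<bar> > e} \<le> expectation (\<lambda>\<omega>. (D \<omega>)\<^sup>2) / e\<^sup>2"
proof -
  let ?A = "{\<omega> \<in> space M. \<bar>D \<omega>\<bar> > e}"
  have A: "?A \<in> sets M" by measurable
  have "prob ?A = expectation (indicator ?A)" using A by simp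
  also have "\<dots> \<le> expectation (\<lambda>\<omega>. (D \<omega>)\<^sup>2 / e\<^sup>2)"
  proof (rule integral_mono)
    show "integrable M (indicator ?A :: 'a \<Rightarrow> real)" using A by (simp add: emeasure_eq_measure)
    show "integrable M (\<lambda>\<omega>. (D \<omega>)\<^sup>2 / e\<^sup>2)" using i by simp
    fix \<omega>
    show "indicator ?A \<omega> \<le> (D \<omega>)\<^sup>2 / e\<^sup>2"
    proof (cases "\<omega> \<in> ?A")
      case True
      then have "e\<^sup>2 \<le> (D \<omega>)\<^sup>2" using e by (simp add: abs_le_square_iff[symmetric])
      then show ?thesis using e True by (simp add: pos_le_divide_eq)
    qed simp
  qed
  finally show ?thesis by simp
qed

lemma ex_le_sets:
  fixes X :: "nat \<Rightarrow> 'a \<Rightarrow> real"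
  assumes "\<And>k. k \<le> K \<Longrightarrow> X k \<in> borel_measurable M"
  shows "{\<omega> \<in> space M. \<exists>k\<le>K. X k \<omega> < c} \<in> sets M"
proof -
  have "{\<omega> \<in> space M. \<exists>k\<le>K. X k \<omega> < c} = (\<Union>k\<in>{..K}. {\<omega> \<in> space M. X k \<omega> < c})" by auto
  also have "\<dots> \<in> sets M"
  proof (rule sets.finite_UN)
    fix k assume "k \<in> {..K}"
    then have [measurable]: "X k \<in> borel_measurable M" using assms by simp
    show "{\<omega> \<in> space M. X k \<omega> < c} \<in> sets M" by measurable
  qed simp
  finally show ?thesis .
qed

lemma prob_union_bound:
  fixes K :: nat
  assumes sub: "A \<subseteq> B \<union> (\<Union>k\<in>{..K}. C k)" and s: "B \<in> sets M" "\<And>k. k \<le> K \<Longrightarrow> C k \<in> sets M"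
  shows "prob A \<le> prob B + (\<Sum>k\<le>K. prob (C k))"
proof -
  have U: "(\<Union>k\<in>{..K}. C k) \<in> sets M" using s(2) by auto
  have "prob A \<le> prob (B \<union> (\<Union>k\<in>{..K}. C k))" using s(1) U by (intro finite_measure_mono[OF sub]) simp
  also have "\<dots> \<le> prob B + prob (\<Union>k\<in>{..K}. C k)" by (rule measure_Un_le[OF s(1) U])
  also have "prob (\<Union>k\<in>{..K}. C k) \<le> (\<Sum>k\<le>K. prob (C k))"
    by (rule finite_measure_subadditive_finite) (use s(2) in auto)
  finally show ?thesis by simp
qed

end

locale gou_process = gou_paths mx mr sx sr N W W'
  for mx mr sx sr :: real and N :: "'b measure" and W W' :: "real \<Rightarrow> 'b \<Rightarrow> real" +
  fixes I :: "real \<Rightarrow> 'b \<Rightarrow> real"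
  assumes I: "is_stoch_integral N (\<lambda>s \<omega>. exp (- (mr * s + sr * W s \<omega>))) (\<lambda>s \<omega>. mx * s + sx * W' s \<omega>) I"
begin

lemma I_rv[measurable]: "I t \<in> borel_measurable N"
  using I by (auto simp: is_stoch_integral_def)

lemma I_cont: "\<omega> \<in> space N \<Longrightarrow> continuous_on {0..} (\<lambda>t. I t \<omega>)"
  using I by (auto simp: is_stoch_integral_def)

definition riemann :: "real \<Rightarrow> nat \<Rightarrow> 'b \<Rightarrow> real" where
  "riemann t m = riemann_sum (\<lambda>s \<omega>. exp (- R s \<omega>)) X t m"

lemma riemann_tendsto:
  assumes "t \<ge> 0" "e > 0"
  shows "(\<lambda>m. prob {\<omega> \<in> space N. \<bar>riemann t m \<omega> - I t \<omega>\<bar> > e}) \<longlonglongrightarrow> 0"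
  using I assms unfolding is_stoch_integral_def riemann_def R_def[abs_def] X_def[abs_def] by blast

definition fine_sum :: "real \<Rightarrow> nat \<Rightarrow> nat \<Rightarrow> 'b \<Rightarrow> real" where
  "fine_sum h n k = wiener_sum (\<lambda>j \<omega>. exp (- R (real j * (h / real n)) \<omega>)) 0 (h / real n) (k * n)"

text \<open>Variation of constants: divided by \<open>exp R\<close>, the affine recursion becomes a
  plain sum. The chain has the sign of \<open>y + fine_sum\<close>, the discrete counterpart of
  \<open>y + I\<close>.\<close>

lemma chain_eq:
  assumes n: "n > 0" and \<omega>: "\<omega> \<in> space N"
  shows "chain y (\<lambda>k. (step_a h n k \<omega>, step_b h k \<omega>)) k = exp (R (real k * h) \<omega>) * (y + fine_sum h n k \<omega>)"
proof (induction k)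
  case 0
  then show ?case using W.B_0[OF \<omega>] by (simp add: R_def fine_sum_def wiener_sum_def)
next
  case (Suc k)
  let ?d = "h / real n"
  let ?g = "\<lambda>j. exp (- R (real j * ?d) \<omega>) * (X (real (Suc j) * ?d) \<omega> - X (real j * ?d) \<omega>)"
  have f: "fine_sum h n k \<omega> = (\<Sum>j<k * n. ?g j)" for k by (simp add: fine_sum_def wiener_sum_def)
  have t: "real k * h + real i * ?d = real (k * n + i) * ?d" for i using n by (simp add: field_simps)
  have a: "step_a h n k \<omega> = exp (R (real k * h + h) \<omega>) * (\<Sum>i<n. ?g (k * n + i))"
    unfolding step_a_def wiener_sum_def sum_distrib_left t
    by (intro sum.cong refl) (simp add: exp_diff exp_minus divide_inverse)
  have "exp (R (real k * h) \<omega>) * exp (step_b h k \<omega>) = exp (R (real k * h + h) \<omega>)"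
    by (simp add: step_b_def flip: exp_add)
  then have "exp (R (real k * h) \<omega>) * (y + fine_sum h n k \<omega>) * exp (step_b h k \<omega>) = exp (R (real k * h + h) \<omega>) * (y + fine_sum h n k \<omega>)"
    by (metis mult.assoc mult.commute)
  moreover have "fine_sum h n (Suc k) \<omega> = fine_sum h n k \<omega> + (\<Sum>i<n. ?g (k * n + i))"
    unfolding f using sum_lessThan_add[of ?g "k * n" n] by (simp add: add.commute)
  moreover have "real (Suc k) * h = real k * h + h" by (simp add: algebra_simps)
  ultimately show ?case using Suc a by (simp add: algebra_simps)
qed

lemma fine_sum_rv[measurable]: "fine_sum h n k \<in> borel_measurable N"
  unfolding fine_sum_def wiener_sum_def[abs_def] by measurable

text \<open>The Riemann sums defining the integral cut \<open>[0, k h]\<close> into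
  \<open>2^m\<close> cells of length \<open>k h / 2^m\<close>, while the chain uses cells of length
  \<open>h / 2^m\<close>. Each coarse cell holds \<open>k\<close> fine ones, and on fine cell
  \<open>j\<close> the integrand is frozen at index \<open>j div k * k\<close>.\<close>

lemma riemann_eq:
  assumes k: "k > 0"
  shows "riemann (real k * h) m \<omega> = wiener_sum (\<lambda>j \<omega>. exp (- R (real (j div k * k) * (h / 2 ^ m)) \<omega>)) 0 (h / 2 ^ m) (k * 2 ^ m) \<omega>"
proof -
  let ?d = "h / 2 ^ m"
  let ?f = "\<lambda>j. exp (- R (real (j div k * k) * ?d) \<omega>) * (X (real (Suc j) * ?d) \<omega> - X (real j * ?d) \<omega>)"
  have t: "real i * (real k * h) / 2 ^ m = real (i * k) * ?d" for i by simp
  have "exp (- R (real (i * k) * ?d) \<omega>) * (X (real (Suc i * k) * ?d) \<omega> - X (real (i * k) * ?d) \<omega>) = (\<Sum>l<k. ?f (i * k + l))" for i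
  proof -
    have "(\<Sum>l<k. ?f (i * k + l)) = (\<Sum>l<k. exp (- R (real (i * k) * ?d) \<omega>) * (X (real (i * k + Suc l) * ?d) \<omega> - X (real (i * k + l) * ?d) \<omega>))"
      by (intro sum.cong refl) simp
    also have "\<dots> = exp (- R (real (i * k) * ?d) \<omega>) * (\<Sum>l<k. X (real (i * k + Suc l) * ?d) \<omega> - X (real (i * k + l) * ?d) \<omega>)"
      by (rule sum_distrib_left[symmetric])
    also have "(\<Sum>l<k. X (real (i * k + Suc l) * ?d) \<omega> - X (real (i * k + l) * ?d) \<omega>) = X (real (i * k + k) * ?d) \<omega> - X (real (i * k + 0) * ?d) \<omega>"
      by (rule sum_lessThan_telescope)
    finally show ?thesis by (simp add: add.commute)
  qed
  then have "riemann (real k * h) m \<omega> = (\<Sum>i<2 ^ m. \<Sum>l<k. ?f (i * k + l))"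
    unfolding riemann_def riemann_sum_def t by simp
  also have "\<dots> = (\<Sum>j<2 ^ m * k. ?f j)" by (rule sum_blocks[OF k])
  finally show ?thesis by (simp add: wiener_sum_def mult.commute)
qed

text \<open>The difference is \<open>exp (- R u)\<close> times
  \<open>exp (- (R s - R u)) - 1\<close>, a product over disjoint stretches of \<open>W\<close>, so
  the expectation of its square factors.\<close>

lemma exp_R_difference:
  assumes us: "0 \<le> u" "u \<le> s" "s - u \<le> 1"
  shows "integrable N (\<lambda>\<omega>. (exp (- R s \<omega>) - exp (- R u \<omega>))\<^sup>2)"
    "expectation (\<lambda>\<omega>. (exp (- R s \<omega>) - exp (- R u \<omega>))\<^sup>2) \<le> exp (\<bar>2 * sr\<^sup>2 - 2 * mr\<bar> * u) * (exp_const (- 1) * (s - u))"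
proof -
  define f where "f x = exp (- 2 * (mr * u + sr * x))" for x
  define g where "g x = (exp (- (mr * (s - u) + sr * x)) - 1)\<^sup>2" for x
  have [measurable]: "f \<in> borel_measurable borel" "g \<in> borel_measurable borel"
    unfolding f_def[abs_def] g_def[abs_def] by measurable
  have e2: "(exp (- z))\<^sup>2 = exp (- 2 * z)" for z :: real by (simp add: power2_eq_square flip: exp_add)
  have fg: "(exp (- R s \<omega>) - exp (- R u \<omega>))\<^sup>2 = f (W u \<omega> - W 0 \<omega>) * g (W s \<omega> - W u \<omega>)" if "\<omega> \<in> space N" for \<omega>
  proof -
    have "exp (- R s \<omega>) - exp (- R u \<omega>) = exp (- R u \<omega>) * (exp (- (R s \<omega> - R u \<omega>)) - 1)"
      by (simp add: algebra_simps flip: exp_add)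
    then have a: "(exp (- R s \<omega>) - exp (- R u \<omega>))\<^sup>2 = exp (- 2 * R u \<omega>) * (exp (- (R s \<omega> - R u \<omega>)) - 1)\<^sup>2"
      by (simp only: power_mult_distrib e2)
    have r1: "R s \<omega> - R u \<omega> = mr * (s - u) + sr * (W s \<omega> - W u \<omega>)" by (simp add: R_def algebra_simps)
    have r2: "R u \<omega> = mr * u + sr * (W u \<omega> - W 0 \<omega>)" using W.B_0[OF that] by (simp add: R_def)
    show ?thesis unfolding f_def g_def r1[symmetric] r2[symmetric] by (rule a)
  qed
  have fR: "f (W u \<omega> - W 0 \<omega>) = exp (- 2 * (R u \<omega> - R 0 \<omega>))" for \<omega>
    unfolding f_def by (simp add: R_def algebra_simps)
  have gR: "g (W s \<omega> - W u \<omega>) = (exp (- 1 * (R s \<omega> - R u \<omega>)) - 1)\<^sup>2" for \<omega>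
    unfolding g_def by (simp add: R_def algebra_simps)
  note r = R_exp[OF order_refl us(1), of "- 2"] and q = R_exp_minus_one[OF us, of "- 1"]
  have i: "integrable N (\<lambda>\<omega>. f (W u \<omega> - W 0 \<omega>))" "integrable N (\<lambda>\<omega>. g (W s \<omega> - W u \<omega>))"
    unfolding fR gR by (rule r(1), rule q(1))
  note p = W.increments_product[OF order_refl us(1) order_refl us(2) _ _ i]
  show "integrable N (\<lambda>\<omega>. (exp (- R s \<omega>) - exp (- R u \<omega>))\<^sup>2)"
    using p(1) fg by (subst Bochner_Integration.integrable_cong[OF refl fg]) auto
  have "expectation (\<lambda>\<omega>. (exp (- R s \<omega>) - exp (- R u \<omega>))\<^sup>2) = expectation (\<lambda>\<omega>. f (W u \<omega> - W 0 \<omega>) * g (W s \<omega> - W u \<omega>))"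
    by (rule Bochner_Integration.integral_cong[OF refl fg])
  also have "\<dots> = expectation (\<lambda>\<omega>. f (W u \<omega> - W 0 \<omega>)) * expectation (\<lambda>\<omega>. g (W s \<omega> - W u \<omega>))"
    by (rule p(2)) auto
  also have "\<dots> \<le> exp (\<bar>2 * sr\<^sup>2 - 2 * mr\<bar> * u) * (exp_const (- 1) * (s - u))"
  proof (rule mult_mono)
    have "expectation (\<lambda>\<omega>. f (W u \<omega> - W 0 \<omega>)) = exp ((- 2 * mr + (- 2)\<^sup>2 * sr\<^sup>2 / 2) * (u - 0))"
      unfolding fR by (rule r(2))
    also have "\<dots> = exp ((2 * sr\<^sup>2 - 2 * mr) * u)" by simp
    also have "\<dots> \<le> exp (\<bar>2 * sr\<^sup>2 - 2 * mr\<bar> * u)" using us(1) by (simp add: mult_right_mono)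
    finally show "expectation (\<lambda>\<omega>. f (W u \<omega> - W 0 \<omega>)) \<le> exp (\<bar>2 * sr\<^sup>2 - 2 * mr\<bar> * u)" .
    show "expectation (\<lambda>\<omega>. g (W s \<omega> - W u \<omega>)) \<le> exp_const (- 1) * (s - u)"
      unfolding gR by (rule q(2))
    show "0 \<le> expectation (\<lambda>\<omega>. g (W s \<omega> - W u \<omega>))"
      by (rule Bochner_Integration.integral_nonneg) (simp add: g_def)
  qed simp
  finally show "expectation (\<lambda>\<omega>. (exp (- R s \<omega>) - exp (- R u \<omega>))\<^sup>2) \<le> exp (\<bar>2 * sr\<^sup>2 - 2 * mr\<bar> * u) * (exp_const (- 1) * (s - u))" .
qed

text \<open>Both sums run over the same increments of \<open>X\<close>, with coefficients taken at
  times at most \<open>T / 2^m\<close> apart. \<open>wiener_sum_moments\<close> turns this into a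
  mean square of order \<open>2^(-m)\<close>.\<close>

lemma fine_minus_riemann:
  assumes h: "h > 0" and k: "k > 0" and m: "real k * (h / 2 ^ m) \<le> 1"
  defines "D \<equiv> \<lambda>\<omega>. fine_sum h (2 ^ m) k \<omega> - riemann (real k * h) m \<omega>"
    and "T \<equiv> real k * h"
  shows "integrable N (\<lambda>\<omega>. (D \<omega>)\<^sup>2)"
    "expectation (\<lambda>\<omega>. (D \<omega>)\<^sup>2) \<le>
      2 * (mx\<^sup>2 * T + sx\<^sup>2) * T * (exp (\<bar>2 * sr\<^sup>2 - 2 * mr\<bar> * T) * (exp_const (- 1) * (T / 2 ^ m)))"
proof -
  let ?d = "h / 2 ^ m" and ?n = "k * 2 ^ m"
  let ?c = "\<lambda>j \<omega>. exp (- R (real j * ?d) \<omega>) - exp (- R (real (j div k * k) * ?d) \<omega>)"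
  let ?C = "exp (\<bar>2 * sr\<^sup>2 - 2 * mr\<bar> * T) * (exp_const (- 1) * (T / 2 ^ m))"
  have d: "0 \<le> ?d" using h by simp
  have Td: "real k * ?d = T / 2 ^ m" "real ?n * ?d = T" by (simp_all add: T_def)
  have D: "D \<omega> = wiener_sum ?c 0 ?d ?n \<omega>" for \<omega>
    unfolding D_def riemann_eq[OF k] fine_sum_def wiener_sum_def by (simp add: left_diff_distrib sum_subtractf)
  have tt: "0 \<le> real (j div k * k) * ?d" "real (j div k * k) * ?d \<le> real j * ?d"
    "real j * ?d - real (j div k * k) * ?d \<le> real k * ?d" for j
  proof -
    show "0 \<le> real (j div k * k) * ?d" using d by (intro mult_nonneg_nonneg) auto
    show "real (j div k * k) * ?d \<le> real j * ?d" using d by (intro mult_right_mono) (simp_all add: div_times_less_eq_dividend del: of_nat_mult)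
    have "j - j div k * k \<le> k" using k by (simp add: minus_div_mult_eq_mod less_imp_le)
    then have "real j - real (j div k * k) \<le> real k" by linarith
    from mult_right_mono[OF this d] show "real j * ?d - real (j div k * k) * ?d \<le> real k * ?d" by (simp only: left_diff_distrib)
  qed
  note e = exp_R_difference[OF tt(1,2) order_trans[OF tt(3) m]]
  have cm: "?c j \<in> borel_measurable \<F>" for j
  proof -
    have "0 \<le> real j * ?d" using d by (intro mult_nonneg_nonneg) auto
    then have [measurable]: "R (real j * ?d) \<in> borel_measurable \<F>" "R (real (j div k * k) * ?d) \<in> borel_measurable \<F>"
      by (rule R_path, intro R_path tt)
    show ?thesis by measurable
  qed
  show "integrable N (\<lambda>\<omega>. (D \<omega>)\<^sup>2)"
    unfolding D by (rule wiener_sum_moments(3)[OF cm e(1) order_refl d])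
  have le: "expectation (\<lambda>\<omega>. (?c j \<omega>)\<^sup>2) \<le> ?C" if "j < ?n" for j
  proof -
    have E0: "0 \<le> exp_const (- 1)" using R_exp_minus_one(4)[of 0 0] by simp
    have "real (j div k * k) * ?d \<le> T"
    proof -
      have "real j \<le> real ?n" using that by (simp only: of_nat_le_iff less_imp_le)
      from mult_right_mono[OF this d] have "real j * ?d \<le> real ?n * ?d" .
      then show ?thesis using tt(2)[of j] unfolding Td by linarith
    qed
    from mult_left_mono[OF this abs_ge_zero]
    have "exp (\<bar>2 * sr\<^sup>2 - 2 * mr\<bar> * (real (j div k * k) * ?d)) \<le> exp (\<bar>2 * sr\<^sup>2 - 2 * mr\<bar> * T)"
      by (simp only: exp_le_cancel_iff)
    moreover have "exp_const (- 1) * (real j * ?d - real (j div k * k) * ?d) \<le> exp_const (- 1) * (T / 2 ^ m)"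
      using tt(3)[of j] E0 unfolding Td by (intro mult_left_mono) auto
    ultimately have "exp (\<bar>2 * sr\<^sup>2 - 2 * mr\<bar> * (real (j div k * k) * ?d)) * (exp_const (- 1) * (real j * ?d - real (j div k * k) * ?d)) \<le> ?C"
      by (rule mult_mono) (rule exp_ge_zero, rule mult_nonneg_nonneg[OF E0], use tt(2)[of j] in linarith)
    then show ?thesis using e(2)[of j] by linarith
  qed
  have "expectation (\<lambda>\<omega>. (D \<omega>)\<^sup>2) \<le> 2 * ?d * (mx\<^sup>2 * (real ?n * ?d) + sx\<^sup>2) * (\<Sum>j<?n. expectation (\<lambda>\<omega>. (?c j \<omega>)\<^sup>2))"
    unfolding D by (rule wiener_sum_moments(4)[OF cm e(1) order_refl d])
  also have "\<dots> \<le> 2 * ?d * (mx\<^sup>2 * (real ?n * ?d) + sx\<^sup>2) * (\<Sum>j<?n. ?C)"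
  proof (rule mult_left_mono)
    show "(\<Sum>j<?n. expectation (\<lambda>\<omega>. (?c j \<omega>)\<^sup>2)) \<le> (\<Sum>j<?n. ?C)" by (rule sum_mono) (use le in simp)
    show "0 \<le> 2 * ?d * (mx\<^sup>2 * (real ?n * ?d) + sx\<^sup>2)"
      using d by (intro mult_nonneg_nonneg add_nonneg_nonneg) auto
  qed
  also have "\<dots> = 2 * (mx\<^sup>2 * (real ?n * ?d) + sx\<^sup>2) * (real ?n * ?d) * ?C"
    by (simp only: sum_constant card_lessThan) (simp only: mult_ac)
  finally show "expectation (\<lambda>\<omega>. (D \<omega>)\<^sup>2) \<le> 2 * (mx\<^sup>2 * T + sx\<^sup>2) * T * ?C" unfolding Td .
qed

lemma riemann_rv[measurable]: "riemann t m \<in> borel_measurable N"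
  unfolding riemann_def riemann_sum_def[abs_def] by measurable

text \<open>The Riemann sums of \<open>is_stoch_integral\<close> are the intermediate term: the fine
  sums approach them in mean square, and they approach \<open>I\<close> in probability.\<close>

lemma fine_sum_tendsto:
  assumes h: "h > 0" and e: "e > 0"
  shows "(\<lambda>m. prob {\<omega> \<in> space N. \<bar>fine_sum h (2 ^ m) k \<omega> - I (real k * h) \<omega>\<bar> > e}) \<longlonglongrightarrow> 0"
proof -
  let ?t = "real k * h"
  have t: "?t \<ge> 0" using h by simp
  have e2: "e / 2 > 0" using e by simp
  let ?D = "\<lambda>m \<omega>. fine_sum h (2 ^ m) k \<omega> - riemann ?t m \<omega>"
  have inv: "(\<lambda>m. c / 2 ^ m) \<longlonglongrightarrow> 0" for c :: real
    using LIMSEQ_divide_realpow_zero[of 2 c] by simp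
  have "(\<lambda>m. prob {\<omega> \<in> space N. \<bar>?D m \<omega>\<bar> > e / 2}) \<longlonglongrightarrow> 0"
  \<comment> \<open>At time 0 all sums vanish; \<open>riemann_eq\<close> assumes
    \<open>k > 0\<close>.\<close>
  proof (cases "k = 0")
    case True
    have "?D m \<omega> = 0" for m \<omega>
      using True by (simp add: fine_sum_def riemann_def riemann_sum_def wiener_sum_def)
    then show ?thesis using e by simp
  next
    case False
    then have k: "k > 0" by simp
    define C where "C = 2 * (mx\<^sup>2 * ?t + sx\<^sup>2) * ?t * (exp (\<bar>2 * sr\<^sup>2 - 2 * mr\<bar> * ?t) * (exp_const (- 1) * ?t)) / (e / 2)\<^sup>2"
    have "eventually (\<lambda>m. ?t / 2 ^ m < 1) sequentially" by (rule order_tendstoD[OF inv]) simp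
    then have "eventually (\<lambda>m. norm (prob {\<omega> \<in> space N. \<bar>?D m \<omega>\<bar> > e / 2}) \<le> C / 2 ^ m) sequentially"
    proof eventually_elim
      case (elim m)
      then have m1: "real k * (h / 2 ^ m) \<le> 1" by simp
      note D = fine_minus_riemann[OF h k m1]
      have Dm: "?D m \<in> borel_measurable N" by measurable
      have "prob {\<omega> \<in> space N. \<bar>?D m \<omega>\<bar> > e / 2} \<le> expectation (\<lambda>\<omega>. (?D m \<omega>)\<^sup>2) / (e / 2)\<^sup>2"
        by (rule markov_square[OF Dm D(1) e2])
      also have "\<dots> \<le> 2 * (mx\<^sup>2 * ?t + sx\<^sup>2) * ?t * (exp (\<bar>2 * sr\<^sup>2 - 2 * mr\<bar> * ?t) * (exp_const (- 1) * (?t / 2 ^ m))) / (e / 2)\<^sup>2"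
        using D(2) by (intro divide_right_mono) auto
      also have "\<dots> = C / 2 ^ m" unfolding C_def by simp
      finally show ?case by simp
    qed
    then show ?thesis by (rule Lim_null_comparison[OF _ inv])
  qed
  then have "(\<lambda>m. prob {\<omega> \<in> space N. \<bar>?D m \<omega>\<bar> > e / 2} + prob {\<omega> \<in> space N. \<bar>riemann ?t m \<omega> - I ?t \<omega>\<bar> > e / 2}) \<longlonglongrightarrow> 0 + 0"
    by (intro tendsto_add riemann_tendsto t e2)
  then have lim: "(\<lambda>m. prob {\<omega> \<in> space N. \<bar>?D m \<omega>\<bar> > e / 2} + prob {\<omega> \<in> space N. \<bar>riemann ?t m \<omega> - I ?t \<omega>\<bar> > e / 2}) \<longlonglongrightarrow> 0" by simp
  show ?thesis
  proof (rule Lim_null_comparison[OF always_eventually[OF allI] lim])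
    fix m
    have s: "{\<omega> \<in> space N. \<bar>?D m \<omega>\<bar> > e / 2} \<in> sets N" "{\<omega> \<in> space N. \<bar>riemann ?t m \<omega> - I ?t \<omega>\<bar> > e / 2} \<in> sets N"
      by measurable
    have "prob {\<omega> \<in> space N. \<bar>fine_sum h (2 ^ m) k \<omega> - I ?t \<omega>\<bar> > e} \<le>
        prob ({\<omega> \<in> space N. \<bar>?D m \<omega>\<bar> > e / 2} \<union> {\<omega> \<in> space N. \<bar>riemann ?t m \<omega> - I ?t \<omega>\<bar> > e / 2})"
    proof (rule finite_measure_mono)
      show "{\<omega> \<in> space N. \<bar>fine_sum h (2 ^ m) k \<omega> - I ?t \<omega>\<bar> > e} \<subseteq>
          {\<omega> \<in> space N. \<bar>?D m \<omega>\<bar> > e / 2} \<union> {\<omega> \<in> space N. \<bar>riemann ?t m \<omega> - I ?t \<omega>\<bar> > e / 2}"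
      proof
        fix \<omega> assume \<omega>: "\<omega> \<in> {\<omega> \<in> space N. \<bar>fine_sum h (2 ^ m) k \<omega> - I ?t \<omega>\<bar> > e}"
        then have "\<bar>?D m \<omega>\<bar> > e / 2 \<or> \<bar>riemann ?t m \<omega> - I ?t \<omega>\<bar> > e / 2" unfolding mem_Collect_eq by linarith
        with \<omega> show "\<omega> \<in> {\<omega> \<in> space N. \<bar>?D m \<omega>\<bar> > e / 2} \<union> {\<omega> \<in> space N. \<bar>riemann ?t m \<omega> - I ?t \<omega>\<bar> > e / 2}" by blast
      qed
      show "{\<omega> \<in> space N. \<bar>?D m \<omega>\<bar> > e / 2} \<union> {\<omega> \<in> space N. \<bar>riemann ?t m \<omega> - I ?t \<omega>\<bar> > e / 2} \<in> sets N"
        using s by (rule sets.Un)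
    qed
    also have "\<dots> \<le> prob {\<omega> \<in> space N. \<bar>?D m \<omega>\<bar> > e / 2} + prob {\<omega> \<in> space N. \<bar>riemann ?t m \<omega> - I ?t \<omega>\<bar> > e / 2}"
      by (rule measure_Un_le[OF s])
    finally show "norm (prob {\<omega> \<in> space N. \<bar>fine_sum h (2 ^ m) k \<omega> - I ?t \<omega>\<bar> > e}) \<le>
        prob {\<omega> \<in> space N. \<bar>?D m \<omega>\<bar> > e / 2} + prob {\<omega> \<in> space N. \<bar>riemann ?t m \<omega> - I ?t \<omega>\<bar> > e / 2}" by simp
  qed
qed

end

section \<open>Ruin on a grid and in continuous time\<close>

context gou_process
begin

lemma chain_rv:
  assumes "h > 0" "n > 0"
  shows "(\<lambda>\<omega>. chain y (\<lambda>k. (step_a h n k \<omega>, step_b h k \<omega>)) k) \<in> borel_measurable N"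
  using indep_chain.chain_rv[OF step_chain[OF assms, of k] order_refl] .

lemma deviation_sets: "{\<omega> \<in> space N. \<bar>fine_sum h n k \<omega> - I t \<omega>\<bar> > e} \<in> sets N"
  by measurable

lemma deviations_tendsto:
  assumes "h > 0" "e > 0"
  shows "(\<lambda>m. \<Sum>k\<le>K. prob {\<omega> \<in> space N. \<bar>fine_sum h (2 ^ m) k \<omega> - I (real k * h) \<omega>\<bar> > e}) \<longlonglongrightarrow> 0"
  using tendsto_sum[of "{..K}" "\<lambda>k m. prob {\<omega> \<in> space N. \<bar>fine_sum h (2 ^ m) k \<omega> - I (real k * h) \<omega>\<bar> > e}" "\<lambda>_. 0"]
    fine_sum_tendsto[OF assms] by simp

lemma grid_ruin_sets: "{\<omega> \<in> space N. \<exists>k\<le>K. y + I (real k * h) \<omega> < c} \<in> sets N" for K :: nat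
  by (rule ex_le_sets) measurable

text \<open>Convergence in probability consumes a margin: if \<open>y + I\<close> falls below
  \<open>- e\<close>, the chain is ruined unless one of the sums deviates by more than
  \<open>e / 2\<close>. After \<open>m\<close> has tended to infinity, \<open>e\<close> is removed
  by an increasing union.\<close>

lemma grid_ruin_upper:
  assumes h: "h > 0"
    and le: "\<And>n. n > 0 \<Longrightarrow> prob {\<omega> \<in> space N. \<exists>k\<le>K. chain y (\<lambda>k. (step_a h n k \<omega>, step_b h k \<omega>)) k < 0} \<le> b"
  shows "prob {\<omega> \<in> space N. \<exists>k\<le>K. y + I (real k * h) \<omega> < 0} \<le> b"
proof -
  have strict: "prob {\<omega> \<in> space N. \<exists>k\<le>K. y + I (real k * h) \<omega> < - e} \<le> b" if e: "e > 0" for e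
  proof -
    let ?A = "{\<omega> \<in> space N. \<exists>k\<le>K. y + I (real k * h) \<omega> < - e}"
    let ?B = "\<lambda>m. {\<omega> \<in> space N. \<exists>k\<le>K. chain y (\<lambda>k. (step_a h (2 ^ m) k \<omega>, step_b h k \<omega>)) k < 0}"
    let ?C = "\<lambda>m k. {\<omega> \<in> space N. \<bar>fine_sum h (2 ^ m) k \<omega> - I (real k * h) \<omega>\<bar> > e / 2}"
    have "prob ?A \<le> b + (\<Sum>k\<le>K. prob (?C m k))" for m
    proof -
      have "prob ?A \<le> prob (?B m) + (\<Sum>k\<le>K. prob (?C m k))"
      proof (rule prob_union_bound)
        show "?A \<subseteq> ?B m \<union> (\<Union>k\<in>{..K}. ?C m k)"
        proof
          fix \<omega> assume "\<omega> \<in> ?A"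
          then obtain k where k: "\<omega> \<in> space N" "k \<le> K" "y + I (real k * h) \<omega> < - e" by auto
          show "\<omega> \<in> ?B m \<union> (\<Union>k\<in>{..K}. ?C m k)"
          proof (cases "\<bar>fine_sum h (2 ^ m) k \<omega> - I (real k * h) \<omega>\<bar> > e / 2")
            case True
            then show ?thesis using k by auto
          next
            case False
            then have "y + fine_sum h (2 ^ m) k \<omega> < 0" using k e by linarith
            then have "chain y (\<lambda>k. (step_a h (2 ^ m) k \<omega>, step_b h k \<omega>)) k < 0"
              using chain_eq[of "2 ^ m", OF _ k(1)] by (simp add: mult_pos_neg)
            then show ?thesis using k by blast
          qed
        qed
        show "?B m \<in> sets N" by (rule ex_le_sets) (rule chain_rv[OF h], simp)
        show "?C m k \<in> sets N" for k by (rule deviation_sets)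
      qed
      then show ?thesis using le[of "2 ^ m"] by simp
    qed
    moreover have "(\<lambda>m. b + (\<Sum>k\<le>K. prob (?C m k))) \<longlonglongrightarrow> b + 0"
      using e by (intro tendsto_add tendsto_const deviations_tendsto h) simp
    ultimately show ?thesis
      using LIMSEQ_le_const[of "\<lambda>m. b + (\<Sum>k\<le>K. prob (?C m k))" "b + 0" "prob ?A"] by auto
  qed
  have "{\<omega> \<in> space N. \<exists>k\<le>K. y + I (real k * h) \<omega> < 0} = (\<Union>i. {\<omega> \<in> space N. \<exists>k\<le>K. y + I (real k * h) \<omega> < - (1 / real (Suc i))})"
  proof (intro set_eqI iffI)
    fix \<omega> assume "\<omega> \<in> {\<omega> \<in> space N. \<exists>k\<le>K. y + I (real k * h) \<omega> < 0}"
    then obtain k where k: "\<omega> \<in> space N" "k \<le> K" "y + I (real k * h) \<omega> < 0" by auto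
    then obtain i where "1 / real (Suc i) < - (y + I (real k * h) \<omega>)"
      using reals_Archimedean[of "- (y + I (real k * h) \<omega>)"] by (auto simp: inverse_eq_divide)
    then have "y + I (real k * h) \<omega> < - (1 / real (Suc i))" by linarith
    then show "\<omega> \<in> (\<Union>i. {\<omega> \<in> space N. \<exists>k\<le>K. y + I (real k * h) \<omega> < - (1 / real (Suc i))})" using k by blast
  next
    fix \<omega> assume "\<omega> \<in> (\<Union>i. {\<omega> \<in> space N. \<exists>k\<le>K. y + I (real k * h) \<omega> < - (1 / real (Suc i))})"
    then obtain i k where k: "\<omega> \<in> space N" "k \<le> K" "y + I (real k * h) \<omega> < - (1 / real (Suc i))" by blast
    moreover have "0 < 1 / real (Suc i)" by simp
    ultimately have "y + I (real k * h) \<omega> < 0" by linarith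
    with k show "\<omega> \<in> {\<omega> \<in> space N. \<exists>k\<le>K. y + I (real k * h) \<omega> < 0}" by blast
  qed
  also have "prob \<dots> \<le> b"
  proof (rule measure_UN_incseq_le)
    show "range (\<lambda>i. {\<omega> \<in> space N. \<exists>k\<le>K. y + I (real k * h) \<omega> < - (1 / real (Suc i))}) \<subseteq> sets N"
      by (intro image_subsetI grid_ruin_sets)
    show "incseq (\<lambda>i. {\<omega> \<in> space N. \<exists>k\<le>K. y + I (real k * h) \<omega> < - (1 / real (Suc i))})"
    proof (rule incseq_SucI)
      fix i
      have "- (1 / real (Suc i)) \<le> - (1 / real (Suc (Suc i)))" by (simp add: frac_le)
      then show "{\<omega> \<in> space N. \<exists>k\<le>K. y + I (real k * h) \<omega> < - (1 / real (Suc i))} \<subseteq>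
          {\<omega> \<in> space N. \<exists>k\<le>K. y + I (real k * h) \<omega> < - (1 / real (Suc (Suc i)))}"
        using less_le_trans by blast
    qed
    show "prob {\<omega> \<in> space N. \<exists>k\<le>K. y + I (real k * h) \<omega> < - (1 / real (Suc i))} \<le> b" for i
      by (rule strict) simp
  qed
  finally show ?thesis .
qed

lemma exp_R_tail:
  assumes t: "0 \<le> t" and Q: "Q > 0"
  shows "prob {\<omega> \<in> space N. exp (R t \<omega>) > Q} \<le> exp ((2 * mr + 2 * sr\<^sup>2) * t) / Q\<^sup>2"
proof -
  have e2: "(exp z)\<^sup>2 = exp (2 * z)" for z :: real by (simp add: power2_eq_square flip: exp_add)
  note r = R_exp[OF order_refl t, of 2]
  have eq: "(exp (R t \<omega>))\<^sup>2 = exp (2 * (R t \<omega> - R 0 \<omega>))" if "\<omega> \<in> space N" for \<omega>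
    using W.B_0[OF that] by (simp add: e2 R_def)
  have i: "integrable N (\<lambda>\<omega>. (exp (R t \<omega>))\<^sup>2)"
    by (subst Bochner_Integration.integrable_cong[OF refl eq]) (simp, rule r(1))
  have "expectation (\<lambda>\<omega>. (exp (R t \<omega>))\<^sup>2) = expectation (\<lambda>\<omega>. exp (2 * (R t \<omega> - R 0 \<omega>)))"
    by (rule Bochner_Integration.integral_cong[OF refl eq])
  also have "\<dots> = exp ((2 * mr + 2 * sr\<^sup>2) * t)" unfolding r(2) by simp
  finally have E: "expectation (\<lambda>\<omega>. (exp (R t \<omega>))\<^sup>2) = exp ((2 * mr + 2 * sr\<^sup>2) * t)" .
  have m: "(\<lambda>\<omega>. exp (R t \<omega>)) \<in> borel_measurable N" by measurable
  show ?thesis using markov_square[OF m i Q] unfolding E by simp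
qed

text \<open>Here the margin is \<open>L\<close>, but it belongs to the chain, which carries the
  factor \<open>exp R\<close>. Off the event \<open>exp R > Q\<close> it leaves a margin
  \<open>- L / Q\<close> for \<open>y + I\<close>. First \<open>m\<close> tends to infinity, then
  \<open>Q\<close>.\<close>

lemma grid_ruin_lower:
  assumes h: "h > 0" and L: "L < 0"
    and le: "\<And>n. n > 0 \<Longrightarrow> c \<le> prob {\<omega> \<in> space N. \<exists>k\<le>K. chain y (\<lambda>k. (step_a h n k \<omega>, step_b h k \<omega>)) k < L}"
  shows "c \<le> prob {\<omega> \<in> space N. \<exists>k\<le>K. y + I (real k * h) \<omega> < 0}"
proof -
  let ?A = "{\<omega> \<in> space N. \<exists>k\<le>K. y + I (real k * h) \<omega> < 0}"
  define V where "V = (\<Sum>k\<le>K. exp ((2 * mr + 2 * sr\<^sup>2) * (real k * h)))"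
  have Q: "c \<le> prob ?A + V / Q\<^sup>2" if Q: "Q > 0" for Q
  proof -
    let ?B = "\<lambda>m. {\<omega> \<in> space N. \<exists>k\<le>K. chain y (\<lambda>k. (step_a h (2 ^ m) k \<omega>, step_b h k \<omega>)) k < L}"
    let ?C = "\<lambda>m k. {\<omega> \<in> space N. \<bar>fine_sum h (2 ^ m) k \<omega> - I (real k * h) \<omega>\<bar> > - L / Q}"
    let ?T = "\<lambda>k. {\<omega> \<in> space N. exp (R (real k * h) \<omega>) > Q}"
    have LQ: "- L / Q > 0" using L Q by (simp add: divide_neg_pos)
    have T: "?T k \<in> sets N" for k by measurable
    have "c \<le> prob ?A + V / Q\<^sup>2 + (\<Sum>k\<le>K. prob (?C m k))" for m
    proof -
      have "prob (?B m) \<le> prob ?A + (\<Sum>k\<le>K. prob (?T k \<union> ?C m k))"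
      proof (rule prob_union_bound)
        show "?B m \<subseteq> ?A \<union> (\<Union>k\<in>{..K}. ?T k \<union> ?C m k)"
        proof
          fix \<omega> assume "\<omega> \<in> ?B m"
          then obtain k where k: "\<omega> \<in> space N" "k \<le> K" "exp (R (real k * h) \<omega>) * (y + fine_sum h (2 ^ m) k \<omega>) < L"
            using chain_eq[of "2 ^ m"] by auto
          show "\<omega> \<in> ?A \<union> (\<Union>k\<in>{..K}. ?T k \<union> ?C m k)"
          proof (cases "exp (R (real k * h) \<omega>) > Q \<or> \<bar>fine_sum h (2 ^ m) k \<omega> - I (real k * h) \<omega>\<bar> > - L / Q")
            case True
            then show ?thesis using k by blast
          next
            case False
            let ?z = "y + fine_sum h (2 ^ m) k \<omega>" and ?e = "exp (R (real k * h) \<omega>)"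
            have "?z < 0" using k(3) L by (smt (verit) exp_gt_zero mult_nonneg_nonneg)
            then have "Q * ?z \<le> ?e * ?z" using False by (intro mult_right_mono_neg) auto
            then have "Q * ?z < L" using k(3) by linarith
            then have "?z < L / Q" using Q by (simp add: pos_less_divide_eq mult.commute)
            then have "y + I (real k * h) \<omega> < 0" using False by (simp add: not_less) linarith
            then show ?thesis using k by blast
          qed
        qed
        show "?A \<in> sets N" by (rule grid_ruin_sets)
        show "?T k \<union> ?C m k \<in> sets N" for k using T deviation_sets by blast
      qed
      also have "(\<Sum>k\<le>K. prob (?T k \<union> ?C m k)) \<le> (\<Sum>k\<le>K. exp ((2 * mr + 2 * sr\<^sup>2) * (real k * h)) / Q\<^sup>2 + prob (?C m k))"
      proof (rule sum_mono)
        fix k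
        have "prob (?T k \<union> ?C m k) \<le> prob (?T k) + prob (?C m k)"
          by (rule measure_Un_le[OF T deviation_sets])
        then show "prob (?T k \<union> ?C m k) \<le> exp ((2 * mr + 2 * sr\<^sup>2) * (real k * h)) / Q\<^sup>2 + prob (?C m k)"
          using exp_R_tail[of "real k * h", OF _ Q] h by simp
      qed
      also have "\<dots> = V / Q\<^sup>2 + (\<Sum>k\<le>K. prob (?C m k))"
        by (simp add: V_def sum.distrib sum_divide_distrib)
      finally show ?thesis using le[of "2 ^ m"] by simp
    qed
    moreover have "(\<lambda>m. prob ?A + V / Q\<^sup>2 + (\<Sum>k\<le>K. prob (?C m k))) \<longlonglongrightarrow> prob ?A + V / Q\<^sup>2 + 0"
      by (intro tendsto_add tendsto_const deviations_tendsto h LQ)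
    ultimately show ?thesis
      using LIMSEQ_le_const[of "\<lambda>m. prob ?A + V / Q\<^sup>2 + (\<Sum>k\<le>K. prob (?C m k))" "prob ?A + V / Q\<^sup>2 + 0" c] by auto
  qed
  have "(\<lambda>i. inverse (real (Suc i))) \<longlonglongrightarrow> 0" by (rule LIMSEQ_inverse_real_of_nat)
  then have "(\<lambda>i. prob ?A + V * (inverse (real (Suc i)))\<^sup>2) \<longlonglongrightarrow> prob ?A + V * 0\<^sup>2"
    by (intro tendsto_intros)
  moreover have "c \<le> prob ?A + V * (inverse (real (Suc i)))\<^sup>2" for i
    using Q[of "real (Suc i)"] by (simp add: divide_inverse power_inverse)
  ultimately show ?thesis
    using LIMSEQ_le_const[of "\<lambda>i. prob ?A + V * (inverse (real (Suc i)))\<^sup>2" "prob ?A + V * 0\<^sup>2" c] by auto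
qed

text \<open>\<open>q\<close> fixes both the mesh \<open>2^(-q)\<close> and the horizon
  \<open>q\<close>, so that one increasing sequence of events exhausts the ruin event.\<close>

definition dyadic_ruin :: "real \<Rightarrow> nat \<Rightarrow> 'b set" where
  "dyadic_ruin y q = {\<omega> \<in> space N. \<exists>k\<le>q * 2 ^ q. y + I (real k * (1 / 2 ^ q)) \<omega> < 0}"

lemma negative_nearby:
  assumes \<omega>: "\<omega> \<in> space N" and t: "0 \<le> t" "y + I t \<omega> < 0"
  obtains d where "d > 0" "\<And>s. 0 \<le> s \<Longrightarrow> \<bar>s - t\<bar> < d \<Longrightarrow> y + I s \<omega> < 0"
proof -
  have "\<exists>d>0. \<forall>s\<in>{0..}. dist s t < d \<longrightarrow> dist (I s \<omega>) (I t \<omega>) < - (y + I t \<omega>)"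
    using I_cont[OF \<omega>] t unfolding continuous_on_iff by auto
  then obtain d where "d > 0" "\<And>s. s \<in> {0..} \<Longrightarrow> dist s t < d \<Longrightarrow> dist (I s \<omega>) (I t \<omega>) < - (y + I t \<omega>)" by blast
  note d = this
  show ?thesis
  proof (rule that[OF d(1)])
    fix s assume "0 \<le> s" "\<bar>s - t\<bar> < d"
    then have "dist (I s \<omega>) (I t \<omega>) < - (y + I t \<omega>)" by (intro d(2)) (auto simp: dist_real_def)
    then show "y + I s \<omega> < 0" unfolding dist_real_def by linarith
  qed
qed

text \<open>The factor \<open>exp R\<close> does not affect the sign, and by continuity a negative
  value persists on an interval, which meets the dyadic grid once the mesh is fine enough.\<close>

lemma ruin_dyadic:
  "{\<omega> \<in> space N. first_neg_time (\<lambda>t. exp (mr * t + sr * W t \<omega>) * (y + I t \<omega>)) < \<infinity>} = (\<Union>q. dyadic_ruin y q)"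
proof (intro set_eqI iffI)
  fix \<omega> assume "\<omega> \<in> {\<omega> \<in> space N. first_neg_time (\<lambda>t. exp (mr * t + sr * W t \<omega>) * (y + I t \<omega>)) < \<infinity>}"
  then obtain t where \<omega>: "\<omega> \<in> space N" and t: "t > 0" "y + I t \<omega> < 0"
    unfolding first_neg_time_finite by (auto simp: mult_less_0_iff)
  obtain d where d: "d > 0" "\<And>s. 0 \<le> s \<Longrightarrow> \<bar>s - t\<bar> < d \<Longrightarrow> y + I s \<omega> < 0"
    using negative_nearby[OF \<omega> less_imp_le[OF t(1)] t(2)] by blast
  obtain q1 where q1: "(1 / 2) ^ q1 < d" using real_arch_pow_inv[OF d(1), of "1/2"] by auto
  obtain q2 :: nat where q2: "t < real q2" using reals_Archimedean2 by blast
  define q where "q = max q1 q2"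
  have qd: "1 / 2 ^ q < d"
  proof -
    have "(1 / 2 :: real) ^ q \<le> (1 / 2) ^ q1" by (rule power_decreasing) (auto simp: q_def)
    then show ?thesis using q1 by (simp add: power_one_over)
  qed
  have qt: "t \<le> real q" using q2 by (simp add: q_def)
  define k where "k = nat \<lfloor>t * 2 ^ q\<rfloor>"
  have k: "real k \<le> t * 2 ^ q" "t * 2 ^ q < real k + 1"
    using t unfolding k_def by (auto simp: of_nat_nat floor_le_iff)
  have k1: "real k * (1 / 2 ^ q) \<le> t" "t < real k * (1 / 2 ^ q) + 1 / 2 ^ q"
    using k by (simp_all add: field_simps)
  have "real k \<le> real q * 2 ^ q" by (rule order_trans[OF k(1) mult_right_mono[OF qt]]) simp
  also have "real q * 2 ^ q = real (q * 2 ^ q)" by simp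
  finally have "k \<le> q * 2 ^ q" by (simp only: of_nat_le_iff)
  moreover have "y + I (real k * (1 / 2 ^ q)) \<omega> < 0"
    by (rule d(2)) (use k1 qd in auto)
  ultimately show "\<omega> \<in> (\<Union>q. dyadic_ruin y q)" unfolding dyadic_ruin_def using \<omega> by blast
next
  fix \<omega> assume "\<omega> \<in> (\<Union>q. dyadic_ruin y q)"
  then obtain q k where \<omega>: "\<omega> \<in> space N" and k: "y + I (real k * (1 / 2 ^ q)) \<omega> < 0"
    unfolding dyadic_ruin_def by blast
  let ?t = "real k * (1 / 2 ^ q)"
  have t0: "0 \<le> ?t" by simp
  obtain d where d: "d > 0" "\<And>s. 0 \<le> s \<Longrightarrow> \<bar>s - ?t\<bar> < d \<Longrightarrow> y + I s \<omega> < 0"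
    using negative_nearby[OF \<omega> t0 k] by blast
  \<comment> \<open>\<open>dyadic_ruin\<close> includes \<open>k = 0\<close>; a shift to the right
    by \<open>d / 2\<close> reaches a positive time.\<close>
  have "y + I (?t + d / 2) \<omega> < 0" by (rule d(2)) (use t0 d(1) in auto)
  moreover have "?t + d / 2 > 0" using t0 d(1) by linarith
  ultimately show "\<omega> \<in> {\<omega> \<in> space N. first_neg_time (\<lambda>t. exp (mr * t + sr * W t \<omega>) * (y + I t \<omega>)) < \<infinity>}"
    using \<omega> unfolding first_neg_time_finite by (auto simp: mult_less_0_iff)
qed

lemma dyadic_ruin_mono: "incseq (dyadic_ruin y)"
proof (rule incseq_SucI)
  fix q
  show "dyadic_ruin y q \<subseteq> dyadic_ruin y (Suc q)"
  proof
    fix \<omega> assume "\<omega> \<in> dyadic_ruin y q"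
    then obtain k where \<omega>: "\<omega> \<in> space N" and k: "k \<le> q * 2 ^ q" "y + I (real k * (1 / 2 ^ q)) \<omega> < 0"
      unfolding dyadic_ruin_def by blast
    have "real (2 * k) * (1 / 2 ^ Suc q) = real k * (1 / 2 ^ q)" by simp
    then have "y + I (real (2 * k) * (1 / 2 ^ Suc q)) \<omega> < 0" using k(2) by simp
    moreover have "2 * k \<le> Suc q * 2 ^ Suc q" using k(1) by simp
    ultimately show "\<omega> \<in> dyadic_ruin y (Suc q)" unfolding dyadic_ruin_def using \<omega> by blast
  qed
qed

lemma dyadic_ruin_tendsto:
  "(\<lambda>q. prob (dyadic_ruin y q)) \<longlonglongrightarrow>
     prob {\<omega> \<in> space N. first_neg_time (\<lambda>t. exp (mr * t + sr * W t \<omega>) * (y + I t \<omega>)) < \<infinity>}"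
  unfolding ruin_dyadic
  by (rule finite_Lim_measure_incseq[OF _ dyadic_ruin_mono])
     (auto simp: dyadic_ruin_def intro!: grid_ruin_sets)

lemma eventually_mesh: "c > 0 \<Longrightarrow> eventually (\<lambda>q. 1 / 2 ^ q < c) sequentially" for c :: real
  using LIMSEQ_divide_realpow_zero[of 2 1] by (intro order_tendstoD[of _ 0]) auto

lemma dyadic_ruin_lower:
  assumes y: "0 \<le> y" "y < B" and e: "e > 0"
  shows "eventually (\<lambda>q. (scale B - scale y) / scale B - e \<le> prob (dyadic_ruin y q)) sequentially"
proof -
  obtain L d T where L: "L < 0" and d: "d > 0" and low:
    "\<And>(M :: 'b measure) p K h. indep_chain M p K \<Longrightarrow> h > 0 \<Longrightarrow>
       (\<And>k. k < K \<Longrightarrow> diffusive_step mx mr sx sr M h d (\<lambda>\<omega>. fst (p k \<omega>)) (\<lambda>\<omega>. snd (p k \<omega>))) \<Longrightarrow>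
       0 < K \<Longrightarrow> T \<le> real K * h \<Longrightarrow>
       (scale B - scale y) / scale B - e \<le> measure M {\<omega> \<in> space M. \<exists>k\<le>K. chain y (\<lambda>i. p i \<omega>) k < L}"
  proof -
    show thesis
    proof (rule chain_ruin_lower[where 'a='b, OF y e], goal_cases)
      case (1 L d T)
      show ?case by (rule that[OF 1])
    qed
  qed
  obtain h0 where h0: "h0 > 0" and
    st: "\<And>h n k. 0 < h \<Longrightarrow> h \<le> h0 \<Longrightarrow> 0 < n \<Longrightarrow> diffusive_step mx mr sx sr N h d (step_a h n k) (step_b h k)"
  proof -
    show thesis
    proof (rule step_diffusive[OF d], goal_cases)
      case (1 h0)
      show ?case by (rule that[OF 1(1,3)])
    qed
  qed
  \<comment> \<open>The horizon of \<open>dyadic_ruin\<close> is \<open>q\<close>: it takes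
    \<open>q * 2^q\<close> steps of length \<open>2^(-q)\<close>.\<close>
  have "eventually (\<lambda>q. T \<le> real q) sequentially"
    using filterlim_real_sequentially unfolding filterlim_at_top by blast
  then show ?thesis using eventually_mesh[OF h0] eventually_gt_at_top[of 0]
  proof eventually_elim
    case (elim q)
    let ?h = "1 / 2 ^ q :: real"
    have h: "?h > 0" by simp
    show ?case unfolding dyadic_ruin_def
    proof (rule grid_ruin_lower[OF h L])
      fix n :: nat assume n: "n > 0"
      show "(scale B - scale y) / scale B - e \<le> prob {\<omega> \<in> space N. \<exists>k\<le>q * 2 ^ q. chain y (\<lambda>k. (step_a ?h n k \<omega>, step_b ?h k \<omega>)) k < L}"
      proof (rule low[OF step_chain[OF h n] h])
        show "diffusive_step mx mr sx sr N ?h d (\<lambda>\<omega>. fst (step_a ?h n k \<omega>, step_b ?h k \<omega>)) (\<lambda>\<omega>. snd (step_a ?h n k \<omega>, step_b ?h k \<omega>))" for k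
          using st[OF h less_imp_le[OF elim(2)] n, of k] by simp
      qed (use elim in auto)
    qed
  qed
qed

lemma dyadic_ruin_upper:
  assumes y: "0 \<le> y" and e: "e > 0" and mu: "sr\<^sup>2 < mr"
    and T: "\<And>x. scale x < T" and lim: "(scale \<longlongrightarrow> T) at_top"
  shows "eventually (\<lambda>q. prob (dyadic_ruin y q) \<le> (T - scale y) / T + e) sequentially"
proof -
  let ?b = "sr\<^sup>2 / 2 - mr"
  let ?C = "2 * (mx\<^sup>2 + sx\<^sup>2) + \<bar>mx\<bar> * exp \<bar>?b\<bar> + \<bar>?b\<bar>"
  have C: "?C \<ge> 0" by simp
  have c: "mr - sr\<^sup>2 > 0" using mu by simp
  obtain d where d: "d > 0" and up:
    "\<And>(M :: 'b measure) p K h u v. indep_chain M p K \<Longrightarrow> h > 0 \<Longrightarrow>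
       (\<And>k. k < K \<Longrightarrow> diffusive_step mx mr sx sr M h d (\<lambda>\<omega>. fst (p k \<omega>)) (\<lambda>\<omega>. snd (p k \<omega>))) \<Longrightarrow>
       (\<And>k. k < K \<Longrightarrow> contracting_step M h (mr - sr\<^sup>2) ?C u v (\<lambda>\<omega>. fst (p k \<omega>)) (\<lambda>\<omega>. snd (p k \<omega>))) \<Longrightarrow>
       0 < K \<Longrightarrow>
       measure M {\<omega> \<in> space M. \<exists>k\<le>K. chain y (\<lambda>i. p i \<omega>) k < 0} \<le> (T - scale y) / T + e"
  proof -
    show thesis
    proof (rule chain_ruin_upper[where 'a='b, OF y e c C T lim], goal_cases)
      case (1 d)
      show ?case by (rule that[OF 1])
    qed
  qed
  obtain h0 where h0: "h0 > 0" "h0 \<le> 1" and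
    st: "\<And>h n k. 0 < h \<Longrightarrow> h \<le> h0 \<Longrightarrow> 0 < n \<Longrightarrow> diffusive_step mx mr sx sr N h d (step_a h n k) (step_b h k)"
    using step_diffusive[OF d] by blast
  \<comment> \<open>The mesh below which \<open>step_contracting\<close> applies.\<close>
  define h1 where "h1 = 1 / (2 * (mr - sr\<^sup>2))"
  have h1: "h1 > 0" using c by (simp add: h1_def)
  show ?thesis using eventually_mesh[OF h0(1)] eventually_mesh[OF h1] eventually_gt_at_top[of 0]
  proof eventually_elim
    case (elim q)
    let ?h = "1 / 2 ^ q :: real"
    have h: "?h > 0" by simp
    have hh: "?h \<le> 1" using elim(1) h0(2) by linarith
    have "?h \<le> 1 / (2 * (mr - sr\<^sup>2))" using elim(2) by (simp add: h1_def)
    then have hc: "2 * (mr - sr\<^sup>2) * ?h \<le> 1" using c by (simp add: field_simps)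
    show ?case unfolding dyadic_ruin_def
    proof (rule grid_ruin_upper[OF h])
      fix n :: nat assume n: "n > 0"
      show "prob {\<omega> \<in> space N. \<exists>k\<le>q * 2 ^ q. chain y (\<lambda>k. (step_a ?h n k \<omega>, step_b ?h k \<omega>)) k < 0} \<le> (T - scale y) / T + e"
      proof (rule up[OF step_chain[OF h n] h])
        show "diffusive_step mx mr sx sr N ?h d (\<lambda>\<omega>. fst (step_a ?h n k \<omega>, step_b ?h k \<omega>)) (\<lambda>\<omega>. snd (step_a ?h n k \<omega>, step_b ?h k \<omega>))" for k
          using st[OF h less_imp_le[OF elim(1)] n, of k] by simp
        show "contracting_step N ?h (mr - sr\<^sup>2) ?C (exp (?b * ?h)) (mx * (?h / real n) * (\<Sum>i<n. exp (?b * (real i * (?h / real n)))))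
          (\<lambda>\<omega>. fst (step_a ?h n k \<omega>, step_b ?h k \<omega>)) (\<lambda>\<omega>. snd (step_a ?h n k \<omega>, step_b ?h k \<omega>))" for k
          using step_contracting[OF mu h hh hc n, of k] unfolding fst_conv snd_conv .
      qed (use elim in auto)
    qed
  qed
qed

end

section \<open>Passage to the limit\<close>

context scale_function
begin

lemma scale_ratio_tendsto:
  assumes T: "\<And>x. scale x < T" and lim: "(scale \<longlongrightarrow> T) at_top"
  shows "((\<lambda>B. (scale B - scale y) / scale B) \<longlongrightarrow> (T - scale y) / T) at_top"
  using T[of 0] scale_0 by (intro tendsto_intros lim) auto

text \<open>Common end of both proofs: \<open>f\<close> is the sequence of ruin probabilities of the
  discrete models, or that of the diffusion on dyadic grids. \<open>B\<close> is sent to infinity in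
  the lower bound; the upper bound is already free of it.\<close>

lemma tendsto_ruin_limit:
  assumes T: "\<And>x. scale x < T" and lim: "(scale \<longlongrightarrow> T) at_top"
    and low: "\<And>B e. y < B \<Longrightarrow> e > 0 \<Longrightarrow> eventually (\<lambda>n. (scale B - scale y) / scale B - e \<le> f n) sequentially"
    and up: "\<And>e. e > 0 \<Longrightarrow> eventually (\<lambda>n. f n \<le> (T - scale y) / T + e) sequentially"
  shows "f \<longlonglongrightarrow> (T - scale y) / T"
proof (rule order_tendstoI)
  fix a assume a: "a < (T - scale y) / T"
  define e where "e = ((T - scale y) / T - a) / 2"
  have "2 * e = (T - scale y) / T - a" by (simp add: e_def)
  then have e: "e > 0" "a + e < (T - scale y) / T" using a by linarith+
  have "eventually (\<lambda>B. a + e < (scale B - scale y) / scale B \<and> y < B) at_top"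
    using order_tendstoD(1)[OF scale_ratio_tendsto[OF T lim] e(2)] eventually_gt_at_top[of y] by eventually_elim simp
  from eventually_happens'[OF trivial_limit_at_top_linorder this]
  obtain B where B: "a + e < (scale B - scale y) / scale B" "y < B" by auto
  show "eventually (\<lambda>n. a < f n) sequentially"
    using low[OF B(2) e(1)] by eventually_elim (use B(1) in linarith)
next
  fix a assume a: "(T - scale y) / T < a"
  define e where "e = (a - (T - scale y) / T) / 2"
  have "2 * e = a - (T - scale y) / T" by (simp add: e_def)
  then have e: "e > 0" "(T - scale y) / T + e < a" using a by linarith+
  show "eventually (\<lambda>n. f n < a) sequentially"
    using up[OF e(1)] by eventually_elim (use e(2) in linarith)
qed

end

text \<open>The dyadic ruin probabilities tend to the probability of ruin by continuity of the
  measure and to the ratio by the two bounds.\<close>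

lemma (in gou_process) ruin_probability:
  assumes y: "0 \<le> y" and mu: "sr\<^sup>2 < mr" and T: "\<And>x. scale x < T" and lim: "(scale \<longlongrightarrow> T) at_top"
  shows "prob {\<omega> \<in> space N. first_neg_time (\<lambda>t. exp (mr * t + sr * W t \<omega>) * (y + I t \<omega>)) < \<infinity>} = (T - scale y) / T"
  by (rule LIMSEQ_unique[OF dyadic_ruin_tendsto tendsto_ruin_limit[OF T lim dyadic_ruin_lower[OF y] dyadic_ruin_upper[OF y _ mu T lim]]])

context random_coefficients
begin

text \<open>The lower bound alone decides: with \<open>scale\<close> unbounded,
  \<open>(scale B - scale y) / scale B\<close> tends to 1 as \<open>B\<close> grows.\<close>

lemma ruin_prob_tendsto_1:
  assumes mu: "mr \<le> 0" and y: "0 \<le> y"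
  shows "ruin_prob y \<longlonglongrightarrow> 1"
proof (rule order_tendstoI)
  fix a :: real assume a: "a < 1"
  define e where "e = (1 - a) / 3"
  have e: "e > 0" using a by (simp add: e_def)
  have "eventually (\<lambda>B. scale y / e < scale B) at_top"
    using scale_unbounded[OF mu] unfolding filterlim_at_top_dense by blast
  then have "eventually (\<lambda>B. scale y / e < scale B \<and> y < B) at_top"
    using eventually_gt_at_top[of y] by eventually_elim simp
  from eventually_happens'[OF trivial_limit_at_top_linorder this]
  obtain B where B: "scale y / e < scale B" "y < B" by auto
  have sB: "scale B > 0" using scale_less[of 0 B] scale_0 y B by simp
  have "scale y / scale B \<le> e" using B(1) e sB by (simp add: field_simps)
  then have "1 - e \<le> (scale B - scale y) / scale B" using sB by (simp add: diff_divide_distrib)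
  moreover have "a < 1 - 2 * e"
  proof -
    have "3 * e = 1 - a" by (simp add: e_def)
    then show ?thesis using a by linarith
  qed
  ultimately have lt: "a < (scale B - scale y) / scale B - e" by linarith
  show "eventually (\<lambda>n. a < ruin_prob y n) sequentially"
    using ruin_prob_lower[OF y B(2) e] by eventually_elim (use lt in linarith)
next
  fix a :: real assume "1 < a"
  then show "eventually (\<lambda>n. ruin_prob y n < a) sequentially"
    by (intro always_eventually allI) (auto simp: ruin_prob_def intro: le_less_trans[OF prob_le_1])
qed

text \<open>\<open>C\<close> may be negative, and \<open>ennreal C\<close> is then 0;
  \<open>max 0 C\<close> is a nonnegative real with the same image.\<close>

lemma gamma_exp_moment:
  assumes C: "C < 1" and n: "n > 0"
    and le: "(\<integral>\<^sup>+ \<omega>. ennreal (exp (- 2 * gamma_n mr rho n 1 \<omega>)) \<partial>M) ^ n \<le> ennreal C"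
  shows "integrable M (\<lambda>\<omega>. exp (- 2 * gamma_n mr rho n 1 \<omega>)) \<and>
       expectation (\<lambda>\<omega>. exp (- 2 * gamma_n mr rho n 1 \<omega>)) \<le> 1 - (1 - max 0 C) / real n"
proof -
  have m: "gamma_n mr rho n 1 \<in> borel_measurable M"
    using step_measurable(2)[of n 0] by (simp add: step_def)
  have "ennreal C \<le> ennreal (max 0 C)" by (rule ennreal_leI) simp
  from exp_moment_bound[OF prob_space_axioms m n _ _ order_trans[OF le this]] C show ?thesis by simp
qed

lemma drift_dominates:
  assumes c: "c > 0" and mom: "\<And>n. n \<ge> n0 \<Longrightarrow> integrable M (\<lambda>\<omega>. exp (- 2 * gamma_n mr rho n 1 \<omega>)) \<and>
       expectation (\<lambda>\<omega>. exp (- 2 * gamma_n mr rho n 1 \<omega>)) \<le> 1 - c / real n"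
  shows "sr\<^sup>2 < mr"
proof -
  have "c \<le> 2 * (mr - expectation (\<lambda>\<omega>. (ln (rho 1 \<omega>) - mr)\<^sup>2))"
    by (rule exp_moment_drift[OF base_rv1(2) rho_sq, folded mr_def])
       (use mom[unfolded gamma_n_eq] in blast)+
  with c have "0 < 2 * (mr - expectation (\<lambda>\<omega>. (ln (rho 1 \<omega>) - mr)\<^sup>2))" by (rule less_le_trans)
  then show ?thesis unfolding sr2[folded mr_def] by simp
qed

end

theorem theorem4:
  fixes M :: "'a measure" and xi rho :: "nat \<Rightarrow> 'a \<Rightarrow> real" and y :: real
  assumes "prob_space M"
    and "\<And>k. k \<ge> 1 \<Longrightarrow> xi k \<in> borel_measurable M"
    and "\<And>k. k \<ge> 1 \<Longrightarrow> rho k \<in> borel_measurable M"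
    and "prob_space.indep_vars M (\<lambda>_. borel)
           (\<lambda>i. case i of Inl k \<Rightarrow> xi k | Inr k \<Rightarrow> rho k) (Inl ` {1..} \<union> Inr ` {1..})"
    and "\<And>k. k \<ge> 1 \<Longrightarrow> distr M borel (xi k) = distr M borel (xi 1)"
    and "\<And>k. k \<ge> 1 \<Longrightarrow> distr M borel (rho k) = distr M borel (rho 1)"
    and "\<And>k. k \<ge> 1 \<Longrightarrow> AE \<omega> in M. rho k \<omega> > 0"
    and "integrable M (\<lambda>\<omega>. (xi 1 \<omega>)^2)"
    and "integrable M (\<lambda>\<omega>. (ln (rho 1 \<omega>))^2)"
    and "integral\<^sup>L M (\<lambda>\<omega>. (xi 1 \<omega> - integral\<^sup>L M (xi 1))^2) > 0"
    and "integral\<^sup>L M (\<lambda>\<omega>. (ln (rho 1 \<omega>) - integral\<^sup>L M (\<lambda>\<omega>. ln (rho 1 \<omega>)))^2) > 0"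
    and "y \<ge> 0"
  defines "mu_xi \<equiv> integral\<^sup>L M (xi 1)"
    and "mu_rho \<equiv> integral\<^sup>L M (\<lambda>\<omega>. ln (rho 1 \<omega>))"
    and "sig_xi \<equiv> sqrt (integral\<^sup>L M (\<lambda>\<omega>. (xi 1 \<omega> - integral\<^sup>L M (xi 1))^2))"
    and "sig_rho \<equiv> sqrt (integral\<^sup>L M (\<lambda>\<omega>. (ln (rho 1 \<omega>) - integral\<^sup>L M (\<lambda>\<omega>. ln (rho 1 \<omega>)))^2))"
  shows
    "(mu_rho \<le> 0 \<longrightarrow>
       (\<lambda>n. measure M {\<omega>\<in>space M. first_neg_time (theta_proc y mu_xi mu_rho xi rho n \<omega>) < \<infinity>})
         \<longlonglongrightarrow> 1)
     \<and>
     ((mu_rho > 0 \<and>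
       (\<exists>C < 1. \<exists>n0 \<ge> (1::nat). \<forall>n \<ge> n0.
          (\<integral>\<^sup>+ \<omega>. ennreal (exp (-2 * gamma_n mu_rho rho n 1 \<omega>)) \<partial>M) ^ n \<le> ennreal C))
      \<longrightarrow>
       ((\<lambda>n. measure M {\<omega>\<in>space M. first_neg_time (theta_proc y mu_xi mu_rho xi rho n \<omega>) < \<infinity>})
          \<longlonglongrightarrow> H_fun mu_xi mu_rho sig_xi sig_rho (-y) / H_fun mu_xi mu_rho sig_xi sig_rho 0)
       \<and>
       (\<forall>(N :: 'b measure) W W' I.
          std_BM N W \<and> std_BM N W' \<and>
          prob_space.indep_var N
            (Pi\<^sub>M {0..} (\<lambda>_. borel)) (\<lambda>\<omega>. restrict (\<lambda>t. W t \<omega>) {0..})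
            (Pi\<^sub>M {0..} (\<lambda>_. borel)) (\<lambda>\<omega>. restrict (\<lambda>t. W' t \<omega>) {0..}) \<and>
          is_stoch_integral N
            (\<lambda>s \<omega>. exp (- (mu_rho * s + sig_rho * W s \<omega>)))
            (\<lambda>s \<omega>. mu_xi * s + sig_xi * W' s \<omega>) I
          \<longrightarrow>
          measure N {\<omega>\<in>space N.
              first_neg_time (\<lambda>t. exp (mu_rho * t + sig_rho * W t \<omega>) * (y + I t \<omega>)) < \<infinity>}
            = H_fun mu_xi mu_rho sig_xi sig_rho (-y) / H_fun mu_xi mu_rho sig_xi sig_rho 0))"
proof -
  interpret rc: random_coefficients M xi rho
    using assms(1-6,8-11) unfolding random_coefficients_def random_coefficients_axioms_def by blast
  have names: "mu_xi = rc.mx" "mu_rho = rc.mr" "sig_xi = rc.sx" "sig_rho = rc.sr"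
    by (simp_all add: mu_xi_def mu_rho_def sig_xi_def sig_rho_def rc.mx_def rc.mr_def rc.sx_def rc.sr_def)
  have y: "0 \<le> y" by fact
  show ?thesis
    unfolding names
  proof (intro conjI impI allI)
    assume "rc.mr \<le> 0"
    from rc.ruin_prob_tendsto_1[OF this y]
    show "(\<lambda>n. measure M {\<omega> \<in> space M. first_neg_time (theta_proc y rc.mx rc.mr xi rho n \<omega>) < \<infinity>}) \<longlonglongrightarrow> 1"
      unfolding rc.ruin_prob_def[abs_def] .
  next
    assume A: "rc.mr > 0 \<and> (\<exists>C<1. \<exists>n0\<ge>(1::nat). \<forall>n\<ge>n0.
          (\<integral>\<^sup>+ \<omega>. ennreal (exp (-2 * gamma_n rc.mr rho n 1 \<omega>)) \<partial>M) ^ n \<le> ennreal C)"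
    then obtain C and n0 :: nat where mr: "rc.mr > 0" and C: "C < 1" and n0: "n0 \<ge> 1"
      and le: "\<And>n. n \<ge> n0 \<Longrightarrow> (\<integral>\<^sup>+ \<omega>. ennreal (exp (-2 * gamma_n rc.mr rho n 1 \<omega>)) \<partial>M) ^ n \<le> ennreal C" by blast
    have c: "1 - max 0 C > 0" using C by simp
    have mom: "integrable M (\<lambda>\<omega>. exp (- 2 * gamma_n rc.mr rho n 1 \<omega>)) \<and>
       rc.expectation (\<lambda>\<omega>. exp (- 2 * gamma_n rc.mr rho n 1 \<omega>)) \<le> 1 - (1 - max 0 C) / real n" if "n \<ge> n0" for n
      by (rule rc.gamma_exp_moment[OF C _ le[OF that]]) (use that n0 in simp)
    have mu: "rc.sr\<^sup>2 < rc.mr" by (rule rc.drift_dominates[OF c mom])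
    obtain T where lim: "(rc.scale \<longlongrightarrow> T) at_top" and T: "\<And>x. rc.scale x < T"
      using rc.scale_convergent[OF mr] by blast
    \<comment> \<open>Since \<open>scale 0 = 0\<close>, the denominator is \<open>T\<close>, the
      mass of the scale density on the positive half-line.\<close>
    have H: "H_fun rc.mx rc.mr rc.sx rc.sr (- y) / H_fun rc.mx rc.mr rc.sx rc.sr 0 = (T - rc.scale y) / T"
      using rc.H_fun_eq[OF lim T, of y] rc.H_fun_eq[OF lim T, of 0] by (simp add: rc.scale_0)
    show "(\<lambda>n. measure M {\<omega> \<in> space M. first_neg_time (theta_proc y rc.mx rc.mr xi rho n \<omega>) < \<infinity>})
        \<longlonglongrightarrow> H_fun rc.mx rc.mr rc.sx rc.sr (- y) / H_fun rc.mx rc.mr rc.sx rc.sr 0"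
      unfolding H rc.ruin_prob_def[symmetric]
      by (rule rc.tendsto_ruin_limit[OF T lim rc.ruin_prob_lower[OF y] rc.ruin_prob_upper[OF y _ c T lim mom]])
    fix N :: "'b measure" and W W' I
    assume B: "std_BM N W \<and> std_BM N W' \<and>
          prob_space.indep_var N
            (Pi\<^sub>M {0..} (\<lambda>_. borel)) (\<lambda>\<omega>. restrict (\<lambda>t. W t \<omega>) {0..})
            (Pi\<^sub>M {0..} (\<lambda>_. borel)) (\<lambda>\<omega>. restrict (\<lambda>t. W' t \<omega>) {0..}) \<and>
          is_stoch_integral N
            (\<lambda>s \<omega>. exp (- (rc.mr * s + rc.sr * W s \<omega>)))
            (\<lambda>s \<omega>. rc.mx * s + rc.sx * W' s \<omega>) I"
    then have N: "prob_space N" by (auto simp: std_BM_def)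
    interpret gp: gou_process rc.mx rc.mr rc.sx rc.sr N W W' I
      using B N rc.scale_function_axioms
      unfolding gou_process_def gou_paths_def gou_paths_axioms_def gou_process_axioms_def by blast
    show "measure N {\<omega> \<in> space N. first_neg_time (\<lambda>t. exp (rc.mr * t + rc.sr * W t \<omega>) * (y + I t \<omega>)) < \<infinity>} =
        H_fun rc.mx rc.mr rc.sx rc.sr (- y) / H_fun rc.mx rc.mr rc.sx rc.sr 0"
      unfolding H by (rule gp.ruin_probability[OF y mu T lim])
  qed
qed

end
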